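(* Let $\Omega$ be an associative $\mathbb{C}$-algebra of finite or countable dimension (possibly not unital). There is an isomorphism of graded algebras $$\operatorname{gr}A_0(\Omega)\simeq\mathcal{S}(\mathrm{T}^+_{\mathrm{cycl}}(\Omega)),$$ where $\operatorname{gr}A_0(\Omega)$ is the graded algebra associated with the canonical filtration of $A_0(\Omega)$, $\mathrm{T}^+_{\mathrm{cycl}}(\Omega)=\bigoplus_{m=1}^\infty\mathrm{T}^m_{\mathrm{cycl}}(\Omega)$ is the graded space of cyclic coinvariants of tensors over $\Omega$, and $\mathcal{S}(\mathrm{T}^+_{\mathrm{cycl}}(\Omega))$ is its symmetric algebra.
   Context: $\mathrm{T}^m_{\mathrm{cycl}}(\Omega)$ ($m\ge1$) is the space of coinvariants for the action of the group $\mathbb{Z}/m\mathbb{Z}$ by cyclic permutations on $\mathrm{T}^m(\Omega):=\Omega^{\otimes m}$ (tensor products over $\mathbb{C}$). The symmetric algebra $\mathcal{S}(\mathrm{T}^+_{\mathrm{cycl}}(\Omega))$ has the grading extending that of $\mathrm{T}^+_{\mathrm{cycl}}(\Omega)$, in which $\mathrm{T}^m_{\mathrm{cycl}}(\Omega)$ has degree $m$. The Lie algebra $\mathfrak{gl}(N,\Omega)=\mathrm{Mat}(N,\mathbb{C})\otimes\Omega$ carries the commutator bracket; with $E_{ij}$ the matrix units ($1\le i,j\le N$) and $E_{ij}(x):=E_{ij}\otimes x$, one has $[E_{ij}(x),E_{kl}(y)]=\delta_{kj}E_{il}(xy)-\delta_{il}E_{kj}(yx)$. The Lie algebra $\mathfrak{gl}(N,\mathbb{C})$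 acts on $\mathfrak{gl}(N,\Omega)=\mathfrak{gl}(N,\mathbb{C})\otimes\Omega$ by $\mathrm{ad}\otimes\mathrm{Id}$, i.e. $[E_{ij},E_{kl}(y)]=\delta_{kj}E_{il}(y)-\delta_{il}E_{kj}(y)$ (even if $\Omega$ is not unital); this action is by derivations and extends to the universal enveloping algebra $\mathcal{U}(\mathfrak{gl}(N,\Omega))$ by derivations. By convention $\mathcal{U}(\mathfrak{gl}(0,\Omega))=\mathbb{C}$. Let $A_0(\Omega;N):=\mathcal{U}(\mathfrak{gl}(N,\Omega))^{\mathfrak{gl}(N,\mathbb{C})}$ be the subalgebra of invariants. Let $I^+(N)$ be the left ideal of $\mathcal{U}(\mathfrak{gl}(N,\Omega))$ generated by all $E_{iN}(x)$, $1\le i\le N$, $x\in\Omega$, and $I^-(N)$ the right ideal generated by all $E_{Nj}(x)$, $1\le j\le N$, $x\in\Omega$. Let $\mathcal{U}(\mathfrak{gl}(N,\Omega))^{E_{NN}}$ be the subalgebra of elements annihilated by $[E_{NN},-]$. Its intersections with $I^+(N)$ and $I^-(N)$ coincide; the common intersection $L(N)$ is a two-sided ideal in it, and $\mathcal{U}(\mathfrak{gl}(N,\Omega))^{E_{NN}}=\mathcal{U}(\mathfrak{gl}(N-1,\Omega))\oplus L(N)$. Let $\pi_{N,N-1}\colon\mathcal{U}(\mathfrak{gl}(N,\Omega))^{E_{NN}}\to\mathcal{U}(\mathfrak{gl}(N-1,\Omega))$ be the projection along $L(N)$; it is a homomorphism of filtered algebras and maps $A_0(\Omega;N)$ into $A_0(\Omega;N-1)$.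 $A_0(\Omega):=\varprojlim(A_0(\Omega;N),\pi_{N,N-1})$, the limit taken in the category of filtered algebras with respect to the canonical filtrations of universal enveloping algebras: its elements are sequences $\mathbf{a}=\{\mathbf{a}(N)\colon N\ge0\}$ with $\mathbf{a}(N)\in A_0(\Omega;N)$, $\pi_{N,N-1}(\mathbf{a}(N))=\mathbf{a}(N-1)$ for $N>0$, and $\deg\mathbf{a}(N)$ bounded uniformly in $N$. The canonical filtration of $A_0(\Omega)$: $\mathbf{a}$ has degree $\le k$ if $\deg\mathbf{a}(N)\le k$ for all $N$. *)

theory Defs
  imports
    "HOL-Library.Poly_Mapping"
    "HOL-Library.Countable_Set"
    "HOL-Library.FuncSet"
    "HOL-Algebra.QuotRing"
    "Jordan_Normal_Form.Matrix"
begin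

section \<open>Complex vector spaces and algebras as records\<close>

text \<open>
  A complex vector space or algebra with an explicit carrier is a record of type
  \<open>(complex, 'b) module\<close>.  Where only the vector space structure matters, the fields
  \<open>mult\<close> and \<open>one\<close> are irrelevant.
\<close>

inductive_set lin_span :: "(complex, 'b) module \<Rightarrow> 'b set \<Rightarrow> 'b set"
  for A :: "(complex, 'b) module" and S :: "'b set"
where
  zero: "\<zero>\<^bsub>A\<^esub> \<in> lin_span A S"
| base: "x \<in> S \<Longrightarrow> x \<in> lin_span A S"
| add: "x \<in> lin_span A S \<Longrightarrow> y \<in> lin_span A S \<Longrightarrow> x \<oplus>\<^bsub>A\<^esub> y \<in> lin_span A S"
| smult: "x \<in> lin_span A S \<Longrightarrow> c \<odot>\<^bsub>A\<^esub> x \<in> lin_span A S"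

text \<open>The map of quotients \<open>A/I \<rightarrow> B/J\<close> induced by a map \<open>f\<close> from \<open>A\<close> to \<open>B\<close> that respects
  congruence modulo \<open>I\<close> and \<open>J\<close>; the source enters only through the cosets \<open>X\<close>.\<close>

definition quot_map :: "(complex, 'c) module \<Rightarrow> 'c set \<Rightarrow> ('b \<Rightarrow> 'c) \<Rightarrow> 'b set \<Rightarrow> 'c set" where
  "quot_map B J f X = (\<Union>x\<in>X. J +>\<^bsub>B\<^esub> f x)"

text \<open>The quotient by a subspace, and by a two-sided ideal in the case of algebras: this is
  \<^const>\<open>FactRing\<close> together with the scalar multiplication.\<close>

definition quot :: "(complex, 'b) module \<Rightarrow> 'b set \<Rightarrow> (complex, 'b set) module" where
  "quot A I = \<lparr>carrier = a_rcosets\<^bsub>A\<^esub> I, monoid.mult = rcoset_mult A I,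
     one = I +>\<^bsub>A\<^esub> \<one>\<^bsub>A\<^esub>, zero = I, add = set_add A,
     smult = (\<lambda>c. quot_map A I (\<lambda>x. c \<odot>\<^bsub>A\<^esub> x))\<rparr>"

text \<open>Direct sum of a family of vector spaces; the analogue of \<open>sum_group\<close> from
  \<open>HOL-Algebra.Product_Groups\<close>.\<close>

definition dsum :: "nat set \<Rightarrow> (nat \<Rightarrow> (complex, 'b) module) \<Rightarrow> (complex, nat \<Rightarrow> 'b) module" where
  "dsum J M = \<lparr>carrier = {u \<in> \<Pi>\<^sub>E m\<in>J. carrier (M m). finite {m \<in> J. u m \<noteq> \<zero>\<^bsub>M m\<^esub>}},
     monoid.mult = undefined, one = undefined,
     zero = (\<lambda>m\<in>J. \<zero>\<^bsub>M m\<^esub>),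
     add = (\<lambda>u v. \<lambda>m\<in>J. u m \<oplus>\<^bsub>M m\<^esub> v m),
     smult = (\<lambda>c u. \<lambda>m\<in>J. c \<odot>\<^bsub>M m\<^esub> u m)\<rparr>"

definition dsum_comp :: "nat set \<Rightarrow> (nat \<Rightarrow> (complex, 'b) module) \<Rightarrow> nat \<Rightarrow> (nat \<Rightarrow> 'b) set" where
  "dsum_comp J M m = {u \<in> carrier (dsum J M). \<forall>i\<in>J. i \<noteq> m \<longrightarrow> u i = \<zero>\<^bsub>M i\<^esub>}"

text \<open>Isomorphisms of graded (unital, complex) algebras; \<open>GA m\<close> and \<open>GB m\<close> are the
  homogeneous components of degree \<open>m\<close>.\<close>

definition graded_alg_iso ::
  "(complex, 'b) module \<Rightarrow> (nat \<Rightarrow> 'b set) \<Rightarrow> (complex, 'c) module \<Rightarrow> (nat \<Rightarrow> 'c set)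
    \<Rightarrow> ('b \<Rightarrow> 'c) set" where
  "graded_alg_iso A GA B GB =
    {\<phi> \<in> ring_iso A B.
       (\<forall>c. \<forall>x\<in>carrier A. \<phi> (c \<odot>\<^bsub>A\<^esub> x) = c \<odot>\<^bsub>B\<^esub> \<phi> x) \<and>
       (\<forall>m. \<phi> ` GA m = GB m)}"


section \<open>The associated graded algebra of a filtered algebra\<close>

definition filt_below :: "(complex, 'b) module \<Rightarrow> (nat \<Rightarrow> 'b set) \<Rightarrow> nat \<Rightarrow> 'b set" where
  "filt_below A F k = (if k = 0 then {\<zero>\<^bsub>A\<^esub>} else F (k - 1))"

definition gr_piece :: "(complex, 'b) module \<Rightarrow> (nat \<Rightarrow> 'b set) \<Rightarrow> nat \<Rightarrow> (complex, 'b set) module" where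
  "gr_piece A F k = quot (A\<lparr>carrier := F k\<rparr>) (filt_below A F k)"

definition gr_alg :: "(complex, 'b) module \<Rightarrow> (nat \<Rightarrow> 'b set) \<Rightarrow> (complex, nat \<Rightarrow> 'b set) module" where
  "gr_alg A F = (dsum UNIV (gr_piece A F))
     \<lparr>monoid.mult := (\<lambda>u v k. finsum (gr_piece A F k)
                 (\<lambda>i. \<Union>a\<in>u i. \<Union>b\<in>v (k - i). filt_below A F k +>\<^bsub>A\<^esub> (a \<otimes>\<^bsub>A\<^esub> b)) {..k}),
      one := (\<lambda>k. if k = 0 then filt_below A F 0 +>\<^bsub>A\<^esub> \<one>\<^bsub>A\<^esub> else filt_below A F k)\<rparr>"

definition gr_comp :: "(complex, 'b) module \<Rightarrow> (nat \<Rightarrow> 'b set) \<Rightarrow> nat \<Rightarrow> (nat \<Rightarrow> 'b set) set" where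
  "gr_comp A F = dsum_comp UNIV (gr_piece A F)"


section \<open>Tensor, symmetric and universal enveloping algebras\<close>

text \<open>Words under concatenation, so that the type of finitely supported functions on words
  carries the product of noncommutative polynomials.\<close>

instantiation list :: (type) monoid_add
begin

definition zero_list :: "'a list" where "zero_list = []"
definition plus_list :: "'a list \<Rightarrow> 'a list \<Rightarrow> 'a list" where "plus_list = (@)"

instance by standard (simp_all add: zero_list_def plus_list_def)

end

abbreviation word :: "'x list \<Rightarrow> ('x list \<Rightarrow>\<^sub>0 complex)" where
  "word w \<equiv> Poly_Mapping.single w 1"

abbreviation scale_poly :: "complex \<Rightarrow> ('x list \<Rightarrow>\<^sub>0 complex) \<Rightarrow> ('x list \<Rightarrow>\<^sub>0 complex)" where
  "scale_poly c p \<equiv> Poly_Mapping.map (\<lambda>d. c * d) p"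

definition free_alg :: "'x set \<Rightarrow> (complex, 'x list \<Rightarrow>\<^sub>0 complex) module" where
  "free_alg X = \<lparr>carrier = {p. \<forall>w\<in>Poly_Mapping.keys p. set w \<subseteq> X}, monoid.mult = (*), one = 1,
     zero = 0, add = (+), smult = scale_poly\<rparr>"

lemma ring_free_alg: "ring (free_alg X)"
proof (rule ringI)
  have um: "Poly_Mapping.keys (-p) = Poly_Mapping.keys p" for p :: "'a list \<Rightarrow>\<^sub>0 complex"
    by (auto simp: in_keys_iff)
  show "abelian_group (free_alg X)"
  proof (rule abelian_groupI)
    fix x y assume "x \<in> carrier (free_alg X)" "y \<in> carrier (free_alg X)"
    then show "x \<oplus>\<^bsub>free_alg X\<^esub> y \<in> carrier (free_alg X)"
      using Poly_Mapping.keys_add[of x y] by (fastforce simp: free_alg_def)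
  next
    fix x assume "x \<in> carrier (free_alg X)"
    then show "\<exists>y\<in>carrier (free_alg X). y \<oplus>\<^bsub>free_alg X\<^esub> x = \<zero>\<^bsub>free_alg X\<^esub>"
      by (intro bexI[of _ "-x"]) (auto simp: free_alg_def um)
  qed (auto simp: free_alg_def algebra_simps)
  show "Group.monoid (free_alg X)"
  proof (rule monoidI)
    fix x y assume "x \<in> carrier (free_alg X)" "y \<in> carrier (free_alg X)"
    then show "x \<otimes>\<^bsub>free_alg X\<^esub> y \<in> carrier (free_alg X)"
      using Poly_Mapping.keys_mult[of x y] by (fastforce simp: free_alg_def plus_list_def)
  qed (auto simp: free_alg_def algebra_simps zero_list_def)
qed (auto simp: free_alg_def algebra_simps)

definition lin_ext :: "('x list \<Rightarrow> ('y list \<Rightarrow>\<^sub>0 complex)) \<Rightarrow> ('x list \<Rightarrow>\<^sub>0 complex) \<Rightarrow> ('y list \<Rightarrow>\<^sub>0 complex)"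
  where "lin_ext h p = (\<Sum>w\<in>Poly_Mapping.keys p. scale_poly (Poly_Mapping.lookup p w) (h w))"

text \<open>The tensor algebra \<open>T(V)\<close>: the free algebra on the underlying set of \<open>V\<close>, modulo the
  relations making the inclusion of \<open>V\<close> linear.  In degree \<open>m\<close> this amounts to dividing the free
  vector space on \<open>V\<^sup>m\<close> by the multilinearity relations, i.e. to the usual construction of the
  \<open>m\<close>-fold tensor product of \<open>V\<close>.\<close>

definition tensor_ideal :: "(complex, 'v) module \<Rightarrow> ('v list \<Rightarrow>\<^sub>0 complex) set" where
  "tensor_ideal V = genideal (free_alg (carrier V))
     ({word [x \<oplus>\<^bsub>V\<^esub> y] - word [x] - word [y] | x y. x \<in> carrier V \<and> y \<in> carrier V} \<union>
      {word [c \<odot>\<^bsub>V\<^esub> x] - scale_poly c (word [x]) | c x. x \<in> carrier V})"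

definition tensor_alg :: "(complex, 'v) module \<Rightarrow> (complex, ('v list \<Rightarrow>\<^sub>0 complex) set) module" where
  "tensor_alg V = quot (free_alg (carrier V)) (tensor_ideal V)"

text \<open>\<open>tens V [x\<^sub>1, \<dots>, x\<^sub>m]\<close> is the pure tensor \<open>x\<^sub>1 \<otimes> \<dots> \<otimes> x\<^sub>m\<close>.\<close>

definition tens :: "(complex, 'v) module \<Rightarrow> 'v list \<Rightarrow> ('v list \<Rightarrow>\<^sub>0 complex) set" where
  "tens V w = tensor_ideal V +>\<^bsub>free_alg (carrier V)\<^esub> word w"

definition tensor_power :: "(complex, 'v) module \<Rightarrow> nat \<Rightarrow> (complex, ('v list \<Rightarrow>\<^sub>0 complex) set) module" where
  "tensor_power V m = (tensor_alg V)
     \<lparr>carrier := lin_span (tensor_alg V) {tens V w | w. length w = m \<and> set w \<subseteq> carrier V}\<rparr>"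

text \<open>The symmetric algebra, and the grading on it that extends a grading \<open>G\<close> of \<open>V\<close>
  (\<open>G m\<close> being the degree \<open>m\<close> component of \<open>V\<close>).  A list of pairs \<open>(v, m)\<close> below encodes a
  product of homogeneous elements together with their degrees.\<close>

definition sym_ideal :: "(complex, 'v) module \<Rightarrow> ('v list \<Rightarrow>\<^sub>0 complex) set set" where
  "sym_ideal V = genideal (tensor_alg V)
     {tens V [x, y] \<ominus>\<^bsub>tensor_alg V\<^esub> tens V [y, x] | x y. x \<in> carrier V \<and> y \<in> carrier V}"

definition sym_alg :: "(complex, 'v) module \<Rightarrow> (complex, ('v list \<Rightarrow>\<^sub>0 complex) set set) module" where
  "sym_alg V = quot (tensor_alg V) (sym_ideal V)"

definition sym_comp :: "(complex, 'v) module \<Rightarrow> (nat \<Rightarrow> 'v set) \<Rightarrow> nat \<Rightarrow> ('v list \<Rightarrow>\<^sub>0 complex) set set set"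
  where
  "sym_comp V G d = lin_span (sym_alg V)
     {sym_ideal V +>\<^bsub>tensor_alg V\<^esub> tens V (map fst ps) | ps.
        (\<forall>(v, m)\<in>set ps. v \<in> G m) \<and> sum_list (map snd ps) = d}"

text \<open>The universal enveloping algebra of the Lie algebra \<open>V\<close> with bracket \<open>br\<close>.\<close>

definition lie_ideal :: "(complex, 'v) module \<Rightarrow> ('v \<Rightarrow> 'v \<Rightarrow> 'v) \<Rightarrow> ('v list \<Rightarrow>\<^sub>0 complex) set set" where
  "lie_ideal V br = genideal (tensor_alg V)
     {tens V [x, y] \<ominus>\<^bsub>tensor_alg V\<^esub> tens V [y, x] \<ominus>\<^bsub>tensor_alg V\<^esub> tens V [br x y] | x y.
        x \<in> carrier V \<and> y \<in> carrier V}"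

definition uea :: "(complex, 'v) module \<Rightarrow> ('v \<Rightarrow> 'v \<Rightarrow> 'v) \<Rightarrow> (complex, ('v list \<Rightarrow>\<^sub>0 complex) set set) module"
  where "uea V br = quot (tensor_alg V) (lie_ideal V br)"

text \<open>\<open>uea_mon V br [x\<^sub>1, \<dots>, x\<^sub>m]\<close> is the product \<open>x\<^sub>1 \<cdots> x\<^sub>m\<close> in the enveloping algebra.\<close>

definition uea_mon :: "(complex, 'v) module \<Rightarrow> ('v \<Rightarrow> 'v \<Rightarrow> 'v) \<Rightarrow> 'v list \<Rightarrow> ('v list \<Rightarrow>\<^sub>0 complex) set set"
  where "uea_mon V br w = lie_ideal V br +>\<^bsub>tensor_alg V\<^esub> tens V w"

definition uea_filt :: "(complex, 'v) module \<Rightarrow> ('v \<Rightarrow> 'v \<Rightarrow> 'v) \<Rightarrow> nat \<Rightarrow> ('v list \<Rightarrow>\<^sub>0 complex) set set set"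
  where "uea_filt V br k = lin_span (uea V br)
    {uea_mon V br w | w. length w \<le> k \<and> set w \<subseteq> carrier V}"

text \<open>The algebra homomorphism of enveloping algebras induced by a Lie algebra homomorphism \<open>f\<close>
  into \<open>(V, br)\<close>.\<close>

definition uea_hom :: "(complex, 'v) module \<Rightarrow> ('v \<Rightarrow> 'v \<Rightarrow> 'v) \<Rightarrow> ('u \<Rightarrow> 'v)
    \<Rightarrow> ('u list \<Rightarrow>\<^sub>0 complex) set set \<Rightarrow> ('v list \<Rightarrow>\<^sub>0 complex) set set" where
  "uea_hom V br f = quot_map (tensor_alg V) (lie_ideal V br)
     (quot_map (free_alg (carrier V)) (tensor_ideal V) (lin_ext (\<lambda>w. word (map f w))))"

text \<open>The derivation of the enveloping algebra extending a derivation \<open>f\<close> of the Lie algebra: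
  \<open>x\<^sub>1 \<cdots> x\<^sub>m \<mapsto> \<Sum>\<^sub>i x\<^sub>1 \<cdots> f x\<^sub>i \<cdots> x\<^sub>m\<close>.\<close>

definition uea_deriv :: "(complex, 'v) module \<Rightarrow> ('v \<Rightarrow> 'v \<Rightarrow> 'v) \<Rightarrow> ('v \<Rightarrow> 'v)
    \<Rightarrow> ('v list \<Rightarrow>\<^sub>0 complex) set set \<Rightarrow> ('v list \<Rightarrow>\<^sub>0 complex) set set" where
  "uea_deriv V br f = quot_map (tensor_alg V) (lie_ideal V br)
     (quot_map (free_alg (carrier V)) (tensor_ideal V)
       (lin_ext (\<lambda>w. \<Sum>i<length w. word (w[i := f (w ! i)]))))"


section \<open>Cyclic coinvariants\<close>

text \<open>Action on tensors of the \<open>k\<close>-th power of the cyclic shift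
  \<open>x\<^sub>1 \<otimes> \<dots> \<otimes> x\<^sub>m \<mapsto> x\<^sub>2 \<otimes> \<dots> \<otimes> x\<^sub>m \<otimes> x\<^sub>1\<close>.\<close>

definition cyc_act :: "(complex, 'v) module \<Rightarrow> nat \<Rightarrow> ('v list \<Rightarrow>\<^sub>0 complex) set \<Rightarrow> ('v list \<Rightarrow>\<^sub>0 complex) set"
  where "cyc_act V k = quot_map (free_alg (carrier V)) (tensor_ideal V) (lin_ext (\<lambda>w. word (rotate k w)))"

definition T_cycl :: "(complex, 'v) module \<Rightarrow> nat \<Rightarrow> (complex, ('v list \<Rightarrow>\<^sub>0 complex) set set) module" where
  "T_cycl V m = quot (tensor_power V m)
     (lin_span (tensor_power V m)
       {t \<ominus>\<^bsub>tensor_alg V\<^esub> cyc_act V k t | t k. t \<in> carrier (tensor_power V m) \<and> k < m})"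

definition T_cycl_plus :: "(complex, 'v) module \<Rightarrow> (complex, nat \<Rightarrow> ('v list \<Rightarrow>\<^sub>0 complex) set set) module" where
  "T_cycl_plus V = dsum {1..} (T_cycl V)"

definition T_cycl_comp :: "(complex, 'v) module \<Rightarrow> nat \<Rightarrow> (nat \<Rightarrow> ('v list \<Rightarrow>\<^sub>0 complex) set set) set" where
  "T_cycl_comp V = dsum_comp {1..} (T_cycl V)"


section \<open>The algebra \<open>\<Omega>\<close>\<close>

text \<open>Associative, not necessarily unital, complex algebras; \<open>\<Omega>\<close> is the whole type \<open>'a\<close>.\<close>

locale complex_assoc_algebra = vector_space scale
  for scale :: "complex \<Rightarrow> 'a::ring \<Rightarrow> 'a" +
  assumes scale_mult_left: "scale c x * y = scale c (x * y)"
    and scale_mult_right: "x * scale c y = scale c (x * y)"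

definition countable_dimension :: "(complex \<Rightarrow> 'a::ab_group_add \<Rightarrow> 'a) \<Rightarrow> bool" where
  "countable_dimension scale \<longleftrightarrow>
    (\<exists>B. countable B \<and> \<not> module.dependent scale B \<and> module.span scale B = UNIV)"

definition Omega :: "(complex \<Rightarrow> 'a::ring \<Rightarrow> 'a) \<Rightarrow> (complex, 'a) module" where
  "Omega scale = \<lparr>carrier = UNIV, monoid.mult = (*), one = undefined, zero = 0, add = (+), smult = scale\<rparr>"


section \<open>The algebras \<open>U(gl(N,\<Omega>))\<close> and \<open>A\<^sub>0(\<Omega>;N)\<close>\<close>

text \<open>\<open>gl(N,\<Omega>) = Mat(N,\<complex>) \<otimes> \<Omega>\<close> is identified with the \<open>N \<times> N\<close> matrices over \<open>\<Omega>\<close>, so that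
  \<open>E\<^sub>i\<^sub>j(x) = E\<^sub>i\<^sub>j \<otimes> x\<close> has the single entry \<open>x\<close>.  Row and column indices start at \<open>0\<close>: what is
  usually written \<open>E\<^sub>N\<^sub>N\<close> has indices \<open>N - 1\<close>.\<close>

definition gl :: "(complex \<Rightarrow> 'a::ring \<Rightarrow> 'a) \<Rightarrow> nat \<Rightarrow> (complex, 'a mat) module" where
  "gl scale N = \<lparr>carrier = carrier_mat N N, monoid.mult = (*), one = undefined,
     zero = 0\<^sub>m N N, add = (+), smult = (\<lambda>c. map_mat (scale c))\<rparr>"

definition comm_br :: "'a::ring mat \<Rightarrow> 'a mat \<Rightarrow> 'a mat" where
  "comm_br A B = A * B - B * A"

definition E_mat :: "nat \<Rightarrow> nat \<Rightarrow> nat \<Rightarrow> 'b::zero \<Rightarrow> 'b mat" where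
  "E_mat N i j x = mat N N (\<lambda>(k, l). if k = i \<and> l = j then x else 0)"

text \<open>The action of \<open>gl(N,\<complex>)\<close> on \<open>gl(N,\<Omega>)\<close>, i.e. \<open>X\<cdot>A = XA - AX\<close>.\<close>

definition ad_act :: "(complex \<Rightarrow> 'a::ring \<Rightarrow> 'a) \<Rightarrow> nat \<Rightarrow> complex mat \<Rightarrow> 'a mat \<Rightarrow> 'a mat" where
  "ad_act scale N X A = mat N N (\<lambda>(i, l).
     \<Sum>j<N. scale (X $$ (i, j)) (A $$ (j, l)) - scale (X $$ (j, l)) (A $$ (i, j)))"

text \<open>The defining commutation formulas on matrix units.\<close>

lemma comm_br_E:
  fixes x y :: "'a::ring"
  assumes "i < N" "j < N" "k < N" "l < N"
  shows "comm_br (E_mat N i j x) (E_mat N k l y) =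
    (if k = j then E_mat N i l (x * y) else 0\<^sub>m N N) -
    (if i = l then E_mat N k j (y * x) else 0\<^sub>m N N)"
proof -
  have *: "(\<Sum>m = 0..<N. (if a = i' \<and> m = j' then u else 0) * (if m = k' \<and> b = l' then v else 0)) =
      (if a = i' \<and> b = l' \<and> j' = k' then u * v else 0)"
    if "j' < N" for a b i' j' k' l' and u v :: 'a
  proof -
    have "(\<Sum>m = 0..<N. (if a = i' \<and> m = j' then u else 0) * (if m = k' \<and> b = l' then v else 0)) =
      (\<Sum>m = 0..<N. if m = j' then (if a = i' \<and> b = l' \<and> j' = k' then u * v else 0) else 0)"
      by (intro sum.cong) auto
    then show ?thesis using that by simp
  qed
  show ?thesis
    using assms by (intro eq_matI) (auto simp: comm_br_def E_mat_def scalar_prod_def *)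
qed

lemma ad_act_E:
  fixes y :: "'a::ring"
  assumes "complex_assoc_algebra scale" and "i < N" "j < N" "k < N" "l < N"
  shows "ad_act scale N (E_mat N i j 1) (E_mat N k l y) =
    (if k = j then E_mat N i l y else 0\<^sub>m N N) - (if i = l then E_mat N k j y else 0\<^sub>m N N)"
proof -
  interpret complex_assoc_algebra scale by fact
  have 1: "(\<Sum>m<N. scale (if a = i \<and> m = j then 1 else 0) (if m = k \<and> b = l then y else 0)) =
      (if a = i \<and> b = l \<and> k = j then y else 0)" for a b
  proof -
    have "(\<Sum>m<N. scale (if a = i \<and> m = j then 1 else 0) (if m = k \<and> b = l then y else 0)) =
      (\<Sum>m<N. if m = j then (if a = i \<and> b = l \<and> k = j then y else 0) else 0)"
      by (intro sum.cong) auto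
    then show ?thesis using assms by simp
  qed
  have 2: "(\<Sum>m<N. scale (if m = i \<and> b = j then 1 else 0) (if a = k \<and> m = l then y else 0)) =
      (if a = k \<and> b = j \<and> i = l then y else 0)" for a b
  proof -
    have "(\<Sum>m<N. scale (if m = i \<and> b = j then 1 else 0) (if a = k \<and> m = l then y else 0)) =
      (\<Sum>m<N. if m = i then (if a = k \<and> b = j \<and> i = l then y else 0) else 0)"
      by (intro sum.cong) auto
    then show ?thesis using assms by simp
  qed
  have "ad_act scale N (E_mat N i j 1) (E_mat N k l y) $$ (a, b) =
      (if a = i \<and> b = l \<and> k = j then y else 0) - (if a = k \<and> b = j \<and> i = l then y else 0)"
    if "a < N" "b < N" for a b
    unfolding 1[of a b, symmetric] 2[of b a, symmetric]
    using that by (simp add: ad_act_def E_mat_def sum_subtractf)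
  then show ?thesis
    using assms(2-) by (intro eq_matI) (auto simp: E_mat_def ad_act_def[THEN arg_cong[of _ _ dim_row]] ad_act_def[THEN arg_cong[of _ _ dim_col]])
qed

definition U_gl :: "(complex \<Rightarrow> 'a::ring \<Rightarrow> 'a) \<Rightarrow> nat \<Rightarrow> (complex, ('a mat list \<Rightarrow>\<^sub>0 complex) set set) module" where
  "U_gl scale N = uea (gl scale N) comm_br"

definition U_ad :: "(complex \<Rightarrow> 'a::ring \<Rightarrow> 'a) \<Rightarrow> nat \<Rightarrow> complex mat
    \<Rightarrow> ('a mat list \<Rightarrow>\<^sub>0 complex) set set \<Rightarrow> ('a mat list \<Rightarrow>\<^sub>0 complex) set set" where
  "U_ad scale N X = uea_deriv (gl scale N) comm_br (ad_act scale N X)"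

definition A0_level :: "(complex \<Rightarrow> 'a::ring \<Rightarrow> 'a) \<Rightarrow> nat \<Rightarrow> ('a mat list \<Rightarrow>\<^sub>0 complex) set set set" where
  "A0_level scale N =
    {u \<in> carrier (U_gl scale N). \<forall>X\<in>carrier_mat N N. U_ad scale N X u = \<zero>\<^bsub>U_gl scale N\<^esub>}"


section \<open>The projections\<close>

text \<open>Throughout this section \<open>N > 0\<close>.\<close>

definition I_plus :: "(complex \<Rightarrow> 'a::ring \<Rightarrow> 'a) \<Rightarrow> nat \<Rightarrow> ('a mat list \<Rightarrow>\<^sub>0 complex) set set set" where
  "I_plus scale N = lin_span (U_gl scale N)
     {u \<otimes>\<^bsub>U_gl scale N\<^esub> uea_mon (gl scale N) comm_br [E_mat N i (N - 1) x] | u i x.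
        u \<in> carrier (U_gl scale N) \<and> i < N}"

definition I_minus :: "(complex \<Rightarrow> 'a::ring \<Rightarrow> 'a) \<Rightarrow> nat \<Rightarrow> ('a mat list \<Rightarrow>\<^sub>0 complex) set set set" where
  "I_minus scale N = lin_span (U_gl scale N)
     {uea_mon (gl scale N) comm_br [E_mat N (N - 1) j x] \<otimes>\<^bsub>U_gl scale N\<^esub> u | u j x.
        u \<in> carrier (U_gl scale N) \<and> j < N}"

definition U_E :: "(complex \<Rightarrow> 'a::ring \<Rightarrow> 'a) \<Rightarrow> nat \<Rightarrow> ('a mat list \<Rightarrow>\<^sub>0 complex) set set set" where
  "U_E scale N = {u \<in> carrier (U_gl scale N).
     U_ad scale N (E_mat N (N - 1) (N - 1) 1) u = \<zero>\<^bsub>U_gl scale N\<^esub>}"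

text \<open>It is a fact that \<open>U_E \<inter> I_plus = U_E \<inter> I_minus\<close>.\<close>

definition L_ideal :: "(complex \<Rightarrow> 'a::ring \<Rightarrow> 'a) \<Rightarrow> nat \<Rightarrow> ('a mat list \<Rightarrow>\<^sub>0 complex) set set set" where
  "L_ideal scale N = U_E scale N \<inter> I_plus scale N \<inter> I_minus scale N"

text \<open>The inclusion of \<open>U(gl(N-1,\<Omega>))\<close> in \<open>U(gl(N,\<Omega>))\<close> induced by placing a matrix in the
  upper left corner.\<close>

definition corner :: "nat \<Rightarrow> 'a::zero mat \<Rightarrow> 'a mat" where
  "corner N A = mat N N (\<lambda>(i, j). if i < N - 1 \<and> j < N - 1 then A $$ (i, j) else 0)"

definition U_incl :: "(complex \<Rightarrow> 'a::ring \<Rightarrow> 'a) \<Rightarrow> nat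
    \<Rightarrow> ('a mat list \<Rightarrow>\<^sub>0 complex) set set \<Rightarrow> ('a mat list \<Rightarrow>\<^sub>0 complex) set set" where
  "U_incl scale N = uea_hom (gl scale N) comm_br (corner N)"

text \<open>The projection of \<open>U_E\<close> onto \<open>U(gl(N-1,\<Omega>))\<close> along \<open>L_ideal\<close>; arguments outside \<open>U_E\<close>
  are meaningless.\<close>

definition proj :: "(complex \<Rightarrow> 'a::ring \<Rightarrow> 'a) \<Rightarrow> nat
    \<Rightarrow> ('a mat list \<Rightarrow>\<^sub>0 complex) set set \<Rightarrow> ('a mat list \<Rightarrow>\<^sub>0 complex) set set" where
  "proj scale N u = (THE v. v \<in> carrier (U_gl scale (N - 1)) \<and>
     u \<ominus>\<^bsub>U_gl scale N\<^esub> U_incl scale N v \<in> L_ideal scale N)"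


section \<open>The projective limit \<open>A\<^sub>0(\<Omega>)\<close>\<close>

definition A0_filt :: "(complex \<Rightarrow> 'a::ring \<Rightarrow> 'a) \<Rightarrow> nat
    \<Rightarrow> (nat \<Rightarrow> ('a mat list \<Rightarrow>\<^sub>0 complex) set set) set" where
  "A0_filt scale k =
    {a. (\<forall>N. a N \<in> A0_level scale N) \<and>
        (\<forall>N>0. proj scale N (a N) = a (N - 1)) \<and>
        (\<forall>N. a N \<in> uea_filt (gl scale N) comm_br k)}"

definition A0 :: "(complex \<Rightarrow> 'a::ring \<Rightarrow> 'a)
    \<Rightarrow> (complex, nat \<Rightarrow> ('a mat list \<Rightarrow>\<^sub>0 complex) set set) module" where
  "A0 scale = \<lparr>carrier = (\<Union>k. A0_filt scale k),
     monoid.mult = (\<lambda>a b N. a N \<otimes>\<^bsub>U_gl scale N\<^esub> b N),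
     one = (\<lambda>N. \<one>\<^bsub>U_gl scale N\<^esub>),
     zero = (\<lambda>N. \<zero>\<^bsub>U_gl scale N\<^esub>),
     add = (\<lambda>a b N. a N \<oplus>\<^bsub>U_gl scale N\<^esub> b N),
     smult = (\<lambda>c a N. c \<odot>\<^bsub>U_gl scale N\<^esub> a N)\<rparr>"

end

theory Submission
  imports Defs
begin

text \<open>
  The Lie bracket of \<open>gl(N,\<Omega>)\<close> is the commutator of an associative product.  If each element \<open>A\<close> of
  such a Lie algebra acts as multiplication by \<open>A\<close> plus the derivation extending left multiplication by
  \<open>A\<close>, the symmetric algebra becomes a module over the enveloping algebra, and applying the enveloping
  algebra to \<open>1\<close> yields a filtered linear isomorphism onto the symmetric algebra, that is, onto
  polynomials in variables \<open>(i, j, b)\<close> with \<open>b\<close> in a basis \<open>B\<close> of \<open>\<Omega>\<close>.  It intertwines the action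
  of \<open>gl(N,\<complex>)\<close> with the action by derivations, turns the ideals \<open>I_plus\<close> and \<open>I_minus\<close> into ideals
  generated by variables, and the projection into the substitution of \<open>0\<close> for all variables with an
  index \<open>N\<close>.

  An element of degree \<open>\<le> k\<close> of the limit thus has as leading terms a sequence of homogeneous invariant
  polynomials of degree \<open>k\<close> that is compatible with these substitutions.  Such a sequence comes from a
  unique polynomial in the traces of products of generic matrices, one trace for each nonempty cyclic
  word over \<open>B\<close>: to compute the polynomial at level \<open>M\<close>, move the row indices of its monomials to
  pairwise distinct new indices at level \<open>M + k\<close> by the infinitesimal invariance; and the traces are
  independent at levels \<open>\<ge> k\<close> because closed walks without repeated vertices can be read off from
  their monomials.  As cyclic words over \<open>B\<close> form a basis of the cyclic coinvariants, the leading term is a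
  multiplicative bijection onto the symmetric algebra.
\<close>

section \<open>Linear maps between spaces of finitely supported functions\<close>

text \<open>A symbol that is meaningful only in top degree would not suffice: the projections are
  defined by one-sided ideals of the enveloping algebra and may lower the degree, so the
  compatibility of a sequence has to be read off from all terms. The symbol used here is exact for
  everything that respects the associative product of matrices: the action of
  \<open>gl(N,\<complex>)\<close> is by derivations of that product, left multiplication keeps
  matrices supported in the last column there, right multiplication does so for the last row, and
  the inclusion of corners is multiplicative. Only products are respected merely in top degree, so
  statements about products are proved in the enveloping algebra itself.

  The module has a simple origin: if \<open>\<Omega>\<close> has a unit, then \<open>rho A\<close>
  is the conjugate of the derivation \<open>left_der A\<close> by the formal exponential of
  \<open>li 1\<close>, because \<open>left_der A (li 1) = li A\<close>. The resulting formula makes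
  no reference to the unit.

  Moving indices needs room, which is why only the truncation of an invariant to a lower level is
  shown to be a polynomial in traces; in a compatible sequence nothing is lost by this.\<close>

abbreviation sc :: "complex \<Rightarrow> ('w \<Rightarrow>\<^sub>0 complex) \<Rightarrow> ('w \<Rightarrow>\<^sub>0 complex)" where
  "sc c p \<equiv> Poly_Mapping.map ((*) c) p"

abbreviation mon :: "'w \<Rightarrow> ('w \<Rightarrow>\<^sub>0 complex)" where
  "mon w \<equiv> Poly_Mapping.single w 1"

abbreviation lkp :: "('w \<Rightarrow>\<^sub>0 complex) \<Rightarrow> 'w \<Rightarrow> complex" where
  "lkp \<equiv> Poly_Mapping.lookup"

abbreviation keys :: "('w \<Rightarrow>\<^sub>0 complex) \<Rightarrow> 'w set" where
  "keys \<equiv> Poly_Mapping.keys"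

lemma lookup_sc [simp]: "lkp (sc c p) w = c * lkp p w"
  by (simp add: Poly_Mapping.map.rep_eq when_def)

lemma sc_add: "sc c (p + q) = sc c p + sc c q"
  by (intro poly_mapping_eqI) (simp add: lookup_add algebra_simps)

lemma sc_diff: "sc c (p - q) = sc c p - sc c q"
  by (intro poly_mapping_eqI) (simp add: lookup_minus algebra_simps)

lemma sc_add_left: "sc (c + d) p = sc c p + sc d p"
  by (intro poly_mapping_eqI) (simp add: lookup_add algebra_simps)

lemma sc_zero [simp]: "sc c 0 = 0" "sc 0 p = 0"
  by (auto intro: poly_mapping_eqI)

lemma sc_one [simp]: "sc 1 p = p"
  by (auto intro: poly_mapping_eqI)

lemma sc_minus_one: "sc (-1) p = - p"
  by (auto intro: poly_mapping_eqI)

lemma sc_sc [simp]: "sc c (sc d p) = sc (c * d) p"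
  by (auto intro: poly_mapping_eqI simp: mult.assoc)

lemma sc_sum: "sc c (sum f A) = (\<Sum>a\<in>A. sc c (f a))"
  by (induction A rule: infinite_finite_induct) (auto simp: sc_add)

lemma sum_keys_mon: "p = (\<Sum>w\<in>keys p. sc (lkp p w) (mon w))"
proof (rule poly_mapping_eqI)
  fix v
  have "lkp (\<Sum>w\<in>keys p. sc (lkp p w) (mon w)) v = (\<Sum>w\<in>keys p. if w = v then lkp p w else 0)"
    unfolding lookup_sum by (intro sum.cong) (auto simp: lookup_single when_def)
  then show "lkp p v = lkp (\<Sum>w\<in>keys p. sc (lkp p w) (mon w)) v"
    by (simp add: in_keys_iff)
qed

text \<open>Nearly all subspaces of polynomials in the proof are given by a condition on monomials:
  words over an alphabet, bounded degree, homogeneous components, ideals generated by variables. One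
  predicate on the support covers them.\<close>

definition pm :: "'w set \<Rightarrow> ('w \<Rightarrow>\<^sub>0 complex) set" where
  "pm S = {p. keys p \<subseteq> S}"

lemma pm_mon [simp]: "mon w \<in> pm S \<longleftrightarrow> w \<in> S"
  by (simp add: pm_def)

lemma pm_zero [simp]: "0 \<in> pm S"
  by (simp add: pm_def)

lemma pm_iff: "p \<in> pm S \<longleftrightarrow> (\<forall>w. w \<notin> S \<longrightarrow> lkp p w = 0)"
  by (auto simp: pm_def in_keys_iff)

lemma pm_add [intro]: "p \<in> pm S \<Longrightarrow> q \<in> pm S \<Longrightarrow> p + q \<in> pm S"
  by (auto simp: pm_iff lookup_add)

lemma pm_diff [intro]: "p \<in> pm S \<Longrightarrow> q \<in> pm S \<Longrightarrow> p - q \<in> pm S"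
  by (auto simp: pm_iff lookup_minus)

lemma pm_uminus [intro]: "p \<in> pm S \<Longrightarrow> - p \<in> pm S"
  by (auto simp: pm_iff)

lemma pm_sc [intro]: "p \<in> pm S \<Longrightarrow> sc c p \<in> pm S"
  by (auto simp: pm_iff)

lemma pm_sum [intro]: "(\<And>a. a \<in> A \<Longrightarrow> f a \<in> pm S) \<Longrightarrow> sum f A \<in> pm S"
  by (induction A rule: infinite_finite_induct) auto

lemma pm_mono: "p \<in> pm S \<Longrightarrow> S \<subseteq> T \<Longrightarrow> p \<in> pm T"
  by (auto simp: pm_def)

lemma pm_UNIV [simp]: "p \<in> pm UNIV"
  by (simp add: pm_def)

lemma pm_mult:
  fixes p q :: "'w::monoid_add \<Rightarrow>\<^sub>0 complex"
  assumes "p \<in> pm S" "q \<in> pm T" "\<And>a b. a \<in> S \<Longrightarrow> b \<in> T \<Longrightarrow> a + b \<in> U"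
  shows "p * q \<in> pm U"
  using assms Poly_Mapping.keys_mult[of p q] unfolding pm_def by blast

lemma pm_induct [consumes 1, case_names zero add mon]:
  assumes "p \<in> pm S" "Q 0" "\<And>p q. p \<in> pm S \<Longrightarrow> q \<in> pm S \<Longrightarrow> Q p \<Longrightarrow> Q q \<Longrightarrow> Q (p + q)"
    "\<And>c w. w \<in> S \<Longrightarrow> Q (sc c (mon w))"
  shows "Q p"
proof -
  have "Q (\<Sum>w\<in>A. sc (lkp p w) (mon w))" if "finite A" "A \<subseteq> S" for A
    using that
  proof (induction A)
    case (insert w A)
    then show ?case
      by (auto simp del: Poly_Mapping.map_single intro!: assms(3) assms(4) pm_sum pm_sc)
  qed (simp add: assms(2))
  from this[of "keys p"] show ?thesis
    using assms(1) sum_keys_mon[of p] by (simp add: pm_def del: Poly_Mapping.map_single)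
qed

section \<open>Linear maps and linear extension from monomials\<close>

definition lin :: "(('w \<Rightarrow>\<^sub>0 complex) \<Rightarrow> ('m \<Rightarrow>\<^sub>0 complex)) \<Rightarrow> bool" where
  "lin f \<longleftrightarrow> (\<forall>p q. f (p + q) = f p + f q) \<and> (\<forall>c p. f (sc c p) = sc c (f p))"

lemma lin_addD: "lin f \<Longrightarrow> f (p + q) = f p + f q"
  and lin_scD: "lin f \<Longrightarrow> f (sc c p) = sc c (f p)"
  by (simp_all add: lin_def)

lemma lin_0: assumes "lin f" shows "f 0 = 0"
  using lin_scD[OF assms, of 0 0] by simp

lemma lin_uminusD: assumes "lin f" shows "f (- p) = - f p"
  using lin_scD[OF assms, of "-1" p] by (simp add: sc_minus_one)

lemma lin_diffD: assumes "lin f" shows "f (p - q) = f p - f q"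
  using lin_addD[OF assms, of p "- q"] by (simp add: lin_uminusD[OF assms])

lemma lin_sumD: assumes "lin f" shows "f (sum g A) = (\<Sum>a\<in>A. f (g a))"
  by (induction A rule: infinite_finite_induct) (auto simp: lin_0[OF assms] lin_addD[OF assms])

text \<open>The basic way to identify two linear maps on a subspace: only monomials with the support
  condition are compared, so the maps may differ elsewhere.\<close>

lemma lin_eq:
  assumes "lin f" "lin g" "p \<in> pm S" "\<And>w. w \<in> S \<Longrightarrow> f (mon w) = g (mon w)"
  shows "f p = g p"
  using assms(3)
  by (induction rule: pm_induct)
    (auto simp: lin_0 lin_addD lin_scD assms simp del: Poly_Mapping.map_single)

lemma lin_pm:
  assumes "lin f" "p \<in> pm S" "\<And>w. w \<in> S \<Longrightarrow> f (mon w) \<in> pm T"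
  shows "f p \<in> pm T"
  using assms(2)
  by (induction rule: pm_induct)
    (auto simp: lin_0 lin_addD lin_scD assms simp del: Poly_Mapping.map_single)

named_theorems lin_intros

lemma lin_id [lin_intros]: "lin (\<lambda>p. p)"
  by (simp add: lin_def)

lemma lin_const_zero [lin_intros]: "lin (\<lambda>p. 0)"
  by (simp add: lin_def)

lemma lin_plus [lin_intros]: "lin f \<Longrightarrow> lin g \<Longrightarrow> lin (\<lambda>p. f p + g p)"
  by (simp add: lin_def sc_add algebra_simps)

lemma lin_minus [lin_intros]: "lin f \<Longrightarrow> lin g \<Longrightarrow> lin (\<lambda>p. f p - g p)"
  by (simp add: lin_def sc_diff algebra_simps)

lemma lin_scale [lin_intros]: "lin f \<Longrightarrow> lin (\<lambda>p. sc c (f p))"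
  by (simp add: lin_def sc_add mult.commute)

lemma lin_comp: "lin f \<Longrightarrow> lin g \<Longrightarrow> lin (\<lambda>p. f (g p))"
  by (simp add: lin_def)

lemma lin_sum_fun [lin_intros]: "(\<And>a. a \<in> A \<Longrightarrow> lin (f a)) \<Longrightarrow> lin (\<lambda>p. \<Sum>a\<in>A. f a p)"
  by (induction A rule: infinite_finite_induct) (auto intro: lin_intros)

lemma sc_mult_left: "sc c p * q = sc c (p * q)" for p q :: "'w::monoid_add \<Rightarrow>\<^sub>0 complex"
  by (simp add: mult_map_scale_conv_mult mult.assoc)

lemma single_zero_commute:
  "p * Poly_Mapping.single 0 c = Poly_Mapping.single 0 c * p" for p :: "'w::monoid_add \<Rightarrow>\<^sub>0 complex"
proof -
  have "p \<in> pm UNIV" by simp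
  then show ?thesis
    by (induction rule: pm_induct) (auto simp: algebra_simps mult_single)
qed

lemma sc_mult_right: "p * sc c q = sc c (p * q)" for p q :: "'w::monoid_add \<Rightarrow>\<^sub>0 complex"
  unfolding mult_map_scale_conv_mult by (metis mult.assoc single_zero_commute)

lemma lin_mult_l [lin_intros]: "lin f \<Longrightarrow> lin (\<lambda>p. f p * (a :: 'w::monoid_add \<Rightarrow>\<^sub>0 complex))"
  by (simp add: lin_def algebra_simps sc_mult_left)

lemma lin_mult_r [lin_intros]: "lin f \<Longrightarrow> lin (\<lambda>p. (a :: 'w::monoid_add \<Rightarrow>\<^sub>0 complex) * f p)"
  by (simp add: lin_def algebra_simps sc_mult_right)

text \<open>The formula of \<open>lin_ext\<close> with arbitrary types in place of words, so that
  multisets, necklaces and basis elements are covered as well.\<close>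

definition lext :: "('w \<Rightarrow> ('m \<Rightarrow>\<^sub>0 complex)) \<Rightarrow> ('w \<Rightarrow>\<^sub>0 complex) \<Rightarrow> ('m \<Rightarrow>\<^sub>0 complex)" where
  "lext h p = (\<Sum>w\<in>keys p. sc (lkp p w) (h w))"

lemma lin_ext_eq_lext: "lin_ext = lext"
  by (simp add: fun_eq_iff lin_ext_def lext_def)

lemma lext_superset:
  assumes "finite A" "keys p \<subseteq> A"
  shows "lext h p = (\<Sum>w\<in>A. sc (lkp p w) (h w))"
  unfolding lext_def using assms by (intro sum.mono_neutral_left) (auto simp: in_keys_iff)

lemma lin_lext [lin_intros]: "lin (lext h)"
  unfolding lin_def
proof safe
  fix p q :: "'a \<Rightarrow>\<^sub>0 complex" and c
  let ?A = "keys p \<union> keys q"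
  have "lext h (p + q) = (\<Sum>w\<in>?A. sc (lkp (p + q) w) (h w))"
    by (rule lext_superset) (auto simp: Poly_Mapping.keys_add)
  also have "\<dots> = lext h p + lext h q"
    by (simp add: lookup_add sc_add_left sum.distrib lext_superset[of ?A])
  finally show "lext h (p + q) = lext h p + lext h q" .
  have "lext h (sc c p) = (\<Sum>w\<in>keys p. sc (lkp (sc c p) w) (h w))"
    by (rule lext_superset) (auto simp: in_keys_iff)
  then show "lext h (sc c p) = sc c (lext h p)"
    by (simp add: lext_def sc_sum)
qed

lemma lext_mon [simp]: "lext h (mon w) = h w"
  by (simp add: lext_def)

lemma lext_single: "lext h (Poly_Mapping.single w c) = sc c (h w)"
  using lin_scD[OF lin_lext, of h c "mon w"] by simp

lemma lext_id: "lext mon p = p"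
  using sum_keys_mon[of p] by (simp add: lext_def)

lemma lin_comp_lext: "lin f \<Longrightarrow> f (lext h p) = lext (\<lambda>w. f (h w)) p"
  by (simp add: lext_def lin_sumD lin_scD)

text \<open>Both sides are bilinear in \<open>p\<close> and \<open>q\<close>, so monomials suffice,
  one factor at a time.\<close>

lemma lin_hom:
  fixes f :: "('w::monoid_add \<Rightarrow>\<^sub>0 complex) \<Rightarrow> ('m::monoid_add \<Rightarrow>\<^sub>0 complex)"
  assumes "lin f" "\<And>u v. f (mon (u + v)) = f (mon u) * f (mon v)"
  shows "f (p * q) = f p * f q"
proof -
  have 1: "f (mon u * q) = f (mon u) * f q" for u
    by (rule lin_eq[of "\<lambda>q. f (mon u * q)" "\<lambda>q. f (mon u) * f q" _ UNIV])
      (auto intro!: lin_comp[OF assms(1)] lin_intros assms simp: mult_single)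
  show ?thesis
    by (rule lin_eq[of "\<lambda>p. f (p * q)" "\<lambda>p. f p * f q" _ UNIV])
      (auto intro!: lin_comp[OF assms(1)] lin_intros assms simp: 1)
qed

text \<open>Homogeneous components (\<open>hom_part\<close>), truncation to a lower level
  (\<open>cutoff\<close>) and components of given weight are all of this kind. Maps that select
  monomials commute with each other.\<close>

definition filter_mon :: "('w \<Rightarrow> bool) \<Rightarrow> ('w \<Rightarrow>\<^sub>0 complex) \<Rightarrow> ('w \<Rightarrow>\<^sub>0 complex)" where
  "filter_mon Q = lext (\<lambda>m. if Q m then mon m else 0)"

lemma lin_filter_mon [lin_intros]: "lin (filter_mon Q)"
  unfolding filter_mon_def by (rule lin_lext)

lemma filter_mon_mon: "filter_mon Q (mon m) = (if Q m then mon m else 0)"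
  by (simp add: filter_mon_def)

lemma lookup_filter_mon: "lkp (filter_mon Q p) m = (if Q m then lkp p m else 0)"
proof -
  have "p \<in> pm UNIV" by simp
  then show ?thesis
  proof (induction rule: pm_induct)
    case (mon c w)
    show ?case
      by (auto simp: lin_scD[OF lin_filter_mon] filter_mon_mon lookup_single when_def simp del: Poly_Mapping.map_single)
  qed (simp_all add: lin_0[OF lin_filter_mon] lin_addD[OF lin_filter_mon] lookup_add)
qed

lemma filter_mon_pm: "filter_mon Q p \<in> pm {m. Q m}"
  by (simp add: pm_iff lookup_filter_mon)

lemma filter_mon_pm_id: "p \<in> pm S \<Longrightarrow> (\<And>m. m \<in> S \<Longrightarrow> Q m) \<Longrightarrow> filter_mon Q p = p"
  by (rule poly_mapping_eqI) (auto simp: pm_iff lookup_filter_mon)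

lemma filter_mon_pm_zero: "p \<in> pm S \<Longrightarrow> (\<And>m. m \<in> S \<Longrightarrow> \<not> Q m) \<Longrightarrow> filter_mon Q p = 0"
  by (rule poly_mapping_eqI) (auto simp: pm_iff lookup_filter_mon)

lemma filter_mon_in_pm: "p \<in> pm S \<Longrightarrow> filter_mon Q p \<in> pm S"
  by (simp add: pm_iff lookup_filter_mon)

section \<open>Polynomials and derivations\<close>

text \<open>The polynomial ring in the variables \<open>'z\<close> is \<open>'z multiset \<Rightarrow>\<^sub>0 complex\<close>.\<close>

definition hom_part :: "nat \<Rightarrow> ('z multiset \<Rightarrow>\<^sub>0 complex) \<Rightarrow> ('z multiset \<Rightarrow>\<^sub>0 complex)" where
  "hom_part k = filter_mon (\<lambda>m. size m = k)"

abbreviation deg_le :: "nat \<Rightarrow> ('z multiset \<Rightarrow>\<^sub>0 complex) set" where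
  "deg_le k \<equiv> pm {m. size m \<le> k}"

abbreviation deg_lt :: "nat \<Rightarrow> ('z multiset \<Rightarrow>\<^sub>0 complex) set" where
  "deg_lt k \<equiv> pm {m. size m < k}"

abbreviation polys :: "'z set \<Rightarrow> ('z multiset \<Rightarrow>\<^sub>0 complex) set" where
  "polys Z \<equiv> pm {m. set_mset m \<subseteq> Z}"

abbreviation var :: "'z \<Rightarrow> ('z multiset \<Rightarrow>\<^sub>0 complex)" where
  "var z \<equiv> mon {#z#}"

lemma pm_one [simp]: "(1 :: 'w::monoid_add \<Rightarrow>\<^sub>0 complex) \<in> pm S \<longleftrightarrow> 0 \<in> S"
  unfolding single_one[symmetric] by (rule pm_mon)

lemma lin_hom_part [lin_intros]: "lin (hom_part k)"
  unfolding hom_part_def by (rule lin_filter_mon)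

lemma hom_part_mon: "hom_part k (mon m) = (if size m = k then mon m else 0)"
  by (simp add: hom_part_def filter_mon_mon)

lemma hom_part_one [simp]: "hom_part k 1 = (if k = 0 then 1 else 0)"
  using hom_part_mon[of k 0] by auto

lemma hom_part_deg_lt: "p \<in> deg_lt k \<Longrightarrow> hom_part k p = 0"
  unfolding hom_part_def by (rule filter_mon_pm_zero) auto

lemma deg_lt_iff: "p \<in> deg_le k \<Longrightarrow> hom_part k p = 0 \<longleftrightarrow> p \<in> deg_lt k"
proof
  assume p: "p \<in> deg_le k" "hom_part k p = 0"
  have "lkp p m = 0" if "k \<le> size m" for m
    using p(1) arg_cong[OF p(2), of "\<lambda>q. lkp q m"] that
    by (cases "size m = k") (auto simp: pm_iff hom_part_def lookup_filter_mon)
  then show "p \<in> deg_lt k" by (simp add: pm_iff not_less)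
qed (rule hom_part_deg_lt)

lemma hom_part_id: "p \<in> pm {m. size m = k} \<Longrightarrow> hom_part k p = p"
  unfolding hom_part_def by (rule filter_mon_pm_id) auto

lemma hom_part_homog: "hom_part k p \<in> pm {m. size m = k}"
  unfolding hom_part_def by (rule filter_mon_pm)

lemma hom_part_diff_deg_lt: "p \<in> deg_le k \<Longrightarrow> p - hom_part k p \<in> deg_lt k"
  by (auto simp: pm_iff hom_part_def lookup_filter_mon lookup_minus)

lemma deg_le_mult: "p \<in> deg_le i \<Longrightarrow> q \<in> deg_le j \<Longrightarrow> p * q \<in> deg_le (i + j)"
  by (erule pm_mult) auto

lemma polys_mult: "p \<in> polys Z \<Longrightarrow> q \<in> polys Z \<Longrightarrow> p * q \<in> polys Z"
  by (erule pm_mult) auto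

text \<open>Terms of total degree \<open>i + j\<close> can come only from the two top
  components.\<close>

lemma hom_part_mult:
  assumes "p \<in> deg_le i" "q \<in> deg_le j"
  shows "hom_part (i + j) (p * q) = hom_part i p * hom_part j q"
proof -
  have 1: "hom_part (i + j) (mon m * q) = hom_part i (mon m) * hom_part j q" if "size m \<le> i" for m
    by (rule lin_eq[of "\<lambda>q. hom_part (i + j) (mon m * q)" "\<lambda>q. hom_part i (mon m) * hom_part j q", OF _ _ assms(2)])
      (use that in \<open>auto intro!: lin_comp[OF lin_hom_part] lin_intros simp: mult_single hom_part_mon\<close>)
  show ?thesis
    by (rule lin_eq[of "\<lambda>p. hom_part (i + j) (p * q)" "\<lambda>p. hom_part i p * hom_part j q", OF _ _ assms(1)])
      (use 1 in \<open>auto intro!: lin_comp[OF lin_hom_part] lin_intros\<close>)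
qed

section \<open>Evaluations and derivations of polynomial rings\<close>

definition poly_eval :: "('z \<Rightarrow> ('y multiset \<Rightarrow>\<^sub>0 complex)) \<Rightarrow> ('z multiset \<Rightarrow>\<^sub>0 complex) \<Rightarrow> ('y multiset \<Rightarrow>\<^sub>0 complex)"
  where "poly_eval g = lext (\<lambda>m. \<Prod>z\<in>#m. g z)"

lemma lin_poly_eval [lin_intros]: "lin (poly_eval g)"
  unfolding poly_eval_def by (rule lin_lext)

lemma poly_eval_mon: "poly_eval g (mon m) = (\<Prod>z\<in>#m. g z)"
  by (simp add: poly_eval_def)

lemma poly_eval_mult: "poly_eval g (p * q) = poly_eval g p * poly_eval g q"
  by (rule lin_hom[OF lin_poly_eval]) (simp add: poly_eval_mon)

lemma poly_eval_one [simp]: "poly_eval g 1 = 1"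
  using poly_eval_mon[of g 0] by simp

text \<open>The derivation that maps \<open>var z\<close> to \<open>g z\<close>. Summation over the
  multiset accounts for the exponents: a variable that occurs n times contributes n equal
  terms.\<close>

definition dv :: "('z \<Rightarrow> ('z multiset \<Rightarrow>\<^sub>0 complex)) \<Rightarrow> ('z multiset \<Rightarrow>\<^sub>0 complex) \<Rightarrow> ('z multiset \<Rightarrow>\<^sub>0 complex)"
  where "dv g = lext (\<lambda>m. \<Sum>z\<in>#m. g z * mon (m - {#z#}))"

lemma lin_dv [lin_intros]: "lin (dv g)"
  unfolding dv_def by (rule lin_lext)

lemma dv_mon: "dv g (mon m) = (\<Sum>z\<in>#m. g z * mon (m - {#z#}))"
  by (simp add: dv_def)

lemma dv_var [simp]: "dv g (var z) = g z"
  using single_one[where 'a = "'a multiset" and 'b = complex] by (simp add: dv_mon)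

lemma dv_one [simp]: "dv g 1 = 0"
  using dv_mon[of g 0] by simp

lemma dv_mult: "dv g (p * q) = dv g p * q + p * dv g q"
proof -
  have mm: "dv g (mon (m + n)) = dv g (mon m) * mon n + mon m * dv g (mon n)" for m n
  proof -
    have l: "(\<Sum>z\<in>#m. g z * mon (m + n - {#z#})) = (\<Sum>z\<in>#m. g z * mon (m - {#z#})) * mon n"
    proof -
      have "(\<Sum>z\<in>#m. g z * mon (m + n - {#z#})) = (\<Sum>z\<in>#m. g z * mon (m - {#z#}) * mon n)"
        by (intro arg_cong[where f=sum_mset] image_mset_cong) (simp add: mult_single mult.assoc)
      then show ?thesis by (simp add: sum_mset_distrib_right)
    qed
    have r: "(\<Sum>z\<in>#n. g z * mon (m + n - {#z#})) = mon m * (\<Sum>z\<in>#n. g z * mon (n - {#z#}))"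
    proof -
      have "(\<Sum>z\<in>#n. g z * mon (m + n - {#z#})) = (\<Sum>z\<in>#n. mon m * (g z * mon (n - {#z#})))"
        by (intro arg_cong[where f=sum_mset] image_mset_cong)
          (simp add: mult_single mult.left_commute)
      then show ?thesis by (simp add: sum_mset_distrib_left image_mset.compositionality comp_def)
    qed
    show ?thesis by (simp add: dv_mon l r)
  qed
  have 1: "dv g (mon m * q) = dv g (mon m) * q + mon m * dv g q" for m
    by (rule lin_eq[of "\<lambda>q. dv g (mon m * q)" "\<lambda>q. dv g (mon m) * q + mon m * dv g q" _ UNIV])
      (auto intro!: lin_comp[OF lin_dv] lin_intros simp: mult_single mm)
  show ?thesis
    by (rule lin_eq[of "\<lambda>p. dv g (p * q)" "\<lambda>p. dv g p * q + p * dv g q" _ UNIV])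
      (auto intro!: lin_comp[OF lin_dv] lin_intros simp: 1)
qed

text \<open>Stated for arbitrary linear maps with the Leibniz rule rather than for
  \<open>dv\<close>, because it is applied to commutators of derivations. At 1 the Leibniz rule
  gives \<open>D 1 = D 1 + D 1\<close>, hence 0.\<close>

lemma derivation_eq:
  fixes D E :: "('z multiset \<Rightarrow>\<^sub>0 complex) \<Rightarrow> ('z multiset \<Rightarrow>\<^sub>0 complex)"
  assumes "lin D" "lin E" "p \<in> polys Z"
    "\<And>p q. D (p * q) = D p * q + p * D q" "\<And>p q. E (p * q) = E p * q + p * E q"
    "\<And>z. z \<in> Z \<Longrightarrow> D (var z) = E (var z)"
  shows "D p = E p"
proof (rule lin_eq[OF assms(1-3)])
  fix m :: "'z multiset" assume "m \<in> {m. set_mset m \<subseteq> Z}"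
  then show "D (mon m) = E (mon m)"
  proof (induction m)
    case empty
    have "D 1 = 0" "E 1 = 0" using assms(4)[of 1 1] assms(5)[of 1 1] by auto
    then show ?case by (simp add: zero_multiset_def[symmetric] del: zero_multiset_def)
  next
    case (add z m)
    have "mon (add_mset z m) = var z * mon m" by (simp add: mult_single)
    then show ?case using add assms by simp
  qed
qed

lemma dv_in:
  assumes "p \<in> polys Z" "\<And>z m. z \<in> Z \<Longrightarrow> set_mset m \<subseteq> Z \<Longrightarrow> g z * mon m \<in> pm T"
  shows "dv g p \<in> pm T"
proof (rule lin_pm[OF lin_dv assms(1)])
  fix m :: "'a multiset" assume m: "m \<in> {m. set_mset m \<subseteq> Z}"
  \<comment> \<open>The range of summation is separated from the \<open>m\<close> inside the
    summand, so that the induction leaves the summand fixed.\<close>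
  have "(\<Sum>z\<in>#n. g z * mon (m - {#z#})) \<in> pm T" if "n \<subseteq># m" for n
    using that
  proof (induction n)
    case (add z n)
    then show ?case using m set_mset_mono[OF add.prems]
      by (auto intro!: pm_add assms(2) simp: subset_mset.le_iff_add dest: in_diffD)
  qed simp
  then show "dv g (mon m) \<in> pm T" by (simp add: dv_mon)
qed

lemma dv_polys:
  assumes "p \<in> polys Z" "\<And>z. z \<in> Z \<Longrightarrow> g z \<in> polys Z" shows "dv g p \<in> polys Z"
  using assms by (intro dv_in) (auto intro!: polys_mult)

definition word_eval :: "('z \<Rightarrow> ('y::monoid_add \<Rightarrow>\<^sub>0 complex)) \<Rightarrow> ('z list \<Rightarrow>\<^sub>0 complex) \<Rightarrow> ('y \<Rightarrow>\<^sub>0 complex)"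
  where "word_eval g = lext (\<lambda>w. prod_list (map g w))"

lemma lin_word_eval [lin_intros]: "lin (word_eval g)"
  unfolding word_eval_def by (rule lin_lext)

lemma word_eval_mon: "word_eval g (mon w) = prod_list (map g w)"
  by (simp add: word_eval_def)

lemma word_eval_mult: "word_eval g (p * q) = word_eval g p * word_eval g q"
  by (rule lin_hom[OF lin_word_eval]) (simp add: word_eval_mon plus_list_def)

lemma mon_Nil: "mon [] = 1"
  by (simp add: zero_list_def[symmetric])

lemma free_alg_sel [simp]:
  "carrier (free_alg X) = pm (lists X)" "monoid.mult (free_alg X) = (*)" "one (free_alg X) = 1"
  "zero (free_alg X) = 0" "add (free_alg X) = (+)" "module.smult (free_alg X) = sc"
  by (auto simp: free_alg_def pm_def subset_eq in_lists_conv_set)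

lemma mon_Cons: "mon (x # w) = mon [x] * mon w"
  by (simp add: mult_single plus_list_def)

lemma mon_append: "mon (v @ w) = mon v * mon w"
  by (simp add: mult_single plus_list_def)

lemma lists_mult: "p \<in> pm (lists X) \<Longrightarrow> q \<in> pm (lists X) \<Longrightarrow> p * q \<in> pm (lists X)"
  by (erule pm_mult) (auto simp: plus_list_def)

section \<open>Quotients\<close>

text \<open>These laws are what the operations on cosets require: addition is that of an abelian
  group, and scalars act by additive maps.\<close>

definition vec_space :: "(complex, 'b) module \<Rightarrow> bool" where
  "vec_space A \<longleftrightarrow> abelian_group A \<and>
     (\<forall>c. \<forall>x\<in>carrier A. c \<odot>\<^bsub>A\<^esub> x \<in> carrier A \<and>
        (\<forall>y\<in>carrier A. c \<odot>\<^bsub>A\<^esub> (x \<oplus>\<^bsub>A\<^esub> y) = c \<odot>\<^bsub>A\<^esub> x \<oplus>\<^bsub>A\<^esub> c \<odot>\<^bsub>A\<^esub> y))"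

text \<open>Scalars act as multiplication by multiples of 1, so that every ideal is closed under
  scalars and can be divided out as a subspace.\<close>

definition complex_alg :: "(complex, 'b) module \<Rightarrow> bool" where
  "complex_alg A \<longleftrightarrow> vec_space A \<and> ring A \<and> (\<forall>c. \<forall>x\<in>carrier A. c \<odot>\<^bsub>A\<^esub> x = (c \<odot>\<^bsub>A\<^esub> \<one>\<^bsub>A\<^esub>) \<otimes>\<^bsub>A\<^esub> x)"

definition lin_subspace :: "'b set \<Rightarrow> (complex, 'b) module \<Rightarrow> bool" where
  "lin_subspace I A \<longleftrightarrow> additive_subgroup I A \<and> (\<forall>c. \<forall>x\<in>I. c \<odot>\<^bsub>A\<^esub> x \<in> I)"

lemma vspD:
  assumes "vec_space A"
  shows "abelian_group A" "\<And>c x. x \<in> carrier A \<Longrightarrow> c \<odot>\<^bsub>A\<^esub> x \<in> carrier A"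
    "\<And>c x y. x \<in> carrier A \<Longrightarrow> y \<in> carrier A \<Longrightarrow>
      c \<odot>\<^bsub>A\<^esub> (x \<oplus>\<^bsub>A\<^esub> y) = c \<odot>\<^bsub>A\<^esub> x \<oplus>\<^bsub>A\<^esub> c \<odot>\<^bsub>A\<^esub> y"
  using assms by (auto simp: vec_space_def)

lemma calgD:
  assumes "complex_alg A"
  shows "vec_space A" "ring A" "\<And>c x. x \<in> carrier A \<Longrightarrow> c \<odot>\<^bsub>A\<^esub> x = (c \<odot>\<^bsub>A\<^esub> \<one>\<^bsub>A\<^esub>) \<otimes>\<^bsub>A\<^esub> x"
  using assms unfolding complex_alg_def by blast+

lemma vec_space_zero:
  assumes "vec_space A" shows "c \<odot>\<^bsub>A\<^esub> \<zero>\<^bsub>A\<^esub> = \<zero>\<^bsub>A\<^esub>"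
proof -
  interpret abelian_group A using vspD(1)[OF assms] .
  have "c \<odot>\<^bsub>A\<^esub> (\<zero>\<^bsub>A\<^esub> \<oplus>\<^bsub>A\<^esub> \<zero>\<^bsub>A\<^esub>) = c \<odot>\<^bsub>A\<^esub> \<zero>\<^bsub>A\<^esub> \<oplus>\<^bsub>A\<^esub> c \<odot>\<^bsub>A\<^esub> \<zero>\<^bsub>A\<^esub>"
    by (rule vspD(3)[OF assms]) auto
  then show ?thesis using vspD(2)[OF assms, of "\<zero>\<^bsub>A\<^esub>" c] by simp
qed

lemma vec_space_minus:
  assumes "vec_space A" "x \<in> carrier A" "y \<in> carrier A"
  shows "c \<odot>\<^bsub>A\<^esub> (x \<ominus>\<^bsub>A\<^esub> y) = c \<odot>\<^bsub>A\<^esub> x \<ominus>\<^bsub>A\<^esub> c \<odot>\<^bsub>A\<^esub> y"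
proof -
  interpret abelian_group A using vspD(1)[OF assms(1)] .
  have "c \<odot>\<^bsub>A\<^esub> ((x \<ominus>\<^bsub>A\<^esub> y) \<oplus>\<^bsub>A\<^esub> y) = c \<odot>\<^bsub>A\<^esub> (x \<ominus>\<^bsub>A\<^esub> y) \<oplus>\<^bsub>A\<^esub> c \<odot>\<^bsub>A\<^esub> y"
    by (rule vspD(3)[OF assms(1)]) (use assms in auto)
  moreover have "(x \<ominus>\<^bsub>A\<^esub> y) \<oplus>\<^bsub>A\<^esub> y = x"
    using assms(2,3) by (simp add: a_minus_def a_assoc l_neg)
  ultimately show ?thesis using assms(2,3) vspD(2)[OF assms(1)]
    by (metis a_minus_def add.inv_solve_right minus_closed)
qed

lemma coset_eq_iff:
  assumes "abelian_group A" "additive_subgroup I A" "x \<in> carrier A" "y \<in> carrier A"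
  shows "I +>\<^bsub>A\<^esub> x = I +>\<^bsub>A\<^esub> y \<longleftrightarrow> x \<ominus>\<^bsub>A\<^esub> y \<in> I"
proof -
  interpret abelian_subgroup I A by (rule abelian_subgroupI3) fact+
  have m: "x \<in> I +>\<^bsub>A\<^esub> y \<longleftrightarrow> x \<oplus>\<^bsub>A\<^esub> \<ominus>\<^bsub>A\<^esub> y \<in> I"
    by (rule a_rcos_module) (use assms abelian_group_axioms in auto)
  show ?thesis
    unfolding a_minus_def m[symmetric]
    using a_rcos_self[of x] a_repr_independence'[of x y] assms by auto
qed

lemma quot_simps:
  assumes "vec_space A" "lin_subspace I A"
  shows "\<And>x y. x \<in> carrier A \<Longrightarrow> y \<in> carrier A \<Longrightarrow>
      (I +>\<^bsub>A\<^esub> x) \<oplus>\<^bsub>quot A I\<^esub> (I +>\<^bsub>A\<^esub> y) = I +>\<^bsub>A\<^esub> (x \<oplus>\<^bsub>A\<^esub> y)"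
    "\<And>x c. x \<in> carrier A \<Longrightarrow> c \<odot>\<^bsub>quot A I\<^esub> (I +>\<^bsub>A\<^esub> x) = I +>\<^bsub>A\<^esub> (c \<odot>\<^bsub>A\<^esub> x)"
    "\<zero>\<^bsub>quot A I\<^esub> = I +>\<^bsub>A\<^esub> \<zero>\<^bsub>A\<^esub>"
    "\<And>x y. x \<in> carrier A \<Longrightarrow> y \<in> carrier A \<Longrightarrow> I +>\<^bsub>A\<^esub> x = I +>\<^bsub>A\<^esub> y \<longleftrightarrow> x \<ominus>\<^bsub>A\<^esub> y \<in> I"
proof -
  have as: "additive_subgroup I A" using assms(2) by (simp add: lin_subspace_def)
  have ag: "abelian_group A" by (rule vspD) fact
  interpret abelian_subgroup I A by (rule abelian_subgroupI3) fact+
  show "\<zero>\<^bsub>quot A I\<^esub> = I +>\<^bsub>A\<^esub> \<zero>\<^bsub>A\<^esub>" using a_subset by (simp add: quot_def)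
  fix x y assume x: "x \<in> carrier A"
  {
    assume y: "y \<in> carrier A"
    show "(I +>\<^bsub>A\<^esub> x) \<oplus>\<^bsub>quot A I\<^esub> (I +>\<^bsub>A\<^esub> y) = I +>\<^bsub>A\<^esub> (x \<oplus>\<^bsub>A\<^esub> y)"
      using x y by (simp add: quot_def a_rcos_sum)
    show "I +>\<^bsub>A\<^esub> x = I +>\<^bsub>A\<^esub> y \<longleftrightarrow> x \<ominus>\<^bsub>A\<^esub> y \<in> I" by (rule coset_eq_iff) fact+
  }
  have "I +>\<^bsub>A\<^esub> c \<odot>\<^bsub>A\<^esub> x' = I +>\<^bsub>A\<^esub> c \<odot>\<^bsub>A\<^esub> x" if x'I: "x' \<in> I +>\<^bsub>A\<^esub> x" for x' c
  proof -
    have x': "x' \<in> carrier A" using x'I x a_r_coset_subset_G[OF a_subset] by auto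
    have "I +>\<^bsub>A\<^esub> x = I +>\<^bsub>A\<^esub> x'" using x'I x by (intro a_repr_independence') auto
    then have "x' \<ominus>\<^bsub>A\<^esub> x \<in> I" using coset_eq_iff[OF ag as x' x] by simp
    then have "c \<odot>\<^bsub>A\<^esub> (x' \<ominus>\<^bsub>A\<^esub> x) \<in> I" using assms(2) by (simp add: lin_subspace_def)
    then show ?thesis
      by (simp add: coset_eq_iff[OF ag as] x' x vspD(2)[OF assms(1)] vec_space_minus[OF assms(1)])
  qed
  moreover have "x \<in> I +>\<^bsub>A\<^esub> x" using a_rcos_self[of x] x by auto
  ultimately have "(\<Union>x'\<in>I +>\<^bsub>A\<^esub> x. I +>\<^bsub>A\<^esub> (c \<odot>\<^bsub>A\<^esub> x')) = I +>\<^bsub>A\<^esub> (c \<odot>\<^bsub>A\<^esub> x)" for c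
    by (intro UN_constant_eq) blast+
  then show "c \<odot>\<^bsub>quot A I\<^esub> (I +>\<^bsub>A\<^esub> x) = I +>\<^bsub>A\<^esub> (c \<odot>\<^bsub>A\<^esub> x)" for c
    by (simp add: quot_def quot_map_def)
qed

lemma quot_carrier: "carrier (quot A I) = (\<lambda>x. I +>\<^bsub>A\<^esub> x) ` carrier A"
  by (auto simp: quot_def A_RCOSETS_def RCOSETS_def a_r_coset_def)

text \<open>The laws pass along a surjection that respects the operations; this is applied to the
  map to cosets.\<close>

lemma abelian_group_image:
  assumes "abelian_group A" "carrier B = f ` carrier A" "f \<zero>\<^bsub>A\<^esub> = \<zero>\<^bsub>B\<^esub>"
    "\<And>x y. x \<in> carrier A \<Longrightarrow> y \<in> carrier A \<Longrightarrow> f x \<oplus>\<^bsub>B\<^esub> f y = f (x \<oplus>\<^bsub>A\<^esub> y)"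
  shows "abelian_group B"
proof -
  interpret abelian_group A by fact
  show ?thesis
  proof (rule abelian_groupI)
    fix x assume "x \<in> carrier B"
    then obtain a where a: "a \<in> carrier A" "x = f a" using assms by auto
    then show "\<exists>y\<in>carrier B. y \<oplus>\<^bsub>B\<^esub> x = \<zero>\<^bsub>B\<^esub>"
      by (intro bexI[of _ "f (\<ominus>\<^bsub>A\<^esub> a)"]) (auto simp: assms l_neg simp flip: assms(3))
  qed (auto simp: assms(2,4) a_assoc simp flip: assms(3) intro!: arg_cong[of _ _ f] a_comm)
qed

lemma ring_image:
  assumes "ring A" "carrier B = f ` carrier A" "f \<zero>\<^bsub>A\<^esub> = \<zero>\<^bsub>B\<^esub>" "f \<one>\<^bsub>A\<^esub> = \<one>\<^bsub>B\<^esub>"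
    "\<And>x y. x \<in> carrier A \<Longrightarrow> y \<in> carrier A \<Longrightarrow> f x \<oplus>\<^bsub>B\<^esub> f y = f (x \<oplus>\<^bsub>A\<^esub> y)"
    "\<And>x y. x \<in> carrier A \<Longrightarrow> y \<in> carrier A \<Longrightarrow> f x \<otimes>\<^bsub>B\<^esub> f y = f (x \<otimes>\<^bsub>A\<^esub> y)"
  shows "ring B"
proof -
  interpret ring A by fact
  show ?thesis
  proof (rule ringI)
    show "abelian_group B" by (rule abelian_group_image[of A B f]) (use assms abelian_group_axioms in auto)
    show "Group.monoid B"
      by (rule monoidI) (auto simp: assms(2,6) m_assoc simp flip: assms(4))
  qed (auto simp: assms(2,5,6) l_distr r_distr)
qed

lemma quot_vec_space:
  assumes "vec_space A" "lin_subspace I A" shows "vec_space (quot A I)"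
proof -
  have "abelian_group (quot A I)"
    by (rule abelian_group_image[of A _ "\<lambda>x. I +>\<^bsub>A\<^esub> x"])
      (simp_all add: quot_carrier quot_simps[OF assms] vspD(1)[OF assms(1)])
  then show ?thesis
    using assms vspD(2,3)[OF assms(1)] abelian_monoid.a_closed[OF abelian_group.axioms(1)[OF vspD(1)[OF assms(1)]]]
    by (simp add: vec_space_def[of "quot A I"] quot_carrier quot_simps(1,2)[OF assms])
qed

lemma lin_subspace_ideal:
  assumes "complex_alg A" "ideal I A" shows "lin_subspace I A"
proof -
  interpret ideal I A by fact
  have "c \<odot>\<^bsub>A\<^esub> x \<in> I" if "x \<in> I" for c x
    using I_l_closed[OF that, of "c \<odot>\<^bsub>A\<^esub> \<one>\<^bsub>A\<^esub>"] vspD(2)[OF calgD(1)[OF assms(1)] one_closed, of c]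
    unfolding calgD(3)[OF assms(1) Icarr[OF that]] by blast
  then show ?thesis by (simp add: lin_subspace_def additive_subgroup_axioms)
qed

lemma quot_mult:
  assumes "ideal I A" "x \<in> carrier A" "y \<in> carrier A"
  shows "(I +>\<^bsub>A\<^esub> x) \<otimes>\<^bsub>quot A I\<^esub> (I +>\<^bsub>A\<^esub> y) = I +>\<^bsub>A\<^esub> (x \<otimes>\<^bsub>A\<^esub> y)"
  using ideal.rcoset_mult_add[OF assms] by (simp add: quot_def)

lemma quot_complex_alg:
  assumes "complex_alg A" "ideal I A" shows "complex_alg (quot A I)"
proof -
  interpret ideal I A by fact
  have s: "lin_subspace I A" by (rule lin_subspace_ideal) fact+
  have v: "vec_space A" by (rule calgD) fact
  note c = calgD(3)[OF assms(1)]
  have "ring (quot A I)"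
  proof (rule ring_image[of A _ "\<lambda>x. I +>\<^bsub>A\<^esub> x"])
    show "ring A" by (rule ring_axioms)
    show "carrier (quot A I) = (\<lambda>x. I +>\<^bsub>A\<^esub> x) ` carrier A" by (rule quot_carrier)
    show "I +>\<^bsub>A\<^esub> \<zero>\<^bsub>A\<^esub> = \<zero>\<^bsub>quot A I\<^esub>"
      by (rule quot_simps(3)[OF v s, symmetric])
    show "I +>\<^bsub>A\<^esub> \<one>\<^bsub>A\<^esub> = \<one>\<^bsub>quot A I\<^esub>" by (simp add: quot_def)
  qed (simp_all only: quot_simps(1)[OF v s] quot_mult[OF assms(2)])
  moreover have "c \<odot>\<^bsub>quot A I\<^esub> x = (c \<odot>\<^bsub>quot A I\<^esub> \<one>\<^bsub>quot A I\<^esub>) \<otimes>\<^bsub>quot A I\<^esub> x"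
    if "x \<in> carrier (quot A I)" for c x
  proof -
    obtain a where a: "a \<in> carrier A" "x = I +>\<^bsub>A\<^esub> a" using \<open>x \<in> _\<close> by (auto simp: quot_carrier)
    have 1: "\<one>\<^bsub>quot A I\<^esub> = I +>\<^bsub>A\<^esub> \<one>\<^bsub>A\<^esub>" by (simp add: quot_def)
    show ?thesis using a vspD(2)[OF v]
      by (simp add: 1 quot_simps(2)[OF v s] quot_mult[OF assms(2)]) (subst c; simp)
  qed
  ultimately show ?thesis using quot_vec_space[OF v s] unfolding complex_alg_def by blast
qed

section \<open>Presentations of algebras by ideals of free algebras\<close>

lemma complex_alg_free_alg: "complex_alg (free_alg X)"
  using ring_free_alg[of X]
  by (auto simp: complex_alg_def vec_space_def ring.is_abelian_group sc_add pm_sc sc_mult_left simp del: single_one)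

text \<open>Closure under scalars and negatives follows from multiplication by multiples of 1, see
  \<open>fidealD\<close>.\<close>

definition fideal :: "'x set \<Rightarrow> ('x list \<Rightarrow>\<^sub>0 complex) set \<Rightarrow> bool" where
  "fideal X K \<longleftrightarrow> K \<subseteq> pm (lists X) \<and> 0 \<in> K \<and> (\<forall>p\<in>K. \<forall>q\<in>K. p + q \<in> K) \<and>
    (\<forall>p\<in>K. \<forall>a\<in>pm (lists X). a * p \<in> K \<and> p * a \<in> K)"

lemma fidealD:
  assumes "fideal X K"
  shows "K \<subseteq> pm (lists X)" "0 \<in> K" "\<And>p q. p \<in> K \<Longrightarrow> q \<in> K \<Longrightarrow> p + q \<in> K"
    "\<And>p a. p \<in> K \<Longrightarrow> a \<in> pm (lists X) \<Longrightarrow> a * p \<in> K"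
    "\<And>p a. p \<in> K \<Longrightarrow> a \<in> pm (lists X) \<Longrightarrow> p * a \<in> K"
    "\<And>p c. p \<in> K \<Longrightarrow> sc c p \<in> K" "\<And>p. p \<in> K \<Longrightarrow> - p \<in> K"
    "\<And>p q. p \<in> K \<Longrightarrow> q \<in> K \<Longrightarrow> p - q \<in> K"
proof -
  show "K \<subseteq> pm (lists X)" "0 \<in> K" and a: "\<And>p q. p \<in> K \<Longrightarrow> q \<in> K \<Longrightarrow> p + q \<in> K"
    and l: "\<And>p a. p \<in> K \<Longrightarrow> a \<in> pm (lists X) \<Longrightarrow> a * p \<in> K"
    and "\<And>p a. p \<in> K \<Longrightarrow> a \<in> pm (lists X) \<Longrightarrow> p * a \<in> K"
    using assms by (auto simp: fideal_def)
  have "sc c 1 \<in> pm (lists X)" for c :: complex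
    by (intro pm_sc) (simp add: zero_list_def)
  then show s: "sc c p \<in> K" if "p \<in> K" for c p
    using l[OF that, of "sc c 1"] by (simp only: sc_mult_left mult_1_left)
  show m: "- p \<in> K" if "p \<in> K" for p
    using s[OF that, of "-1"] by (simp add: sc_minus_one)
  show "p - q \<in> K" if "p \<in> K" "q \<in> K" for p q
    using a[OF that(1) m[OF that(2)]] by simp
qed

text \<open>\<open>q\<close> identifies \<open>Q\<close> with the quotient of the free algebra on \<open>X\<close> by the ideal \<open>K\<close>.\<close>

definition presents :: "'x set \<Rightarrow> ('x list \<Rightarrow>\<^sub>0 complex) set \<Rightarrow> (complex, 'b) module \<Rightarrow>
    (('x list \<Rightarrow>\<^sub>0 complex) \<Rightarrow> 'b) \<Rightarrow> bool" where
  "presents X K Q q \<longleftrightarrow> complex_alg Q \<and> fideal X K \<and> carrier Q = q ` pm (lists X) \<and>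
    (\<forall>p\<in>pm (lists X). \<forall>p'\<in>pm (lists X). (q p = q p' \<longleftrightarrow> p - p' \<in> K) \<and>
       q p \<oplus>\<^bsub>Q\<^esub> q p' = q (p + p') \<and> q p \<otimes>\<^bsub>Q\<^esub> q p' = q (p * p')) \<and>
    (\<forall>c. \<forall>p\<in>pm (lists X). c \<odot>\<^bsub>Q\<^esub> q p = q (sc c p)) \<and> \<one>\<^bsub>Q\<^esub> = q 1 \<and> \<zero>\<^bsub>Q\<^esub> = q 0"

lemma presentsD:
  assumes "presents X K Q q"
  shows "complex_alg Q" "fideal X K" "ring Q" "carrier Q = q ` pm (lists X)"
    "\<And>p p'. p \<in> pm (lists X) \<Longrightarrow> p' \<in> pm (lists X) \<Longrightarrow> q p = q p' \<longleftrightarrow> p - p' \<in> K"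
    "\<And>p p'. p \<in> pm (lists X) \<Longrightarrow> p' \<in> pm (lists X) \<Longrightarrow> q p \<oplus>\<^bsub>Q\<^esub> q p' = q (p + p')"
    "\<And>p p'. p \<in> pm (lists X) \<Longrightarrow> p' \<in> pm (lists X) \<Longrightarrow> q p \<otimes>\<^bsub>Q\<^esub> q p' = q (p * p')"
    "\<And>p c. p \<in> pm (lists X) \<Longrightarrow> c \<odot>\<^bsub>Q\<^esub> q p = q (sc c p)"
    "\<one>\<^bsub>Q\<^esub> = q 1" "\<zero>\<^bsub>Q\<^esub> = q 0"
  using assms calgD(2)[of Q] unfolding presents_def by auto

lemma presents_minus:
  assumes "presents X K Q q" "p \<in> pm (lists X)" "p' \<in> pm (lists X)"
  shows "q p \<ominus>\<^bsub>Q\<^esub> q p' = q (p - p')"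
proof -
  interpret ring Q using presentsD[OF assms(1)] by simp
  have "q (- p') \<oplus>\<^bsub>Q\<^esub> q p' = \<zero>\<^bsub>Q\<^esub>"
    using assms by (simp add: presentsD(6)[OF assms(1)] presentsD(10)[OF assms(1)] pm_uminus)
  then have "\<ominus>\<^bsub>Q\<^esub> q p' = q (- p')"
    using assms by (intro minus_equality) (auto simp: presentsD(4)[OF assms(1)] pm_uminus)
  then show ?thesis
    using assms by (simp add: a_minus_def presentsD(6)[OF assms(1)] pm_uminus)
qed

lemma presents_free: "presents X {0} (free_alg X) (\<lambda>p. p)"
  by (simp add: presents_def complex_alg_free_alg fideal_def)

text \<open>A quotient of a presented algebra is presented by the preimage \<open>K\<close> of the
  ideal, so tensor, symmetric and enveloping algebras can all be handled as quotients of free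
  algebras by ideals of noncommutative polynomials. \<open>K\<close> is the least ideal that
  contains both the old relations \<open>T\<close> and the lifts \<open>R\<close> of the new
  generators, and this is how it is computed later.\<close>

lemma presents_quot:
  assumes P: "presents X T A q" and R: "R \<subseteq> pm (lists X)" and L: "L = genideal A (q ` R)"
  defines "K \<equiv> {p \<in> pm (lists X). q p \<in> L}"
  shows "presents X K (quot A L) (\<lambda>p. L +>\<^bsub>A\<^esub> q p)" "T \<subseteq> K" "R \<subseteq> K"
    "\<And>Z. fideal X Z \<Longrightarrow> T \<subseteq> Z \<Longrightarrow> R \<subseteq> Z \<Longrightarrow> K \<subseteq> Z" "ideal L A"
proof -
  note D = presentsD[OF P]
  interpret ring A by (rule D)
  have Rc: "q ` R \<subseteq> carrier A" using R D(4) by auto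
  show id: "ideal L A" unfolding L by (rule genideal_ideal[OF Rc])
  interpret L: ideal L A by fact
  have one: "1 \<in> pm (lists X)" by (simp add: zero_list_def)
  have fK: "fideal X K"
    unfolding fideal_def K_def
    using L.zero_closed L.a_closed L.I_l_closed L.I_r_closed D(4)
    by (auto simp: pm_add lists_mult D(10) simp flip: D(6) D(7))
  have s: "lin_subspace L A" by (rule lin_subspace_ideal[OF D(1) id])
  have v: "vec_space A" by (rule calgD) (rule D)
  note qs = quot_simps[OF v s]
  show "presents X K (quot A L) (\<lambda>p. L +>\<^bsub>A\<^esub> q p)"
    unfolding presents_def
  proof (intro conjI ballI allI)
    show "complex_alg (quot A L)" by (rule quot_complex_alg) fact+
    show "fideal X K" by fact
    show "carrier (quot A L) = (\<lambda>p. L +>\<^bsub>A\<^esub> q p) ` pm (lists X)"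
      by (simp add: quot_carrier D(4) image_image)
    show "\<one>\<^bsub>quot A L\<^esub> = L +>\<^bsub>A\<^esub> q 1" by (simp add: quot_def D(9))
    show "\<zero>\<^bsub>quot A L\<^esub> = L +>\<^bsub>A\<^esub> q 0"
      using qs(3) by (simp add: D(10))
  next
    fix p p' assume p: "p \<in> pm (lists X)" "p' \<in> pm (lists X)"
    then have c: "q p \<in> carrier A" "q p' \<in> carrier A" by (auto simp: D(4))
    show "(L +>\<^bsub>A\<^esub> q p = L +>\<^bsub>A\<^esub> q p') = (p - p' \<in> K)"
      using p by (simp add: qs(4)[OF c] presents_minus[OF P] K_def pm_diff)
    show "(L +>\<^bsub>A\<^esub> q p) \<oplus>\<^bsub>quot A L\<^esub> (L +>\<^bsub>A\<^esub> q p') = L +>\<^bsub>A\<^esub> q (p + p')"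
      using p by (simp add: qs(1)[OF c] D(6))
    show "(L +>\<^bsub>A\<^esub> q p) \<otimes>\<^bsub>quot A L\<^esub> (L +>\<^bsub>A\<^esub> q p') = L +>\<^bsub>A\<^esub> q (p * p')"
      using p by (simp add: quot_mult[OF id c] D(7))
  next
    fix c p assume p: "p \<in> pm (lists X)"
    then have "q p \<in> carrier A" by (auto simp: D(4))
    then show "c \<odot>\<^bsub>quot A L\<^esub> (L +>\<^bsub>A\<^esub> q p) = L +>\<^bsub>A\<^esub> q (sc c p)"
      using p by (simp add: qs(2) D(8))
  qed
  show "T \<subseteq> K"
  proof
    fix t assume t: "t \<in> T"
    then have "t \<in> pm (lists X)" using fidealD(1)[OF D(2)] by auto
    moreover from this t have "q t = q 0" using fidealD(2)[OF D(2)] by (simp add: D(5))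
    ultimately show "t \<in> K" using L.zero_closed by (simp add: K_def D(10))
  qed
  show "R \<subseteq> K" using R genideal_self[OF Rc] by (auto simp: K_def L)
  fix Z assume Z: "fideal X Z" "T \<subseteq> Z" "R \<subseteq> Z"
  note DZ = fidealD[OF Z(1)]
  have "ideal (q ` Z) A"
  proof (rule idealI)
    show "ring A" by (rule D)
    show "subgroup (q ` Z) (add_monoid A)"
    proof
      show "q ` Z \<subseteq> carrier (add_monoid A)" using DZ(1) by (auto simp: D(4))
      show "\<one>\<^bsub>add_monoid A\<^esub> \<in> q ` Z" using DZ(2) by (auto simp: D(10))
      show "x \<otimes>\<^bsub>add_monoid A\<^esub> y \<in> q ` Z" if "x \<in> q ` Z" "y \<in> q ` Z" for x y
        using that DZ(1,3) by (auto simp: D(6) subset_iff)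
      show "inv\<^bsub>add_monoid A\<^esub> x \<in> q ` Z" if xq: "x \<in> q ` Z" for x
      proof -
        obtain z where z: "z \<in> Z" "x = q z" using xq by auto
        have "x \<in> carrier A" using z DZ(1) by (auto simp: D(4))
        have "\<zero>\<^bsub>A\<^esub> \<ominus>\<^bsub>A\<^esub> x = q (- z)"
          unfolding z D(10) using presents_minus[OF P, of 0 z] z DZ(1) by auto
        then have "\<ominus>\<^bsub>A\<^esub> x = q (- z)" using \<open>x \<in> carrier A\<close> by (simp add: a_minus_def)
        then show ?thesis using DZ(7)[OF z(1)] by (simp add: a_inv_def)
      qed
    qed
    fix a x assume ax: "a \<in> q ` Z" "x \<in> carrier A"
    then obtain z p where "z \<in> Z" "a = q z" "p \<in> pm (lists X)" "x = q p" by (auto simp: D(4))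
    then show "x \<otimes>\<^bsub>A\<^esub> a \<in> q ` Z" "a \<otimes>\<^bsub>A\<^esub> x \<in> q ` Z"
      using DZ(1,4,5) by (auto simp: D(7) subset_iff)
  qed
  then have LZ: "L \<subseteq> q ` Z" unfolding L by (rule genideal_minimal) (use Z in auto)
  show "K \<subseteq> Z"
  proof
    fix p assume p: "p \<in> K"
    then obtain z where z: "z \<in> Z" "q p = q z" using LZ by (auto simp: K_def)
    \<comment> \<open>\<open>p\<close> has the same image as some element of \<open>Z\<close>; the
      difference lies in the old relations and hence in \<open>Z\<close> too.\<close>
    have "p - z \<in> T" using D(5)[of p z] z p DZ(1) by (auto simp: K_def)
    then have "p - z \<in> Z" using Z(2) by auto
    from DZ(3)[OF this z(1)] show "p \<in> Z" by simp
  qed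
qed

text \<open>\<open>quot_map\<close> is a union over all representatives of the coset. If they all
  yield the same coset of \<open>J\<close>, the union is that coset.\<close>

lemma quot_map_coset:
  assumes "abelian_group A" "additive_subgroup I A" "x \<in> carrier A"
    "\<And>x'. x' \<in> carrier A \<Longrightarrow> x' \<ominus>\<^bsub>A\<^esub> x \<in> I \<Longrightarrow> J +>\<^bsub>B\<^esub> f x' = J +>\<^bsub>B\<^esub> f x"
  shows "quot_map B J f (I +>\<^bsub>A\<^esub> x) = J +>\<^bsub>B\<^esub> f x"
proof -
  interpret abelian_subgroup I A by (rule abelian_subgroupI3) fact+
  have "J +>\<^bsub>B\<^esub> f x' = J +>\<^bsub>B\<^esub> f x" if "x' \<in> I +>\<^bsub>A\<^esub> x" for x'
  proof (rule assms(4))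
    show x': "x' \<in> carrier A" using that assms a_r_coset_subset_G[OF a_subset] by auto
    have "I +>\<^bsub>A\<^esub> x = I +>\<^bsub>A\<^esub> x'" using that assms by (intro a_repr_independence') auto
    then show "x' \<ominus>\<^bsub>A\<^esub> x \<in> I" using coset_eq_iff[OF assms(1,2) x' assms(3)] by simp
  qed
  moreover have "x \<in> I +>\<^bsub>A\<^esub> x" using a_rcos_self[of x] assms by auto
  ultimately show ?thesis unfolding quot_map_def by (intro UN_constant_eq) blast+
qed

text \<open>The map on \<open>Q\<close> induced by \<open>h\<close>; it is independent of the representative if \<open>h\<close> vanishes on \<open>K\<close>.\<close>

definition ind :: "(('x list \<Rightarrow>\<^sub>0 complex) \<Rightarrow> 'b) \<Rightarrow> 'x set \<Rightarrow> (('x list \<Rightarrow>\<^sub>0 complex) \<Rightarrow> 'c) \<Rightarrow> 'b \<Rightarrow> 'c" where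
  "ind q X h u = h (SOME p. p \<in> pm (lists X) \<and> q p = u)"

lemma ind_eq:
  fixes h :: "('x list \<Rightarrow>\<^sub>0 complex) \<Rightarrow> ('m \<Rightarrow>\<^sub>0 complex)"
  assumes "presents X K Q q" "lin h" "\<And>p. p \<in> K \<Longrightarrow> h p = 0" "p \<in> pm (lists X)"
  shows "ind q X h (q p) = h p"
proof -
  let ?p = "SOME p'. p' \<in> pm (lists X) \<and> q p' = q p"
  have s: "?p \<in> pm (lists X) \<and> q ?p = q p" by (rule someI[of _ p]) (use assms in auto)
  then have "?p - p \<in> K" using presentsD(5)[OF assms(1), of ?p p] assms(4) by auto
  then have "h ?p - h p = 0" using assms(3) lin_diffD[OF assms(2)] by metis
  then show ?thesis by (simp add: ind_def)
qed

lemma lin_span_carrier: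
  assumes "vec_space A" "S \<subseteq> carrier A" shows "lin_span A S \<subseteq> carrier A"
proof
  fix x assume "x \<in> lin_span A S"
  then show "x \<in> carrier A"
    using assms vspD[OF assms(1)] abelian_monoid.zero_closed[OF abelian_group.axioms(1)]
    by (induction rule: lin_span.induct) (auto intro: abelian_monoid.a_closed[OF abelian_group.axioms(1)])
qed

lemma lin_span_least:
  assumes "S \<subseteq> W" "\<zero>\<^bsub>A\<^esub> \<in> W" "\<And>x y. x \<in> W \<Longrightarrow> y \<in> W \<Longrightarrow> x \<oplus>\<^bsub>A\<^esub> y \<in> W"
    "\<And>c x. x \<in> W \<Longrightarrow> c \<odot>\<^bsub>A\<^esub> x \<in> W"
  shows "lin_span A S \<subseteq> W"
proof
  fix x assume "x \<in> lin_span A S"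
  then show "x \<in> W" using assms by (induction rule: lin_span.induct) auto
qed

lemma lin_span_update [simp]: "lin_span (A\<lparr>carrier := C\<rparr>) S = lin_span A S"
proof
  show "lin_span (A\<lparr>carrier := C\<rparr>) S \<subseteq> lin_span A S"
    by (rule lin_span_least) (auto intro: lin_span.intros)
  show "lin_span A S \<subseteq> lin_span (A\<lparr>carrier := C\<rparr>) S"
    using lin_span.zero[of "A\<lparr>carrier := C\<rparr>" S] lin_span.add[of _ "A\<lparr>carrier := C\<rparr>" S]
      lin_span.smult[of _ "A\<lparr>carrier := C\<rparr>" S]
    by (intro lin_span_least) (auto intro: lin_span.base)
qed

lemma coset_update [simp]: "I +>\<^bsub>A\<lparr>carrier := C\<rparr>\<^esub> x = I +>\<^bsub>A\<^esub> x"
  by (simp add: a_r_coset_def')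

lemma sub_abelian_group:
  assumes "abelian_group A" "additive_subgroup S A"
  shows "abelian_group (A\<lparr>carrier := S\<rparr>)"
proof -
  interpret abelian_group A by fact
  interpret S: additive_subgroup S A by fact
  show ?thesis
  proof (rule abelian_groupI)
    fix x assume "x \<in> carrier (A\<lparr>carrier := S\<rparr>)"
    then show "\<exists>y\<in>carrier (A\<lparr>carrier := S\<rparr>). y \<oplus>\<^bsub>A\<lparr>carrier := S\<rparr>\<^esub> x = \<zero>\<^bsub>A\<lparr>carrier := S\<rparr>\<^esub>"
      using S.a_subset by (intro bexI[of _ "\<ominus>\<^bsub>A\<^esub> x"]) (auto simp: l_neg)
  qed (use S.a_subset in \<open>auto simp: a_ac subset_iff\<close>)
qed

text \<open>The additive inverse is specified by means of the carrier, so a smaller carrier could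
  change it. Uniqueness of inverses in the restricted group excludes this.\<close>

lemma sub_minus:
  assumes "abelian_group A" "additive_subgroup S A" "x \<in> S" "y \<in> S"
  shows "x \<ominus>\<^bsub>A\<lparr>carrier := S\<rparr>\<^esub> y = x \<ominus>\<^bsub>A\<^esub> y"
proof -
  interpret abelian_group A by fact
  interpret S: additive_subgroup S A by fact
  interpret B: abelian_group "A\<lparr>carrier := S\<rparr>" by (rule sub_abelian_group) fact+
  have "y \<in> carrier A" using assms S.a_subset by auto
  then have "\<ominus>\<^bsub>A\<lparr>carrier := S\<rparr>\<^esub> y = \<ominus>\<^bsub>A\<^esub> y"
    using assms by (intro B.minus_equality) (auto simp: l_neg)
  then show ?thesis by (simp add: a_minus_def)
qed

lemma sub_vec_space:
  assumes "vec_space A" "lin_subspace S A" shows "vec_space (A\<lparr>carrier := S\<rparr>)"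
proof -
  have "S \<subseteq> carrier A" using assms(2) additive_subgroup.a_subset by (auto simp: lin_subspace_def)
  then show ?thesis
    using assms sub_abelian_group[of A S] by (auto simp: vec_space_def lin_subspace_def subset_iff)
qed

lemma sub_lin_subspace:
  assumes "vec_space A" "lin_subspace S A" "lin_subspace I A" "I \<subseteq> S"
  shows "lin_subspace I (A\<lparr>carrier := S\<rparr>)"
proof -
  interpret A: abelian_group A by (rule vspD) fact
  have S: "additive_subgroup S A" using assms(2) by (simp add: lin_subspace_def)
  interpret S: additive_subgroup S A by fact
  interpret I: additive_subgroup I A using assms(3) by (simp add: lin_subspace_def)
  interpret B: abelian_group "A\<lparr>carrier := S\<rparr>" by (rule sub_abelian_group[OF A.abelian_group_axioms S])
  have "subgroup I (add_monoid (A\<lparr>carrier := S\<rparr>))"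
  proof
    show "inv\<^bsub>add_monoid (A\<lparr>carrier := S\<rparr>)\<^esub> x \<in> I" if x: "x \<in> I" for x
    proof -
      have "x \<in> carrier A" using x I.a_subset by auto
      then have "\<ominus>\<^bsub>A\<lparr>carrier := S\<rparr>\<^esub> x = \<ominus>\<^bsub>A\<^esub> x"
        using x assms(4) by (intro B.minus_equality) (auto simp: A.l_neg)
      then show ?thesis using I.a_inv_closed[OF x] by (simp add: a_inv_def)
    qed
  qed (use assms(4) in auto)
  then show ?thesis using assms(3) by (auto simp: lin_subspace_def additive_subgroupI)
qed

lemma lin_subspace_image:
  assumes P: "presents X K Q q" and R: "R \<subseteq> pm (lists X)" "0 \<in> R"
    "\<And>p p'. p \<in> R \<Longrightarrow> p' \<in> R \<Longrightarrow> p + p' \<in> R" "\<And>c p. p \<in> R \<Longrightarrow> sc c p \<in> R"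
  shows "lin_subspace (q ` R) Q"
proof -
  note D = presentsD[OF P]
  interpret ring Q by (rule D)
  have "subgroup (q ` R) (add_monoid Q)"
  proof
    show "q ` R \<subseteq> carrier (add_monoid Q)" using R(1) by (auto simp: D(4))
    show "\<one>\<^bsub>add_monoid Q\<^esub> \<in> q ` R" using R(2) by (auto simp: D(10))
    show "x \<otimes>\<^bsub>add_monoid Q\<^esub> y \<in> q ` R" if "x \<in> q ` R" "y \<in> q ` R" for x y
      using that R(1,3) by (auto simp: D(6) subset_iff)
    show "inv\<^bsub>add_monoid Q\<^esub> x \<in> q ` R" if x: "x \<in> q ` R" for x
    proof -
      obtain p where p: "p \<in> R" "x = q p" using x by auto
      then have pF: "p \<in> pm (lists X)" using R(1) by auto
      have "x \<in> carrier Q" using p pF by (auto simp: D(4))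
      moreover have "\<zero>\<^bsub>Q\<^esub> \<ominus>\<^bsub>Q\<^esub> x = q (sc (-1) p)"
        unfolding p D(10) using presents_minus[OF P, of 0 p] pF by (simp add: sc_minus_one)
      ultimately have "\<ominus>\<^bsub>Q\<^esub> x = q (sc (-1) p)" by (simp add: a_minus_def)
      then show ?thesis using R(4)[OF p(1)] by (simp add: a_inv_def)
    qed
  qed
  moreover have "c \<odot>\<^bsub>Q\<^esub> x \<in> q ` R" if "x \<in> q ` R" for c x
    using that R(1,4) by (auto simp: D(8) subset_iff)
  ultimately show ?thesis by (simp add: lin_subspace_def additive_subgroupI)
qed

lemma lin_span_presents:
  assumes P: "presents X K Q q" and S: "S \<subseteq> lists X"
  shows "lin_span Q (q ` mon ` S) = q ` pm S"
proof
  note D = presentsD[OF P]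
  have F: "p \<in> pm (lists X)" if "p \<in> pm S" for p using pm_mono[OF that S] .
  show "lin_span Q (q ` mon ` S) \<subseteq> q ` pm S"
  proof (rule lin_span_least)
    show "x \<oplus>\<^bsub>Q\<^esub> y \<in> q ` pm S" if "x \<in> q ` pm S" "y \<in> q ` pm S" for x y
      using that F by (auto simp: D(6))
    show "c \<odot>\<^bsub>Q\<^esub> x \<in> q ` pm S" if "x \<in> q ` pm S" for x c
      using that F by (auto simp: D(8))
  qed (auto simp: D(10))
  show "q ` pm S \<subseteq> lin_span Q (q ` mon ` S)"
  proof safe
    fix p assume "p \<in> pm S"
    then show "q p \<in> lin_span Q (q ` mon ` S)"
    proof (induction rule: pm_induct)
      case zero
      show ?case using lin_span.zero[of Q] by (simp add: D(10))
    next
      case (add p p')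
      then show ?case using lin_span.add[OF add(3,4)] F by (simp add: D(6))
    next
      case (mon c w)
      then have "q (mon w) \<in> lin_span Q (q ` mon ` S)" by (intro lin_span.base) auto
      from lin_span.smult[OF this, of c] show ?case
        using mon S by (simp add: D(8) subset_iff del: Poly_Mapping.map_single)
    qed
  qed
qed

lemma lin_span_map:
  assumes "vec_space A" "T \<subseteq> carrier A" "\<And>t. t \<in> T \<Longrightarrow> f t \<in> lin_span A S"
    and "\<And>x y. x \<in> carrier A \<Longrightarrow> y \<in> carrier A \<Longrightarrow> f (x \<oplus>\<^bsub>A\<^esub> y) = f x \<oplus>\<^bsub>A\<^esub> f y"
    and "\<And>c x. x \<in> carrier A \<Longrightarrow> f (c \<odot>\<^bsub>A\<^esub> x) = c \<odot>\<^bsub>A\<^esub> f x"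
    and "f \<zero>\<^bsub>A\<^esub> = \<zero>\<^bsub>A\<^esub>" "l \<in> lin_span A T"
  shows "f l \<in> lin_span A S"
proof -
  interpret abelian_group A by (rule vspD) fact
  have "lin_span A T \<subseteq> {l \<in> carrier A. f l \<in> lin_span A S}"
    by (rule lin_span_least) (use assms vspD(2)[OF assms(1)] in \<open>auto intro: lin_span.intros\<close>)
  then show ?thesis using assms(7) by auto
qed

section \<open>Tensor and symmetric algebras of spaces with a basis\<close>

text \<open>Linear independence of \<open>e\<close> is expressed by a linear coordinate map with
  \<open>co (e z) = mon z\<close>, generation by \<open>carrier_span\<close>. The instances are
  \<open>\<Omega>\<close>, the matrices over \<open>\<Omega>\<close> with labelled matrix units, and
  the cyclic coinvariants with necklaces.\<close>

locale vbasis =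
  fixes V :: "(complex, 'v) module" and Z :: "'z set" and e :: "'z \<Rightarrow> 'v" and co :: "'v \<Rightarrow> ('z \<Rightarrow>\<^sub>0 complex)"
  assumes vec_space: "vec_space V"
    and e_carrier: "z \<in> Z \<Longrightarrow> e z \<in> carrier V"
    and co_add: "v \<in> carrier V \<Longrightarrow> w \<in> carrier V \<Longrightarrow> co (v \<oplus>\<^bsub>V\<^esub> w) = co v + co w"
    and co_smult: "v \<in> carrier V \<Longrightarrow> co (c \<odot>\<^bsub>V\<^esub> v) = sc c (co v)"
    and co_e: "z \<in> Z \<Longrightarrow> co (e z) = mon z"
    and carrier_span: "carrier V \<subseteq> lin_span V (e ` Z)"
begin

abbreviation "FV \<equiv> pm (lists (carrier V))"

lemma carrier_eq: "carrier V = lin_span V (e ` Z)"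
  using carrier_span lin_span_carrier[OF vec_space, of "e ` Z"] e_carrier by auto

lemma co_zero: "co \<zero>\<^bsub>V\<^esub> = 0"
proof -
  interpret abelian_group V by (rule vspD[OF vec_space])
  show ?thesis using co_add[of "\<zero>\<^bsub>V\<^esub>" "\<zero>\<^bsub>V\<^esub>"] by simp
qed

lemma carrier_induct [consumes 1, case_names zero base add smult]:
  assumes "v \<in> carrier V" "Q \<zero>\<^bsub>V\<^esub>" "\<And>z. z \<in> Z \<Longrightarrow> Q (e z)"
    "\<And>v w. v \<in> carrier V \<Longrightarrow> w \<in> carrier V \<Longrightarrow> Q v \<Longrightarrow> Q w \<Longrightarrow> Q (v \<oplus>\<^bsub>V\<^esub> w)"
    "\<And>c v. v \<in> carrier V \<Longrightarrow> Q v \<Longrightarrow> Q (c \<odot>\<^bsub>V\<^esub> v)"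
  shows "Q v"
proof -
  have "v \<in> lin_span V (e ` Z)" using assms(1) carrier_eq by simp
  then show ?thesis
    by (induction rule: lin_span.induct) (use assms carrier_eq in auto)
qed

lemma co_pm: "v \<in> carrier V \<Longrightarrow> co v \<in> pm Z"
  by (induction rule: carrier_induct) (auto simp: co_zero co_e co_add co_smult)

definition lin_word :: "'v \<Rightarrow> ('z list \<Rightarrow>\<^sub>0 complex)" where
  "lin_word v = lext (\<lambda>z. mon [z]) (co v)"

text \<open>Expansion of all letters in the basis. It is inverse to \<open>em\<close> modulo the
  multilinearity relations, so the tensor algebra is the ring of noncommutative polynomials over
  \<open>Z\<close>, and the tensor ideal is the kernel of \<open>ex\<close> on
  \<open>FV\<close>.\<close>

definition ex :: "('v list \<Rightarrow>\<^sub>0 complex) \<Rightarrow> ('z list \<Rightarrow>\<^sub>0 complex)" where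
  "ex = word_eval lin_word"

definition em :: "('z list \<Rightarrow>\<^sub>0 complex) \<Rightarrow> ('v list \<Rightarrow>\<^sub>0 complex)" where
  "em = lext (\<lambda>w. mon (map e w))"

definition tensor_rels :: "('v list \<Rightarrow>\<^sub>0 complex) set" where
  "tensor_rels = {word [x \<oplus>\<^bsub>V\<^esub> y] - word [x] - word [y] | x y. x \<in> carrier V \<and> y \<in> carrier V} \<union>
      {word [c \<odot>\<^bsub>V\<^esub> x] - scale_poly c (word [x]) | c x. x \<in> carrier V}"

definition qT :: "('v list \<Rightarrow>\<^sub>0 complex) \<Rightarrow> ('v list \<Rightarrow>\<^sub>0 complex) set" where
  "qT p = tensor_ideal V +>\<^bsub>free_alg (carrier V)\<^esub> p"

lemma lin_ex: "lin ex" unfolding ex_def by (rule lin_word_eval)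
lemma lin_em: "lin em" unfolding em_def by (rule lin_lext)
lemma ex_mult: "ex (p * q) = ex p * ex q" unfolding ex_def by (rule word_eval_mult)
lemma em_mon: "em (mon w) = mon (map e w)" by (simp add: em_def)
lemma em_mult: "em (p * q) = em p * em q"
  by (rule lin_hom[OF lin_em]) (simp add: em_mon plus_list_def, simp add: mon_append)
lemma ex_mon: "ex (mon w) = prod_list (map lin_word w)" by (simp add: ex_def word_eval_mon)

lemma lin_word_pm: "v \<in> carrier V \<Longrightarrow> lin_word v \<in> pm {[z] | z. z \<in> Z}"
  unfolding lin_word_def by (rule lin_pm[OF lin_lext co_pm]) auto

lemma ex_pm: "p \<in> FV \<Longrightarrow> ex p \<in> pm (lists Z)"
proof (rule lin_pm[OF lin_ex])
  fix w assume "w \<in> lists (carrier V)"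
  then show "ex (mon w) \<in> pm (lists Z)"
  proof (induction w)
    case (Cons v w)
    have "lin_word v \<in> pm (lists Z)" using lin_word_pm[OF Cons(1)] by (rule pm_mono) auto
    then show ?case using Cons by (simp add: ex_mon lists_mult)
  qed (simp add: ex_mon zero_list_def)
qed

lemma ex_length: "w \<in> lists (carrier V) \<Longrightarrow> ex (mon w) \<in> pm {w' \<in> lists Z. length w' = length w}"
proof (induction w)
  case (Cons v w)
  then have w: "w \<in> lists (carrier V)" and v: "v \<in> carrier V" by auto
  show ?case
    unfolding mon_Cons[of v w] ex_mult
    by (rule pm_mult[OF _ Cons.IH[OF w], of _ "{[z] | z. z \<in> Z}"])
      (use lin_word_pm[OF v] in \<open>auto simp: ex_mon plus_list_def\<close>)
qed (simp add: ex_mon zero_list_def)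

lemma em_pm: "p \<in> pm (lists Z) \<Longrightarrow> em p \<in> FV"
  by (rule lin_pm[OF lin_em]) (auto simp: em_mon e_carrier)

lemma ex_em: "p \<in> pm (lists Z) \<Longrightarrow> ex (em p) = p"
proof (rule lin_eq[OF lin_comp[OF lin_ex lin_em] lin_id])
  fix w assume "w \<in> lists Z"
  then show "ex (em (mon w)) = mon w"
    unfolding em_mon ex_mon
    by (induction w) (simp_all add: lin_word_def co_e mon_Nil flip: mon_Cons)
qed

lemma tensor_rels_sub: "tensor_rels \<subseteq> FV"
  using vspD[OF vec_space] abelian_monoid.a_closed[OF abelian_group.axioms(1)]
  by (auto simp: tensor_rels_def simp del: Poly_Mapping.map_single intro!: pm_diff pm_sc)

lemma tensor_ideal_eq': "tensor_ideal V = genideal (free_alg (carrier V)) ((\<lambda>p. p) ` tensor_rels)"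
  by (simp add: tensor_ideal_def tensor_rels_def)

lemmas tensor_quot = presents_quot[OF presents_free tensor_rels_sub tensor_ideal_eq']

lemma tensor_ideal_sub: "tensor_ideal V \<subseteq> FV"
  using ideal.Icarr[OF tensor_quot(5)] by auto

lemma fideal_tensor: "fideal (carrier V) (tensor_ideal V)"
proof -
  have "{p \<in> FV. p \<in> tensor_ideal V} = tensor_ideal V" using tensor_ideal_sub by auto
  then show ?thesis using presentsD(2)[OF tensor_quot(1)] by simp
qed

lemma tensor_rels_in: "tensor_rels \<subseteq> tensor_ideal V"
  using tensor_quot(3) by auto

lemma presents_tensor: "presents (carrier V) (tensor_ideal V) (tensor_alg V) qT"
proof -
  have "{p \<in> FV. p \<in> tensor_ideal V} = tensor_ideal V" using tensor_ideal_sub by auto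
  then show ?thesis using tensor_quot(1) by (simp add: tensor_alg_def qT_def[abs_def])
qed

lemma tensor_ideal_least: "fideal (carrier V) W \<Longrightarrow> tensor_rels \<subseteq> W \<Longrightarrow> tensor_ideal V \<subseteq> W"
  using tensor_quot(4)[of W] fidealD(2)[of _ W] tensor_ideal_sub by auto

lemma word_em_ex:
  assumes "v \<in> carrier V" shows "mon [v] - em (lin_word v) \<in> tensor_ideal V"
  using assms
proof (induction rule: carrier_induct)
  case zero
  interpret abelian_group V by (rule vspD[OF vec_space])
  \<comment> \<open>The relation for \<open>0 + 0 = 0\<close> is \<open>- mon [0]\<close>, so the
    one-letter word of the zero vector is itself a relation up to sign.\<close>
  have "word [\<zero>\<^bsub>V\<^esub> \<oplus>\<^bsub>V\<^esub> \<zero>\<^bsub>V\<^esub>] - word [\<zero>\<^bsub>V\<^esub>] - word [\<zero>\<^bsub>V\<^esub>] \<in> tensor_rels"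
    unfolding tensor_rels_def by blast
  then have "- mon [\<zero>\<^bsub>V\<^esub>] \<in> tensor_ideal V" using tensor_rels_in by auto
  from fidealD(7)[OF fideal_tensor this] show ?case
    by (simp add: lin_word_def co_zero lin_0[OF lin_lext] lin_0[OF lin_em])
next
  case (base z)
  then show ?case using fidealD(2)[OF fideal_tensor] by (simp add: lin_word_def co_e em_mon)
next
  case (add v w)
  have "word [v \<oplus>\<^bsub>V\<^esub> w] - word [v] - word [w] \<in> tensor_ideal V"
    using tensor_rels_in add unfolding tensor_rels_def by blast
  from fidealD(3)[OF fideal_tensor fidealD(3)[OF fideal_tensor this add(3)] add(4)]
  show ?case using add
    by (simp add: lin_word_def co_add lin_addD[OF lin_lext] lin_addD[OF lin_em] algebra_simps)
next
  case (smult c v)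
  have "word [c \<odot>\<^bsub>V\<^esub> v] - sc c (word [v]) \<in> tensor_ideal V"
    using tensor_rels_in smult unfolding tensor_rels_def by blast
  from fidealD(3)[OF fideal_tensor this fidealD(6)[OF fideal_tensor smult(2), of c]]
  show ?case using smult
    by (simp add: lin_word_def co_smult lin_scD[OF lin_lext] lin_scD[OF lin_em] sc_diff
       del: Poly_Mapping.map_single)
qed

lemma em_ex: "p \<in> FV \<Longrightarrow> p - em (ex p) \<in> tensor_ideal V"
proof (induction rule: pm_induct)
  case zero
  show ?case using fidealD(2)[OF fideal_tensor] by (simp add: lin_0[OF lin_ex] lin_0[OF lin_em])
next
  case (add p q)
  have "p + q - em (ex (p + q)) = (p - em (ex p)) + (q - em (ex q))"
    by (simp add: lin_addD[OF lin_ex] lin_addD[OF lin_em])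
  then show ?case using fidealD(3)[OF fideal_tensor add(3,4)] by metis
next
  case (mon c w)
  then have "mon w - em (ex (mon w)) \<in> tensor_ideal V"
  proof (induction w)
    case Nil
    show ?case using fidealD(2)[OF fideal_tensor]
      by (simp add: ex_mon em_mon mon_Nil[symmetric] del: single_one)
  next
    case (Cons v w)
    have 1: "mon w \<in> FV" "em (ex (mon [v])) \<in> FV"
      using Cons by (auto intro!: em_pm ex_pm)
    \<comment> \<open>The first letter is replaced first, the remaining word afterwards; both
      differences lie in the ideal.\<close>
    have "mon (v # w) - em (ex (mon (v # w))) =
      (mon [v] - em (lin_word v)) * mon w + em (ex (mon [v])) * (mon w - em (ex (mon w)))"
      by (simp only: mon_Cons[of v w] ex_mult em_mult) (simp add: algebra_simps ex_mon)
    then show ?case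
      using fidealD(3)[OF fideal_tensor fidealD(5)[OF fideal_tensor word_em_ex[OF Cons(1)] 1(1)]
          fidealD(4)[OF fideal_tensor Cons(3) 1(2)]] by simp
  qed
  from fidealD(6)[OF fideal_tensor this, of c] show ?case
    by (simp only: sc_diff lin_scD[OF lin_ex] lin_scD[OF lin_em])
qed

lemma fideal_kernel:
  assumes "lin h" "\<And>p q. h (p * q) = h p * h q"
  shows "fideal X {p \<in> pm (lists X). h p = (0 :: 'm::monoid_add \<Rightarrow>\<^sub>0 complex)}"
  using assms by (auto simp: fideal_def lin_0 lin_addD lists_mult)

lemma ex_tensor_ideal: "p \<in> tensor_ideal V \<Longrightarrow> ex p = 0"
proof -
  have "tensor_ideal V \<subseteq> {p \<in> FV. ex p = 0}"
  proof (rule tensor_ideal_least[OF fideal_kernel[OF lin_ex ex_mult]], safe)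
    fix p assume p: "p \<in> tensor_rels"
    then show "p \<in> FV" using tensor_rels_sub by auto
    show "ex p = 0" using p
      by (auto simp: tensor_rels_def lin_diffD[OF lin_ex] lin_scD[OF lin_ex] ex_mon lin_word_def
        co_add co_smult lin_addD[OF lin_lext] lin_scD[OF lin_lext] simp del: Poly_Mapping.map_single)
  qed
  then show "p \<in> tensor_ideal V \<Longrightarrow> ex p = 0" by auto
qed

lemma tensor_ideal_iff: "p \<in> FV \<Longrightarrow> p \<in> tensor_ideal V \<longleftrightarrow> ex p = 0"
  using em_ex[of p] ex_tensor_ideal[of p] by (auto simp: lin_0[OF lin_em])

end

text \<open>Words with the same letters are connected by exchanges of neighbours: the first letter
  of \<open>w\<close> is carried to its place in \<open>w'\<close> after the rest has been arranged.
  The claim is proved behind an arbitrary prefix \<open>p\<close>, since the rest is arranged behind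
  the first letter.\<close>

lemma swap_words:
  fixes R :: "'z list \<Rightarrow> 'z list \<Rightarrow> bool"
  assumes refl: "\<And>w. R w w" and trans: "\<And>u v w. R u v \<Longrightarrow> R v w \<Longrightarrow> R u w"
    and swap: "\<And>u v a b. set u \<subseteq> Z \<Longrightarrow> set v \<subseteq> Z \<Longrightarrow> a \<in> Z \<Longrightarrow> b \<in> Z \<Longrightarrow> R (u @ [a, b] @ v) (u @ [b, a] @ v)"
    and "mset w = mset w'" "set w \<subseteq> Z"
  shows "R w w'"
proof -
  have move: "R (p @ a # u @ v) (p @ u @ a # v)"
    if "set p \<subseteq> Z" "set u \<subseteq> Z" "set v \<subseteq> Z" "a \<in> Z" for p a u v
    using that
  proof (induction u arbitrary: p)
    case (Cons b u)
    have "R (p @ [a, b] @ (u @ v)) (p @ [b, a] @ (u @ v))" using Cons by (intro swap) auto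
    with Cons(1)[of "p @ [b]"] Cons(2-) show ?case by (auto intro: trans)
  qed (simp add: refl)
  have "R (p @ w) (p @ w')" if "mset w = mset w'" "set p \<subseteq> Z" "set w \<subseteq> Z" for p w w'
    using that
  proof (induction w arbitrary: p w')
    case (Cons a w)
    have aw: "a \<in> set w'" using Cons(2) by (metis list.set_intros(1) set_mset_mset)
    then obtain u v where w': "w' = u @ a # v" by (meson split_list)
    have "set w' = set (a # w)" using Cons(2) by (metis set_mset_mset)
    then have uv: "set u \<subseteq> Z" "set v \<subseteq> Z" using w' Cons(4) by auto
    have "R ((p @ [a]) @ w) ((p @ [a]) @ (u @ v))"
      using Cons(2-) w' by (intro Cons(1)) auto
    moreover have "R (p @ a # u @ v) (p @ u @ a # v)" using Cons uv by (intro move) auto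
    ultimately show ?case using w' by (auto intro: trans)
  qed (simp add: refl)
  from this[of w w' "[]"] assms show ?thesis by simp
qed

section \<open>Symmetric algebras as polynomial rings\<close>

definition ab :: "('z list \<Rightarrow>\<^sub>0 complex) \<Rightarrow> ('z multiset \<Rightarrow>\<^sub>0 complex)" where
  "ab = lext (\<lambda>w. mon (mset w))"

lemma lin_ab: "lin ab" unfolding ab_def by (rule lin_lext)
lemma ab_mon: "ab (mon w) = mon (mset w)" by (simp add: ab_def)
lemma ab_mult: "ab (p * q) = ab p * ab q"
  by (rule lin_hom[OF lin_ab]) (simp add: ab_mon plus_list_def mult_single)

context vbasis
begin

definition sy :: "('v list \<Rightarrow>\<^sub>0 complex) \<Rightarrow> ('z multiset \<Rightarrow>\<^sub>0 complex)" where
  "sy p = ab (ex p)"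

lemma lin_sy: "lin sy"
  unfolding sy_def[abs_def] by (rule lin_comp[OF lin_ab lin_ex])

lemma sy_mult: "sy (p * q) = sy p * sy q"
  by (simp add: sy_def ex_mult ab_mult)

lemma sy_pm: "p \<in> FV \<Longrightarrow> sy p \<in> polys Z"
  unfolding sy_def by (rule lin_pm[OF lin_ab ex_pm]) (auto simp: ab_mon)

text \<open>A linear section of \<open>sy\<close> on \<open>polys Z\<close>. The order of the
  letters in the chosen word is irrelevant; it is enough that one word is fixed for each
  multiset.\<close>

definition lift :: "('z multiset \<Rightarrow>\<^sub>0 complex) \<Rightarrow> ('v list \<Rightarrow>\<^sub>0 complex)" where
  "lift = lext (\<lambda>m. em (mon (SOME w. mset w = m)))"

lemma mset_some: "mset (SOME w. mset w = m) = m"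
  by (rule someI_ex) (rule ex_mset)

lemma set_some: "set (SOME w. mset w = m) = set_mset m"
  by (metis mset_some set_mset_mset)

lemma lift_pm: "p \<in> polys Z \<Longrightarrow> lift p \<in> FV"
  unfolding lift_def 
proof (rule lin_pm[OF lin_lext])
  fix m assume "m \<in> {m. set_mset m \<subseteq> Z}"
  then have "(SOME w. mset w = m) \<in> lists Z" by (simp add: in_lists_conv_set set_some subset_iff)
  then show "lext (\<lambda>m. em (mon (SOME w. mset w = m))) (mon m) \<in> FV" by (simp add: em_pm)
qed

lemma sy_lift: "p \<in> polys Z \<Longrightarrow> sy (lift p) = p"
proof (rule lin_eq[OF lin_comp[OF lin_sy] lin_id])
  show "lin lift" unfolding lift_def by (rule lin_lext)
  fix m assume "m \<in> {m. set_mset m \<subseteq> Z}"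
  then have "ex (em (mon (SOME w. mset w = m))) = mon (SOME w. mset w = m)"
    by (intro ex_em) (auto simp: set_some)
  then show "sy (lift (mon m)) = mon m" by (simp add: sy_def lift_def ab_mon mset_some)
qed

text \<open>Used for the symmetric algebra with \<open>W n = K\<close>, and for enveloping algebras with
  \<open>W n\<close> the sum of the ideal and the elements of degree \<open>< n\<close>.\<close>

lemma sort_words:
  assumes W: "\<And>n. 0 \<in> W n" "\<And>n p q. p \<in> W n \<Longrightarrow> q \<in> W n \<Longrightarrow> p + q \<in> W n"
    "\<And>n c p. p \<in> W n \<Longrightarrow> sc c p \<in> W n"
    and swap: "\<And>u v a b. set u \<subseteq> Z \<Longrightarrow> set v \<subseteq> Z \<Longrightarrow> a \<in> Z \<Longrightarrow> b \<in> Z \<Longrightarrow>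
      em (mon (u @ [a, b] @ v)) - em (mon (u @ [b, a] @ v)) \<in> W (length u + 2 + length v)"
    and p: "p \<in> pm {w \<in> lists Z. length w = n}"
  shows "em p - lift (ab p) \<in> W n"
  using p
proof (induction rule: pm_induct)
  case zero
  show ?case using W by (simp add: lin_0 lin_em lin_ab lift_def lin_lext)
next
  case (add p q)
  have "em (p + q) - lift (ab (p + q)) = (em p - lift (ab p)) + (em q - lift (ab q))"
    by (simp add: lin_addD lin_em lin_ab lift_def lin_lext)
  then show ?case using W(2)[OF add(3,4)] by metis
next
  case (mon c w)
  let ?w' = "SOME w'. mset w' = mset w"
  \<comment> \<open>Equality of lengths is part of the relation, so that the same space
    \<open>W (length w)\<close> serves along the whole chain of exchanges.\<close>
  have "length w = length ?w' \<and> em (mon w) - em (mon ?w') \<in> W (length w)"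
  proof (rule swap_words[where Z = Z
      and R = "\<lambda>w w'. length w = length w' \<and> em (mon w) - em (mon w') \<in> W (length w)"])
    show "length w = length w \<and> em (mon w) - em (mon w) \<in> W (length w)" for w using W by simp
    fix u v w
    assume a: "length u = length v \<and> em (mon u) - em (mon v) \<in> W (length u)"
      "length v = length w \<and> em (mon v) - em (mon w) \<in> W (length v)"
    have "em (mon u) - em (mon w) = (em (mon u) - em (mon v)) + (em (mon v) - em (mon w))" by simp
    then show "length u = length w \<and> em (mon u) - em (mon w) \<in> W (length u)"
      using a W(2) by metis
  next
    fix u v a b assume "set u \<subseteq> Z" "set v \<subseteq> Z" "a \<in> Z" "b \<in> Z"
    from swap[OF this] show "length (u @ [a, b] @ v) = length (u @ [b, a] @ v) \<and>
      em (mon (u @ [a, b] @ v)) - em (mon (u @ [b, a] @ v)) \<in> W (length (u @ [a, b] @ v))" by simp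
  qed (use mon in \<open>auto simp: mset_some\<close>)
  then have "sc c (em (mon w) - lift (ab (mon w))) \<in> W n"
    using mon by (intro W) (auto simp: ab_mon lift_def)
  then show ?case by (simp only: sc_diff lin_scD[OF lin_em] lin_scD[OF lin_ab] lift_def lin_scD[OF lin_lext])
qed

definition sym_rels :: "('v list \<Rightarrow>\<^sub>0 complex) set" where
  "sym_rels = {mon [x, y] - mon [y, x] | x y. x \<in> carrier V \<and> y \<in> carrier V}"

definition qS :: "('v list \<Rightarrow>\<^sub>0 complex) \<Rightarrow> ('v list \<Rightarrow>\<^sub>0 complex) set set" where
  "qS p = sym_ideal V +>\<^bsub>tensor_alg V\<^esub> qT p"

lemma sym_rels_sub: "sym_rels \<subseteq> FV"
  by (auto simp: sym_rels_def intro!: pm_diff)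

lemma sym_ideal_eq': "sym_ideal V = genideal (tensor_alg V) (qT ` sym_rels)"
proof -
  have "tens V [x, y] \<ominus>\<^bsub>tensor_alg V\<^esub> tens V [y, x] = qT (mon [x, y] - mon [y, x])"
    if "x \<in> carrier V" "y \<in> carrier V" for x y
    using presents_minus[OF presents_tensor, of "mon [x, y]" "mon [y, x]"] that
    by (simp add: qT_def tens_def)
  then have "{tens V [x, y] \<ominus>\<^bsub>tensor_alg V\<^esub> tens V [y, x] | x y. x \<in> carrier V \<and> y \<in> carrier V}
    = qT ` sym_rels"
    unfolding sym_rels_def image_def by (auto simp: qT_def) metis+
  then show ?thesis by (simp add: sym_ideal_def)
qed

lemmas sym_quot = presents_quot[OF presents_tensor sym_rels_sub sym_ideal_eq']

text \<open>The commutators lie in the kernel of \<open>sy\<close> because polynomials commute.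
  Conversely, modulo the ideal a noncommutative polynomial \<open>y\<close> over the basis equals
  \<open>lift (ab y)\<close>, which is 0 when \<open>ab y\<close> is.\<close>

lemma presents_sym: "presents (carrier V) {p \<in> FV. sy p = 0} (sym_alg V) qS"
proof -
  let ?K = "{p \<in> FV. qT p \<in> sym_ideal V}"
  have K: "fideal (carrier V) ?K" using presentsD(2)[OF sym_quot(1)] .
  have "?K \<subseteq> {p \<in> FV. sy p = 0}"
  proof (rule sym_quot(4)[OF fideal_kernel[OF lin_sy sy_mult]])
    show "tensor_ideal V \<subseteq> {p \<in> FV. sy p = 0}"
      using tensor_ideal_sub by (auto simp: sy_def ex_tensor_ideal lin_0[OF lin_ab])
    have "sy (mon [x, y]) = sy (mon [y, x])" for x y
      by (simp only: mon_Cons[of x "[y]"] mon_Cons[of y "[x]"] sy_mult mult.commute)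
    then show "sym_rels \<subseteq> {p \<in> FV. sy p = 0}"
      using sym_rels_sub by (auto simp: sym_rels_def lin_diffD[OF lin_sy])
  qed
  moreover have "{p \<in> FV. sy p = 0} \<subseteq> ?K"
  proof
    fix p assume "p \<in> {p \<in> FV. sy p = 0}"
    then have p: "p \<in> FV" "ab (ex p) = 0" by (auto simp: sy_def)
    have em1: "em y - lift (ab y) \<in> ?K" if "y \<in> pm {w \<in> lists Z. length w = n}" for n y
    proof (rule sort_words[OF _ _ _ _ that, of "\<lambda>_. ?K"])
      fix u v a b assume uv: "set u \<subseteq> Z" "set v \<subseteq> Z" "a \<in> Z" "b \<in> Z"
      have "mon [e a, e b] - mon [e b, e a] \<in> sym_rels"
        using uv e_carrier unfolding sym_rels_def by blast
      then have "mon [e a, e b] - mon [e b, e a] \<in> ?K" using sym_quot(3) by blast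
      moreover have "mon (map e u) \<in> FV" "mon (map e v) \<in> FV"
        using uv by (simp_all add: in_lists_conv_set subset_iff e_carrier)
      ultimately have "mon (map e u) * (mon [e a, e b] - mon [e b, e a]) * mon (map e v) \<in> ?K"
        using fidealD(4,5)[OF K] by blast
      then show "em (mon (u @ [a, b] @ v)) - em (mon (u @ [b, a] @ v)) \<in> ?K"
        by (simp only: mon_append em_mult em_mon list.map mult.assoc left_diff_distrib right_diff_distrib)
    qed (fact fidealD[OF K])+
    have "em y - lift (ab y) \<in> ?K" if "y \<in> pm (lists Z)" for y
      using that
    proof (induction rule: pm_induct)
      case zero
      show ?case using fidealD(2)[OF K] by (simp add: lin_0 lin_em lin_ab lift_def lin_lext)
    next
      case (add p q)
      have "em (p + q) - lift (ab (p + q)) = (em p - lift (ab p)) + (em q - lift (ab q))"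
        by (simp add: lin_addD lin_em lin_ab lift_def lin_lext)
      then show ?case using fidealD(3)[OF K add(3,4)] by metis
    next
      case (mon c w)
      then show ?case by (intro em1[of _ "length w"] pm_sc) auto
    qed
    from this[OF ex_pm[OF p(1)]] have "em (ex p) \<in> ?K"
      using p by (simp add: lift_def lin_0[OF lin_lext])
    moreover have "p - em (ex p) \<in> ?K" using em_ex[OF p(1)] sym_quot(2) by auto
    ultimately show "p \<in> ?K" using fidealD(3)[OF K] by fastforce
  qed
  ultimately show ?thesis
    using sym_quot(1) by (simp add: sym_alg_def qS_def[abs_def] subset_antisym)
qed

end

section \<open>Enveloping algebras of associative algebras\<close>

text \<open>The maps induced on enveloping algebras are \<open>quot_map\<close> of
  \<open>quot_map\<close> of a map of words. This lemma evaluates one layer, and is applied first to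
  the tensor ideal and then to the Lie ideal; \<open>h\<close> is the map of words at the
  bottom.\<close>

lemma quot_map_presents:
  assumes A: "presents X KA A qA" and Q: "presents X K (quot A I) (\<lambda>p. I +>\<^bsub>A\<^esub> qA p)"
    and I: "ideal I A" and IK: "\<And>p. p \<in> pm (lists X) \<Longrightarrow> qA p \<in> I \<Longrightarrow> p \<in> K"
    and Q': "presents Y K' Q' (\<lambda>p. J +>\<^bsub>B\<^esub> qB p)"
    and h: "lin h" "\<And>p. p \<in> pm (lists X) \<Longrightarrow> h p \<in> pm (lists Y)"
    and g: "\<And>p. p \<in> pm (lists X) \<Longrightarrow> g (qA p) = qB (h p)"
    and hK: "\<And>p. p \<in> K \<Longrightarrow> h p \<in> K'" and p: "p \<in> pm (lists X)"
  shows "quot_map B J g (I +>\<^bsub>A\<^esub> qA p) = J +>\<^bsub>B\<^esub> qB (h p)"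
proof -
  interpret I: ideal I A by fact
  have "quot_map B J g (I +>\<^bsub>A\<^esub> qA p) = J +>\<^bsub>B\<^esub> g (qA p)"
  proof (rule quot_map_coset)
    show "abelian_group A" by (rule ring.is_abelian_group) (rule presentsD[OF A])
    show "additive_subgroup I A" by (rule I.additive_subgroup_axioms)
    show "qA p \<in> carrier A" using p by (simp add: presentsD(4)[OF A])
    fix x' assume x': "x' \<in> carrier A" "x' \<ominus>\<^bsub>A\<^esub> qA p \<in> I"
    then obtain p' where p': "p' \<in> pm (lists X)" "x' = qA p'" by (auto simp: presentsD(4)[OF A])
    then have "qA (p' - p) \<in> I" using x' p presents_minus[OF A] by simp
    then have "p' - p \<in> K" using p p' by (intro IK) auto
    then have "h p' - h p \<in> K'" using hK[of "p' - p"] by (simp add: lin_diffD[OF h(1)])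
    then show "J +>\<^bsub>B\<^esub> g x' = J +>\<^bsub>B\<^esub> g (qA p)"
      using presentsD(5)[OF Q', of "h p'" "h p"] p p' by (simp add: g h(2))
  qed
  then show ?thesis using g p by simp
qed

lemma deg_le_deg_lt: "p \<in> deg_le n \<Longrightarrow> n < m \<Longrightarrow> p \<in> deg_lt m"
  by (erule pm_mono) auto

lemma deg_le_mono: "p \<in> deg_le n \<Longrightarrow> n \<le> m \<Longrightarrow> p \<in> deg_le m"
  by (erule pm_mono) auto

lemma deg_lt_deg_le: "p \<in> deg_lt n \<Longrightarrow> n \<le> Suc m \<Longrightarrow> p \<in> deg_le m"
  by (erule pm_mono) auto

text \<open>The product \<open>mul\<close> on the Lie algebra is the additional structure that
  replaces an ordering of the basis. The commutator formula is written without subtraction, so that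
  additive maps such as \<open>li\<close> apply to it directly.\<close>

locale pbw = vbasis V Z e co
  for V :: "(complex, 'v) module" and Z :: "'z set" and e :: "'z \<Rightarrow> 'v" and co :: "'v \<Rightarrow> ('z \<Rightarrow>\<^sub>0 complex)" +
  fixes mul br :: "'v \<Rightarrow> 'v \<Rightarrow> 'v"
  assumes mul_closed: "x \<in> carrier V \<Longrightarrow> y \<in> carrier V \<Longrightarrow> mul x y \<in> carrier V"
    and br_closed: "x \<in> carrier V \<Longrightarrow> y \<in> carrier V \<Longrightarrow> br x y \<in> carrier V"
    and br_mul: "x \<in> carrier V \<Longrightarrow> y \<in> carrier V \<Longrightarrow> br x y \<oplus>\<^bsub>V\<^esub> mul y x = mul x y"
    and mul_assoc: "x \<in> carrier V \<Longrightarrow> y \<in> carrier V \<Longrightarrow> z \<in> carrier V \<Longrightarrow> mul (mul x y) z = mul x (mul y z)"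
    and mul_add_left: "x \<in> carrier V \<Longrightarrow> y \<in> carrier V \<Longrightarrow> z \<in> carrier V \<Longrightarrow>
      mul (x \<oplus>\<^bsub>V\<^esub> y) z = mul x z \<oplus>\<^bsub>V\<^esub> mul y z"
    and mul_add_right: "x \<in> carrier V \<Longrightarrow> y \<in> carrier V \<Longrightarrow> z \<in> carrier V \<Longrightarrow>
      mul x (y \<oplus>\<^bsub>V\<^esub> z) = mul x y \<oplus>\<^bsub>V\<^esub> mul x z"
    and mul_smult_left: "x \<in> carrier V \<Longrightarrow> y \<in> carrier V \<Longrightarrow> mul (c \<odot>\<^bsub>V\<^esub> x) y = c \<odot>\<^bsub>V\<^esub> mul x y"
    and mul_smult_right: "x \<in> carrier V \<Longrightarrow> y \<in> carrier V \<Longrightarrow> mul x (c \<odot>\<^bsub>V\<^esub> y) = c \<odot>\<^bsub>V\<^esub> mul x y"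
begin

definition li :: "'v \<Rightarrow> ('z multiset \<Rightarrow>\<^sub>0 complex)" where
  "li v = lext var (co v)"

lemma li_add: "v \<in> carrier V \<Longrightarrow> w \<in> carrier V \<Longrightarrow> li (v \<oplus>\<^bsub>V\<^esub> w) = li v + li w"
  by (simp add: li_def co_add lin_addD[OF lin_lext])

lemma li_smult: "v \<in> carrier V \<Longrightarrow> li (c \<odot>\<^bsub>V\<^esub> v) = sc c (li v)"
  by (simp add: li_def co_smult lin_scD[OF lin_lext])

lemma li_zero: "li \<zero>\<^bsub>V\<^esub> = 0"
  by (simp add: li_def co_zero lin_0[OF lin_lext])

lemma li_e: "z \<in> Z \<Longrightarrow> li (e z) = var z"
  by (simp add: li_def co_e)

lemma li_in: "co v \<in> pm C \<Longrightarrow> li v \<in> pm {{#z#} | z. z \<in> C}"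
  unfolding li_def by (rule lin_pm[OF lin_lext]) auto

lemma li_polys: "v \<in> carrier V \<Longrightarrow> li v \<in> polys Z"
  by (rule pm_mono[OF li_in[OF co_pm]]) auto

lemma li_deg_le: "v \<in> carrier V \<Longrightarrow> li v \<in> deg_le 1"
  by (rule pm_mono[OF li_in[OF co_pm]]) auto

lemma sy_word: "sy (mon w) = (\<Prod>v\<leftarrow>w. li v)"
proof -
  have "ab (lin_word v) = li v" for v
    unfolding lin_word_def li_def lin_comp_lext[OF lin_ab] by (simp add: ab_mon)
  moreover have "ab 1 = (1 :: 'z multiset \<Rightarrow>\<^sub>0 complex)"
    using ab_mon[of "[]"] by (simp add: mon_Nil)
  ultimately show ?thesis unfolding sy_def ex_mon
    by (induction w) (simp_all add: ab_mult)
qed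

text \<open>The derivations \<open>left_der A\<close> represent the Lie algebra, because left multiplication does, and
  \<open>left_der A (li B) - left_der B (li A) = li (br A B)\<close>.  Hence \<open>rho\<close> is a representation as well; since
  \<open>rho A\<close> is multiplication by \<open>A\<close> up to terms that do not raise the degree, applying it to \<open>1\<close>
  yields the Poincare-Birkhoff-Witt isomorphism \<open>symbol\<close>, without any ordering of the basis.\<close>

definition left_der :: "'v \<Rightarrow> ('z multiset \<Rightarrow>\<^sub>0 complex) \<Rightarrow> ('z multiset \<Rightarrow>\<^sub>0 complex)" where
  "left_der A = dv (\<lambda>z. li (mul A (e z)))"

definition rho :: "'v \<Rightarrow> ('z multiset \<Rightarrow>\<^sub>0 complex) \<Rightarrow> ('z multiset \<Rightarrow>\<^sub>0 complex)" where
  "rho A f = li A * f + left_der A f"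

lemma lin_left_der: "lin (left_der A)" unfolding left_der_def by (rule lin_dv)
lemma lin_rho: "lin (rho A)" unfolding rho_def[abs_def] by (intro lin_intros lin_left_der)
lemma left_der_mult: "left_der A (p * q) = left_der A p * q + p * left_der A q" unfolding left_der_def by (rule dv_mult)

lemma derivation_li:
  assumes "lin D" "A \<in> carrier V" "\<And>v w. v \<in> carrier V \<Longrightarrow> w \<in> carrier V \<Longrightarrow> f (v \<oplus>\<^bsub>V\<^esub> w) = f v \<oplus>\<^bsub>V\<^esub> f w"
    "\<And>c v. v \<in> carrier V \<Longrightarrow> f (c \<odot>\<^bsub>V\<^esub> v) = c \<odot>\<^bsub>V\<^esub> f v" "\<And>v. v \<in> carrier V \<Longrightarrow> f v \<in> carrier V"
    "\<And>z. z \<in> Z \<Longrightarrow> D (var z) = li (f (e z))"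
  shows "D (li A) = li (f A)"
  using assms(2)
proof (induction rule: carrier_induct)
  case zero
  interpret abelian_group V by (rule vspD[OF vec_space])
  have "f \<zero>\<^bsub>V\<^esub> \<oplus>\<^bsub>V\<^esub> f \<zero>\<^bsub>V\<^esub> = f \<zero>\<^bsub>V\<^esub>" using assms(3)[of "\<zero>\<^bsub>V\<^esub>" "\<zero>\<^bsub>V\<^esub>"] by simp
  then have "f \<zero>\<^bsub>V\<^esub> = \<zero>\<^bsub>V\<^esub>" using assms(5)[of "\<zero>\<^bsub>V\<^esub>"] by simp
  then show ?case by (simp add: li_zero lin_0[OF assms(1)])
qed (simp_all add: assms li_e li_add li_smult lin_addD[OF assms(1)] lin_scD[OF assms(1)])

lemma left_der_li: "A \<in> carrier V \<Longrightarrow> B \<in> carrier V \<Longrightarrow> left_der A (li B) = li (mul A B)"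
  by (rule derivation_li[OF lin_left_der])
    (simp_all add: mul_add_right mul_smult_right mul_closed, simp add: left_der_def)

lemma left_der_polys: "A \<in> carrier V \<Longrightarrow> f \<in> polys Z \<Longrightarrow> left_der A f \<in> polys Z"
  unfolding left_der_def by (rule dv_polys) (auto intro!: li_polys mul_closed e_carrier)

lemma rho_polys: "A \<in> carrier V \<Longrightarrow> f \<in> polys Z \<Longrightarrow> rho A f \<in> polys Z"
  unfolding rho_def by (intro pm_add polys_mult left_der_polys li_polys)

lemma rho_add:
  assumes "A \<in> carrier V" "B \<in> carrier V" "f \<in> polys Z"
  shows "rho (A \<oplus>\<^bsub>V\<^esub> B) f = rho A f + rho B f"
proof -
  have "left_der (A \<oplus>\<^bsub>V\<^esub> B) f = left_der A f + left_der B f"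
    by (rule derivation_eq[OF lin_left_der lin_plus[OF lin_left_der lin_left_der] assms(3)])
      (use assms in \<open>simp_all add: left_der_mult algebra_simps, simp add: left_der_def mul_add_left e_carrier li_add mul_closed\<close>)
  then show ?thesis using assms by (simp add: rho_def li_add algebra_simps)
qed

lemma rho_smult:
  assumes "A \<in> carrier V" "f \<in> polys Z"
  shows "rho (c \<odot>\<^bsub>V\<^esub> A) f = sc c (rho A f)"
proof -
  have "left_der (c \<odot>\<^bsub>V\<^esub> A) f = sc c (left_der A f)"
    by (rule derivation_eq[OF lin_left_der lin_scale[OF lin_left_der] assms(2)])
      (use assms in \<open>simp_all add: left_der_mult sc_add sc_mult_left sc_mult_right,
         simp add: left_der_def mul_smult_left e_carrier li_smult mul_closed\<close>)
  then show ?thesis using assms by (simp add: rho_def li_smult sc_mult_left sc_add)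
qed

lemma rho_br:
  assumes "A \<in> carrier V" "B \<in> carrier V" "f \<in> polys Z"
  shows "rho (br A B) f = rho A (rho B f) - rho B (rho A f)"
proof -
  have m: "li (mul (br A B) C) = li (mul A (mul B C)) - li (mul B (mul A C))" if "C \<in> carrier V" for C
  proof -
    have "mul (br A B) C \<oplus>\<^bsub>V\<^esub> mul (mul B A) C = mul (mul A B) C"
      using that assms by (simp add: br_closed mul_closed br_mul flip: mul_add_left)
    from arg_cong[OF this, of li] show ?thesis
      using that assms by (simp add: br_closed mul_closed mul_assoc li_add algebra_simps)
  qed
  have l: "li (br A B) = li (mul A B) - li (mul B A)"
    using arg_cong[OF br_mul[OF assms(1,2)], of li] assms by (simp add: br_closed mul_closed li_add algebra_simps)
  \<comment> \<open>A commutator of derivations is a derivation, so it suffices to compare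
    variables, where associativity of \<open>mul\<close> enters through \<open>m\<close>.\<close>
  have "left_der (br A B) f = left_der A (left_der B f) - left_der B (left_der A f)"
  proof (rule derivation_eq[OF lin_left_der lin_minus[OF lin_comp[OF lin_left_der lin_left_der] lin_comp[OF lin_left_der lin_left_der]] assms(3)])
    fix z assume z: "z \<in> Z"
    have v: "left_der C (var z) = li (mul C (e z))" for C by (simp add: left_der_def)
    show "left_der (br A B) (var z) = left_der A (left_der B (var z)) - left_der B (left_der A (var z))"
      unfolding v using z assms by (simp add: left_der_li mul_closed e_carrier m)
  qed (simp_all add: left_der_mult lin_addD[OF lin_left_der] algebra_simps)
  then show ?thesis using assms
    by (simp add: rho_def l left_der_mult lin_addD[OF lin_left_der] left_der_li algebra_simps)
qed

section \<open>The Poincare-Birkhoff-Witt isomorphism\<close>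

definition act :: "('v list \<Rightarrow>\<^sub>0 complex) \<Rightarrow> ('z multiset \<Rightarrow>\<^sub>0 complex) \<Rightarrow> ('z multiset \<Rightarrow>\<^sub>0 complex)" where
  "act p f = lext (\<lambda>w. foldr rho w f) p"

lemma lin_act_left: "lin (\<lambda>p. act p f)"
  unfolding act_def by (rule lin_lext)

lemma act_mon: "act (mon w) f = foldr rho w f"
  by (simp add: act_def)

lemma lin_foldr_rho: "lin (foldr rho w)"
  by (induction w) (auto simp: lin_id id_def lin_comp[OF lin_rho] comp_def)

lemma lin_act_right: "lin (act p)"
  unfolding act_def lext_def by (intro lin_intros lin_foldr_rho)

lemma act_mult: "act (p * q) f = act p (act q f)"
proof -
  have *: "act (mon u * q) f = act (mon u) (act q f)" for u
  proof (rule lin_eq[of "\<lambda>q. act (mon u * q) f" "\<lambda>q. act (mon u) (act q f)" q UNIV])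
    show "lin (\<lambda>q. act (mon u * q) f)" by (rule lin_comp[OF lin_act_left lin_mult_r[OF lin_id]])
    show "lin (\<lambda>q. act (mon u) (act q f))" by (rule lin_comp[OF lin_act_right lin_act_left])
    show "q \<in> pm UNIV" by simp
    show "act (mon u * mon w) f = act (mon u) (act (mon w) f)" for w
      unfolding mon_append[symmetric] act_mon by simp
  qed
  show ?thesis
  proof (rule lin_eq[of "\<lambda>p. act (p * q) f" "\<lambda>p. act p (act q f)" p UNIV])
    show "lin (\<lambda>p. act (p * q) f)" by (rule lin_comp[OF lin_act_left lin_mult_l[OF lin_id]])
    show "lin (\<lambda>p. act p (act q f))" by (rule lin_act_left)
    show "p \<in> pm UNIV" by simp
  qed (rule *)
qed

lemma act_polys: "p \<in> FV \<Longrightarrow> f \<in> polys Z \<Longrightarrow> act p f \<in> polys Z"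
proof (rule lin_pm[OF lin_act_left])
  fix w assume "w \<in> lists (carrier V)" "f \<in> polys Z"
  then show "act (mon w) f \<in> polys Z"
    unfolding act_mon by (induction w) (auto intro: rho_polys)
qed

definition pre_symbol :: "('v list \<Rightarrow>\<^sub>0 complex) \<Rightarrow> ('z multiset \<Rightarrow>\<^sub>0 complex)" where
  "pre_symbol p = act p 1"

lemma lin_pre_symbol: "lin pre_symbol"
  unfolding pre_symbol_def[abs_def] by (rule lin_act_left)

lemma pre_symbol_polys: "p \<in> FV \<Longrightarrow> pre_symbol p \<in> polys Z"
  unfolding pre_symbol_def by (rule act_polys) auto

abbreviation "FVl n \<equiv> pm {w \<in> lists (carrier V). length w \<le> n}"
abbreviation "FVs n \<equiv> pm {w \<in> lists (carrier V). length w < n}"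

lemma FVl_FV: "p \<in> FVl n \<Longrightarrow> p \<in> FV"
  by (erule pm_mono) auto

lemma left_der_deg: "A \<in> carrier V \<Longrightarrow> f \<in> polys Z \<Longrightarrow> f \<in> deg_le n \<Longrightarrow> left_der A f \<in> deg_le n"
proof -
  assume A: "A \<in> carrier V" and f: "f \<in> polys Z" "f \<in> deg_le n"
  have "f \<in> pm {m. set_mset m \<subseteq> Z \<and> size m \<le> n}"
    using f by (auto simp: pm_def)
  then show "left_der A f \<in> deg_le n"
  proof (rule lin_pm[OF lin_left_der])
    fix m assume m: "m \<in> {m. set_mset m \<subseteq> Z \<and> size m \<le> n}"
    have "mon m \<in> pm {m'. m' = m}" by simp
    have "(\<Sum>z\<in>#k. li (mul A (e z)) * mon (m - {#z#})) \<in> deg_le n" if "k \<subseteq># m" for k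
      using that
    proof (induction k)
      case (add z k)
      then have z: "z \<in># m" by (meson mset_subset_eq_insertD)
      then have zZ: "z \<in> Z" using m by auto
      have "li (mul A (e z)) * mon (m - {#z#}) \<in> deg_le (1 + size (m - {#z#}))"
        by (intro deg_le_mult li_deg_le mul_closed A e_carrier zZ) auto
      moreover have "1 + size (m - {#z#}) \<le> n"
        using z m by (simp add: size_Diff_singleton) (metis One_nat_def Suc_pred nonempty_has_size empty_not_add_mset multi_member_split)
      ultimately have "li (mul A (e z)) * mon (m - {#z#}) \<in> deg_le n"
        by (elim pm_mono) auto
      with add show ?case by (auto intro!: pm_add dest: mset_subset_eq_insertD)
    qed simp
    then show "left_der A (mon m) \<in> deg_le n" by (simp add: left_der_def dv_mon)
  qed
qed

text \<open>Each letter contributes the factor \<open>li A\<close> and a derivation term that does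
  not raise the degree. The two claims are proved together, because the degree bound for the rest of
  the word controls the derivation term.\<close>

lemma pre_symbol_word_top:
  assumes "w \<in> lists (carrier V)"
  shows "pre_symbol (mon w) - sy (mon w) \<in> deg_lt (length w) \<and> pre_symbol (mon w) \<in> deg_le (length w)"
  using assms
proof (induction w)
  case Nil
  show ?case by (simp add: pre_symbol_def act_mon sy_word)
next
  case (Cons A w)
  have p: "pre_symbol (mon w) \<in> polys Z" using Cons by (intro pre_symbol_polys) auto
  have s: "pre_symbol (mon (A # w)) = li A * pre_symbol (mon w) + left_der A (pre_symbol (mon w))"
    by (simp add: pre_symbol_def act_mon rho_def)
  have d: "left_der A (pre_symbol (mon w)) \<in> deg_le (length w)" using Cons p by (intro left_der_deg) auto
  have "li A * (pre_symbol (mon w) - sy (mon w)) \<in> deg_lt (length (A # w))"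
    using li_deg_le[OF Cons(1)] Cons(3) by (intro pm_mult[of _ "{m. size m \<le> 1}" _ "{m. size m < length w}"]) auto
  then have "li A * (pre_symbol (mon w) - sy (mon w)) + left_der A (pre_symbol (mon w)) \<in> deg_lt (length (A # w))"
    by (rule pm_add) (rule deg_le_deg_lt[OF d], simp)
  moreover have "pre_symbol (mon (A # w)) - sy (mon (A # w)) = li A * (pre_symbol (mon w) - sy (mon w)) + left_der A (pre_symbol (mon w))"
    by (simp add: s sy_word algebra_simps)
  moreover have "li A * pre_symbol (mon w) \<in> deg_le (length (A # w))"
    using deg_le_mult[OF li_deg_le[OF Cons(1)], of "pre_symbol (mon w)" "length w"] Cons(3) by simp
  moreover have "left_der A (pre_symbol (mon w)) \<in> deg_le (length (A # w))" by (rule deg_le_mono[OF d]) simp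
  ultimately show ?case unfolding s by (metis pm_add)
qed

lemma pre_symbol_top: "p \<in> FVl n \<Longrightarrow> pre_symbol p - sy p \<in> deg_lt n"
  by (erule lin_pm[OF lin_minus[OF lin_pre_symbol lin_sy]], rule pm_mono[OF conjunct1[OF pre_symbol_word_top]]) auto

lemma pre_symbol_deg_le: "p \<in> FVl n \<Longrightarrow> pre_symbol p \<in> deg_le n"
  by (erule lin_pm[OF lin_pre_symbol], rule pm_mono[OF conjunct2[OF pre_symbol_word_top]]) auto

lemma hom_part_pre_symbol: "p \<in> FVl n \<Longrightarrow> hom_part n (pre_symbol p) = hom_part n (sy p)"
  using hom_part_deg_lt[OF pre_symbol_top[of p n]] by (simp add: lin_diffD[OF lin_hom_part])

lemma sy_deg_le: "p \<in> FVl n \<Longrightarrow> sy p \<in> deg_le n"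
  using pm_diff[OF pre_symbol_deg_le deg_lt_deg_le[OF pre_symbol_top, of p n n], of p] by simp

lemma ex_FVl: "p \<in> FVl n \<Longrightarrow> ex p \<in> pm {w \<in> lists Z. length w \<le> n}"
  by (erule lin_pm[OF lin_ex], rule pm_mono[OF ex_length]) auto

lemma em_length: "em p \<in> pm {w \<in> lists (carrier V). Q (length w)}" if "p \<in> pm {w \<in> lists Z. Q (length w)}"
  using that by (rule lin_pm[OF lin_em]) (auto simp: em_mon e_carrier)

definition lie_rels :: "('v list \<Rightarrow>\<^sub>0 complex) set" where
  "lie_rels = {mon [x, y] - mon [y, x] - mon [br x y] | x y. x \<in> carrier V \<and> y \<in> carrier V}"

definition qU :: "('v list \<Rightarrow>\<^sub>0 complex) \<Rightarrow> ('v list \<Rightarrow>\<^sub>0 complex) set set" where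
  "qU p = lie_ideal V br +>\<^bsub>tensor_alg V\<^esub> qT p"

lemma lie_rels_sub: "lie_rels \<subseteq> FV"
  by (auto simp: lie_rels_def br_closed intro!: pm_diff)

lemma lie_ideal_eq': "lie_ideal V br = genideal (tensor_alg V) (qT ` lie_rels)"
proof -
  have "tens V [x, y] \<ominus>\<^bsub>tensor_alg V\<^esub> tens V [y, x] \<ominus>\<^bsub>tensor_alg V\<^esub> tens V [br x y]
      = qT (mon [x, y] - mon [y, x] - mon [br x y])"
    if "x \<in> carrier V" "y \<in> carrier V" for x y
    using presents_minus[OF presents_tensor, of "mon [x, y]" "mon [y, x]"] that
      presents_minus[OF presents_tensor, of "mon [x, y] - mon [y, x]" "mon [br x y]"]
    by (simp add: qT_def tens_def br_closed pm_diff)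
  then have "{tens V [x, y] \<ominus>\<^bsub>tensor_alg V\<^esub> tens V [y, x] \<ominus>\<^bsub>tensor_alg V\<^esub> tens V [br x y] | x y.
      x \<in> carrier V \<and> y \<in> carrier V} = qT ` lie_rels"
    unfolding lie_rels_def image_def by (auto simp: qT_def) metis+
  then show ?thesis by (simp add: lie_ideal_def)
qed

lemmas lie_quot = presents_quot[OF presents_tensor lie_rels_sub lie_ideal_eq']

text \<open>For the elements with \<open>act p 1 = 0\<close> only closure under left multiplication
  is evident. The annihilator \<open>?W\<close> of the whole module is a two-sided ideal, contains
  the relations and consists of elements with symbol 0.\<close>

lemma lie_kernel_sub: "{p \<in> FV. qT p \<in> lie_ideal V br} \<subseteq> {p \<in> FV. pre_symbol p = 0}"
proof -
  let ?W = "{p \<in> FV. \<forall>f\<in>polys Z. act p f = 0}"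
  have "{p \<in> FV. qT p \<in> lie_ideal V br} \<subseteq> ?W"
  proof (rule lie_quot(4))
    show W: "fideal (carrier V) ?W"
      unfolding fideal_def
      by (auto simp: lin_0[OF lin_act_left] lin_addD[OF lin_act_left] act_mult lin_0[OF lin_act_right]
          lists_mult act_polys)
    show "tensor_ideal V \<subseteq> ?W"
    proof (rule tensor_ideal_least[OF W], safe)
      fix p assume p: "p \<in> tensor_rels"
      then show "p \<in> FV" using tensor_rels_sub by auto
      fix f assume f: "f \<in> polys Z"
      show "act p f = 0" using p f
        by (auto simp: tensor_rels_def lin_diffD[OF lin_act_left] lin_scD[OF lin_act_left] act_mon
            rho_add rho_smult simp del: Poly_Mapping.map_single)
    qed
    show "lie_rels \<subseteq> ?W"
    proof safe
      fix p assume p: "p \<in> lie_rels"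
      then show "p \<in> FV" using lie_rels_sub by blast
      fix f assume f: "f \<in> polys Z"
      obtain x y where xy: "x \<in> carrier V" "y \<in> carrier V" "p = mon [x, y] - mon [y, x] - mon [br x y]"
        using p unfolding lie_rels_def by blast
      show "act p f = 0"
        unfolding xy(3) lin_diffD[OF lin_act_left] act_mon using rho_br[OF xy(1,2) f] by simp
    qed
  qed
  then show ?thesis by (auto simp: pre_symbol_def)
qed

text \<open>Induction on the degree. If the symbol vanishes, so does the abelianisation of the top
  component; sorting its words rewrites this component by shorter words modulo the ideal, because
  each exchange of neighbours costs one bracket. The shorter remainder still has symbol 0.\<close>

lemma pre_symbol_kernel_sub:
  assumes "p \<in> FVs n" "pre_symbol p = 0" shows "p \<in> {p \<in> FV. qT p \<in> lie_ideal V br}" (is "_ \<in> ?K")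
  using assms
proof (induction n arbitrary: p)
  case 0
  have "p = 0" using 0 by (auto simp: pm_def)
  then show ?case using fidealD(2)[OF presentsD(2)[OF lie_quot(1)]] by simp
next
  case (Suc n)
  define KK where "KK = ?K"
  have K: "fideal (carrier V) KK" unfolding KK_def by (rule presentsD(2)[OF lie_quot(1)])
  note K = fidealD[OF K]
  have p: "p \<in> FVl n" using Suc(2) by (simp add: less_Suc_eq_le)
  \<comment> \<open>The sum of the ideal and of the words of length below \<open>n\<close>;
    exchanging neighbours in a word of length \<open>n\<close> changes it by an element of this
    space.\<close>
  define W where "W n = {p. \<exists>a\<in>KK. \<exists>b\<in>FVs n. p = a + b}" for n
  have WI: "a + b \<in> W n" if "a \<in> KK" "b \<in> FVs n" for a b n
    unfolding W_def using that by blast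
  have WE: "\<exists>a\<in>KK. \<exists>b\<in>FVs n. p = a + b" if "p \<in> W n" for p n
    using that unfolding W_def by (rule CollectD)
  let ?y = "filter_mon (\<lambda>w. length w = n) (ex p)"
  have y: "?y \<in> pm {w \<in> lists Z. length w = n}"
    using ex_pm[OF FVl_FV[OF p]] by (auto simp: pm_iff lookup_filter_mon)
  have y': "ex p - ?y \<in> pm {w \<in> lists Z. length w < n}"
    using ex_FVl[OF p] by (auto simp: pm_iff lookup_filter_mon lookup_minus)
  have "em ?y - lift (ab ?y) \<in> W n"
  proof (rule sort_words[OF _ _ _ _ y, of W])
    show "0 \<in> W n" for n using WI[OF K(2) pm_zero] by simp
    show "p + q \<in> W n" if pq: "p \<in> W n" "q \<in> W n" for p q n
    proof -
      from WE[OF pq(1)] obtain a b where 1: "a \<in> KK" "b \<in> FVs n" "p = a + b" by auto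
      from WE[OF pq(2)] obtain a' b' where 2: "a' \<in> KK" "b' \<in> FVs n" "q = a' + b'" by auto
      have "p + q = (a + a') + (b + b')" using 1 2 by (simp add: algebra_simps)
      then show ?thesis using WI[OF K(3)[OF 1(1) 2(1)] pm_add[OF 1(2) 2(2)]] by metis
    qed
    show "sc c p \<in> W n" if pW: "p \<in> W n" for p n c
    proof -
      from WE[OF pW] obtain a b where 1: "a \<in> KK" "b \<in> FVs n" "p = a + b" by auto
      show ?thesis unfolding 1(3) sc_add by (rule WI[OF K(6)[OF 1(1)] pm_sc[OF 1(2)]])
    qed
    fix u v a b assume uv: "set u \<subseteq> Z" "set v \<subseteq> Z" "a \<in> Z" "b \<in> Z"
    have "mon [e a, e b] - mon [e b, e a] - mon [br (e a) (e b)] \<in> lie_rels"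
      using uv e_carrier unfolding lie_rels_def by blast
    then have r: "mon [e a, e b] - mon [e b, e a] - mon [br (e a) (e b)] \<in> KK"
      using lie_quot(3) unfolding KK_def by blast
    have uvF: "mon (map e u) \<in> FV" "mon (map e v) \<in> FV"
      using uv by (simp_all add: in_lists_conv_set subset_iff e_carrier)
    have 1: "mon (map e u) * (mon [e a, e b] - mon [e b, e a] - mon [br (e a) (e b)]) * mon (map e v) \<in> KK"
      by (intro K(4) K(5) r uvF)
    have 2: "mon (map e u @ [br (e a) (e b)] @ map e v) \<in> FVs (length u + 2 + length v)"
      using uv by (auto simp: in_lists_conv_set subset_iff e_carrier br_closed)
    have "em (mon (u @ [a, b] @ v)) - em (mon (u @ [b, a] @ v)) =
       mon (map e u) * (mon [e a, e b] - mon [e b, e a] - mon [br (e a) (e b)]) * mon (map e v) +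
       mon (map e u @ [br (e a) (e b)] @ map e v)"
      by (simp only: mon_append em_mult em_mon list.map mult.assoc left_diff_distrib right_diff_distrib) simp
    then show "em (mon (u @ [a, b] @ v)) - em (mon (u @ [b, a] @ v)) \<in> W (length u + 2 + length v)"
      using WI[OF 1 2] by metis
  qed
  \<comment> \<open>\<open>ab ?y\<close> is the component of degree \<open>n\<close> of
    \<open>sy p\<close>, which agrees with that of the vanishing symbol.\<close>
  moreover have "ab ?y = 0"
  proof -
    have "ab (filter_mon (\<lambda>w. length w = n) x) = hom_part n (ab x)" for x :: "'z list \<Rightarrow>\<^sub>0 complex"
      by (rule lin_eq[OF lin_comp[OF lin_ab lin_filter_mon] lin_comp[OF lin_hom_part lin_ab], of x UNIV])
        (auto simp: filter_mon_mon ab_mon hom_part_mon lin_0[OF lin_ab])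
    then have "ab ?y = hom_part n (sy p)" by (simp add: sy_def)
    then show ?thesis using hom_part_pre_symbol[OF p] Suc(3) by (simp add: lin_0[OF lin_hom_part])
  qed
  ultimately have "em ?y \<in> W n" by (simp add: lift_def lin_0[OF lin_lext])
  from WE[OF this] obtain a b where ab: "a \<in> KK" "b \<in> FVs n" "em ?y = a + b" by auto
  define b' where "b' = b + em (ex p - ?y)"
  have b': "b' \<in> FVs n"
    unfolding b'_def using ab(2) em_length[of _ "\<lambda>k. k < n", OF y'] by auto
  have pe: "p = (p - em (ex p)) + a + b'"
    by (simp add: b'_def lin_diffD[OF lin_em] ab(3))
  have "p - em (ex p) \<in> KK" using em_ex[OF FVl_FV[OF p]] lie_quot(2) unfolding KK_def by blast
  then have ka: "p - em (ex p) + a \<in> KK" by (rule K(3)) fact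
  then have "pre_symbol (p - em (ex p) + a) = 0" using lie_kernel_sub unfolding KK_def by blast
  then have "pre_symbol b' = 0"
    using Suc(3) lin_addD[OF lin_pre_symbol, of "p - em (ex p) + a" b'] pe by simp
  from Suc(1)[OF b' this] have "b' \<in> KK" unfolding KK_def .
  from K(3)[OF ka this] pe have "p \<in> KK" by simp
  then show ?case unfolding KK_def .
qed

lemma FV_bounded: "p \<in> FV \<Longrightarrow> \<exists>n. p \<in> FVs n"
proof -
  assume p: "p \<in> FV"
  have "finite (length ` keys p)" by simp
  then obtain n where "\<forall>w\<in>keys p. length w < n"
    by (metis finite_imageI finite_nat_set_iff_bounded image_eqI)
  then show "\<exists>n. p \<in> FVs n" using p by (auto simp: pm_def)
qed

lemma presents_uea: "presents (carrier V) {p \<in> FV. pre_symbol p = 0} (uea V br) qU"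
proof -
  have "{p \<in> FV. pre_symbol p = 0} \<subseteq> {p \<in> FV. qT p \<in> lie_ideal V br}"
    using pre_symbol_kernel_sub FV_bounded by blast
  then show ?thesis
    using lie_quot(1) lie_kernel_sub by (simp add: uea_def qU_def[abs_def] subset_antisym)
qed

lemma lie_in: "p \<in> FV \<Longrightarrow> qT p \<in> lie_ideal V br \<Longrightarrow> p \<in> {p \<in> FV. pre_symbol p = 0}"
  using lie_kernel_sub by auto

abbreviation "U \<equiv> uea V br"

text \<open>A linear isomorphism of the enveloping algebra onto the polynomial ring over
  \<open>Z\<close>, which matches the canonical filtration with the filtration by degree. It is
  multiplicative in top degree only, see \<open>symbol_mult_top\<close>.\<close>

definition symbol :: "('v list \<Rightarrow>\<^sub>0 complex) set set \<Rightarrow> ('z multiset \<Rightarrow>\<^sub>0 complex)" where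
  "symbol = ind qU (carrier V) pre_symbol"

lemma symbol_qU: "p \<in> FV \<Longrightarrow> symbol (qU p) = pre_symbol p"
  unfolding symbol_def by (rule ind_eq[OF presents_uea lin_pre_symbol]) auto

lemma U_carrier: "carrier U = qU ` FV"
  by (rule presentsD(4)[OF presents_uea])

lemma U_ring: "ring U"
  by (rule presentsD(3)[OF presents_uea])

lemma symbol_polys: "u \<in> carrier U \<Longrightarrow> symbol u \<in> polys Z"
  by (auto simp: U_carrier symbol_qU pre_symbol_polys)

lemma symbol_inj: "u \<in> carrier U \<Longrightarrow> v \<in> carrier U \<Longrightarrow> symbol u = symbol v \<Longrightarrow> u = v"
proof -
  assume a: "u \<in> carrier U" "v \<in> carrier U" "symbol u = symbol v"
  then obtain p q where pq: "p \<in> FV" "q \<in> FV" "u = qU p" "v = qU q" by (auto simp: U_carrier)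
  then show "u = v" using a(3) presentsD(5)[OF presents_uea, of p q]
    by (simp add: symbol_qU lin_diffD[OF lin_pre_symbol] pm_diff)
qed

lemma symbol_add: "u \<in> carrier U \<Longrightarrow> v \<in> carrier U \<Longrightarrow> symbol (u \<oplus>\<^bsub>U\<^esub> v) = symbol u + symbol v"
  by (auto simp: U_carrier symbol_qU presentsD(6)[OF presents_uea] lin_addD[OF lin_pre_symbol] pm_add)

lemma symbol_smult: "u \<in> carrier U \<Longrightarrow> symbol (c \<odot>\<^bsub>U\<^esub> u) = sc c (symbol u)"
  by (auto simp: U_carrier symbol_qU presentsD(8)[OF presents_uea] lin_scD[OF lin_pre_symbol] pm_sc)

lemma one_FV: "1 \<in> FV"
  by (simp add: zero_list_def)

lemma symbol_one: "symbol \<one>\<^bsub>U\<^esub> = 1"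
  using one_FV act_mon[of "[]" 1]
  by (simp add: presentsD(9)[OF presents_uea] symbol_qU pre_symbol_def mon_Nil)

lemma symbol_zero: "symbol \<zero>\<^bsub>U\<^esub> = 0"
  by (simp add: presentsD(10)[OF presents_uea] symbol_qU lin_0[OF lin_pre_symbol])

lemma symbol_minus: "u \<in> carrier U \<Longrightarrow> v \<in> carrier U \<Longrightarrow> symbol (u \<ominus>\<^bsub>U\<^esub> v) = symbol u - symbol v"
  by (auto simp: U_carrier symbol_qU presents_minus[OF presents_uea] lin_diffD[OF lin_pre_symbol] pm_diff)

text \<open>\<open>lift\<close> of the leading component has the right leading term, and the
  difference has lower degree. The bound on word lengths is kept because it identifies the
  filtration in \<open>uea_filt_iff\<close>.\<close>

lemma pre_symbol_onto:
  assumes "f \<in> polys Z" "f \<in> deg_lt n" shows "\<exists>p\<in>FVs n. pre_symbol p = f"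
  using assms
proof (induction n arbitrary: f)
  case 0
  then have "f = 0" by (auto simp: pm_def)
  then show ?case using lin_0[OF lin_pre_symbol] by (intro bexI[of _ 0]) auto
next
  case (Suc n)
  let ?p = "lift (hom_part n f)"
  have h: "hom_part n f \<in> polys Z" using Suc(2) unfolding hom_part_def by (rule filter_mon_in_pm)
  have "hom_part n f \<in> pm {m. set_mset m \<subseteq> Z \<and> size m = n}"
    using h hom_part_homog[of n f] by (auto simp: pm_def)
  then have p: "?p \<in> FVl n"
    unfolding lift_def
  proof (rule lin_pm[OF lin_lext])
    fix m :: "'z multiset" assume m: "m \<in> {m. set_mset m \<subseteq> Z \<and> size m = n}"
    have "length (SOME w. mset w = m) = size m" by (metis mset_some size_mset)
    moreover have "(SOME w. mset w = m) \<in> lists Z" using m by (simp add: in_lists_conv_set set_some subset_iff)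
    ultimately show "lext (\<lambda>m. em (mon (SOME w. mset w = m))) (mon m) \<in> FVl n"
      using m by (auto simp: em_mon e_carrier)
  qed
  have d: "f - pre_symbol ?p \<in> deg_lt n"
  proof -
    have "f - hom_part n f \<in> deg_lt n" using Suc(3) by (intro hom_part_diff_deg_lt) (simp add: less_Suc_eq_le)
    moreover have "pre_symbol ?p - hom_part n f \<in> deg_lt n" using pre_symbol_top[OF p] sy_lift[OF h] by simp
    ultimately have "(f - hom_part n f) - (pre_symbol ?p - hom_part n f) \<in> deg_lt n" by (rule pm_diff)
    then show ?thesis by simp
  qed
  have "f - pre_symbol ?p \<in> polys Z" using Suc(2) pre_symbol_polys[OF FVl_FV[OF p]] by auto
  from Suc(1)[OF this d] obtain p' where p': "p' \<in> FVs n" "pre_symbol p' = f - pre_symbol ?p" by blast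
  have "?p + p' \<in> FVs (Suc n)" 
    by (rule pm_add) (rule pm_mono[OF p], force, rule pm_mono[OF p'(1)], force)
  moreover have "pre_symbol (?p + p') = f" using p' by (simp add: lin_addD[OF lin_pre_symbol])
  ultimately show ?case by blast
qed

lemma symbol_onto: assumes "f \<in> polys Z" shows "\<exists>u\<in>carrier U. symbol u = f"
proof -
  have "finite (size ` keys f)" by simp
  then obtain n where "\<forall>m\<in>keys f. size m < n"
    by (metis finite_imageI finite_nat_set_iff_bounded image_eqI)
  then have "f \<in> deg_lt n" by (auto simp: pm_def)
  from pre_symbol_onto[OF assms this] obtain p where "p \<in> FVs n" "pre_symbol p = f" by blast
  moreover from this(1) have "p \<in> FV" by (elim pm_mono) auto
  ultimately show ?thesis using symbol_qU U_carrier by auto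
qed

lemma uea_filt_eq: "uea_filt V br k = qU ` FVl k"
proof -
  have "{uea_mon V br w | w. length w \<le> k \<and> set w \<subseteq> carrier V} = qU ` mon ` {w \<in> lists (carrier V). length w \<le> k}"
    by (auto simp: uea_mon_def qU_def qT_def tens_def image_image in_lists_conv_set subset_iff)
  then show ?thesis
    unfolding uea_filt_def by (simp only:) (rule lin_span_presents[OF presents_uea], blast)
qed

text \<open>From right to left, surjectivity with a degree bound produces a short representative
  with the same symbol, and injectivity identifies its class with \<open>u\<close>.\<close>

lemma uea_filt_iff: "u \<in> uea_filt V br k \<longleftrightarrow> u \<in> carrier U \<and> symbol u \<in> deg_le k"
proof
  assume "u \<in> uea_filt V br k"
  then show "u \<in> carrier U \<and> symbol u \<in> deg_le k"
    using FVl_FV by (auto simp: uea_filt_eq U_carrier symbol_qU pre_symbol_deg_le)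
next
  assume u: "u \<in> carrier U \<and> symbol u \<in> deg_le k"
  then have "symbol u \<in> deg_lt (Suc k)" by (simp add: less_Suc_eq_le)
  from pre_symbol_onto[OF symbol_polys this] u obtain p where p: "p \<in> FVs (Suc k)" "pre_symbol p = symbol u" by auto
  have pl: "p \<in> FVl k" using p by (simp add: less_Suc_eq_le)
  then have "u = qU p" using u p FVl_FV[OF pl] by (intro symbol_inj) (auto simp: U_carrier symbol_qU)
  then show "u \<in> uea_filt V br k" using pl by (auto simp: uea_filt_eq)
qed

text \<open>In top degree the symbol agrees with \<open>sy\<close>, and \<open>sy\<close> is
  multiplicative.\<close>

lemma symbol_mult_top:
  assumes "u \<in> uea_filt V br i" "v \<in> uea_filt V br j"
  shows "u \<otimes>\<^bsub>U\<^esub> v \<in> uea_filt V br (i + j)"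
    "hom_part (i + j) (symbol (u \<otimes>\<^bsub>U\<^esub> v)) = hom_part i (symbol u) * hom_part j (symbol v)"
proof -
  obtain p q where pq: "p \<in> FVl i" "q \<in> FVl j" "u = qU p" "v = qU q"
    using assms by (auto simp: uea_filt_eq)
  have pq': "p * q \<in> FVl (i + j)"
    using pq(1,2) by (rule pm_mult) (auto simp: plus_list_def)
  have uv: "u \<otimes>\<^bsub>U\<^esub> v = qU (p * q)"
    using pq FVl_FV by (simp add: presentsD(7)[OF presents_uea])
  then show "u \<otimes>\<^bsub>U\<^esub> v \<in> uea_filt V br (i + j)" using pq' by (auto simp: uea_filt_eq)
  show "hom_part (i + j) (symbol (u \<otimes>\<^bsub>U\<^esub> v)) = hom_part i (symbol u) * hom_part j (symbol v)"
    unfolding uv unfolding pq(3,4)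
    using hom_part_mult[OF sy_deg_le[OF pq(1)] sy_deg_le[OF pq(2)]] FVl_FV[OF pq'] FVl_FV[OF pq(1)] FVl_FV[OF pq(2)]
    by (simp add: symbol_qU hom_part_pre_symbol[OF pq'] hom_part_pre_symbol[OF pq(1)] hom_part_pre_symbol[OF pq(2)] sy_mult)
qed

end

section \<open>Derivations and one-sided ideals under the symbol map\<close>

lemma pm_sum_mset: "(\<And>z. z \<in># n \<Longrightarrow> h z \<in> pm T) \<Longrightarrow> (\<Sum>z\<in>#n. h z) \<in> pm T"
  by (induction n) (auto intro!: pm_add)

text \<open>The ideal generated by the variables in \<open>C\<close>, which is spanned by
  monomials.\<close>

abbreviation varideal :: "'z set \<Rightarrow> ('z multiset \<Rightarrow>\<^sub>0 complex) set" where
  "varideal C \<equiv> pm {m. set_mset m \<inter> C \<noteq> {}}"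

lemma varideal_mult: "p \<in> varideal C \<Longrightarrow> p * q \<in> varideal C"
  by (rule pm_mult[of _ "{m. set_mset m \<inter> C \<noteq> {}}" _ UNIV]) auto

lemma varideal_mult_right: "q \<in> varideal C \<Longrightarrow> p * q \<in> varideal C"
  by (metis varideal_mult mult.commute)

lemma varideal_linear: "p \<in> pm {{#z#} | z. z \<in> C} \<Longrightarrow> p \<in> varideal C"
  by (erule pm_mono) auto

lemma pm_Int: "p \<in> pm S \<Longrightarrow> p \<in> pm T \<Longrightarrow> p \<in> pm (S \<inter> T)"
  by (auto simp: pm_def)

text \<open>Either the variable that is replaced belongs to \<open>C\<close>, and the hypothesis on
  \<open>g\<close> applies, or a variable from \<open>C\<close> survives in the rest of the
  monomial.\<close>

lemma dv_varideal:
  assumes "p \<in> polys Z" "p \<in> varideal C" "\<And>z. z \<in> Z \<Longrightarrow> z \<in> C \<Longrightarrow> g z \<in> varideal C"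
  shows "dv g p \<in> varideal C"
proof (rule lin_pm[OF lin_dv pm_Int[OF assms(1,2)]])
  fix m assume m: "m \<in> {m. set_mset m \<subseteq> Z} \<inter> {m. set_mset m \<inter> C \<noteq> {}}"
  show "dv g (mon m) \<in> varideal C"
    unfolding dv_mon
  proof (rule pm_sum_mset)
    fix z assume z: "z \<in># m"
    show "g z * mon (m - {#z#}) \<in> varideal C"
    proof (cases "z \<in> C")
      case True
      then show ?thesis using z m by (intro varideal_mult assms(3)) auto
    next
      case False
      obtain y where "y \<in># m" "y \<in> C" using m by blast
      then have "y \<in># m - {#z#}" using False by (auto simp: in_diff_count)
      then have "set_mset (m - {#z#}) \<inter> C \<noteq> {}" using \<open>y \<in> C\<close> by blast
      then show ?thesis by (intro varideal_mult_right) simp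
    qed
  qed
qed

context pbw
begin

definition word_der :: "('v \<Rightarrow> 'v) \<Rightarrow> ('v list \<Rightarrow>\<^sub>0 complex) \<Rightarrow> ('v list \<Rightarrow>\<^sub>0 complex)" where
  "word_der f = lext (\<lambda>w. \<Sum>i<length w. mon (w[i := f (w ! i)]))"

lemma lin_word_der: "lin (word_der f)" unfolding word_der_def by (rule lin_lext)

lemma word_der_Cons: "word_der f (mon (A # w)) = mon [f A] * mon w + mon [A] * word_der f (mon w)"
proof -
  have "word_der f (mon (A # w)) = mon (f A # w) + (\<Sum>i<length w. mon (A # w[i := f (w ! i)]))"
    by (simp add: word_der_def sum.lessThan_Suc_shift del: sum.lessThan_Suc)
  also have "\<dots> = mon [f A] * mon w + mon [A] * word_der f (mon w)"
    by (simp add: word_der_def sum_distrib_left mon_Cons[of _ "_[_ := _]"] mon_Cons[of "f A" w])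
  finally show ?thesis .
qed

lemma word_der_one: "word_der f 1 = 0"
  using lext_mon[of "\<lambda>w. \<Sum>i<length w. mon (w[i := f (w ! i)])" "[]"] by (simp add: word_der_def mon_Nil)

lemma word_der_mult: "word_der f (p * q) = word_der f p * q + p * word_der f q"
proof -
  have 0: "word_der f (mon u * mon v) = word_der f (mon u) * mon v + mon u * word_der f (mon v)" for u v
  proof (induction u)
    case (Cons A u)
    have "word_der f (mon (A # u) * mon v) = word_der f (mon (A # u @ v))"
      using mon_append[of "A # u" v] by simp
    also have "\<dots> = mon [f A] * (mon u * mon v) + mon [A] * word_der f (mon u * mon v)"
      by (simp only: word_der_Cons mon_append)
    finally show ?case
      unfolding Cons word_der_Cons[of f A u] by (simp only: mon_Cons[of A u]) (simp add: algebra_simps)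
  qed (simp add: mon_Nil word_der_one)
  have 1: "word_der f (mon u * q) = word_der f (mon u) * q + mon u * word_der f q" for u
    by (rule lin_eq[of "\<lambda>q. word_der f (mon u * q)" "\<lambda>q. word_der f (mon u) * q + mon u * word_der f q" _ UNIV])
      (auto intro!: lin_comp[OF lin_word_der] lin_word_der lin_intros simp: 0)
  show ?thesis
    by (rule lin_eq[of "\<lambda>p. word_der f (p * q)" "\<lambda>p. word_der f p * q + p * word_der f q" _ UNIV])
      (auto intro!: lin_comp[OF lin_word_der] lin_word_der lin_intros simp: 1)
qed

lemma qT_alt: "qT p = tensor_ideal V +>\<^bsub>free_alg (carrier V)\<^esub> p"
  by (simp add: qT_def)

text \<open>Because \<open>f\<close> is a derivation of \<open>mul\<close> and not only of the
  bracket, the derivation \<open>?D\<close> of polynomials satisfies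
  \<open>?D (rho A g) = rho (f A) g + rho A (?D g)\<close>; moreover \<open>?D 1 = 0\<close>.
  Therefore the symbol intertwines the two derivations in all degrees.\<close>

lemma uea_deriv_symbol:
  assumes f: "\<And>x. x \<in> carrier V \<Longrightarrow> f x \<in> carrier V"
    "\<And>x y. x \<in> carrier V \<Longrightarrow> y \<in> carrier V \<Longrightarrow> f (x \<oplus>\<^bsub>V\<^esub> y) = f x \<oplus>\<^bsub>V\<^esub> f y"
    "\<And>c x. x \<in> carrier V \<Longrightarrow> f (c \<odot>\<^bsub>V\<^esub> x) = c \<odot>\<^bsub>V\<^esub> f x"
    "\<And>x y. x \<in> carrier V \<Longrightarrow> y \<in> carrier V \<Longrightarrow> f (mul x y) = mul (f x) y \<oplus>\<^bsub>V\<^esub> mul x (f y)"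
    and u: "u \<in> carrier U"
  shows "uea_deriv V br f u \<in> carrier U"
    "symbol (uea_deriv V br f u) = dv (\<lambda>z. li (f (e z))) (symbol u)"
    "\<And>v. v \<in> carrier U \<Longrightarrow> uea_deriv V br f (u \<otimes>\<^bsub>U\<^esub> v) =
      (uea_deriv V br f u \<otimes>\<^bsub>U\<^esub> v) \<oplus>\<^bsub>U\<^esub> (u \<otimes>\<^bsub>U\<^esub> uea_deriv V br f v)"
proof -
  let ?D = "dv (\<lambda>z. li (f (e z)))"
  have dF: "word_der f p \<in> FV" if "p \<in> FV" for p
    using that
  proof (rule lin_pm[OF lin_word_der])
    fix w assume "w \<in> lists (carrier V)"
    then show "word_der f (mon w) \<in> FV"
      by (induction w) (auto simp: word_der_Cons mon_Nil word_der_one f intro!: pm_add lists_mult)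
  qed
  have DA: "?D (li A) = li (f A)" if "A \<in> carrier V" for A
    by (rule derivation_li[OF lin_dv that]) (auto simp: f)
  have Dr: "?D (rho A g) = rho (f A) g + rho A (?D g)" if A: "A \<in> carrier V" and g: "g \<in> polys Z" for A g
  proof -
    \<comment> \<open>Both sides are derivations, and on a basis vector the equation is the Leibniz
      rule of \<open>f\<close> for its product with \<open>A\<close>.\<close>
    have "?D (left_der A g) - left_der A (?D g) = left_der (f A) g"
    proof (rule derivation_eq[OF lin_minus[OF lin_comp[OF lin_dv lin_left_der] lin_comp[OF lin_left_der lin_dv]] lin_left_der g])
      fix z assume z: "z \<in> Z"
      have "?D (left_der A (var z)) = li (f (mul A (e z)))"
        using z A by (simp add: left_der_def DA mul_closed e_carrier)
      moreover have "left_der A (?D (var z)) = li (mul A (f (e z)))"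
        using z A by (simp add: left_der_li f e_carrier)
      ultimately show "?D (left_der A (var z)) - left_der A (?D (var z)) = left_der (f A) (var z)"
        using z A by (simp add: f e_carrier mul_closed li_add left_der_def)
    qed (simp_all add: left_der_mult dv_mult lin_addD[OF lin_left_der] lin_addD[OF lin_dv] algebra_simps)
    then show ?thesis using A
      by (simp add: rho_def lin_addD[OF lin_dv] dv_mult DA algebra_simps)
  qed
  have sd: "pre_symbol (word_der f p) = ?D (pre_symbol p)" if "p \<in> FV" for p
  proof (rule lin_eq[OF lin_comp[OF lin_pre_symbol lin_word_der] lin_comp[OF lin_dv lin_pre_symbol] that])
    fix w assume "w \<in> lists (carrier V)"
    then show "pre_symbol (word_der f (mon w)) = ?D (pre_symbol (mon w))"
    proof (induction w)
      case Nil
      show ?case by (simp add: mon_Nil word_der_one pre_symbol_def lin_0[OF lin_act_left] act_mon[of "[]", unfolded mon_Nil])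
    next
      case (Cons A w)
      have "pre_symbol (word_der f (mon (A # w))) = rho (f A) (pre_symbol (mon w)) + rho A (pre_symbol (word_der f (mon w)))"
        by (simp add: word_der_Cons lin_addD[OF lin_pre_symbol], simp add: pre_symbol_def act_mult act_mon)
      also have "\<dots> = ?D (rho A (pre_symbol (mon w)))"
        using Cons by (simp add: Dr pre_symbol_polys)
      finally show ?case by (simp add: pre_symbol_def act_mon)
    qed
  qed
  have dT: "word_der f p \<in> tensor_ideal V" if "p \<in> tensor_ideal V" for p
  proof -
    note K = fidealD[OF fideal_tensor]
    \<comment> \<open>The set \<open>?W\<close> contains only elements of the ideal, since in the
      Leibniz rule the element itself occurs next to its derivative.\<close>
    have "tensor_ideal V \<subseteq> {p \<in> tensor_ideal V. word_der f p \<in> tensor_ideal V}" (is "_ \<subseteq> ?W")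
    proof (rule tensor_ideal_least)
      show "fideal (carrier V) ?W"
        unfolding fideal_def
      proof (intro conjI ballI)
        show "?W \<subseteq> FV" using K(1) by blast
        show "0 \<in> ?W" by (simp add: K(2) lin_0[OF lin_word_der])
        show "p + q \<in> ?W" if "p \<in> ?W" "q \<in> ?W" for p q
          using that by (simp add: K(3) lin_addD[OF lin_word_der])
        show "a * p \<in> ?W" "p * a \<in> ?W" if "p \<in> ?W" "a \<in> FV" for p a
          using that by (simp_all add: K(3,4,5) dF word_der_mult)
      qed
      have w: "word_der f (mon [x]) = mon [f x]" for x by (simp add: word_der_def)
      show "tensor_rels \<subseteq> ?W"
      proof
        fix p assume p: "p \<in> tensor_rels"
        then have "word_der f p \<in> tensor_rels"
          unfolding tensor_rels_def
        proof (elim UnE CollectE exE conjE)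
          fix x y assume "x \<in> carrier V" "y \<in> carrier V" "p = mon [x \<oplus>\<^bsub>V\<^esub> y] - mon [x] - mon [y]"
          then have "word_der f p = mon [f x \<oplus>\<^bsub>V\<^esub> f y] - mon [f x] - mon [f y]" "f x \<in> carrier V" "f y \<in> carrier V"
            by (simp_all add: lin_diffD[OF lin_word_der] w f)
          then show "word_der f p \<in> {mon [x \<oplus>\<^bsub>V\<^esub> y] - mon [x] - mon [y] | x y. x \<in> carrier V \<and> y \<in> carrier V} \<union>
            {mon [c \<odot>\<^bsub>V\<^esub> x] - scale_poly c (mon [x]) | c x. x \<in> carrier V}" by blast
        next
          fix c x assume "x \<in> carrier V" "p = mon [c \<odot>\<^bsub>V\<^esub> x] - sc c (mon [x])"
          then have "word_der f p = mon [c \<odot>\<^bsub>V\<^esub> f x] - sc c (mon [f x])" "f x \<in> carrier V"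
            by (simp_all add: lin_diffD[OF lin_word_der] lin_scD[OF lin_word_der] w f del: Poly_Mapping.map_single)
          then show "word_der f p \<in> {mon [x \<oplus>\<^bsub>V\<^esub> y] - mon [x] - mon [y] | x y. x \<in> carrier V \<and> y \<in> carrier V} \<union>
            {mon [c \<odot>\<^bsub>V\<^esub> x] - scale_poly c (mon [x]) | c x. x \<in> carrier V}" by blast
        qed
        then show "p \<in> ?W" using p tensor_rels_in by blast
      qed
    qed
    then show ?thesis using that by blast
  qed
  have qm: "quot_map (free_alg (carrier V)) (tensor_ideal V) (word_der f) (qT p) = qT (word_der f p)" if "p \<in> FV" for p
    unfolding qT_alt
    by (rule quot_map_presents[OF presents_free presents_tensor[unfolded tensor_alg_def qT_def[abs_def]]
        tensor_quot(5) _ presents_tensor[unfolded qT_def[abs_def]] lin_word_der]) (auto simp: dF dT that)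
  have qq: "uea_deriv V br f (qU p) = qU (word_der f p)" if "p \<in> FV" for p
    unfolding qU_def uea_deriv_def lin_ext_eq_lext word_der_def[symmetric]
    by (rule quot_map_presents[OF presents_tensor presents_uea[unfolded uea_def qU_def[abs_def]]
        lie_quot(5) lie_in presents_uea[unfolded qU_def[abs_def]] lin_word_der])
      (auto simp: dF sd qm lin_0[OF lin_dv] that)
  obtain p where p: "p \<in> FV" "u = qU p" using u by (auto simp: U_carrier)
  show "uea_deriv V br f u \<in> carrier U" using p by (auto simp: qq dF U_carrier)
  show "symbol (uea_deriv V br f u) = ?D (symbol u)" using p by (simp add: qq dF symbol_qU sd)
  fix v assume "v \<in> carrier U"
  then obtain p' where p': "p' \<in> FV" "v = qU p'" by (auto simp: U_carrier)
  note D = presentsD[OF presents_uea]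
  show "uea_deriv V br f (u \<otimes>\<^bsub>U\<^esub> v) =
      (uea_deriv V br f u \<otimes>\<^bsub>U\<^esub> v) \<oplus>\<^bsub>U\<^esub> (u \<otimes>\<^bsub>U\<^esub> uea_deriv V br f v)"
    using p p' by (simp add: D(6,7) qq dF lists_mult word_der_mult)
qed

lemma uea_mon_qU: "uea_mon V br w = qU (mon w)"
  by (simp add: uea_mon_def qU_def qT_def tens_def)

lemma pre_symbol_single: "pre_symbol (mon [s]) = li s"
  by (simp add: pre_symbol_def act_mon rho_def left_der_def)

text \<open>Triangular elimination: every monomial of the ideal over \<open>Z\<close> is the leading
  term of the symbol of some element of \<open>I\<close>. The error has lower degree and lies in the
  ideal again, so an induction on the degree realises every polynomial of the ideal as the symbol of
  an element of \<open>I\<close>.\<close>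

lemma varideal_sub:
  assumes I: "I \<subseteq> carrier U" "\<And>u v. u \<in> I \<Longrightarrow> v \<in> I \<Longrightarrow> u \<oplus>\<^bsub>U\<^esub> v \<in> I" "\<And>c u. u \<in> I \<Longrightarrow> c \<odot>\<^bsub>U\<^esub> u \<in> I"
    "\<zero>\<^bsub>U\<^esub> \<in> I" "\<And>u. u \<in> I \<Longrightarrow> symbol u \<in> varideal C"
    and ex: "\<And>m. set_mset m \<subseteq> Z \<Longrightarrow> set_mset m \<inter> C \<noteq> {} \<Longrightarrow> \<exists>u\<in>I. symbol u - mon m \<in> deg_lt (size m)"
    and u: "u \<in> carrier U" "symbol u \<in> varideal C"
  shows "u \<in> I"
proof -
  have *: "\<exists>v\<in>I. symbol v = f" if "f \<in> polys Z" "f \<in> varideal C" "f \<in> deg_lt n" for f n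
    using that
  proof (induction n arbitrary: f)
    case 0
    then have "f = 0" by (auto simp: pm_def)
    then show ?case using I(4) symbol_zero by auto
  next
    case (Suc n)
    have "f \<in> pm ({m. set_mset m \<subseteq> Z} \<inter> {m. set_mset m \<inter> C \<noteq> {}} \<inter> {m. size m < Suc n})"
      by (intro pm_Int Suc)
    then show ?case
    proof (induction rule: pm_induct)
      case zero
      show ?case using I(4) symbol_zero by auto
    next
      case (add p q)
      then obtain v v' where v: "v \<in> I" "symbol v = p" "v' \<in> I" "symbol v' = q" by blast
      then have "symbol (v \<oplus>\<^bsub>U\<^esub> v') = p + q" using I(1) symbol_add[of v v'] by auto
      then show ?case using I(2)[OF v(1,3)] by blast
    next
      case (mon c m)
      then obtain v where v: "v \<in> I" "symbol v - mon m \<in> deg_lt (size m)" using ex[of m] by auto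
      have "symbol v - mon m \<in> deg_lt n" using v(2) by (rule pm_mono) (use mon in auto)
      moreover have "symbol v - mon m \<in> polys Z" using mon v I(1) symbol_polys by (intro pm_diff) auto
      moreover have "symbol v - mon m \<in> varideal C" using mon v I(5) by (intro pm_diff) auto
      ultimately obtain v' where v': "v' \<in> I" "symbol v' = symbol v - mon m" using Suc.IH by blast
      have "symbol (c \<odot>\<^bsub>U\<^esub> (v \<oplus>\<^bsub>U\<^esub> (-1) \<odot>\<^bsub>U\<^esub> v')) = sc c (mon m)"
        using v v' I(1,2,3) by (simp add: symbol_smult symbol_add subset_iff sc_minus_one del: Poly_Mapping.map_single)
      moreover have "c \<odot>\<^bsub>U\<^esub> (v \<oplus>\<^bsub>U\<^esub> (-1) \<odot>\<^bsub>U\<^esub> v') \<in> I" using v v' I by blast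
      ultimately show ?case by blast
    qed
  qed
  have "finite (size ` keys (symbol u))" by simp
  then obtain n where "\<forall>m\<in>keys (symbol u). size m < n"
    by (metis finite_imageI finite_nat_set_iff_bounded image_eqI)
  then have "symbol u \<in> deg_lt n" by (auto simp: pm_def)
  from *[OF symbol_polys[OF u(1)] u(2) this] obtain v where "v \<in> I" "symbol v = symbol u" by blast
  then show ?thesis using symbol_inj[of v u] u I(1) by auto
qed

lemma symbol_word_top:
  assumes "set w \<subseteq> Z"
  shows "qU (mon (map e w)) \<in> carrier U" "symbol (qU (mon (map e w))) - mon (mset w) \<in> deg_lt (length w)"
proof -
  have w: "map e w \<in> lists (carrier V)" using assms by (auto intro!: e_carrier)
  have "sy (mon (map e w)) = mon (mset w)"
    using ex_em[of "mon w"] assms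
    by (simp add: sy_def em_mon ab_mon in_lists_conv_set subset_iff)
  then show "symbol (qU (mon (map e w))) - mon (mset w) \<in> deg_lt (length w)"
    using pre_symbol_word_top[OF w] w by (simp add: symbol_qU)
  show "qU (mon (map e w)) \<in> carrier U" using w by (simp add: U_carrier)
qed

text \<open>The symbol of \<open>u s\<close> arises from \<open>li s\<close> by letting
  \<open>u\<close> act, and \<open>rho A\<close> preserves the ideal of the variables in
  \<open>C\<close> if \<open>mul A (e z)\<close> stays in the span of \<open>C\<close>. For the
  converse, a monomial divisible by a variable from \<open>C\<close> is the leading term of a word
  that ends with the corresponding basis vector.\<close>

lemma left_ideal_symbol:
  assumes C: "C \<subseteq> Z" and S: "S \<subseteq> carrier V" "\<And>s. s \<in> S \<Longrightarrow> co s \<in> pm C" "e ` C \<subseteq> S"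
    and m: "\<And>A z. A \<in> carrier V \<Longrightarrow> z \<in> C \<Longrightarrow> co (mul A (e z)) \<in> pm C"
  shows "lin_span U {u \<otimes>\<^bsub>U\<^esub> uea_mon V br [s] | u s. u \<in> carrier U \<and> s \<in> S} =
    {u \<in> carrier U. symbol u \<in> varideal C}" (is "?I = ?J")
proof
  interpret ring U by (rule U_ring)
  have vU: "vec_space U" by (rule calgD(1)[OF presentsD(1)[OF presents_uea]])
  have lmC: "left_der A f \<in> varideal C" if "A \<in> carrier V" "f \<in> polys Z" "f \<in> varideal C" for A f
    unfolding left_der_def using that(2,3)
    by (rule dv_varideal) (auto intro!: varideal_linear[OF li_in] m that(1))
  have aw: "act (mon w) f \<in> varideal C" if "w \<in> lists (carrier V)" "f \<in> polys Z" "f \<in> varideal C" for w f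
    using that
  proof (induction w)
    case (Cons A w)
    have "act (mon w) f \<in> polys Z" using Cons by (intro act_polys) auto
    then show ?case using Cons unfolding act_mon by (auto simp: rho_def intro!: varideal_mult_right lmC)
  qed (simp add: act_mon)
  have ap: "act p f \<in> varideal C" if "p \<in> FV" "f \<in> polys Z" "f \<in> varideal C" for p f
    using that(1) by (rule lin_pm[OF lin_act_left]) (rule aw[OF _ that(2,3)])
  have gen: "u \<otimes>\<^bsub>U\<^esub> uea_mon V br [s] \<in> ?J" if us: "u \<in> carrier U" "s \<in> S" for u s
  proof -
    obtain p where p: "p \<in> FV" "u = qU p" using us by (auto simp: U_carrier)
    have s: "s \<in> carrier V" using us S by auto
    then have ms: "mon [s] \<in> FV" by simp
    have "u \<otimes>\<^bsub>U\<^esub> uea_mon V br [s] = qU (p * mon [s])"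
      unfolding p(2) uea_mon_qU by (rule presentsD(7)[OF presents_uea p(1) ms])
    moreover have "symbol (qU (p * mon [s])) = act p (li s)"
      using lists_mult[OF p(1) ms] pre_symbol_single[of s] by (simp add: symbol_qU pre_symbol_def act_mult)
    moreover have "act p (li s) \<in> varideal C"
      by (rule ap[OF p(1) li_polys[OF s] varideal_linear[OF li_in[OF S(2)[OF us(2)]]]])
    ultimately show ?thesis using lists_mult[OF p(1) ms] by (simp add: U_carrier)
  qed
  show IJ: "?I \<subseteq> ?J"
    by (rule lin_span_least) (use gen in \<open>auto simp: symbol_zero symbol_add symbol_smult vspD(2)[OF vU]\<close>)
  show "?J \<subseteq> ?I"
  proof safe
    fix u assume u: "u \<in> carrier U" "symbol u \<in> varideal C"
    show "u \<in> ?I"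
    proof (rule varideal_sub[OF _ _ _ _ _ _ u])
      fix m assume mm: "set_mset m \<subseteq> Z" "set_mset m \<inter> C \<noteq> {}"
      then obtain z m' where z: "z \<in> C" "m = add_mset z m'" by (metis disjoint_iff multi_member_split)
      obtain w where w: "mset w = m'" using ex_mset by blast
      have sw: "set (w @ [z]) \<subseteq> Z" using mm z w by auto
      have F: "mon (map e w) \<in> FV" "mon [e z] \<in> FV" using sw by (auto intro!: e_carrier)
      have "qU (mon (map e (w @ [z]))) = qU (mon (map e w)) \<otimes>\<^bsub>U\<^esub> uea_mon V br [e z]"
        unfolding uea_mon_qU presentsD(7)[OF presents_uea F] mon_append[symmetric] by simp
      moreover have "qU (mon (map e w)) \<otimes>\<^bsub>U\<^esub> uea_mon V br [e z] \<in> ?I"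
      proof (rule lin_span.base)
        have "qU (mon (map e w)) \<in> carrier U" unfolding U_carrier by (rule imageI) (rule F)
        moreover have "e z \<in> S" using S(3) z by blast
        ultimately show "qU (mon (map e w)) \<otimes>\<^bsub>U\<^esub> uea_mon V br [e z] \<in>
          {u \<otimes>\<^bsub>U\<^esub> uea_mon V br [s] | u s. u \<in> carrier U \<and> s \<in> S}" by blast
      qed
      ultimately show "\<exists>u\<in>?I. symbol u - mon m \<in> deg_lt (size m)"
        using symbol_word_top(2)[OF sw] w z by (intro bexI[of _ "qU (mon (map e (w @ [z])))"]) auto
    qed (use IJ in \<open>auto intro: lin_span.intros\<close>)
  qed
qed

text \<open>Here the generator \<open>s\<close> acts last, on an arbitrary polynomial. So
  \<open>left_der s\<close> must map every variable into the ideal, which is why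
  \<open>mul s A\<close> is required to have coordinates in \<open>C\<close> for all
  \<open>A\<close>.\<close>

lemma right_ideal_symbol:
  assumes C: "C \<subseteq> Z" and S: "S \<subseteq> carrier V" "\<And>s. s \<in> S \<Longrightarrow> co s \<in> pm C" "e ` C \<subseteq> S"
    and m: "\<And>s A. s \<in> S \<Longrightarrow> A \<in> carrier V \<Longrightarrow> co (mul s A) \<in> pm C"
  shows "lin_span U {uea_mon V br [s] \<otimes>\<^bsub>U\<^esub> u | u s. u \<in> carrier U \<and> s \<in> S} =
    {u \<in> carrier U. symbol u \<in> varideal C}" (is "?I = ?J")
proof
  interpret ring U by (rule U_ring)
  have vU: "vec_space U" by (rule calgD(1)[OF presentsD(1)[OF presents_uea]])
  have gen: "uea_mon V br [s] \<otimes>\<^bsub>U\<^esub> u \<in> ?J" if us: "u \<in> carrier U" "s \<in> S" for u s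
  proof -
    obtain p where p: "p \<in> FV" "u = qU p" using us by (auto simp: U_carrier)
    have s: "s \<in> carrier V" using us S by auto
    then have ms: "mon [s] \<in> FV" by simp
    have "uea_mon V br [s] \<otimes>\<^bsub>U\<^esub> u = qU (mon [s] * p)"
      unfolding p(2) uea_mon_qU by (rule presentsD(7)[OF presents_uea ms p(1)])
    moreover have "symbol (qU (mon [s] * p)) = rho s (pre_symbol p)"
      using lists_mult[OF ms p(1)] by (simp add: symbol_qU pre_symbol_def act_mult act_mon)
    moreover have "li s * pre_symbol p \<in> varideal C"
      by (intro varideal_mult varideal_linear[OF li_in[OF S(2)[OF us(2)]]])
    moreover have "left_der s (pre_symbol p) \<in> varideal C"
      unfolding left_der_def using pre_symbol_polys[OF p(1)]
      by (rule dv_in) (intro varideal_mult varideal_linear[OF li_in] m us e_carrier)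
    ultimately show ?thesis using lists_mult[OF ms p(1)] by (auto simp: U_carrier rho_def)
  qed
  show IJ: "?I \<subseteq> ?J"
    by (rule lin_span_least) (use gen in \<open>auto simp: symbol_zero symbol_add symbol_smult vspD(2)[OF vU]\<close>)
  show "?J \<subseteq> ?I"
  proof safe
    fix u assume u: "u \<in> carrier U" "symbol u \<in> varideal C"
    show "u \<in> ?I"
    proof (rule varideal_sub[OF _ _ _ _ _ _ u])
      fix m assume mm: "set_mset m \<subseteq> Z" "set_mset m \<inter> C \<noteq> {}"
      then obtain z m' where z: "z \<in> C" "m = add_mset z m'" by (metis disjoint_iff multi_member_split)
      obtain w where w: "mset w = m'" using ex_mset by blast
      have sw: "set (z # w) \<subseteq> Z" using mm z w by auto
      have F: "mon (map e w) \<in> FV" "mon [e z] \<in> FV" using sw by (auto intro!: e_carrier)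
      have "qU (mon (map e (z # w))) = uea_mon V br [e z] \<otimes>\<^bsub>U\<^esub> qU (mon (map e w))"
        unfolding uea_mon_qU presentsD(7)[OF presents_uea F(2,1)] mon_append[symmetric] by simp
      moreover have "uea_mon V br [e z] \<otimes>\<^bsub>U\<^esub> qU (mon (map e w)) \<in> ?I"
      proof (rule lin_span.base)
        have "qU (mon (map e w)) \<in> carrier U" unfolding U_carrier by (rule imageI) (rule F)
        moreover have "e z \<in> S" using S(3) z by blast
        ultimately show "uea_mon V br [e z] \<otimes>\<^bsub>U\<^esub> qU (mon (map e w)) \<in>
          {uea_mon V br [s] \<otimes>\<^bsub>U\<^esub> u | u s. u \<in> carrier U \<and> s \<in> S}" by blast
      qed
      ultimately show "\<exists>u\<in>?I. symbol u - mon m \<in> deg_lt (size m)"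
        using symbol_word_top(2)[OF sw] w z by (intro bexI[of _ "qU (mon (map e (z # w)))"]) auto
    qed (use IJ in \<open>auto intro: lin_span.intros\<close>)
  qed
qed

end

section \<open>Compatibility of the symbol with homomorphisms\<close>

locale pbw_hom = P: pbw V Z e co mul br + P': pbw V' Z' e' co' mul' br'
  for V :: "(complex, 'v) module" and Z :: "'z set" and e co mul br
    and V' :: "(complex, 'u) module" and Z' :: "'z set" and e' co' mul' br' +
  fixes f :: "'v \<Rightarrow> 'u"
  assumes f_closed: "x \<in> carrier V \<Longrightarrow> f x \<in> carrier V'"
    and f_add: "x \<in> carrier V \<Longrightarrow> y \<in> carrier V \<Longrightarrow> f (x \<oplus>\<^bsub>V\<^esub> y) = f x \<oplus>\<^bsub>V'\<^esub> f y"
    and f_smult: "x \<in> carrier V \<Longrightarrow> f (c \<odot>\<^bsub>V\<^esub> x) = c \<odot>\<^bsub>V'\<^esub> f x"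
    and f_mul: "x \<in> carrier V \<Longrightarrow> y \<in> carrier V \<Longrightarrow> f (mul x y) = mul' (f x) (f y)"
    and f_e: "z \<in> Z \<Longrightarrow> e' z = f (e z)"
    and f_co: "x \<in> carrier V \<Longrightarrow> co' (f x) = co x"
begin

text \<open>Both algebras use variables of the same type, and \<open>f\<close> sends basis vectors
  to basis vectors with the same index. On polynomials over \<open>Z\<close> the two module
  structures then coincide, and the symbol does not change.\<close>

lemma uea_hom_symbol:
  assumes u: "u \<in> carrier P.U"
  shows "uea_hom V' br' f u \<in> carrier P'.U" "P'.symbol (uea_hom V' br' f u) = P.symbol u"
    "\<And>v. v \<in> carrier P.U \<Longrightarrow>
      uea_hom V' br' f (u \<otimes>\<^bsub>P.U\<^esub> v) = uea_hom V' br' f u \<otimes>\<^bsub>P'.U\<^esub> uea_hom V' br' f v"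
proof -
  define h where "h = lext (\<lambda>w. mon (map f w))"
  have lh: "lin h" unfolding h_def by (rule lin_lext)
  have hm: "h (mon w) = mon (map f w)" for w by (simp add: h_def)
  have hmult: "h (p * q) = h p * h q" for p q
    by (rule lin_hom[OF lh]) (simp add: hm plus_list_def, simp add: mon_append)
  have hF: "h p \<in> P'.FV" if "p \<in> P.FV" for p
    using that by (rule lin_pm[OF lh]) (auto simp: hm f_closed)
  have li: "P'.li (f x) = P.li x" if "x \<in> carrier V" for x
    using that by (simp add: P'.li_def P.li_def f_co)
  have rho: "P'.rho (f A) g = P.rho A g" if "A \<in> carrier V" "g \<in> polys Z" for A g
  proof -
    have "P'.left_der (f A) g = P.left_der A g"
      by (rule derivation_eq[OF P'.lin_left_der P.lin_left_der that(2) P'.left_der_mult P.left_der_mult])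
        (use that in \<open>simp add: P'.left_der_def P.left_der_def f_e li P.mul_closed P.e_carrier flip: f_mul\<close>)
    then show ?thesis using that by (simp add: P'.rho_def P.rho_def li)
  qed
  have sh: "P'.pre_symbol (h p) = P.pre_symbol p" if "p \<in> P.FV" for p
  proof (rule lin_eq[OF lin_comp[OF P'.lin_pre_symbol lh] P.lin_pre_symbol that])
    fix w assume "w \<in> lists (carrier V)"
    then show "P'.pre_symbol (h (mon w)) = P.pre_symbol (mon w)"
    proof (induction w)
      case (Cons A w)
      have "P.pre_symbol (mon w) \<in> polys Z" using Cons by (intro P.pre_symbol_polys) auto
      with Cons show ?case by (simp add: hm P'.pre_symbol_def P.pre_symbol_def P'.act_mon P.act_mon rho)
    qed (simp add: hm P'.pre_symbol_def P.pre_symbol_def P'.act_mon P.act_mon)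
  qed
  have hT: "h p \<in> tensor_ideal V'" if "p \<in> tensor_ideal V" for p
  proof -
    note K = fidealD[OF P'.fideal_tensor]
    have "tensor_ideal V \<subseteq> {p \<in> P.FV. h p \<in> tensor_ideal V'}" (is "_ \<subseteq> ?W")
    proof (rule P.tensor_ideal_least)
      show "fideal (carrier V) ?W"
        unfolding fideal_def
      proof (intro conjI ballI)
        show "?W \<subseteq> P.FV" by blast
        show "0 \<in> ?W" by (simp add: K(2) lin_0[OF lh])
        show "p + q \<in> ?W" if "p \<in> ?W" "q \<in> ?W" for p q
          using that by (simp add: K(3) lin_addD[OF lh] pm_add)
        show "a * p \<in> ?W" "p * a \<in> ?W" if "p \<in> ?W" "a \<in> P.FV" for p a
          using that by (simp_all add: K(4,5) hF hmult lists_mult)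
      qed
      show "P.tensor_rels \<subseteq> ?W"
      proof
        fix p assume p: "p \<in> P.tensor_rels"
        then have "h p \<in> P'.tensor_rels"
          unfolding P.tensor_rels_def
        proof (elim UnE CollectE exE conjE)
          fix x y assume "x \<in> carrier V" "y \<in> carrier V" "p = mon [x \<oplus>\<^bsub>V\<^esub> y] - mon [x] - mon [y]"
          then have "h p = mon [f x \<oplus>\<^bsub>V'\<^esub> f y] - mon [f x] - mon [f y]" "f x \<in> carrier V'" "f y \<in> carrier V'"
            by (simp_all add: lin_diffD[OF lh] hm f_add f_closed)
          then show "h p \<in> P'.tensor_rels" unfolding P'.tensor_rels_def by blast
        next
          fix c x assume "x \<in> carrier V" "p = mon [c \<odot>\<^bsub>V\<^esub> x] - sc c (mon [x])"
          then have "h p = mon [c \<odot>\<^bsub>V'\<^esub> f x] - sc c (mon [f x])" "f x \<in> carrier V'"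
            by (simp_all add: lin_diffD[OF lh] lin_scD[OF lh] hm f_smult f_closed del: Poly_Mapping.map_single)
          then show "h p \<in> P'.tensor_rels" unfolding P'.tensor_rels_def by blast
        qed
        then show "p \<in> ?W" using p P.tensor_rels_sub P'.tensor_rels_in by blast
      qed
    qed
    then show ?thesis using that by blast
  qed
  have qm: "quot_map (free_alg (carrier V')) (tensor_ideal V') h (P.qT p) = P'.qT (h p)" if "p \<in> P.FV" for p
    unfolding P.qT_alt P'.qT_alt
    by (rule quot_map_presents[OF presents_free P.presents_tensor[unfolded tensor_alg_def P.qT_def[abs_def]]
        P.tensor_quot(5) _ P'.presents_tensor[unfolded P'.qT_def[abs_def]] lh]) (auto simp: hF hT that)
  have qq: "uea_hom V' br' f (P.qU p) = P'.qU (h p)" if "p \<in> P.FV" for p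
    unfolding P.qU_def P'.qU_def uea_hom_def lin_ext_eq_lext h_def[symmetric]
    by (rule quot_map_presents[OF P.presents_tensor P.presents_uea[unfolded uea_def P.qU_def[abs_def]]
        P.lie_quot(5) P.lie_in P'.presents_uea[unfolded P'.qU_def[abs_def]] lh])
      (auto simp: hF sh qm that)
  obtain p where p: "p \<in> P.FV" "u = P.qU p" using u by (auto simp: P.U_carrier)
  show "uea_hom V' br' f u \<in> carrier P'.U" using p by (auto simp: qq hF P'.U_carrier)
  show "P'.symbol (uea_hom V' br' f u) = P.symbol u" using p by (simp add: qq hF P'.symbol_qU P.symbol_qU sh)
  fix v assume "v \<in> carrier P.U"
  then obtain p' where p': "p' \<in> P.FV" "v = P.qU p'" by (auto simp: P.U_carrier)
  show "uea_hom V' br' f (u \<otimes>\<^bsub>P.U\<^esub> v) = uea_hom V' br' f u \<otimes>\<^bsub>P'.U\<^esub> uea_hom V' br' f v"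
    using p p'
    by (simp add: presentsD(7)[OF P.presents_uea] presentsD(7)[OF P'.presents_uea] qq hF lists_mult hmult)
qed

end

section \<open>The enveloping algebras of \<open>gl(N,\<Omega>)\<close>\<close>

type_synonym 'a gpoly = "(nat \<times> nat \<times> 'a) multiset \<Rightarrow>\<^sub>0 complex"

lemma map_zero_fun [simp]: "Poly_Mapping.map (\<lambda>_. 0) p = (0 :: 'w \<Rightarrow>\<^sub>0 complex)"
  by (rule poly_mapping_eqI) (simp add: Poly_Mapping.map.rep_eq when_def)

lemma E_mat_sel [simp]:
  "dim_row (E_mat N i j x) = N" "dim_col (E_mat N i j x) = N" "E_mat N i j x \<in> carrier_mat N N"
  "k < N \<Longrightarrow> l < N \<Longrightarrow> E_mat N i j x $$ (k, l) = (if k = i \<and> l = j then x else 0)"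
  by (auto simp: E_mat_def)

lemma index_mult_sum:
  "i < dim_row A \<Longrightarrow> j < dim_col C \<Longrightarrow> dim_row C = dim_col A \<Longrightarrow>
    (A * C) $$ (i, j) = (\<Sum>k<dim_col A. A $$ (i, k) * C $$ (k, j))"
  by (simp add: scalar_prod_def atLeast0LessThan)

lemma gl_sel [simp]:
  "carrier (gl scale N) = carrier_mat N N" "zero (gl scale N) = 0\<^sub>m N N"
  "add (gl scale N) = (+)" "module.smult (gl scale N) = (\<lambda>c. map_mat (scale c))"
  by (simp_all add: gl_def)

locale omega_basis = complex_assoc_algebra scale
  for scale :: "complex \<Rightarrow> 'a::ring \<Rightarrow> 'a" +
  fixes B :: "'a set"
  assumes indep: "\<not> dependent B" and span_B: "span B = UNIV"
begin

definition coords :: "'a \<Rightarrow> ('a \<Rightarrow>\<^sub>0 complex)" where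
  "coords x = Abs_poly_mapping (representation B x)"

lemma lookup_coords: "lkp (coords x) b = representation B x b"
  unfolding coords_def by (simp add: finite_representation)

lemma coords_add: "coords (x + y) = coords x + coords y"
  by (rule poly_mapping_eqI) (simp add: lookup_coords lookup_add representation_add[OF indep] span_B)

lemma coords_scale: "coords (scale c x) = sc c (coords x)"
  by (rule poly_mapping_eqI) (simp add: lookup_coords representation_scale[OF indep] span_B)

lemma coords_basis: "b \<in> B \<Longrightarrow> coords b = mon b"
  by (rule poly_mapping_eqI) (simp add: lookup_coords representation_basis[OF indep] lookup_single when_def)

lemma Omega_sel [simp]:
  "carrier (Omega scale) = UNIV" "zero (Omega scale) = 0" "add (Omega scale) = (+)"
  "module.smult (Omega scale) = scale"
  by (simp_all add: Omega_def)

lemma vec_space_Omega: "vec_space (Omega scale)"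
proof -
  have "abelian_group (Omega scale)"
  proof (rule abelian_groupI)
    fix x :: 'a
    show "\<exists>y\<in>carrier (Omega scale). y \<oplus>\<^bsub>Omega scale\<^esub> x = \<zero>\<^bsub>Omega scale\<^esub>"
      by (rule bexI[of _ "- x"]) simp_all
  qed (simp_all add: algebra_simps)
  then show ?thesis by (simp add: vec_space_def scale_right_distrib)
qed

sublocale om: vbasis "Omega scale" B "\<lambda>b. b" coords
proof
  show "vec_space (Omega scale)" by (rule vec_space_Omega)
  show "carrier (Omega scale) \<subseteq> lin_span (Omega scale) ((\<lambda>b. b) ` B)"
  proof
    fix x :: 'a
    have "x \<in> span B" by (simp add: span_B)
    then show "x \<in> lin_span (Omega scale) ((\<lambda>b. b) ` B)"
    proof (induction rule: span_induct_alt)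
      case base
      show ?case using lin_span.zero[of "Omega scale"] by simp
    next
      case (step c x y)
      then show ?case
        using lin_span.add[OF lin_span.smult[OF lin_span.base[of x B "Omega scale"], of c], of y] by simp
    qed
  qed
qed (simp_all add: coords_add coords_scale coords_basis)

definition ZN :: "nat \<Rightarrow> (nat \<times> nat \<times> 'a) set" where
  "ZN N = {..<N} \<times> {..<N} \<times> B"

definition eN :: "nat \<Rightarrow> nat \<times> nat \<times> 'a \<Rightarrow> 'a mat" where
  "eN N = (\<lambda>(i, j, b). E_mat N i j b)"

definition emb :: "nat \<Rightarrow> nat \<Rightarrow> ('a \<Rightarrow>\<^sub>0 complex) \<Rightarrow> (nat \<times> nat \<times> 'a \<Rightarrow>\<^sub>0 complex)" where
  "emb i j = lext (\<lambda>b. mon (i, j, b))"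

definition coN :: "nat \<Rightarrow> 'a mat \<Rightarrow> (nat \<times> nat \<times> 'a \<Rightarrow>\<^sub>0 complex)" where
  "coN N A = (\<Sum>i<N. \<Sum>j<N. emb i j (coords (A $$ (i, j))))"

lemma lookup_emb: "lkp (emb i j p) (k, l, b) = (if k = i \<and> l = j then lkp p b else 0)"
proof -
  have "p \<in> pm UNIV" by simp
  then show ?thesis
  proof (induction rule: pm_induct)
    case (mon c w)
    show ?case by (auto simp: emb_def lext_single lookup_single when_def)
  qed (simp_all add: emb_def lin_0[OF lin_lext] lin_addD[OF lin_lext] lookup_add)
qed

lemma lookup_coN:
  "lkp (coN N A) (k, l, b) = (if k < N \<and> l < N then representation B (A $$ (k, l)) b else 0)"
proof -
  have "lkp (coN N A) (k, l, b) = (\<Sum>i<N. \<Sum>j<N. if k = i \<and> l = j then lkp (coords (A $$ (i, j))) b else 0)"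
    by (simp add: coN_def lookup_sum lookup_emb)
  also have "\<dots> = (\<Sum>i<N. if k = i then (\<Sum>j<N. if l = j then lkp (coords (A $$ (i, j))) b else 0) else 0)"
    by (intro sum.cong) auto
  finally show ?thesis by (simp add: lookup_coords)
qed

lemma coN_pm:
  assumes "\<And>k l. k < N \<Longrightarrow> l < N \<Longrightarrow> \<not> Q k l \<Longrightarrow> A $$ (k, l) = 0"
  shows "coN N A \<in> pm {(k, l, b). k < N \<and> l < N \<and> b \<in> B \<and> Q k l}"
  using assms by (auto simp: pm_iff lookup_coN representation_zero dest: representation_ne_zero)

lemma vec_space_gl: "vec_space (gl scale N)"
proof -
  have "abelian_group (gl scale N)"
  proof (rule abelian_groupI)
    fix A assume "A \<in> carrier (gl scale N)"
    then show "\<exists>C\<in>carrier (gl scale N). C \<oplus>\<^bsub>gl scale N\<^esub> A = \<zero>\<^bsub>gl scale N\<^esub>"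
      by (intro bexI[of _ "- A"]) (simp_all add: uminus_l_inv_mat[of A N N])
  qed (auto simp: comm_add_mat[of _ N N] assoc_add_mat[of _ N N] left_add_zero_mat)
  then show ?thesis
    by (auto simp: vec_space_def scale_right_distrib intro!: eq_matI)
qed

lemma gl_span: "A \<in> carrier_mat N N \<Longrightarrow> A \<in> lin_span (gl scale N) (eN N ` ZN N)"
proof -
  assume A: "A \<in> carrier_mat N N"
  have E: "E_mat N i j x \<in> lin_span (gl scale N) (eN N ` ZN N)" if "i < N" "j < N" for i j x
  proof -
    have "x \<in> span B" by (simp add: span_B)
    then show ?thesis
    proof (induction rule: span_induct_alt)
      case base
      have "E_mat N i j 0 = \<zero>\<^bsub>gl scale N\<^esub>" by (auto simp: E_mat_def)
      then show ?case using lin_span.zero[of "gl scale N"] by simp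
    next
      case (step c x y)
      have "eN N (i, j, x) \<in> eN N ` ZN N" using that step(1) by (intro imageI) (auto simp: ZN_def)
      then have "E_mat N i j x \<in> lin_span (gl scale N) (eN N ` ZN N)"
        by (intro lin_span.base) (simp add: eN_def)
      from lin_span.add[OF lin_span.smult[OF this, of c] step(2)]
      have "map_mat (scale c) (E_mat N i j x) + E_mat N i j y \<in> lin_span (gl scale N) (eN N ` ZN N)"
        by simp
      moreover have "map_mat (scale c) (E_mat N i j x) + E_mat N i j y = E_mat N i j (scale c x + y)"
        by (intro eq_matI) auto
      ultimately show ?case by simp
    qed
  qed
  \<comment> \<open>The matrix is assembled entry by entry; \<open>P\<close> is the set of positions
    already filled.\<close>
  have "mat N N (\<lambda>ij. if ij \<in> P then A $$ ij else 0) \<in> lin_span (gl scale N) (eN N ` ZN N)"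
    if "finite P" "P \<subseteq> {..<N} \<times> {..<N}" for P
    using that
  proof (induction P)
    case empty
    have "mat N N (\<lambda>ij. if ij \<in> {} then A $$ ij else 0) = \<zero>\<^bsub>gl scale N\<^esub>" by auto
    then show ?case using lin_span.zero[of "gl scale N"] by simp
  next
    case (insert ij P)
    obtain i j where ij: "ij = (i, j)" "i < N" "j < N" using insert by auto
    have "mat N N (\<lambda>ij'. if ij' \<in> insert ij P then A $$ ij' else 0) =
      E_mat N i j (A $$ (i, j)) \<oplus>\<^bsub>gl scale N\<^esub> mat N N (\<lambda>ij. if ij \<in> P then A $$ ij else 0)"
      using insert(2) ij by (intro eq_matI) auto
    then show ?case using lin_span.add[OF E[OF ij(2,3)] insert(3)] insert(4) by simp
  qed
  from this[of "{..<N} \<times> {..<N}"]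
  have "mat N N (\<lambda>ij. if ij \<in> {..<N} \<times> {..<N} then A $$ ij else 0) \<in> lin_span (gl scale N) (eN N ` ZN N)"
    by simp
  moreover have "mat N N (\<lambda>ij. if ij \<in> {..<N} \<times> {..<N} then A $$ ij else 0) = A"
    using A by (intro eq_matI) auto
  ultimately show ?thesis by simp
qed

sublocale gl: pbw "gl scale N" "ZN N" "eN N" "coN N" "(*)" comm_br for N
proof
  show "vec_space (gl scale N)" by (rule vec_space_gl)
  show "carrier (gl scale N) \<subseteq> lin_span (gl scale N) (eN N ` ZN N)" using gl_span by auto
  show "eN N z \<in> carrier (gl scale N)" if "z \<in> ZN N" for z by (cases z) (simp add: eN_def)
  show "coN N (eN N z) = mon z" if "z \<in> ZN N" for z
  proof (rule poly_mapping_eqI)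
    fix y :: "nat \<times> nat \<times> 'a"
    obtain i j b k l c where "z = (i, j, b)" "y = (k, l, c)" by (metis prod_cases3)
    then show "lkp (coN N (eN N z)) y = lkp (mon z) y"
      using that by (auto simp: eN_def lookup_coN ZN_def representation_zero representation_basis[OF indep]
          lookup_single when_def)
  qed
  fix A C D assume A: "A \<in> carrier (gl scale N)" and C: "C \<in> carrier (gl scale N)"
  show "coN N (A \<oplus>\<^bsub>gl scale N\<^esub> C) = coN N A + coN N C"
    using A C by (intro poly_mapping_eqI)
      (auto simp: lookup_coN lookup_add representation_add[OF indep] span_B)
  show "coN N (c \<odot>\<^bsub>gl scale N\<^esub> A) = sc c (coN N A)" for c
    using A by (intro poly_mapping_eqI)
      (auto simp: lookup_coN representation_scale[OF indep] span_B)
  show "A * C \<in> carrier (gl scale N)" using A C by simp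
  show "comm_br A C \<in> carrier (gl scale N)" 
    unfolding comm_br_def gl_sel by (rule minus_carrier_mat) (use A C in simp)
  show "comm_br A C \<oplus>\<^bsub>gl scale N\<^esub> C * A = A * C"
    using A C by (intro eq_matI) (auto simp: comm_br_def)
  show "(c \<odot>\<^bsub>gl scale N\<^esub> A) * C = c \<odot>\<^bsub>gl scale N\<^esub> (A * C)" for c
    using A C by (intro eq_matI)
      (auto simp: index_mult_sum scale_mult_left scale_sum_right simp del: index_mult_mat(1))
  show "A * (c \<odot>\<^bsub>gl scale N\<^esub> C) = c \<odot>\<^bsub>gl scale N\<^esub> (A * C)" for c
    using A C by (intro eq_matI)
      (auto simp: index_mult_sum scale_mult_right scale_sum_right simp del: index_mult_mat(1))
  assume D: "D \<in> carrier (gl scale N)"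
  show "A * C * D = A * (C * D)"
    using A C D by (simp add: assoc_mult_mat[of A N N C N D N])
  show "(A \<oplus>\<^bsub>gl scale N\<^esub> C) * D = A * D \<oplus>\<^bsub>gl scale N\<^esub> C * D"
    using A C D by (simp add: add_mult_distrib_mat[of A N N C D N])
  show "A * (C \<oplus>\<^bsub>gl scale N\<^esub> D) = A * C \<oplus>\<^bsub>gl scale N\<^esub> A * D"
    using A C D by (simp add: mult_add_distrib_mat[of A N N C N D])
qed

section \<open>The action of gl(N,C) under the symbol map\<close>

abbreviation sgm :: "nat \<Rightarrow> ('a mat list \<Rightarrow>\<^sub>0 complex) set set \<Rightarrow> 'a gpoly" where
  "sgm N \<equiv> gl.symbol N"

lemma U_gl_eq: "U_gl scale N = uea (gl scale N) comm_br"
  by (simp add: U_gl_def)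

lemma ad_act_closed [simp]:
  "ad_act scale N X A \<in> carrier_mat N N" "dim_row (ad_act scale N X A) = N" "dim_col (ad_act scale N X A) = N"
  by (simp_all add: ad_act_def)

lemma ad_act_index:
  "i < N \<Longrightarrow> l < N \<Longrightarrow> ad_act scale N X A $$ (i, l) =
    (\<Sum>j<N. scale (X $$ (i, j)) (A $$ (j, l))) - (\<Sum>j<N. scale (X $$ (j, l)) (A $$ (i, j)))"
  by (simp add: ad_act_def sum_subtractf)

lemma ad_act_add:
  "A \<in> carrier_mat N N \<Longrightarrow> C \<in> carrier_mat N N \<Longrightarrow>
    ad_act scale N X (A + C) = ad_act scale N X A + ad_act scale N X C"
  by (intro eq_matI)
    (auto simp: ad_act_index scale_right_distrib sum.distrib)

lemma ad_act_smult:
  "A \<in> carrier_mat N N \<Longrightarrow> ad_act scale N X (map_mat (scale c) A) = map_mat (scale c) (ad_act scale N X A)"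
  by (intro eq_matI)
    (auto simp: ad_act_index scale_right_diff_distrib scale_sum_right mult.commute)

text \<open>The product A X C, written \<open>?c\<close> in the proof, occurs with both signs and
  cancels. That the commutator with \<open>X\<close> is a derivation of the matrix product is the
  hypothesis of \<open>gl.uea_deriv_symbol\<close>.\<close>

lemma ad_act_mult:
  assumes A: "A \<in> carrier_mat N N" and C: "C \<in> carrier_mat N N"
  shows "ad_act scale N X (A * C) = ad_act scale N X A * C + A * ad_act scale N X C"
proof (rule eq_matI)
  let ?r = "ad_act scale N X A * C + A * ad_act scale N X C"
  fix i l assume "i < dim_row ?r" "l < dim_col ?r"
  then have il: "i < N" "l < N" using A C by auto
  have m: "(D * E) $$ (p, q) = (\<Sum>k<N. D $$ (p, k) * E $$ (k, q))"
    if "D \<in> carrier_mat N N" "E \<in> carrier_mat N N" "p < N" "q < N" for D E :: "'a mat" and p q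
    using that by (subst index_mult_sum) auto
  let ?a = "\<Sum>j<N. \<Sum>k<N. scale (X $$ (i, j)) (A $$ (j, k) * C $$ (k, l))"
  let ?b = "\<Sum>j<N. \<Sum>k<N. scale (X $$ (j, l)) (A $$ (i, k) * C $$ (k, j))"
  let ?c = "\<Sum>k<N. \<Sum>j<N. scale (X $$ (j, k)) (A $$ (i, j) * C $$ (k, l))"
  have "ad_act scale N X (A * C) $$ (i, l) = ?a - ?b"
    using il A C by (simp add: ad_act_index m scale_sum_right del: index_mult_mat(1))
  moreover have "(ad_act scale N X A * C) $$ (i, l) = ?a - ?c"
  proof -
    have "(ad_act scale N X A * C) $$ (i, l) =
      (\<Sum>k<N. \<Sum>j<N. scale (X $$ (i, j)) (A $$ (j, k) * C $$ (k, l))) - ?c"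
      using il A C by (simp add: m ad_act_index algebra_simps sum_distrib_right scale_mult_left sum_subtractf
          del: index_mult_mat(1))
    moreover have "(\<Sum>k<N. \<Sum>j<N. scale (X $$ (i, j)) (A $$ (j, k) * C $$ (k, l))) = ?a"
      by (rule sum.swap)
    ultimately show ?thesis by simp
  qed
  moreover have "(A * ad_act scale N X C) $$ (i, l) = ?c - ?b"
  proof -
    have "(A * ad_act scale N X C) $$ (i, l) =
      (\<Sum>k<N. \<Sum>j<N. scale (X $$ (k, j)) (A $$ (i, k) * C $$ (j, l))) -
      (\<Sum>k<N. \<Sum>j<N. scale (X $$ (j, l)) (A $$ (i, k) * C $$ (k, j)))"
      using il A C by (simp add: m ad_act_index algebra_simps sum_distrib_left scale_mult_right sum_subtractf
          del: index_mult_mat(1))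
    moreover have "(\<Sum>k<N. \<Sum>j<N. scale (X $$ (k, j)) (A $$ (i, k) * C $$ (j, l))) = ?c"
      by (rule sum.swap)
    moreover have "(\<Sum>k<N. \<Sum>j<N. scale (X $$ (j, l)) (A $$ (i, k) * C $$ (k, j))) = ?b"
      by (rule sum.swap)
    ultimately show ?thesis by simp
  qed
  ultimately show "ad_act scale N X (A * C) $$ (i, l) = ?r $$ (i, l)"
    using il A C by simp
qed (use A C in auto)

definition dX :: "nat \<Rightarrow> complex mat \<Rightarrow> 'a gpoly \<Rightarrow> 'a gpoly" where
  "dX N X = dv (\<lambda>z. gl.li N (ad_act scale N X (eN N z)))"

lemma lin_dX: "lin (dX N X)" unfolding dX_def by (rule lin_dv)
lemma dX_mult: "dX N X (p * q) = dX N X p * q + p * dX N X q" unfolding dX_def by (rule dv_mult)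

lemma dX_var:
  assumes "(k, l, b) \<in> ZN N"
  shows "dX N X (var (k, l, b)) =
    (\<Sum>a<N. sc (X $$ (a, k)) (var (a, l, b))) - (\<Sum>a<N. sc (X $$ (l, a)) (var (k, a, b)))"
proof -
  have kl: "k < N" "l < N" "b \<in> B" using assms by (auto simp: ZN_def)
  have "coN N (ad_act scale N X (eN N (k, l, b))) =
    (\<Sum>a<N. sc (X $$ (a, k)) (mon (a, l, b))) - (\<Sum>a<N. sc (X $$ (l, a)) (mon (k, a, b)))" (is "?x = ?y")
  proof (rule poly_mapping_eqI)
    fix y :: "nat \<times> nat \<times> 'a"
    obtain i j c where y: "y = (i, j, c)" by (metis prod_cases3)
    have E: "ad_act scale N X (eN N (k, l, b)) $$ (i, j) =
      (if j = l then scale (X $$ (i, k)) b else 0) - (if i = k then scale (X $$ (l, j)) b else 0)"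
      if "i < N" "j < N"
    proof -
      have "(\<Sum>m<N. scale (X $$ (i, m)) (eN N (k, l, b) $$ (m, j))) =
          (\<Sum>m<N. if m = k then (if j = l then scale (X $$ (i, k)) b else 0) else 0)"
        using that by (intro sum.cong) (auto simp: eN_def)
      moreover have "(\<Sum>m<N. scale (X $$ (m, j)) (eN N (k, l, b) $$ (i, m))) =
          (\<Sum>m<N. if m = l then (if i = k then scale (X $$ (l, j)) b else 0) else 0)"
        using that by (intro sum.cong) (auto simp: eN_def)
      ultimately show ?thesis using that kl by (simp add: ad_act_index)
    qed
    have 1: "(\<Sum>a<N. lkp (sc (X $$ (a, k)) (mon (a, l, b))) (i, j, c)) =
      (\<Sum>a<N. if a = i then (if j = l \<and> c = b then X $$ (i, k) else 0) else 0)"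
      by (intro sum.cong) (auto simp: lookup_single when_def)
    have 2: "(\<Sum>a<N. lkp (sc (X $$ (l, a)) (mon (k, a, b))) (i, j, c)) =
      (\<Sum>a<N. if a = j then (if i = k \<and> c = b then X $$ (l, j) else 0) else 0)"
      by (intro sum.cong) (auto simp: lookup_single when_def)
    have "lkp ?y y = (if i < N \<and> j = l \<and> c = b then X $$ (i, k) else 0) -
        (if j < N \<and> i = k \<and> c = b then X $$ (l, j) else 0)"
      unfolding y lookup_minus lookup_sum 1 2 by simp
    moreover have "representation B (scale s b) c = (if c = b then s else 0)" for s
      using kl by (simp add: representation_scale[OF indep] span_B representation_basis[OF indep])
    ultimately show "lkp ?x y = lkp ?y y"
      using kl by (auto simp: y lookup_coN E representation_zero representation_diff[OF indep] span_B)
  qed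
  then show ?thesis
    by (simp add: dX_def gl.li_def lin_diffD[OF lin_lext] lin_sumD[OF lin_lext] lin_scD[OF lin_lext]
        del: Poly_Mapping.map_single)
qed

lemma U_ad_symbol:
  assumes "u \<in> carrier (U_gl scale N)"
  shows "U_ad scale N X u \<in> carrier (U_gl scale N)" "sgm N (U_ad scale N X u) = dX N X (sgm N u)"
  unfolding U_ad_def dX_def U_gl_eq
  by (rule gl.uea_deriv_symbol; use assms in \<open>simp add: ad_act_add ad_act_smult ad_act_mult U_gl_eq\<close>)+

lemma U_ad_zero_iff:
  assumes "u \<in> carrier (U_gl scale N)"
  shows "U_ad scale N X u = \<zero>\<^bsub>U_gl scale N\<^esub> \<longleftrightarrow> dX N X (sgm N u) = 0"
proof -
  have z: "\<zero>\<^bsub>U_gl scale N\<^esub> \<in> carrier (U_gl scale N)"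
    using ring.ring_simprules(2)[OF gl.U_ring] by (simp add: U_gl_eq)
  show ?thesis
    using U_ad_symbol[OF assms, of X] gl.symbol_inj[of "U_ad scale N X u" N "\<zero>\<^bsub>U_gl scale N\<^esub>"] z
    by (auto simp: U_gl_eq gl.symbol_zero)
qed

lemma A0_level_iff:
  "u \<in> A0_level scale N \<longleftrightarrow> u \<in> carrier (U_gl scale N) \<and> (\<forall>X\<in>carrier_mat N N. dX N X (sgm N u) = 0)"
  by (simp add: A0_level_def U_ad_zero_iff cong: conj_cong)

section \<open>The projection as a substitution\<close>

definition cutoff :: "nat \<Rightarrow> 'a gpoly \<Rightarrow> 'a gpoly" where
  "cutoff M = filter_mon (\<lambda>m. \<forall>(i, j, b)\<in>#m. i < M \<and> j < M)"

lemma lin_cutoff: "lin (cutoff M)" unfolding cutoff_def by (rule lin_filter_mon)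

lemma cutoff_mon: "cutoff M (mon m) = (if \<forall>(i, j, b)\<in>#m. i < M \<and> j < M then mon m else 0)"
  by (simp add: cutoff_def filter_mon_mon)

lemma cutoff_mult: "cutoff M (p * q) = cutoff M p * cutoff M q"
  by (rule lin_hom[OF lin_cutoff]) (auto simp: cutoff_mon mult_single)

lemma cutoff_one: "cutoff M 1 = 1"
  using cutoff_mon[of M 0] by simp

lemma cutoff_id: "p \<in> polys (ZN M) \<Longrightarrow> cutoff M p = p"
  unfolding cutoff_def by (rule filter_mon_pm_id) (auto simp: ZN_def)

lemma cutoff_polys: "p \<in> polys (ZN N) \<Longrightarrow> cutoff M p \<in> polys (ZN M)"
  by (auto simp: pm_iff cutoff_def lookup_filter_mon ZN_def subset_iff)

lemma cutoff_hom_part: "hom_part k (cutoff M p) = cutoff M (hom_part k p)"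
  by (rule poly_mapping_eqI) (simp add: hom_part_def cutoff_def lookup_filter_mon)

lemma corner_hom:
  assumes "N > 0"
  shows "pbw_hom (gl scale (N - 1)) (ZN (N - 1)) (eN (N - 1)) (coN (N - 1)) (*) comm_br
    (gl scale N) (ZN N) (eN N) (coN N) (*) comm_br (corner N)"
proof (unfold_locales)
  fix A C assume A: "A \<in> carrier (gl scale (N - 1))"
  show "corner N A \<in> carrier (gl scale N)" by (simp add: corner_def)
  show "corner N (c \<odot>\<^bsub>gl scale (N - 1)\<^esub> A) = c \<odot>\<^bsub>gl scale N\<^esub> corner N A" for c
    using A by (intro eq_matI) (auto simp: corner_def)
  show "coN N (corner N A) = coN (N - 1) A"
  proof (rule poly_mapping_eqI)
    fix y :: "nat \<times> nat \<times> 'a"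
    obtain i j c where "y = (i, j, c)" by (metis prod_cases3)
    then show "lkp (coN N (corner N A)) y = lkp (coN (N - 1) A) y"
      using A assms by (auto simp: lookup_coN corner_def representation_zero)
  qed
  assume C: "C \<in> carrier (gl scale (N - 1))"
  show "corner N (A \<oplus>\<^bsub>gl scale (N - 1)\<^esub> C) = corner N A \<oplus>\<^bsub>gl scale N\<^esub> corner N C"
    using A C by (intro eq_matI) (auto simp: corner_def)
  show "corner N (A * C) = corner N A * corner N C"
  proof (rule eq_matI)
    fix i l assume "i < dim_row (corner N A * corner N C)" "l < dim_col (corner N A * corner N C)"
    then have il: "i < N" "l < N" by (auto simp: corner_def)
    have "(corner N A * corner N C) $$ (i, l) = (\<Sum>k<N. corner N A $$ (i, k) * corner N C $$ (k, l))"
      using il by (subst index_mult_sum) (auto simp: corner_def)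
    also have "\<dots> = (\<Sum>k<N - 1. corner N A $$ (i, k) * corner N C $$ (k, l))"
      using il by (intro sum.mono_neutral_right) (auto simp: corner_def)
    also have "\<dots> = (\<Sum>k<N - 1. if i < N - 1 \<and> l < N - 1 then A $$ (i, k) * C $$ (k, l) else 0)"
      using il by (intro sum.cong) (auto simp: corner_def)
    also have "\<dots> = corner N (A * C) $$ (i, l)"
      using il A C by (auto simp: corner_def index_mult_sum simp del: index_mult_mat(1))
    finally show "corner N (A * C) $$ (i, l) = (corner N A * corner N C) $$ (i, l)" by simp
  qed (auto simp: corner_def)
next
  fix z assume "z \<in> ZN (N - 1)"
  then show "eN N z = corner N (eN (N - 1) z)"
    by (intro eq_matI) (auto simp: eN_def ZN_def corner_def)
qed

lemma U_incl_symbol: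
  assumes "N > 0" "v \<in> carrier (U_gl scale (N - 1))"
  shows "U_incl scale N v \<in> carrier (U_gl scale N)" "sgm N (U_incl scale N v) = sgm (N - 1) v"
  using pbw_hom.uea_hom_symbol[OF corner_hom[OF assms(1)]] assms(2) by (simp_all add: U_gl_eq U_incl_def)

text \<open>Left multiplication preserves the matrices supported in the last column, so
  \<open>gl.left_ideal_symbol\<close> applies with \<open>C\<close> the set of variables of that
  column.\<close>

lemma I_plus_iff:
  assumes "N > 0"
  shows "u \<in> I_plus scale N \<longleftrightarrow> u \<in> carrier (U_gl scale N) \<and>
    sgm N u \<in> varideal {(i, j, b). i < N \<and> j < N \<and> b \<in> B \<and> j = N - 1}"
proof -
  let ?S = "{E_mat N i (N - 1) x | i x. i < N}"
  let ?C = "{(i, j, b). i < N \<and> j < N \<and> b \<in> B \<and> j = N - 1}"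
  have "{u \<otimes>\<^bsub>U_gl scale N\<^esub> uea_mon (gl scale N) comm_br [E_mat N i (N - 1) x] | u i x.
        u \<in> carrier (U_gl scale N) \<and> i < N} =
      {u \<otimes>\<^bsub>gl.U N\<^esub> uea_mon (gl scale N) comm_br [s] | u s. u \<in> carrier (gl.U N) \<and> s \<in> ?S}"
    by (auto simp: U_gl_eq)
  moreover have "lin_span (gl.U N) {u \<otimes>\<^bsub>gl.U N\<^esub> uea_mon (gl scale N) comm_br [s] | u s.
      u \<in> carrier (gl.U N) \<and> s \<in> ?S} = {u \<in> carrier (gl.U N). sgm N u \<in> varideal ?C}"
  proof (rule gl.left_ideal_symbol)
    show "?C \<subseteq> ZN N" by (auto simp: ZN_def)
    show "?S \<subseteq> carrier (gl scale N)" by auto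
    show "coN N s \<in> pm ?C" if "s \<in> ?S" for s
      using that by (intro coN_pm) auto
    show "eN N ` ?C \<subseteq> ?S" by (auto simp: eN_def)
    show "coN N (A * eN N z) \<in> pm ?C" if "A \<in> carrier (gl scale N)" "z \<in> ?C" for A z
      using that by (intro coN_pm) (auto simp: eN_def index_mult_sum simp del: index_mult_mat(1) intro!: sum.neutral)
  qed
  ultimately show ?thesis by (simp add: I_plus_def U_gl_eq)
qed

text \<open>Right multiplication preserves the matrices supported in the last row, so
  \<open>gl.right_ideal_symbol\<close> applies with the variables of that row.\<close>

lemma I_minus_iff:
  assumes "N > 0"
  shows "u \<in> I_minus scale N \<longleftrightarrow> u \<in> carrier (U_gl scale N) \<and>
    sgm N u \<in> varideal {(i, j, b). i < N \<and> j < N \<and> b \<in> B \<and> i = N - 1}"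
proof -
  let ?S = "{E_mat N (N - 1) j x | j x. j < N}"
  let ?C = "{(i, j, b). i < N \<and> j < N \<and> b \<in> B \<and> i = N - 1}"
  have "{uea_mon (gl scale N) comm_br [E_mat N (N - 1) j x] \<otimes>\<^bsub>U_gl scale N\<^esub> u | u j x.
        u \<in> carrier (U_gl scale N) \<and> j < N} =
      {uea_mon (gl scale N) comm_br [s] \<otimes>\<^bsub>gl.U N\<^esub> u | u s. u \<in> carrier (gl.U N) \<and> s \<in> ?S}"
    by (auto simp: U_gl_eq)
  moreover have "lin_span (gl.U N) {uea_mon (gl scale N) comm_br [s] \<otimes>\<^bsub>gl.U N\<^esub> u | u s.
      u \<in> carrier (gl.U N) \<and> s \<in> ?S} = {u \<in> carrier (gl.U N). sgm N u \<in> varideal ?C}"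
  proof (rule gl.right_ideal_symbol)
    show "?C \<subseteq> ZN N" by (auto simp: ZN_def)
    show "?S \<subseteq> carrier (gl scale N)" by auto
    show "coN N s \<in> pm ?C" if "s \<in> ?S" for s
      using that by (intro coN_pm) auto
    show "eN N ` ?C \<subseteq> ?S" by (auto simp: eN_def)
    show "coN N (s * A) \<in> pm ?C" if "s \<in> ?S" "A \<in> carrier (gl scale N)" for s A
      using that by (intro coN_pm) (auto simp: index_mult_sum simp del: index_mult_mat(1) intro!: sum.neutral)
  qed
  ultimately show ?thesis by (simp add: I_minus_def U_gl_eq)
qed

text \<open>The eigenvalue of the diagonal matrix unit with index \<open>n\<close> on the monomial
  \<open>m\<close>.\<close>

definition wt :: "nat \<Rightarrow> (nat \<times> nat \<times> 'a) multiset \<Rightarrow> complex" where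
  "wt n m = (\<Sum>(i, j, b)\<in>#m. of_bool (i = n) - of_bool (j = n))"

lemma dX_diag:
  assumes "n < N" "p \<in> polys (ZN N)"
  shows "lkp (dX N (E_mat N n n 1) p) m = wt n m * lkp p m"
  using assms(2)
proof (induction rule: pm_induct)
  case zero
  show ?case by (simp add: lin_0[OF lin_dX])
next
  case (add p q)
  then show ?case by (simp add: lin_addD[OF lin_dX] lookup_add algebra_simps)
next
  case (mon c w)
  have v: "gl.li N (ad_act scale N (E_mat N n n 1) (eN N z)) =
      (case z of (i, j, b) \<Rightarrow> sc (of_bool (i = n) - of_bool (j = n)) (var z))" if "z \<in> ZN N" for z
  proof -
    obtain i j b where z: "z = (i, j, b)" by (metis prod_cases3)
    have ij: "i < N" "j < N" using that z by (auto simp: ZN_def)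
    have 1: "(\<Sum>a<N. sc (E_mat N n n 1 $$ (a, i)) (var (a, j, b))) =
        (\<Sum>a<N. if a = n then (if i = n then var (n, j, b) else 0) else 0)"
      using ij assms(1) by (intro sum.cong) auto
    have 2: "(\<Sum>a<N. sc (E_mat N n n 1 $$ (j, a)) (var (i, a, b))) =
        (\<Sum>a<N. if a = n then (if j = n then var (i, n, b) else 0) else 0)"
      using ij assms(1) by (intro sum.cong) auto
    have "dX N (E_mat N n n 1) (var z) =
       (if i = n then var (n, j, b) else 0) - (if j = n then var (i, n, b) else 0)"
      unfolding z using that z assms(1) unfolding dX_var[OF that[unfolded z]] 1 2 by simp
    then have "gl.li N (ad_act scale N (E_mat N n n 1) (eN N z)) =
       (if i = n then var (n, j, b) else 0) - (if j = n then var (i, n, b) else 0)"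
      by (simp add: dX_def)
    also have "\<dots> = sc (of_bool (i = n) - of_bool (j = n)) (var z)"
      by (auto simp: z single_uminus)
    finally show ?thesis by (simp add: z)
  qed
  have "dX N (E_mat N n n 1) (mon w) =
    (\<Sum>z\<in>#w. (case z of (i, j, b) \<Rightarrow> sc (of_bool (i = n) - of_bool (j = n)) (mon w)))"
    unfolding dX_def dv_mon
  proof (intro arg_cong[where f = sum_mset] image_mset_cong)
    fix z assume z: "z \<in># w"
    then have "var z * mon (w - {#z#}) = mon w" by (simp add: mult_single)
    then show "gl.li N (ad_act scale N (E_mat N n n 1) (eN N z)) * mon (w - {#z#}) =
      (case z of (i, j, b) \<Rightarrow> sc (of_bool (i = n) - of_bool (j = n)) (mon w))"
      using v[of z] z mon
      by (auto simp: sc_mult_left subset_iff split: prod.splits simp del: Poly_Mapping.map_single)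
  qed
  also have "(\<Sum>z\<in>#k. (case z of (i, j, b) \<Rightarrow> sc (of_bool (i = n) - of_bool (j = n)) (mon w))) =
      sc (wt n k) (mon w)" for k :: "(nat \<times> nat \<times> 'a) multiset"
    unfolding wt_def by (induction k) (auto simp: sc_add_left simp del: Poly_Mapping.map_single)
  finally have d: "dX N (E_mat N n n 1) (mon w) = sc (wt n w) (mon w)" .
  show ?case
    unfolding lin_scD[OF lin_dX] d by (auto simp: lookup_single when_def)
qed

text \<open>The weight is the number of occurrences of \<open>n\<close> as a row index minus that as
  a column index. For weight 0 both numbers vanish or neither does, and so \<open>I_plus\<close> and
  \<open>I_minus\<close> cut out the same elements of \<open>U_E\<close>.\<close>

lemma wt_zero:
  assumes "wt n m = 0"
  shows "(\<exists>i b. (i, n, b) \<in># m) \<longleftrightarrow> (\<exists>j b. (n, j, b) \<in># m)"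
proof -
  have r: "(\<Sum>(i, j, b)\<in>#m. (of_bool (i = n) :: complex)) = of_nat (size (filter_mset (\<lambda>(i, j, b). i = n) m))"
    by (induction m) auto
  have c: "(\<Sum>(i, j, b)\<in>#m. (of_bool (j = n) :: complex)) = of_nat (size (filter_mset (\<lambda>(i, j, b). j = n) m))"
    by (induction m) auto
  have "wt n m = (\<Sum>(i, j, b)\<in>#m. of_bool (i = n)) - (\<Sum>(i, j, b)\<in>#m. of_bool (j = n))"
    unfolding wt_def by (induction m) auto
  then have e: "size (filter_mset (\<lambda>(i, j, b). i = n) m) = size (filter_mset (\<lambda>(i, j, b). j = n) m)"
    using assms unfolding r c by simp
  have ne: "(\<exists>z\<in>#m. P z) \<longleftrightarrow> size (filter_mset P m) \<noteq> 0" for P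
    by (induction m) auto
  have "(\<exists>z\<in>#m. case z of (i, j, b) \<Rightarrow> i = n) \<longleftrightarrow> (\<exists>z\<in>#m. case z of (i, j, b) \<Rightarrow> j = n)"
    unfolding ne e ..
  moreover have "(\<exists>z\<in>#m. case z of (i, j, b) \<Rightarrow> i = n) \<longleftrightarrow> (\<exists>j b. (n, j, b) \<in># m)"
    "(\<exists>z\<in>#m. case z of (i, j, b) \<Rightarrow> j = n) \<longleftrightarrow> (\<exists>i b. (i, n, b) \<in># m)" by force+
  ultimately show ?thesis by blast
qed

lemma U_E_iff:
  assumes "N > 0"
  shows "u \<in> U_E scale N \<longleftrightarrow> u \<in> carrier (U_gl scale N) \<and>
    (\<forall>m\<in>keys (sgm N u). wt (N - 1) m = 0)"
proof -
  have "dX N (E_mat N (N - 1) (N - 1) 1) p = 0 \<longleftrightarrow> (\<forall>m\<in>keys p. wt (N - 1) m = 0)"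
    if "p \<in> polys (ZN N)" for p
    using dX_diag[of "N - 1" N p] that assms
    by (auto simp: poly_mapping_eq_iff fun_eq_iff in_keys_iff)
  moreover have "u \<in> carrier (U_gl scale N) \<Longrightarrow> sgm N u \<in> polys (ZN N)"
    by (simp add: U_gl_eq gl.symbol_polys)
  ultimately show ?thesis
    by (simp add: U_E_def U_ad_zero_iff cong: conj_cong)
qed

lemma A0_level_U_E: "N > 0 \<Longrightarrow> A0_level scale N \<subseteq> U_E scale N"
  by (auto simp: A0_level_def U_E_def)

text \<open>The element of the smaller algebra with the truncated symbol satisfies the defining
  condition of \<open>proj\<close>, by the description of the ideals in terms of monomials. It is
  the only one, since the symbols of elements of \<open>L_ideal\<close> contain no monomial free of
  the index \<open>N - 1\<close>.\<close>

lemma proj_symbol: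
  assumes N: "N > 0" and u: "u \<in> U_E scale N"
  shows "proj scale N u \<in> carrier (U_gl scale (N - 1))"
    "sgm (N - 1) (proj scale N u) = cutoff (N - 1) (sgm N u)"
    "u \<ominus>\<^bsub>U_gl scale N\<^esub> U_incl scale N (proj scale N u) \<in> L_ideal scale N"
proof -
  have uc: "u \<in> carrier (U_gl scale N)" using u by (simp add: U_E_def)
  have up: "sgm N u \<in> polys (ZN N)" using uc by (simp add: gl.symbol_polys U_gl_eq)
  let ?P = "\<lambda>v. v \<in> carrier (U_gl scale (N - 1)) \<and>
     u \<ominus>\<^bsub>U_gl scale N\<^esub> U_incl scale N v \<in> L_ideal scale N"
  let ?C = "{(i, j, b). i < N \<and> j < N \<and> b \<in> B \<and> j = N - 1}"
  let ?R = "{(i, j, b). i < N \<and> j < N \<and> b \<in> B \<and> i = N - 1}"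
  have diff: "u \<ominus>\<^bsub>U_gl scale N\<^esub> U_incl scale N v \<in> carrier (U_gl scale N)"
    "sgm N (u \<ominus>\<^bsub>U_gl scale N\<^esub> U_incl scale N v) = sgm N u - sgm (N - 1) v"
    if "v \<in> carrier (U_gl scale (N - 1))" for v
    using U_incl_symbol[OF N that] uc gl.symbol_minus[of u N "U_incl scale N v"]
      abelian_group.minus_closed[OF ring.is_abelian_group[OF gl.U_ring[of N]], of u "U_incl scale N v"]
    by (simp_all add: U_gl_eq)
  have P1: "sgm (N - 1) v = cutoff (N - 1) (sgm N u)" if v: "?P v" for v
  proof -
    have "sgm N u - sgm (N - 1) v \<in> varideal ?C"
      using v by (auto simp: L_ideal_def I_plus_iff[OF N] diff)
    then have "cutoff (N - 1) (sgm N u - sgm (N - 1) v) = 0"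
      unfolding cutoff_def by (rule filter_mon_pm_zero) force
    moreover have "sgm (N - 1) v \<in> polys (ZN (N - 1))" using v by (simp add: gl.symbol_polys U_gl_eq)
    ultimately show ?thesis by (simp add: lin_diffD[OF lin_cutoff] cutoff_id)
  qed
  obtain v where v: "v \<in> carrier (U_gl scale (N - 1))" "sgm (N - 1) v = cutoff (N - 1) (sgm N u)"
    using gl.symbol_onto[OF cutoff_polys[OF up]] by (auto simp: U_gl_eq)
  have Pv: "?P v"
  proof
    let ?d = "u \<ominus>\<^bsub>U_gl scale N\<^esub> U_incl scale N v"
    let ?p = "sgm N u - cutoff (N - 1) (sgm N u)"
    have d: "?d \<in> carrier (U_gl scale N)" "sgm N ?d = ?p" using diff[OF v(1)] v(2) by auto
    have k: "m \<in> keys (sgm N u)" "\<not> (\<forall>(i, j, b)\<in>#m. i < N - 1 \<and> j < N - 1)" if "m \<in> keys ?p" for m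
      using that by (auto simp: in_keys_iff lookup_minus cutoff_def lookup_filter_mon split: if_splits)
    have w: "wt (N - 1) m = 0" if "m \<in> keys ?p" for m
      using k(1)[OF that] u by (auto simp: U_E_iff[OF N])
    \<comment> \<open>A monomial removed by \<open>cutoff\<close> contains the index
      \<open>N - 1\<close> as row or column; weight 0 then provides the other occurrence.\<close>
    have "(\<exists>i b. (i, N - 1, b) \<in># m) \<and> (\<exists>j b. (N - 1, j, b) \<in># m) \<and> set_mset m \<subseteq> ZN N"
      if m: "m \<in> keys ?p" for m
    proof -
      have s: "set_mset m \<subseteq> ZN N" using k(1)[OF m] up by (auto simp: pm_def)
      obtain i j b where ij: "(i, j, b) \<in># m" "\<not> (i < N - 1 \<and> j < N - 1)" using k(2)[OF m] by auto
      then have "(i, j, b) \<in> ZN N" using s by blast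
      then have "i < N" "j < N" by (simp_all add: ZN_def)
      then have "i = N - 1 \<or> j = N - 1" using ij(2) by linarith
      then show ?thesis using wt_zero[OF w[OF m]] ij(1) s by blast
    qed
    then have "?p \<in> varideal ?C" "?p \<in> varideal ?R"
      unfolding pm_def ZN_def by (blast, blast)
    then show "?d \<in> L_ideal scale N"
      using d w by (auto simp: L_ideal_def I_plus_iff[OF N] I_minus_iff[OF N] U_E_iff[OF N])
  qed (rule v)
  have "proj scale N u = v"
    unfolding proj_def
  proof (rule the_equality)
    show "?P v" by (rule Pv)
    show "v' = v" if "?P v'" for v'
      using P1[OF that] v that gl.symbol_inj[of v' "N - 1" v] by (simp add: U_gl_eq)
  qed
  with v Pv show "proj scale N u \<in> carrier (U_gl scale (N - 1))"
    "sgm (N - 1) (proj scale N u) = cutoff (N - 1) (sgm N u)"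
    "u \<ominus>\<^bsub>U_gl scale N\<^esub> U_incl scale N (proj scale N u) \<in> L_ideal scale N" by auto
qed

end

section \<open>Necklaces and traces\<close>

definition necklace :: "'a list \<Rightarrow> 'a list set" where
  "necklace w = range (\<lambda>k. rotate k w)"

text \<open>The empty word must be left out: its trace is the constant \<open>N\<close>, which is
  not compatible with truncation to lower levels.\<close>

definition necklaces :: "'a set \<Rightarrow> 'a list set set" where
  "necklaces B = necklace ` {w. w \<noteq> [] \<and> set w \<subseteq> B}"

primrec path :: "nat \<Rightarrow> 'a list \<Rightarrow> nat \<Rightarrow> nat \<Rightarrow> 'a gpoly" where
  "path N [] i j = (if i = j then 1 else 0)"
| "path N (b # w) i j = (\<Sum>k<N. var (i, k, b) * path N w k j)"

text \<open>\<open>path N w\<close> is the product of the generic matrices \<open>(var (i, j, b))\<^sub>i\<^sub>j\<close>, for \<open>b\<close> in \<open>w\<close>, and \<open>trace\<close>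
  its trace.\<close>

definition trace :: "nat \<Rightarrow> 'a list \<Rightarrow> 'a gpoly" where
  "trace N w = (\<Sum>i<N. path N w i i)"

lemma path_append: "i < N \<Longrightarrow> path N (u @ v) i j = (\<Sum>k<N. path N u i k * path N v k j)"
proof (induction u arbitrary: i)
  case Nil
  have "(\<Sum>k<N. path N [] i k * path N v k j) = (\<Sum>k<N. if k = i then path N v i j else 0)"
    by (intro sum.cong) auto
  then show ?case using Nil by simp
next
  case (Cons b u)
  have "path N ((b # u) @ v) i j = (\<Sum>l<N. \<Sum>k<N. var (i, l, b) * (path N u l k * path N v k j))"
    using Cons by (simp add: sum_distrib_left)
  also have "\<dots> = (\<Sum>k<N. \<Sum>l<N. var (i, l, b) * (path N u l k * path N v k j))"
    by (rule sum.swap)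
  finally show ?case by (simp add: sum_distrib_right mult.assoc)
qed

lemma trace_append: "trace N (u @ v) = trace N (v @ u)"
proof -
  have "trace N (u @ v) = (\<Sum>i<N. \<Sum>k<N. path N u i k * path N v k i)"
    by (simp add: trace_def path_append)
  also have "\<dots> = (\<Sum>k<N. \<Sum>i<N. path N u i k * path N v k i)"
    by (rule sum.swap)
  finally show ?thesis by (simp add: trace_def path_append mult.commute)
qed

lemma trace_rotate: "trace N (rotate k w) = trace N w"
  unfolding rotate_drop_take by (subst trace_append) simp

lemma necklace_self: "w \<in> necklace w"
  unfolding necklace_def by (rule range_eqI[of _ _ 0]) simp

lemma necklace_iff: "v \<in> necklace w \<longleftrightarrow> (\<exists>k. v = rotate k w)"
  by (auto simp: necklace_def)

lemma necklace_rotate: "necklace (rotate k w) = necklace w"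
proof
  show "necklace (rotate k w) \<subseteq> necklace w"
    unfolding necklace_def by (auto simp: rotate_rotate)
  show "necklace w \<subseteq> necklace (rotate k w)"
  proof
    fix v assume "v \<in> necklace w"
    then obtain l where l: "v = rotate l w" by (auto simp: necklace_iff)
    \<comment> \<open>The part of the exponent in parentheses completes the rotation by
      \<open>k\<close> to a multiple of the length.\<close>
    have "rotate (l + (length w - k mod length w)) (rotate k w) = rotate l w"
    proof (cases "w = []")
      case False
      have "(L - r) + (L * d + r) = L * (1 + d)" if "r < L" for L r d :: nat
        using that by simp
      from this[of "k mod length w" "length w" "k div length w"] False
      have "(length w - k mod length w) + k = length w * (1 + k div length w)"
        by simp
      then have "rotate ((length w - k mod length w) + k) w = w"
        by (simp add: rotate_id)
      then show ?thesis by (simp add: rotate_rotate[symmetric])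
    qed simp
    then show "v \<in> necklace (rotate k w)" unfolding necklace_iff l by metis
  qed
qed

lemma some_necklace: "\<exists>k. (SOME v. v \<in> necklace w) = rotate k w"
  using someI[of "\<lambda>v. v \<in> necklace w", OF necklace_self] by (simp add: necklace_iff)

text \<open>The choice of the representative does not matter by \<open>trace_rotate\<close>.\<close>

definition tr :: "nat \<Rightarrow> 'a list set \<Rightarrow> 'a gpoly" where
  "tr N z = trace N (SOME w. w \<in> z)"

definition nlen :: "'a list set \<Rightarrow> nat" where
  "nlen z = length (SOME w. w \<in> z)"

lemma tr_necklace: "tr N (necklace w) = trace N w"
  using some_necklace[of w] by (auto simp: tr_def trace_rotate)

lemma nlen_necklace: "nlen (necklace w) = length w"
  using some_necklace[of w] by (auto simp: nlen_def)

definition weight :: "'a list set multiset \<Rightarrow> nat" where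
  "weight \<mu> = (\<Sum>z\<in>#\<mu>. nlen z)"

text \<open>In terms of the basis of necklaces, the component of degree \<open>k\<close> of the
  symmetric algebra of the cyclic coinvariants.\<close>

abbreviation NP :: "'a set \<Rightarrow> nat \<Rightarrow> ('a list set multiset \<Rightarrow>\<^sub>0 complex) set" where
  "NP B k \<equiv> pm {\<mu>. set_mset \<mu> \<subseteq> necklaces B \<and> weight \<mu> = k}"

definition TN :: "nat \<Rightarrow> ('a list set multiset \<Rightarrow>\<^sub>0 complex) \<Rightarrow> 'a gpoly" where
  "TN N = poly_eval (tr N)"

lemma lin_TN: "lin (TN N)" unfolding TN_def by (rule lin_poly_eval)
lemma TN_mult: "TN N (p * q) = TN N p * TN N q" unfolding TN_def by (rule poly_eval_mult)
lemma TN_one: "TN N 1 = 1" unfolding TN_def by (rule poly_eval_one)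
lemma TN_mon: "TN N (mon \<mu>) = (\<Prod>z\<in>#\<mu>. tr N z)" by (simp add: TN_def poly_eval_mon)
lemma TN_necklace: "TN N (var (necklace w)) = trace N w" by (simp add: TN_mon tr_necklace)

lemma NP_mult: "p \<in> NP B k \<Longrightarrow> q \<in> NP B l \<Longrightarrow> p * q \<in> NP B (k + l)"
  by (erule pm_mult) (auto simp: weight_def)

lemma NP_one: "1 \<in> NP B 0"
  by (simp add: weight_def)

lemma NP_necklace: "w \<noteq> [] \<Longrightarrow> set w \<subseteq> B \<Longrightarrow> var (necklace w) \<in> NP B (length w)"
  by (auto simp: necklaces_def weight_def nlen_necklace)

text \<open>The weight is an argument of \<open>Q\<close>, as it changes in the step that multiplies
  by a necklace.\<close>

lemma NP_induct [consumes 1, case_names zero add sc one necklace]: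
  assumes "s \<in> NP B k" "\<And>k. Q k 0" "\<And>k p q. Q k p \<Longrightarrow> Q k q \<Longrightarrow> Q k (p + q)" "\<And>k c p. Q k p \<Longrightarrow> Q k (sc c p)"
    "Q 0 1" "\<And>k w p. w \<noteq> [] \<Longrightarrow> set w \<subseteq> B \<Longrightarrow> Q k p \<Longrightarrow> Q (length w + k) (var (necklace w) * p)"
  shows "Q k s"
  using assms(1)
proof (induction rule: pm_induct)
  case (mon c \<mu>)
  have "Q (weight \<mu>) (mon \<mu>)" if "set_mset \<mu> \<subseteq> necklaces B" for \<mu>
    using that
  proof (induction \<mu>)
    case empty
    show ?case using assms(5) single_one[where 'a = "'a list set multiset" and 'b = complex] by (simp add: weight_def)
  next
    case (add z \<mu>)
    then obtain w where w: "z = necklace w" "w \<noteq> []" "set w \<subseteq> B" by (auto simp: necklaces_def)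
    have "weight (add_mset z \<mu>) = length w + weight \<mu>" by (simp add: weight_def w nlen_necklace)
    moreover have "mon (add_mset z \<mu>) = var (necklace w) * mon \<mu>" by (simp add: mult_single w)
    ultimately show ?case using assms(6)[OF w(2,3)] add by simp
  qed
  then show ?case using mon assms(4) by blast
qed (use assms in auto)

section \<open>Invariance and stability of traces\<close>

context omega_basis
begin

lemma path_homog: "set w \<subseteq> B \<Longrightarrow> i < N \<Longrightarrow> j < N \<Longrightarrow>
    path N w i j \<in> pm {m. set_mset m \<subseteq> ZN N \<and> size m = length w}"
proof (induction w arbitrary: i)
  case (Cons b w)
  have "var (i, k, b) * path N w k j \<in> pm {m. set_mset m \<subseteq> ZN N \<and> size m = length (b # w)}" if "k < N" for k
    by (rule pm_mult[of _ "{m. set_mset m \<subseteq> ZN N \<and> size m = 1}", OF _ Cons.IH])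
      (use that Cons in \<open>auto simp: ZN_def\<close>)
  then show ?case by (auto intro!: pm_sum)
qed auto

lemma trace_homog: "set w \<subseteq> B \<Longrightarrow> trace N w \<in> pm {m. set_mset m \<subseteq> ZN N \<and> size m = length w}"
  unfolding trace_def by (intro pm_sum path_homog) auto

lemma TN_homog: "s \<in> NP B k \<Longrightarrow> TN N s \<in> pm {m. set_mset m \<subseteq> ZN N \<and> size m = k}"
proof (induction rule: NP_induct)
  case (necklace k w p)
  then show ?case
    by (auto simp: TN_mult TN_necklace intro!: pm_mult[OF trace_homog necklace(3)])
qed (auto simp: lin_0[OF lin_TN] lin_addD[OF lin_TN] lin_scD[OF lin_TN] TN_one)

lemma dX_sum: "dX N X (sum f A) = (\<Sum>a\<in>A. dX N X (f a))"
  by (rule lin_sumD[OF lin_dX])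

lemma dX_one: "dX N X 1 = 0" unfolding dX_def by (rule dv_one)

text \<open>The entries of a product of generic matrices transform like those of a single one: by
  the Leibniz rule the variations at each inner index cancel, and only those at the two ends
  remain.\<close>

lemma dX_path:
  assumes "set w \<subseteq> B" "i < N" "j < N"
  shows "dX N X (path N w i j) =
    (\<Sum>a<N. sc (X $$ (a, i)) (path N w a j)) - (\<Sum>a<N. sc (X $$ (j, a)) (path N w i a))"
  using assms
proof (induction w arbitrary: i)
  case Nil
  have "(\<Sum>a<N. sc (X $$ (a, i)) (path N [] a j)) = (\<Sum>a<N. if a = j then sc (X $$ (j, i)) 1 else (0 :: 'a gpoly))"
    by (intro sum.cong) auto
  moreover have "(\<Sum>a<N. sc (X $$ (j, a)) (path N [] i a)) = (\<Sum>a<N. if a = i then sc (X $$ (j, i)) 1 else (0 :: 'a gpoly))"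
    by (intro sum.cong) auto
  ultimately show ?case using Nil by (auto simp: dX_one lin_0[OF lin_dX])
next
  case (Cons b w)
  let ?P = "\<lambda>k. path N w k j"
  have v: "dX N X (var (i, k, b)) = (\<Sum>a<N. sc (X $$ (a, i)) (var (a, k, b))) - (\<Sum>a<N. sc (X $$ (k, a)) (var (i, a, b)))"
    if "k < N" for k
    using Cons that by (intro dX_var) (auto simp: ZN_def)
  let ?S1 = "\<Sum>k<N. \<Sum>a<N. sc (X $$ (a, i)) (var (a, k, b) * ?P k)"
  let ?S2 = "\<Sum>k<N. \<Sum>a<N. sc (X $$ (k, a)) (var (i, a, b) * ?P k)"
  let ?S3 = "\<Sum>k<N. \<Sum>a<N. sc (X $$ (a, k)) (var (i, k, b) * ?P a)"
  let ?S4 = "\<Sum>k<N. \<Sum>a<N. sc (X $$ (j, a)) (var (i, k, b) * path N w k a)"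
  have "dX N X (path N (b # w) i j) = (\<Sum>k<N. dX N X (var (i, k, b)) * ?P k + var (i, k, b) * dX N X (?P k))"
    by (simp add: dX_sum dX_mult)
  also have "\<dots> = (\<Sum>k<N.
      ((\<Sum>a<N. sc (X $$ (a, i)) (var (a, k, b) * ?P k)) - (\<Sum>a<N. sc (X $$ (k, a)) (var (i, a, b) * ?P k))) +
      ((\<Sum>a<N. sc (X $$ (a, k)) (var (i, k, b) * ?P a)) - (\<Sum>a<N. sc (X $$ (j, a)) (var (i, k, b) * path N w k a))))"
    using Cons
    by (intro sum.cong)
      (simp_all add: v left_diff_distrib right_diff_distrib sum_distrib_left sum_distrib_right sc_mult_left sc_mult_right
        del: Poly_Mapping.map_single)
  also have "\<dots> = (?S1 - ?S2) + (?S3 - ?S4)"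
    by (simp only: sum.distrib sum_subtractf)
  \<comment> \<open>The column variation of the first letter cancels the row variation of the rest
    of the path.\<close>
  also have "?S2 = ?S3" by (rule sum.swap)
  finally have "dX N X (path N (b # w) i j) = ?S1 - ?S4" by simp
  also have "?S1 = (\<Sum>a<N. sc (X $$ (a, i)) (path N (b # w) a j))"
    by (subst sum.swap) (simp add: sc_sum)
  also have "?S4 = (\<Sum>a<N. sc (X $$ (j, a)) (path N (b # w) i a))"
    by (subst sum.swap) (simp add: sc_sum)
  finally show ?case .
qed

lemma dX_trace: "set w \<subseteq> B \<Longrightarrow> dX N X (trace N w) = 0"
proof -
  assume w: "set w \<subseteq> B"
  have "dX N X (trace N w) = (\<Sum>i<N. \<Sum>a<N. sc (X $$ (a, i)) (path N w a i)) - (\<Sum>i<N. \<Sum>a<N. sc (X $$ (i, a)) (path N w i a))"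
    using w by (simp add: trace_def dX_sum dX_path sum_subtractf)
  also have "(\<Sum>i<N. \<Sum>a<N. sc (X $$ (a, i)) (path N w a i)) = (\<Sum>i<N. \<Sum>a<N. sc (X $$ (i, a)) (path N w i a))"
    by (rule sum.swap)
  finally show ?thesis by simp
qed

lemma dX_TN: "s \<in> NP B k \<Longrightarrow> dX N X (TN N s) = 0"
  by (induction rule: NP_induct)
    (auto simp: lin_0[OF lin_TN] lin_addD[OF lin_TN] lin_scD[OF lin_TN] TN_one TN_mult TN_necklace
      lin_0[OF lin_dX] lin_addD[OF lin_dX] lin_scD[OF lin_dX] dX_one dX_mult dX_trace)

lemma cutoff_var: "cutoff M (var (i, k, b)) = (if i < M \<and> k < M then var (i, k, b) else 0)"
  by (simp add: cutoff_mon)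

lemma cutoff_path:
  assumes "M \<le> N" "i < M" "j < M"
  shows "cutoff M (path N w i j) = path M w i j"
  using assms(2)
proof (induction w arbitrary: i)
  case (Cons b w)
  have "cutoff M (path N (b # w) i j) = (\<Sum>k<N. cutoff M (var (i, k, b)) * cutoff M (path N w k j))"
    by (simp add: lin_sumD[OF lin_cutoff] cutoff_mult)
  also have "\<dots> = (\<Sum>k<M. cutoff M (var (i, k, b)) * cutoff M (path N w k j))"
    using assms by (intro sum.mono_neutral_right) (auto simp: cutoff_var)
  also have "\<dots> = path M (b # w) i j"
    using Cons by (simp add: cutoff_var)
  finally show ?case .
qed (auto simp: cutoff_one lin_0[OF lin_cutoff])

text \<open>A path from \<open>i \<ge> M\<close> has a first variable with row index
  \<open>i\<close> and is removed entirely. For the empty word there is no such variable.\<close>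

lemma cutoff_trace:
  assumes "M \<le> N" "w \<noteq> []"
  shows "cutoff M (trace N w) = trace M w"
proof -
  have 0: "cutoff M (path N w i j) = 0" if "\<not> i < M" for i j
    using assms(2) that by (cases w) (auto simp: lin_sumD[OF lin_cutoff] cutoff_mult cutoff_var)
  have "cutoff M (trace N w) = (\<Sum>i<N. cutoff M (path N w i i))"
    by (simp add: trace_def lin_sumD[OF lin_cutoff])
  also have "\<dots> = (\<Sum>i<M. cutoff M (path N w i i))"
    using assms 0 by (intro sum.mono_neutral_right) auto
  also have "\<dots> = trace M w" using assms by (simp add: trace_def cutoff_path)
  finally show ?thesis .
qed

lemma cutoff_TN: "s \<in> NP B k \<Longrightarrow> M \<le> N \<Longrightarrow> cutoff M (TN N s) = TN M s"
  by (induction rule: NP_induct)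
    (auto simp: lin_0[OF lin_TN] lin_addD[OF lin_TN] lin_scD[OF lin_TN] TN_one TN_mult TN_necklace
      lin_0[OF lin_cutoff] lin_addD[OF lin_cutoff] lin_scD[OF lin_cutoff] cutoff_one cutoff_mult cutoff_trace)

end

section \<open>Asymptotic independence of traces\<close>

text \<open>The monomials of a product of traces are disjoint unions of closed walks.  If no vertex is
  visited twice, these walks can be read off from the monomial.\<close>

primrec walk :: "nat \<Rightarrow> (nat \<times> 'a) list \<Rightarrow> (nat \<times> nat \<times> 'a) multiset" where
  "walk i [] = {#}"
| "walk i (kb # ps) = add_mset (i, fst kb, snd kb) (walk (fst kb) ps)"

abbreviation Ln :: "'b set \<Rightarrow> nat \<Rightarrow> 'b list set" where
  "Ln A n \<equiv> {xs. set xs \<subseteq> A \<and> length xs = n}"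

lemma sum_lists_Suc:
  fixes F :: "'b list \<Rightarrow> 'c::comm_monoid_add"
  shows "(\<Sum>xs\<in>Ln A (Suc n). F xs) = (\<Sum>x\<in>A. \<Sum>xs\<in>Ln A n. F (x # xs))"
proof -
  have "Ln A (Suc n) = (\<lambda>(x, xs). x # xs) ` (A \<times> Ln A n)"
    by (auto simp: length_Suc_conv image_iff)
  then have "(\<Sum>xs\<in>Ln A (Suc n). F xs) = (\<Sum>(x, xs)\<in>A \<times> Ln A n. F (x # xs))"
    by (simp add: sum.reindex inj_on_def case_prod_unfold)
  then show ?thesis by (simp add: sum.cartesian_product)
qed

lemma Ln_zero: "Ln A 0 = {[]}"
  by auto

lemma path_walks:
  "i < N \<Longrightarrow> path N w i j = (\<Sum>js\<in>Ln {..<N} (length w). if last (i # js) = j then mon (walk i (zip js w)) else 0)"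
proof (induction w arbitrary: i)
  case Nil
  show ?case unfolding list.size Ln_zero by (simp add: zero_multiset_def[symmetric] del: zero_multiset_def)
next
  case (Cons b w)
  have "path N (b # w) i j = (\<Sum>k<N. \<Sum>js\<in>Ln {..<N} (length w).
      var (i, k, b) * (if last (k # js) = j then mon (walk k (zip js w)) else 0))"
    by (simp only: path.simps) (intro sum.cong; simp only: Cons.IH lessThan_iff sum_distrib_left)
  also have "\<dots> = (\<Sum>k<N. \<Sum>js\<in>Ln {..<N} (length w).
      if last (i # k # js) = j then mon (walk i (zip (k # js) (b # w))) else 0)"
    by (intro sum.cong) (auto simp: mult_single)
  finally show ?case by (simp only: sum_lists_Suc list.size add_0_right add_Suc_right)
qed

text \<open>A closed walk is recorded by the list \<open>js\<close> of the vertices reached after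
  each step, so that its starting point is \<open>last js\<close>.\<close>

lemma trace_walks:
  assumes "w \<noteq> []"
  shows "trace N w = (\<Sum>js\<in>Ln {..<N} (length w). mon (walk (last js) (zip js w)))"
proof -
  have "trace N w = (\<Sum>i<N. \<Sum>js\<in>Ln {..<N} (length w). if last (i # js) = i then mon (walk i (zip js w)) else 0)"
    unfolding trace_def by (intro sum.cong refl path_walks) auto
  also have "\<dots> = (\<Sum>js\<in>Ln {..<N} (length w). \<Sum>i<N. if last (i # js) = i then mon (walk i (zip js w)) else 0)"
    by (rule sum.swap)
  also have "\<dots> = (\<Sum>js\<in>Ln {..<N} (length w). mon (walk (last js) (zip js w)))"
  proof (rule sum.cong)
    fix js assume "js \<in> Ln {..<N} (length w)"
    then have n: "js \<noteq> []" and s: "set js \<subseteq> {..<N}" using assms by auto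
    have "last js < N" using last_in_set[OF n] s by blast
    note n = n this
    have "(\<Sum>i<N. if last (i # js) = i then mon (walk i (zip js w)) else 0) =
        (\<Sum>i<N. if i = last js then mon (walk (last js) (zip js w)) else 0)"
      using n by (intro sum.cong) auto
    then show "(\<Sum>i<N. if last (i # js) = i then mon (walk i (zip js w)) else 0) = mon (walk (last js) (zip js w))"
      using n by simp
  qed simp
  finally show ?thesis .
qed

section \<open>Decompositions of monomials into closed walks\<close>

inductive walks :: "nat \<Rightarrow> (nat \<times> nat \<times> 'a) multiset \<Rightarrow> 'a list set multiset \<Rightarrow> bool" for N where
  empty: "walks N {#} {#}"
| add: "w \<noteq> [] \<Longrightarrow> js \<in> Ln {..<N} (length w) \<Longrightarrow> walks N m \<mu> \<Longrightarrow>
    walks N (walk (last js) (zip js w) + m) (add_mset (necklace w) \<mu>)"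

text \<open>At most one edge leaves each vertex, so a walk inside \<open>m\<close> has no choice at
  any step.\<close>

definition generic :: "(nat \<times> nat \<times> 'a) multiset \<Rightarrow> bool" where
  "generic m \<longleftrightarrow> (\<forall>v. count (image_mset fst m) v \<le> 1)"

lemma walk_rows: "length js = length w \<Longrightarrow> image_mset fst (walk i (zip js w)) = mset (butlast (i # js))"
  by (induction js w arbitrary: i rule: list_induct2) auto

lemma walk_rows_cyc:
  assumes "length js = length w" "w \<noteq> []"
  shows "image_mset fst (walk (last js) (zip js w)) = mset js"
proof -
  have n: "js \<noteq> []" using assms by auto
  then have "mset (butlast (last js # js)) = mset (butlast js @ [last js])"
    by (simp del: append_butlast_last_id)
  also have "\<dots> = mset js" by (subst append_butlast_last_id[OF n]) (rule refl)
  finally show ?thesis using walk_rows[OF assms(1), of "last js"] by simp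
qed

text \<open>Products of traces have natural numbers as coefficients. Writing them as multisets of
  monomials shows that no terms cancel.\<close>

definition rep :: "'w multiset \<Rightarrow> ('w \<Rightarrow>\<^sub>0 complex)" where
  "rep ms = (\<Sum>m\<in>#ms. mon m)"

lemma lookup_rep: "lkp (rep ms) m = of_nat (count ms m)"
  by (induction ms) (auto simp: rep_def lookup_add lookup_single when_def)

text \<open>The last clause provides a generic monomial whenever the weight is at most
  \<open>N\<close>. It is formulated for an arbitrary block of consecutive vertices starting at
  \<open>n\<close>, so that the walks of the different factors can be placed in disjoint
  blocks.\<close>

lemma TN_rep:
  assumes "set_mset \<mu> \<subseteq> necklaces B"
  shows "\<exists>ms. TN N (mon \<mu>) = rep ms \<and> (\<forall>m\<in>#ms. walks N m \<mu>) \<and>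
    (\<forall>n. n + weight \<mu> \<le> N \<longrightarrow> (\<exists>m\<in>#ms. \<forall>v. count (image_mset fst m) v \<le> (if n \<le> v \<and> v < n + weight \<mu> then 1 else 0)))"
  using assms
proof (induction \<mu>)
  case empty
  show ?case
    by (rule exI[of _ "{#{#}#}"]) (auto simp: rep_def TN_one zero_multiset_def[symmetric] simp del: zero_multiset_def
      intro: walks.empty[unfolded zero_multiset_def[symmetric]])
next
  case (add z \<mu>)
  then obtain ms where ms: "TN N (mon \<mu>) = rep ms" "\<And>m. m \<in># ms \<Longrightarrow> walks N m \<mu>"
    "\<And>n. n + weight \<mu> \<le> N \<Longrightarrow> \<exists>m\<in>#ms. \<forall>v. count (image_mset fst m) v \<le> (if n \<le> v \<and> v < n + weight \<mu> then 1 else 0)"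
    by auto
  obtain w where w: "z = necklace w" "w \<noteq> []" using add by (auto simp: necklaces_def)
  let ?L = "Ln {..<N} (length w)"
  have fL: "finite ?L" by (rule finite_lists_length_eq) simp
  let ?c = "\<lambda>js. walk (last js) (zip js w)"
  let ?ms = "\<Sum>js\<in>#mset_set ?L. image_mset (\<lambda>m. ?c js + m) ms"
  have "TN N (mon (add_mset z \<mu>)) = trace N w * rep ms"
    using ms(1) by (simp add: TN_mon w tr_necklace)
  also have "\<dots> = (\<Sum>js\<in>?L. rep (image_mset (\<lambda>m. ?c js + m) ms))"
  proof -
    have "mon x * rep ms = rep (image_mset (\<lambda>m. x + m) ms)" for x :: "(nat \<times> nat \<times> 'a) multiset"
      by (induction ms) (auto simp: rep_def algebra_simps mult_single)
    then show ?thesis by (simp add: trace_walks[OF w(2)] sum_distrib_right)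
  qed
  also have "\<dots> = rep ?ms"
  proof -
    have "(\<Sum>js\<in>#K. rep (image_mset (\<lambda>m. ?c js + m) ms)) = rep (\<Sum>js\<in>#K. image_mset (\<lambda>m. ?c js + m) ms)" for K
      by (induction K) (auto simp: rep_def)
    then show ?thesis by (metis (no_types, lifting) sum_unfold_sum_mset)
  qed
  finally have T: "TN N (mon (add_mset z \<mu>)) = rep ?ms" .
  have el: "m \<in># ?ms \<longleftrightarrow> (\<exists>js\<in>?L. \<exists>m'\<in>#ms. m = ?c js + m')" for m
  proof -
    have "m \<in># (\<Sum>js\<in>#K. image_mset (\<lambda>m. ?c js + m) ms) \<longleftrightarrow> (\<exists>js\<in>#K. \<exists>m'\<in>#ms. m = ?c js + m')" for K
      by (induction K) auto
    from this[of "mset_set ?L"] show ?thesis using finite_set_mset_mset_set[OF fL] by blast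
  qed
  show ?case
  proof (intro exI[of _ ?ms] conjI ballI allI impI T)
    fix m assume "m \<in># ?ms"
    then obtain js m' where i: "js \<in> ?L" "m' \<in># ms" "m = ?c js + m'" unfolding el by blast
    show "walks N m (add_mset z \<mu>)" unfolding i(3) w(1) by (rule walks.add[OF w(2) i(1) ms(2)[OF i(2)]])
  next
    fix n assume n: "n + weight (add_mset z \<mu>) \<le> N"
    have wg: "weight (add_mset z \<mu>) = length w + weight \<mu>" by (simp add: weight_def w nlen_necklace)
    have "(n + length w) + weight \<mu> \<le> N" using n wg by simp
    from ms(3)[OF this] obtain m where m: "m \<in># ms"
      "\<And>v. count (image_mset fst m) v \<le> (if n + length w \<le> v \<and> v < n + length w + weight \<mu> then 1 else 0)" by blast
    \<comment> \<open>The new walk runs once through the first part of the block; the rows of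
      \<open>m\<close> use only the vertices behind it.\<close>
    let ?js = "[n..<n + length w]"
    have iL: "?js \<in> ?L" using n wg by auto
    have "count (image_mset fst (?c ?js)) v = (if n \<le> v \<and> v < n + length w then 1 else 0)" for v
      using walk_rows_cyc[of ?js w] w(2) by (simp add: count_mset_set)
    then have "count (image_mset fst (?c ?js + m)) v \<le> (if n \<le> v \<and> v < n + weight (add_mset z \<mu>) then 1 else 0)" for v
      using m(2)[of v] unfolding wg by (auto split: if_splits)
    moreover have "?c ?js + m \<in># ?ms" unfolding el using iL m(1) by blast
    ultimately show "\<exists>m\<in>#?ms. \<forall>v. count (image_mset fst m) v \<le> (if n \<le> v \<and> v < n + weight (add_mset z \<mu>) then 1 else 0)"
      by blast
  qed
qed

lemma walk_append: "walk i (ps @ qs) = walk i ps + walk (if ps = [] then i else fst (last ps)) qs"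
  by (induction ps arbitrary: i) auto

lemma walk_rotate1:
  assumes "length js = length w"
  shows "walk (last (rotate1 js)) (zip (rotate1 js) (rotate1 w)) = walk (last js) (zip js w)"
proof (cases js)
  case (Cons x xs)
  then obtain y ys where w: "w = y # ys" "length xs = length ys" using assms by (cases w) auto
  have "(if zip xs ys = [] then x else fst (last (zip xs ys))) = last (x # xs)"
  proof (cases "xs = []")
    case False
    then have "last (zip xs ys) = (last xs, last ys)" using w(2) by (intro last_zip) auto
    then show ?thesis using False w(2) by auto
  qed simp
  then show ?thesis by (simp add: Cons w walk_append)
qed (use assms in simp)

lemma walk_rotate:
  "length js = length w \<Longrightarrow> walk (last (rotate k js)) (zip (rotate k js) (rotate k w)) = walk (last js) (zip js w)"
  by (induction k) (simp_all add: walk_rotate1)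

text \<open>The walk through \<open>v\<close> is rotated until it ends in \<open>v\<close>. Rotation
  changes neither its monomial nor its necklace, so each vertex of the walk can serve as base
  point.\<close>

lemma walks_extract:
  assumes "walks N m \<nu>" "v \<in># image_mset fst m"
  shows "\<exists>js w m' \<nu>'. w \<noteq> [] \<and> js \<in> Ln {..<N} (length w) \<and> last js = v \<and> walks N m' \<nu>' \<and>
    m = walk (last js) (zip js w) + m' \<and> \<nu> = add_mset (necklace w) \<nu>'"
  using assms
proof (induction rule: walks.induct)
  case (add w js m \<mu>)
  show ?case
  proof (cases "v \<in> set js")
    case True
    then obtain p where p: "p < length js" "js ! p = v" by (auto simp: in_set_conv_nth)
    \<comment> \<open>Rotation by \<open>Suc p\<close> brings the entry at position \<open>p\<close>
      to the end; for the last position it is the full rotation.\<close>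
    have l: "last (rotate (Suc p) js) = v"
    proof (cases "Suc p = length js")
      case True
      then show ?thesis using p by (simp add: rotate_id last_conv_nth) (metis diff_Suc_1 last_conv_nth length_0_conv nat.distinct(1))
    next
      case False
      then have "Suc p < length js" using p by simp
      then have "rotate (Suc p) js = drop (Suc p) js @ take (Suc p) js" by (simp add: rotate_drop_take)
      moreover have "last (take (Suc p) js) = js ! p" "take (Suc p) js \<noteq> []"
        using p by (auto simp: take_Suc_conv_app_nth)
      ultimately show ?thesis using p by (simp add: last_append)
    qed
    show ?thesis
      using add l walk_rotate[of js w "Suc p"]
      by (intro exI[of _ "rotate (Suc p) js"] exI[of _ "rotate (Suc p) w"] exI[of _ m] exI[of _ \<mu>])
        (simp add: necklace_rotate del: rotate_Suc)
  next
    case False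
    have "image_mset fst (walk (last js) (zip js w)) = mset js"
      using add by (intro walk_rows_cyc) auto
    then have "v \<in># image_mset fst m" using add False by (auto simp del: set_image_mset)
    from add.IH[OF this] obtain js' w' m' \<nu>' where *: "w' \<noteq> []" "js' \<in> Ln {..<N} (length w')" "last js' = v" "walks N m' \<nu>'"
      "m = walk (last js') (zip js' w') + m'" "\<mu> = add_mset (necklace w') \<nu>'" by blast
    show ?thesis
      using * walks.add[OF add(1,2) *(4)]
      by (intro exI[of _ js'] exI[of _ w'] exI[of _ "walk (last js) (zip js w) + m'"] exI[of _ "add_mset (necklace w) \<nu>'"])
        (simp add: ac_simps)
  qed
qed simp

lemma generic_unique:
  assumes "generic m" "x \<in># m" "y \<in># m" "fst x = fst y" shows "x = y"
proof (rule ccontr)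
  assume "x \<noteq> y"
  then obtain m' where "m = add_mset x (add_mset y m')"
    using assms(2,3) by (metis insert_DiffM insert_noteq_member)
  then have "count (image_mset fst m) (fst x) \<ge> 2" using assms(4) by simp
  then show False using assms(1) unfolding generic_def by (metis Suc_1 not_less_eq_eq)
qed

text \<open>The current vertex determines the next edge of a generic monomial, so two walks from the
  same vertex agree as long as both run.\<close>

lemma walk_prefix:
  assumes "generic m" "walk i ps \<subseteq># m" "walk i qs \<subseteq># m" "length ps \<le> length qs"
  shows "ps = take (length ps) qs"
  using assms(2-)
proof (induction ps arbitrary: i qs)
  case (Cons kb ps)
  then obtain kb' qs' where q: "qs = kb' # qs'" by (cases qs) auto
  have "(i, fst kb, snd kb) \<in># m" "(i, fst kb', snd kb') \<in># m"
    using Cons(2,3) q by (auto dest: mset_subset_eq_insertD)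
  from generic_unique[OF assms(1) this] have e: "kb = kb'" by (simp add: prod_eq_iff)
  have "walk (fst kb) ps \<subseteq># m" "walk (fst kb) qs' \<subseteq># m"
    using Cons(2,3) q e by (auto dest: mset_subset_eq_insertD subset_mset.less_imp_le)
  from Cons.IH[OF this] show ?case using Cons(4) q e by simp
qed simp

lemma zip_prefix:
  assumes "length xs = length ys" "length us = length vs" "length xs \<le> length us"
    "zip xs ys = take (length xs) (zip us vs)"
  shows "xs = take (length xs) us" "ys = take (length xs) vs"
proof -
  have "xs = map fst (zip xs ys)" using assms(1) by simp
  also have "\<dots> = take (length xs) us" unfolding assms(4) using assms(2,3) by (simp add: take_zip)
  finally show "xs = take (length xs) us" .
  have "ys = map snd (zip xs ys)" using assms(1) by simp
  also have "\<dots> = take (length xs) vs" unfolding assms(4) using assms(2,3) by (simp add: take_zip)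
  finally show "ys = take (length xs) vs" .
qed

text \<open>A closed walk of one decomposition is compared with the closed walk of the other one
  that has the same base point. One is an initial segment of the other, and as the longer one
  reaches the base point only at its end, both coincide; they are removed, and the induction
  continues.\<close>

lemma walks_unique:
  assumes "walks N m \<mu>" "generic m" "walks N m \<nu>"
  shows "\<mu> = \<nu>"
  using assms
proof (induction arbitrary: \<nu> rule: walks.induct)
  case empty
  from empty(2) show ?case
  proof (cases rule: walks.cases)
    case (add w js m \<mu>)
    then have "image_mset fst (walk (last js) (zip js w)) = {#}" by simp
    moreover have "image_mset fst (walk (last js) (zip js w)) = mset js" using add by (intro walk_rows_cyc) auto
    ultimately show ?thesis using add by auto
  qed simp
next
  case (add w js m0 \<mu>)
  let ?m = "walk (last js) (zip js w) + m0"
  have is0: "js \<noteq> []" "length js = length w" using add by auto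
  have rows: "image_mset fst (walk (last js) (zip js w)) = mset js" using add is0 by (intro walk_rows_cyc) auto
  have "last js \<in># image_mset fst ?m" using rows is0 by (auto simp del: set_image_mset)
  from walks_extract[OF add(6) this] obtain js' w' m' \<nu>' where *: "w' \<noteq> []" "js' \<in> Ln {..<N} (length w')"
    "last js' = last js" "walks N m' \<nu>'" "?m = walk (last js') (zip js' w') + m'" "\<nu> = add_mset (necklace w') \<nu>'" by blast
  have is1: "js' \<noteq> []" "length js' = length w'" using * by auto
  have rows': "image_mset fst (walk (last js') (zip js' w')) = mset js'" using * is1 by (intro walk_rows_cyc) auto
  have sub: "walk (last js) (zip js w) \<subseteq># ?m" "walk (last js) (zip js' w') \<subseteq># ?m"
  proof -
    show "walk (last js) (zip js w) \<subseteq># ?m" by simp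
    show "walk (last js) (zip js' w') \<subseteq># ?m" unfolding *(5) *(3) by simp
  qed
  have dist: "distinct xs" if "mset xs \<subseteq># image_mset fst ?m" for xs
    unfolding distinct_count_atmost_1
  proof
    fix a
    have "count (image_mset fst ?m) a \<le> 1" using add(5) unfolding generic_def by blast
    then have "count (mset xs) a \<le> 1" using mset_subset_eq_count[OF that, of a] by linarith
    moreover have "count (mset xs) a = 0 \<longleftrightarrow> a \<notin> set xs" by (simp add: count_eq_zero_iff)
    ultimately show "count (mset xs) a = (if a \<in> set xs then 1 else 0)"
      by (cases "count (mset xs) a") (simp_all split: if_splits)
  qed
  have d: "distinct js" "distinct js'"
    using dist[of js] dist[of js'] rows rows' image_mset_subseteq_mono[OF sub(1), of fst]
      image_mset_subseteq_mono[OF sub(2), of fst] *(3) by auto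
  \<comment> \<open>A proper initial segment with the same last vertex would make this vertex occur
    twice in \<open>ys\<close>.\<close>
  have short: "length xs = length ys" if "length xs \<le> length ys" "xs = take (length xs) ys" "xs \<noteq> []"
    "last xs = last ys" "distinct ys" for xs ys :: "nat list"
  proof (rule ccontr)
    assume "length xs \<noteq> length ys"
    then have l: "length xs < length ys" using that by simp
    have "xs ! (length xs - 1) = take (length xs) ys ! (length xs - 1)"
      by (rule arg_cong[where f = "\<lambda>l. l ! (length xs - 1)", OF that(2)])
    also have "\<dots> = ys ! (length xs - 1)" using that(3) by (intro nth_take) simp
    finally have "ys ! (length xs - 1) = xs ! (length xs - 1)" by simp
    also have "\<dots> = last ys" using that by (simp add: last_conv_nth)
    also have "\<dots> = ys ! (length ys - 1)" using l by (intro last_conv_nth) auto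
    finally have "length xs - 1 = length ys - 1" using that(5) l by (subst (asm) nth_eq_iff_index_eq) auto
    then show False using l that(3) by (cases xs) auto
  qed
  have "js = js' \<and> w = w'"
  proof (cases "length js \<le> length js'")
    case True
    then have "zip js w = take (length js) (zip js' w')"
      using walk_prefix[OF add(5) sub] is0 is1 by simp
    note p = zip_prefix[OF is0(2) is1(2) True this]
    have "length js = length js'" by (rule short[OF True p(1) is0(1) _ d(2)]) (simp add: *(3))
    then have a: "take (length js) js' = js'" "take (length js) w' = w'" using is1 by simp_all
    show ?thesis using trans[OF p(1) a(1)] trans[OF p(2) a(2)] by blast
  next
    case False
    then have l: "length js' \<le> length js" by simp
    then have "zip js' w' = take (length js') (zip js w)"
      using walk_prefix[OF add(5) sub(2,1)] is0 is1 by simp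
    note p = zip_prefix[OF is1(2) is0(2) l this]
    have "length js' = length js" by (rule short[OF l p(1) is1(1) _ d(1)]) (simp add: *(3))
    then show ?thesis using False by simp
  qed
  then have "m0 = m'" "necklace w = necklace w'" using *(3,5) by auto
  moreover have "generic m0" unfolding generic_def
  proof
    fix v
    have "count (image_mset fst ?m) v \<le> 1" using add(5) unfolding generic_def by blast
    then show "count (image_mset fst m0) v \<le> 1" by simp
  qed
  ultimately show ?case using add(4)[of \<nu>'] * by simp
qed

text \<open>A generic monomial of \<open>TN N (mon \<mu>)\<close> exists because the weight of
  \<open>\<mu>\<close> is at most \<open>N\<close>, and by uniqueness of decompositions it occurs
  for no other product of traces. Its coefficient in \<open>TN N s\<close> is a positive multiple of
  the coefficient of \<open>\<mu>\<close> in \<open>s\<close>.\<close>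

lemma TN_inj:
  assumes s: "s \<in> NP B k" and k: "k \<le> N" and 0: "TN N s = 0"
  shows "s = 0"
proof (rule ccontr)
  assume "s \<noteq> 0"
  then obtain \<mu> where \<mu>: "lkp s \<mu> \<noteq> 0" by (metis lookup_zero poly_mapping_eqI)
  have mem: "set_mset \<nu> \<subseteq> necklaces B \<and> weight \<nu> = k" if "lkp s \<nu> \<noteq> 0" for \<nu>
    using s that unfolding pm_iff by blast
  obtain ms where ms: "TN N (mon \<mu>) = rep ms" "\<And>m. m \<in># ms \<Longrightarrow> walks N m \<mu>"
    "\<And>n. n + weight \<mu> \<le> N \<Longrightarrow> \<exists>m\<in>#ms. \<forall>v. count (image_mset fst m) v \<le> (if n \<le> v \<and> v < n + weight \<mu> then 1 else 0)"
    using TN_rep[of \<mu> B N] mem[OF \<mu>] by blast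
  obtain m where m: "m \<in># ms" "\<And>v. count (image_mset fst m) v \<le> (if 0 \<le> v \<and> v < 0 + weight \<mu> then 1 else 0)"
    using ms(3)[of 0] mem[OF \<mu>] k by auto
  have g: "generic m" unfolding generic_def
  proof
    show "count (image_mset fst m) v \<le> 1" for v using m(2)[of v] by (auto split: if_splits)
  qed
  have z: "lkp (TN N (mon \<nu>)) m = 0" if \<nu>: "\<nu> \<in> keys s" "\<nu> \<noteq> \<mu>" for \<nu>
  proof -
    obtain ns where ns: "TN N (mon \<nu>) = rep ns" "\<And>m. m \<in># ns \<Longrightarrow> walks N m \<nu>"
      using TN_rep[of \<nu> B N] mem[of \<nu>] \<nu> by (auto simp: in_keys_iff)
    have "m \<notin># ns" using walks_unique[OF ms(2)[OF m(1)] g] ns(2)[of m] \<nu>(2) by blast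
    then show ?thesis by (simp add: ns lookup_rep not_in_iff)
  qed
  have "0 = lkp (TN N s) m" by (simp add: 0)
  also have "TN N s = (\<Sum>\<nu>\<in>keys s. sc (lkp s \<nu>) (TN N (mon \<nu>)))"
    by (subst sum_keys_mon[of s]) (simp only: lin_sumD[OF lin_TN] lin_scD[OF lin_TN])
  also have "lkp \<dots> m = (\<Sum>\<nu>\<in>keys s. lkp s \<nu> * lkp (TN N (mon \<nu>)) m)"
    by (simp add: lookup_sum)
  also have "\<dots> = (\<Sum>\<nu>\<in>keys s. if \<nu> = \<mu> then lkp s \<mu> * lkp (TN N (mon \<mu>)) m else 0)"
    using z by (intro sum.cong) auto
  also have "\<dots> = lkp s \<mu> * of_nat (count ms m)"
    using \<mu> by (simp add: in_keys_iff ms lookup_rep)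
  finally show False using \<mu> m(1) by (simp add: count_eq_zero_iff)
qed

section \<open>Invariants\<close>

lemma map_id_fun [simp]: "Poly_Mapping.map (\<lambda>a. a) p = (p :: 'w \<Rightarrow>\<^sub>0 complex)"
  by (rule poly_mapping_eqI) (simp add: Poly_Mapping.map.rep_eq when_def)

section \<open>Polarisation of homogeneous polynomials\<close>

definition partial :: "'z \<Rightarrow> ('z multiset \<Rightarrow>\<^sub>0 complex) \<Rightarrow> ('z multiset \<Rightarrow>\<^sub>0 complex)" where
  "partial x = dv (\<lambda>z. if z = x then 1 else 0)"

primrec partials :: "'z list \<Rightarrow> ('z multiset \<Rightarrow>\<^sub>0 complex) \<Rightarrow> ('z multiset \<Rightarrow>\<^sub>0 complex)" where
  "partials [] f = f"
| "partials (x # xs) f = partials xs (partial x f)"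

text \<open>For \<open>f\<close> homogeneous of degree \<open>k\<close> and a list \<open>xs\<close>
  of \<open>k\<close> variables this is \<open>k!\<close> times the coefficient of the polarisation
  of \<open>f\<close> at \<open>xs\<close>.\<close>

definition partials_const :: "'z list \<Rightarrow> ('z multiset \<Rightarrow>\<^sub>0 complex) \<Rightarrow> complex" where
  "partials_const xs f = lkp (partials xs f) {#}"

lemma lin_partial: "lin (partial x)" unfolding partial_def by (rule lin_dv)
lemma partial_mult: "partial x (p * q) = partial x p * q + p * partial x q" unfolding partial_def by (rule dv_mult)

lemma lin_partials: "lin (partials xs)"
  by (induction xs) (auto intro: lin_id lin_comp[OF _ lin_partial])

lemma partial_polys: "f \<in> polys Z \<Longrightarrow> partial x f \<in> polys Z"
  unfolding partial_def by (rule dv_polys) (auto simp del: single_one simp: single_one[symmetric])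

lemma partial_homog:
  assumes "g \<in> pm {m. set_mset m \<subseteq> E \<and> size m = Suc k}"
  shows "partial x g \<in> pm {m. set_mset m \<subseteq> E \<and> size m = k}"
proof (rule lin_pm[OF lin_partial assms])
  fix m :: "'a multiset" assume m: "m \<in> {m. set_mset m \<subseteq> E \<and> size m = Suc k}"
  show "partial x (mon m) \<in> pm {m. set_mset m \<subseteq> E \<and> size m = k}"
    unfolding partial_def dv_mon
    by (rule pm_sum_mset) (use m in \<open>auto simp: size_Diff_singleton dest: in_diffD\<close>)
qed

lemma euler:
  assumes "finite E" "g \<in> pm {m. set_mset m \<subseteq> E \<and> size m = k}"
  shows "sc (of_nat k) g = (\<Sum>x\<in>E. var x * partial x g)"
proof (rule lin_eq[OF _ _ assms(2)])
  show "lin (sc (of_nat k) :: ('a multiset \<Rightarrow>\<^sub>0 complex) \<Rightarrow> _)" by (rule lin_scale[OF lin_id])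
  show "lin (\<lambda>g. \<Sum>x\<in>E. var x * partial x g)" by (intro lin_intros lin_partial)
  fix m assume m: "m \<in> {m. set_mset m \<subseteq> E \<and> size m = k}"
  have "var x * partial x (mon m) = (\<Sum>z\<in>#m. if z = x then mon m else 0)" for x
  proof -
    have "var x * partial x (mon m) = (\<Sum>z\<in>#m. var x * ((if z = x then 1 else 0) * mon (m - {#z#})))"
      by (simp add: partial_def dv_mon sum_mset_distrib_left image_mset.compositionality comp_def)
    also have "\<dots> = (\<Sum>z\<in>#m. if z = x then mon m else 0)"
      by (intro arg_cong[where f = sum_mset] image_mset_cong) (auto simp: mult_single)
    finally show ?thesis .
  qed
  then have "(\<Sum>x\<in>E. var x * partial x (mon m)) = (\<Sum>x\<in>E. \<Sum>z\<in>#m. if z = x then mon m else 0)" by simp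
  also have "\<dots> = (\<Sum>z\<in>#m. \<Sum>x\<in>E. if z = x then mon m else 0)"
  proof -
    have "(\<Sum>x\<in>E. \<Sum>z\<in>#n. h x z) = (\<Sum>z\<in>#n. \<Sum>x\<in>E. h x z)" for n and h :: "_ \<Rightarrow> _ \<Rightarrow> 'a multiset \<Rightarrow>\<^sub>0 complex"
      by (induction n) (simp_all add: sum.distrib)
    then show ?thesis .
  qed
  also have "\<dots> = (\<Sum>z\<in>#m. mon m)"
    using m assms(1) by (intro arg_cong[where f = sum_mset] image_mset_cong) auto
  also have "\<dots> = sc (of_nat (size m)) (mon m)"
  proof -
    have "(\<Sum>z\<in>#n. mon m) = sc (of_nat (size n)) (mon m)" for n :: "'a multiset"
      by (induction n) (simp_all add: sc_add_left del: Poly_Mapping.map_single)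
    then show ?thesis .
  qed
  finally show "sc (of_nat k) (mon m) = (\<Sum>x\<in>E. var x * partial x (mon m))" using m by simp
qed

text \<open>Euler's formula applied \<open>k\<close> times. A function of sequences of variables
  replaces the coefficients of monomials, so the indices in different positions can be changed
  independently; the price is the factor \<open>fact k\<close>.\<close>

lemma euler_lists:
  assumes "finite E" "g \<in> pm {m. set_mset m \<subseteq> E \<and> size m = k}"
  shows "sc (fact k) g = (\<Sum>xs\<in>Ln E k. sc (partials_const xs g) (mon (mset xs)))"
  using assms(2)
proof (induction k arbitrary: g)
  case 0
  have "g = sc (lkp g {#}) (mon {#})"
    using 0 by (intro poly_mapping_eqI) (auto simp: pm_iff lookup_one when_def)
  then show ?case unfolding Ln_zero by (simp add: partials_const_def del: Poly_Mapping.map_single)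
next
  case (Suc k)
  have "sc (fact (Suc k)) g = sc (fact k) (sc (of_nat (Suc k)) g)" by (simp add: mult.commute)
  also have "\<dots> = (\<Sum>x\<in>E. var x * sc (fact k) (partial x g))"
    unfolding euler[OF assms(1) Suc(2)] by (simp add: sc_sum sc_mult_right)
  also have "\<dots> = (\<Sum>x\<in>E. \<Sum>xs\<in>Ln E k. var x * sc (partials_const xs (partial x g)) (mon (mset xs)))"
    by (intro sum.cong refl) (simp only: Suc.IH[OF partial_homog[OF Suc(2)]] sum_distrib_left)
  also have "\<dots> = (\<Sum>x\<in>E. \<Sum>xs\<in>Ln E k. sc (partials_const (x # xs) g) (mon (mset (x # xs))))"
    by (intro sum.cong refl) (simp add: partials_const_def mult_single)
  finally show ?case by (simp only: sum_lists_Suc)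
qed

text \<open>A function on pairs of index sequences that satisfies the invariance equations is determined
  by its values on sequences without repetitions: the row indices are replaced by the fresh
  indices \<open>M, M + 1, \<dots>\<close> one at a time.\<close>

lemma invariant_sequences:
  fixes c :: "(nat \<Rightarrow> nat) \<Rightarrow> (nat \<Rightarrow> nat) \<Rightarrow> complex"
  assumes cong: "\<And>I J I' J'. (\<And>p. p < k \<Longrightarrow> I p = I' p) \<Longrightarrow> (\<And>p. p < k \<Longrightarrow> J p = J' p) \<Longrightarrow> c I J = c I' J'"
    and eq: "\<And>I J a b. (\<And>p. p < k \<Longrightarrow> I p < M + k \<and> J p < M + k) \<Longrightarrow> a < M + k \<Longrightarrow> b < M + k \<Longrightarrow>
      (\<Sum>p<k. if I p = a then c (I(p := b)) J else 0) = (\<Sum>p<k. if J p = b then c I (J(p := a)) else 0)"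
    and IJ: "\<And>p. p < k \<Longrightarrow> I p < M" "\<And>p. p < k \<Longrightarrow> J p < M"
  shows "c I J = (\<Sum>\<tau> | \<tau> permutes {..<k}. if \<forall>q<k. J q = I (\<tau> q) then c (\<lambda>p. M + p) (\<lambda>p. M + \<tau> p) else 0)"
proof -
  define G where "G \<tau> = c (\<lambda>p. M + p) (\<lambda>p. M + \<tau> p)" for \<tau>
  \<comment> \<open>The first \<open>t\<close> row indices have been moved to
    \<open>M, ..., M + t - 1\<close>, and \<open>d\<close> remain. Each of these fresh values has
    also been placed in some column, while the other columns are still below
    \<open>M\<close>.\<close>
  have "c I J = (\<Sum>\<tau> | \<tau> permutes {..<k}. if \<forall>q<k. J q = I (\<tau> q) then G \<tau> else 0)"
    if "d + t = k" "\<And>p. p < t \<Longrightarrow> I p = M + p" "\<And>p. t \<le> p \<Longrightarrow> p < k \<Longrightarrow> I p < M"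
      "\<And>q. q < k \<Longrightarrow> J q < M \<or> (\<exists>p<t. J q = M + p)" "\<And>p. p < t \<Longrightarrow> \<exists>q<k. J q = M + p" for d t I J
    using that
  proof (induction d arbitrary: t I J)
    case 0
    then have t: "t = k" by simp
    let ?A = "{q. q < k \<and> M \<le> J q}"
    \<comment> \<open>All \<open>k\<close> fresh indices occur among the \<open>k\<close> columns,
      so the columns are a permutation of them.\<close>
    have "{M..<M + k} \<subseteq> J ` ?A"
    proof
      fix x assume x: "x \<in> {M..<M + k}"
      then have "x - M < t" using t by auto
      from 0(5)[OF this] obtain q where "q < k" "J q = M + (x - M)" by blast
      then show "x \<in> J ` ?A" using x by (intro image_eqI[of _ _ q]) auto
    qed
    then have "card {M..<M + k} \<le> card ?A"
      by (intro surj_card_le) auto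
    then have "?A = {..<k}" by (intro card_subset_eq) (auto intro!: antisym card_mono[of "{..<k}" ?A, simplified])
    then have ge: "M \<le> J q" if "q < k" for q using that by auto
    define \<tau>0 where "\<tau>0 q = (if q < k then J q - M else q)" for q
    have J: "J q = M + \<tau>0 q" if "q < k" for q using ge[OF that] that by (simp add: \<tau>0_def)
    have \<tau>0: "\<tau>0 permutes {..<k}"
    proof (rule bij_imp_permutes)
      have s: "{..<k} \<subseteq> \<tau>0 ` {..<k}"
      proof
        fix p assume "p \<in> {..<k}"
        then obtain q where "q < k" "J q = M + p" using 0(5) t by auto
        then show "p \<in> \<tau>0 ` {..<k}" by (intro image_eqI[of _ _ q]) (auto simp: \<tau>0_def)
      qed
      moreover have i: "\<tau>0 ` {..<k} \<subseteq> {..<k}"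
      proof
        fix y assume "y \<in> \<tau>0 ` {..<k}"
        then obtain q where q: "q < k" "y = \<tau>0 q" by auto
        then have "\<not> J q < M" using ge[of q] by simp
        then obtain p where "p < t" "J q = M + p" using 0(4)[OF q(1)] by blast
        then show "y \<in> {..<k}" using q t by (simp add: \<tau>0_def)
      qed
      ultimately have "inj_on \<tau>0 {..<k}" by (intro finite_surj_inj) auto
      show "bij_betw \<tau>0 {..<k} {..<k}" unfolding bij_betw_def using s i \<open>inj_on \<tau>0 {..<k}\<close> by blast
    qed (simp add: \<tau>0_def)
    have "(\<forall>q<k. J q = I (\<tau> q)) \<longleftrightarrow> \<tau> = \<tau>0" if \<tau>: "\<tau> permutes {..<k}" for \<tau>
    proof
      assume a: "\<forall>q<k. J q = I (\<tau> q)"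
      show "\<tau> = \<tau>0"
      proof
        fix q show "\<tau> q = \<tau>0 q"
        proof (cases "q < k")
          case True
          then have "\<tau> q < t" using permutes_in_image[OF \<tau>, of q] t by simp
          then show ?thesis using a 0(2) J[OF True] True by simp
        qed (use \<tau> in \<open>simp add: permutes_def \<tau>0_def\<close>)
      qed
    next
      assume "\<tau> = \<tau>0"
      moreover have "\<tau>0 q < t" if "q < k" for q using permutes_in_image[OF \<tau>0, of q] t that by simp
      ultimately show "\<forall>q<k. J q = I (\<tau> q)" using 0(2) J by auto
    qed
    then have "(\<Sum>\<tau> | \<tau> permutes {..<k}. if \<forall>q<k. J q = I (\<tau> q) then G \<tau> else 0) =
      (\<Sum>\<tau> | \<tau> permutes {..<k}. if \<tau> = \<tau>0 then G \<tau>0 else 0)"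
      by (intro sum.cong) auto
    also have "\<dots> = G \<tau>0" using \<tau>0 by (simp add: finite_permutations)
    also have "\<dots> = c I J" unfolding G_def by (rule cong) (use 0(2) t J in auto)
    finally show ?case by simp
  next
    case (Suc d)
    have t: "t < k" using Suc(2) by simp
    let ?a = "M + t" and ?b = "I t"
    let ?I = "I(t := ?a)"
    have b: "?b < M" using Suc(4)[of t] t by simp
    have Ik: "?I p < M + k" if "p < k" for p
      using that Suc(3)[of p] Suc(4)[of p] t by (cases "p < t") (auto simp: not_less)
    have Jk: "J p < M + k" if p: "p < k" for p
      using Suc(5)[OF p] t by auto
    have fI: "?I r = ?a \<longleftrightarrow> r = t" if "r < k" for r
      using Suc(3)[of r] Suc(4)[of r] that t by (cases "r < t") auto
    have fJ: "J r \<noteq> ?a" if "r < k" for r using Suc(5)[OF that] by auto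
    \<comment> \<open>The invariance equation is used for the fresh row index \<open>?a\<close> and
      the old one \<open>?b\<close>. Since \<open>?a\<close> occurs in the rows of \<open>?I\<close>
      only at position \<open>t\<close>, the left-hand side is the single term \<open>c I J\<close>;
      on the right \<open>?a\<close> moves into one of the columns with value
      \<open>?b\<close>.\<close>
    have "(\<Sum>p<k. if ?I p = ?a then c (?I(p := ?b)) J else 0) = (\<Sum>p<k. if p = t then c I J else 0)"
      by (intro sum.cong refl) (use fI in auto)
    then have "c I J = (\<Sum>p<k. if ?I p = ?a then c (?I(p := ?b)) J else 0)" using t by simp
    also have "\<dots> = (\<Sum>q<k. if J q = ?b then c ?I (J(q := ?a)) else 0)"
      by (rule eq) (use Ik Jk b t in auto)
    also have "\<dots> = (\<Sum>q<k. if J q = ?b then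
        (\<Sum>\<tau> | \<tau> permutes {..<k}. if \<forall>r<k. (J(q := ?a)) r = ?I (\<tau> r) then G \<tau> else 0) else 0)"
    proof (intro sum.cong refl if_cong)
      fix q assume q: "q \<in> {..<k}" "J q = ?b"
      show "c ?I (J(q := ?a)) = (\<Sum>\<tau> | \<tau> permutes {..<k}. if \<forall>r<k. (J(q := ?a)) r = ?I (\<tau> r) then G \<tau> else 0)"
      proof (rule Suc.IH[of "Suc t"])
        show "d + Suc t = k" using Suc(2) by simp
        show "?I p = M + p" if "p < Suc t" for p using that Suc(3)[of p] by (auto simp: less_Suc_eq)
        show "?I p < M" if "Suc t \<le> p" "p < k" for p using that Suc(4)[of p] by auto
        show "(J(q := ?a)) r < M \<or> (\<exists>p<Suc t. (J(q := ?a)) r = M + p)" if "r < k" for r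
          using Suc(5)[OF that] by (auto simp: less_Suc_eq)
        show "\<exists>r<k. (J(q := ?a)) r = M + p" if "p < Suc t" for p
        proof (cases "p = t")
          case False
          then have "p < t" using that by simp
          from Suc(6)[OF this] obtain r where r: "r < k" "J r = M + p" by blast
          then have "r \<noteq> q" using q b by auto
          then show ?thesis using r by (intro exI[of _ r]) simp
        qed (use q in auto)
      qed
    qed
    also have "\<dots> = (\<Sum>q<k. \<Sum>\<tau> | \<tau> permutes {..<k}.
        if J q = ?b \<and> (\<forall>r<k. (J(q := ?a)) r = ?I (\<tau> r)) then G \<tau> else 0)"
      by (intro sum.cong) auto
    also have "\<dots> = (\<Sum>\<tau> | \<tau> permutes {..<k}. \<Sum>q<k.
        if J q = ?b \<and> (\<forall>r<k. (J(q := ?a)) r = ?I (\<tau> r)) then G \<tau> else 0)"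
      by (rule sum.swap)
    also have "\<dots> = (\<Sum>\<tau> | \<tau> permutes {..<k}. if \<forall>q<k. J q = I (\<tau> q) then G \<tau> else 0)"
    proof (rule sum.cong)
      fix \<tau> assume "\<tau> \<in> {\<tau>. \<tau> permutes {..<k}}"
      then have \<tau>: "\<tau> permutes {..<k}" by simp
      obtain q0 where q0: "\<tau> q0 = t" using permutes_surj[OF \<tau>] by (metis surjD)
      have q0k: "q0 < k" using permutes_in_image[OF \<tau>, of q0] q0 t by simp
      have uq: "r = q0" if "\<tau> r = t" for r using permutes_inj[OF \<tau>] q0 that by (metis injD)
      have \<tau>k: "\<tau> r < k" if "r < k" for r using permutes_in_image[OF \<tau>, of r] that by simp
      \<comment> \<open>For each permutation at most one column contributes, namely the preimage of
        \<open>t\<close>.\<close>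
      have cond: "J q = ?b \<and> (\<forall>r<k. (J(q := ?a)) r = ?I (\<tau> r)) \<longleftrightarrow> q = q0 \<and> (\<forall>r<k. J r = I (\<tau> r))"
        if q: "q < k" for q
      proof
        assume a: "J q = ?b \<and> (\<forall>r<k. (J(q := ?a)) r = ?I (\<tau> r))"
        then have "?I (\<tau> q) = ?a" using q by (metis fun_upd_same)
        then have "\<tau> q = t" using fI[OF \<tau>k[OF q]] by blast
        then have qq: "q = q0" by (rule uq)
        have "J r = I (\<tau> r)" if r: "r < k" for r
        proof (cases "r = q0")
          case False
          then have "\<tau> r \<noteq> t" using uq by blast
          moreover have "(J(q := ?a)) r = ?I (\<tau> r)" using a r by blast
          ultimately show ?thesis using False qq by simp
        qed (use a qq q0 in simp)
        with qq show "q = q0 \<and> (\<forall>r<k. J r = I (\<tau> r))" by blast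
      next
        assume a: "q = q0 \<and> (\<forall>r<k. J r = I (\<tau> r))"
        have "(J(q := ?a)) r = ?I (\<tau> r)" if r: "r < k" for r
        proof (cases "r = q0")
          case False
          then have "\<tau> r \<noteq> t" using uq by blast
          then show ?thesis using a r False by simp
        qed (use a q0 in simp)
        moreover have "J q0 = I (\<tau> q0)" using a q0k by blast
        then have "J q = ?b" using a q0 by simp
        ultimately show "J q = ?b \<and> (\<forall>r<k. (J(q := ?a)) r = ?I (\<tau> r))" by blast
      qed
      have "(\<Sum>q<k. if J q = ?b \<and> (\<forall>r<k. (J(q := ?a)) r = ?I (\<tau> r)) then G \<tau> else 0) =
        (\<Sum>q<k. if q = q0 then (if \<forall>r<k. J r = I (\<tau> r) then G \<tau> else 0) else 0)"
        by (rule sum.cong[OF refl]) (use cond in auto)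
      then show "(\<Sum>q<k. if J q = ?b \<and> (\<forall>r<k. (J(q := ?a)) r = ?I (\<tau> r)) then G \<tau> else 0) =
        (if \<forall>q<k. J q = I (\<tau> q) then G \<tau> else 0)" using q0k by simp
    qed simp
    finally show ?case .
  qed
  from this[of k 0 I J] IJ show ?thesis unfolding G_def by simp
qed

lemma sum_PiE_insert:
  assumes "v \<notin> V"
  shows "(\<Sum>I\<in>PiE (insert v V) (\<lambda>_. S). F I) = (\<Sum>I\<in>PiE V (\<lambda>_. S). \<Sum>x\<in>S. F (I(v := x)))"
proof -
  have "(\<Sum>I\<in>PiE (insert v V) (\<lambda>_. S). F I) = (\<Sum>(x, I)\<in>S \<times> PiE V (\<lambda>_. S). F (I(v := x)))"
    unfolding PiE_insert_eq using inj_combinator[OF assms, of "\<lambda>_. S"]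
    by (simp add: sum.reindex case_prod_unfold comp_def)
  also have "\<dots> = (\<Sum>x\<in>S. \<Sum>I\<in>PiE V (\<lambda>_. S). F (I(v := x)))"
    by (simp add: sum.cartesian_product)
  finally show ?thesis by (simp add: sum.swap[of _ S])
qed

text \<open>The sum over the index at \<open>v\<close> merges the words on the edges entering and leaving \<open>v\<close>, or
  produces a trace if these coincide.\<close>

lemma permutation_trace:
  assumes "finite V" "bij_betw \<tau> V V" "\<And>p. p \<in> V \<Longrightarrow> \<beta> p \<noteq> [] \<and> set (\<beta> p) \<subseteq> B"
  shows "\<exists>s\<in>NP B (\<Sum>p\<in>V. length (\<beta> p)). \<forall>N.
    (\<Sum>I\<in>PiE V (\<lambda>_. {..<N}). \<Prod>p\<in>V. path N (\<beta> p) (I p) (I (\<tau> p))) = TN N s"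
  using assms
proof (induction V arbitrary: \<tau> \<beta>)
  case empty
  show ?case using NP_one[of B] by (intro bexI[of _ 1]) (simp_all add: TN_one)
next
  case (insert v V)
  note b = insert(4)
  have inj: "inj_on \<tau> (insert v V)" and im: "\<tau> ` insert v V = insert v V"
    using b by (auto simp: bij_betw_def)
  show ?case
  proof (cases "\<tau> v = v")
    case True
    have "v \<notin> \<tau> ` V" using inj True insert(2) by (auto dest: inj_onD)
    then have "\<tau> ` V = V" using im insert(2) unfolding image_insert True by (simp add: insert_ident)
    then have b': "bij_betw \<tau> V V" using inj by (auto simp: bij_betw_def)
    obtain s where s: "s \<in> NP B (\<Sum>p\<in>V. length (\<beta> p))"
      "\<And>N. (\<Sum>I\<in>PiE V (\<lambda>_. {..<N}). \<Prod>p\<in>V. path N (\<beta> p) (I p) (I (\<tau> p))) = TN N s"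
      using insert(3)[OF b', of \<beta>] insert(5) by blast
    have \<tau>V: "\<tau> p \<noteq> v \<and> p \<noteq> v" if "p \<in> V" for p
      using b' that insert(2) by (auto simp: bij_betw_def)
    \<comment> \<open>A fixed point is a loop: the index at \<open>v\<close> occurs in one factor
      only, and summing over it gives a trace.\<close>
    have "(\<Sum>I\<in>PiE (insert v V) (\<lambda>_. {..<N}). \<Prod>p\<in>insert v V. path N (\<beta> p) (I p) (I (\<tau> p))) =
      TN N (var (necklace (\<beta> v)) * s)" for N
    proof -
      have "(\<Prod>p\<in>insert v V. path N (\<beta> p) ((I(v := x)) p) ((I(v := x)) (\<tau> p))) =
        path N (\<beta> v) x x * (\<Prod>p\<in>V. path N (\<beta> p) (I p) (I (\<tau> p)))" for I x
      proof -
        have "(\<Prod>p\<in>V. path N (\<beta> p) ((I(v := x)) p) ((I(v := x)) (\<tau> p))) =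
          (\<Prod>p\<in>V. path N (\<beta> p) (I p) (I (\<tau> p)))"
          by (intro prod.cong refl) (use \<tau>V in auto)
        then show ?thesis using insert(1,2) True by simp
      qed
      then have "(\<Sum>I\<in>PiE (insert v V) (\<lambda>_. {..<N}). \<Prod>p\<in>insert v V. path N (\<beta> p) (I p) (I (\<tau> p))) =
        trace N (\<beta> v) * TN N s"
        unfolding sum_PiE_insert[OF insert(2)]
        by (simp add: trace_def s(2)[symmetric] sum_distrib_right[symmetric] sum_distrib_left)
      then show ?thesis by (simp add: TN_mult TN_necklace)
    qed
    moreover have "var (necklace (\<beta> v)) * s \<in> NP B (\<Sum>p\<in>insert v V. length (\<beta> p))"
      using NP_mult[OF NP_necklace s(1)] insert(1,2,5) by simp
    ultimately show ?thesis by blast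
  next
    case False
    define w where "w = \<tau> v"
    have w: "w \<in> V" using im False unfolding w_def by blast
    obtain u where u: "u \<in> insert v V" "\<tau> u = v" using im by (metis imageE insertI1)
    then have uV: "u \<in> V" using False by auto
    then have uv: "u \<noteq> v" using insert(2) by auto
    have other: "\<tau> p \<noteq> v \<and> \<tau> p \<noteq> w \<and> \<tau> p \<in> V" if p: "p \<in> V" "p \<noteq> u" for p
    proof -
      have "\<tau> p \<noteq> \<tau> u" using inj_onD[OF inj, of p u] p uV by blast
      moreover have "\<tau> p \<noteq> \<tau> v" using inj_onD[OF inj, of p v] p insert(2) by blast
      ultimately have "\<tau> p \<noteq> \<tau> u" "\<tau> p \<noteq> \<tau> v" by auto
      then show ?thesis using im p u w_def by auto
    qed
    \<comment> \<open>The passage from \<open>u\<close> through \<open>v\<close> to \<open>w\<close>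
      is short-circuited, and the word of \<open>v\<close> is appended to that of \<open>u\<close>.
      The case \<open>u = w\<close>, where a loop at \<open>u\<close> arises, is included.\<close>
    let ?\<tau> = "\<tau>(u := w)" and ?\<beta> = "\<beta>(u := \<beta> u @ \<beta> v)"
    have b': "bij_betw ?\<tau> V V"
    proof -
      have "?\<tau> ` V \<subseteq> V" using other w by auto
      moreover have "inj_on ?\<tau> V"
      proof (rule inj_onI)
        fix x y assume xy: "x \<in> V" "y \<in> V" "?\<tau> x = ?\<tau> y"
        show "x = y"
        proof (cases "x = u \<or> y = u")
          case True
          then show ?thesis using xy other[of x] other[of y] by (auto split: if_splits)
        next
          case False
          then have "\<tau> x = \<tau> y" using xy by simp
          then show ?thesis using inj xy by (auto dest: inj_onD)
        qed
      qed
      ultimately show ?thesis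
        unfolding bij_betw_def using endo_inj_surj[OF insert(1)] by blast
    qed
    have \<beta>': "?\<beta> p \<noteq> [] \<and> set (?\<beta> p) \<subseteq> B" if "p \<in> V" for p
      using insert(5) that uV by auto
    from insert(3)[OF b' \<beta>'] obtain s where s: "s \<in> NP B (\<Sum>p\<in>V. length (?\<beta> p))"
      "\<forall>N. (\<Sum>I\<in>PiE V (\<lambda>_. {..<N}). \<Prod>p\<in>V. path N (?\<beta> p) (I p) (I (?\<tau> p))) = TN N s"
      by (rule bexE)
    note s = s(1) s(2)[rule_format]
    have "(\<Sum>I\<in>PiE (insert v V) (\<lambda>_. {..<N}). \<Prod>p\<in>insert v V. path N (\<beta> p) (I p) (I (\<tau> p))) = TN N s" for N
    proof -
      have "(\<Sum>x<N. \<Prod>p\<in>insert v V. path N (\<beta> p) ((I(v := x)) p) ((I(v := x)) (\<tau> p))) =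
        (\<Prod>p\<in>V. path N (?\<beta> p) (I p) (I (?\<tau> p)))" if I: "I \<in> PiE V (\<lambda>_. {..<N})" for I
      proof -
        let ?R = "\<Prod>p\<in>V - {u}. path N (\<beta> p) (I p) (I (\<tau> p))"
        have "(\<Prod>p\<in>insert v V. path N (\<beta> p) ((I(v := x)) p) ((I(v := x)) (\<tau> p))) =
          path N (\<beta> u) (I u) x * path N (\<beta> v) x (I w) * ?R" for x
        proof -
          have "(\<Prod>p\<in>V - {u}. path N (\<beta> p) ((I(v := x)) p) ((I(v := x)) (\<tau> p))) = ?R"
          proof (intro prod.cong refl)
            fix p assume "p \<in> V - {u}"
            then show "path N (\<beta> p) ((I(v := x)) p) ((I(v := x)) (\<tau> p)) = path N (\<beta> p) (I p) (I (\<tau> p))"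
              using other[of p] insert(2) by auto
          qed
          then have "(\<Prod>p\<in>V. path N (\<beta> p) ((I(v := x)) p) ((I(v := x)) (\<tau> p))) = path N (\<beta> u) (I u) x * ?R"
            using prod.remove[OF insert(1) uV, of "\<lambda>p. path N (\<beta> p) ((I(v := x)) p) ((I(v := x)) (\<tau> p))"] uv u
            by simp
          then show ?thesis using insert(1,2) False by (simp add: w_def ac_simps)
        qed
        then have "(\<Sum>x<N. \<Prod>p\<in>insert v V. path N (\<beta> p) ((I(v := x)) p) ((I(v := x)) (\<tau> p))) =
          (\<Sum>x<N. path N (\<beta> u) (I u) x * path N (\<beta> v) x (I w)) * ?R"
          by (simp add: sum_distrib_right)
        also have "\<dots> = path N (\<beta> u @ \<beta> v) (I u) (I w) * ?R"
          using I uV by (subst path_append) auto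
        also have "?R = (\<Prod>p\<in>V - {u}. path N (?\<beta> p) (I p) (I (?\<tau> p)))"
          by (intro prod.cong refl) auto
        also have "path N (\<beta> u @ \<beta> v) (I u) (I w) * \<dots> = (\<Prod>p\<in>V. path N (?\<beta> p) (I p) (I (?\<tau> p)))"
          using prod.remove[OF insert(1) uV, of "\<lambda>p. path N (?\<beta> p) (I p) (I (?\<tau> p))"] by simp
        finally show ?thesis .
      qed
      then show ?thesis unfolding sum_PiE_insert[OF insert(2)] s(2)[symmetric] by (intro sum.cong) auto
    qed
    moreover have "(\<Sum>p\<in>V. length (?\<beta> p)) = (\<Sum>p\<in>insert v V. length (\<beta> p))"
    proof -
      have "(\<Sum>p\<in>V. length (?\<beta> p)) = length (\<beta> u @ \<beta> v) + (\<Sum>p\<in>V - {u}. length (\<beta> p))"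
        using sum.remove[OF insert(1) uV, of "\<lambda>p. length (?\<beta> p)"] by simp
      also have "\<dots> = (\<Sum>p\<in>insert v V. length (\<beta> p))"
        using sum.remove[OF insert(1) uV, of "\<lambda>p. length (\<beta> p)"] insert(1,2) by simp
      finally show ?thesis .
    qed
    ultimately show ?thesis using s(1) by metis
  qed
qed

definition triples :: "nat \<Rightarrow> (nat \<Rightarrow> nat) \<Rightarrow> (nat \<Rightarrow> nat) \<Rightarrow> (nat \<Rightarrow> 'a) \<Rightarrow> (nat \<times> nat \<times> 'a) list" where
  "triples k I J \<beta> = map (\<lambda>p. (I p, J p, \<beta> p)) [0..<k]"

lemma triples_upd:
  assumes "p < k"
  shows "(triples k I J \<beta>)[p := (b, J p, \<beta> p)] = triples k (I(p := b)) J \<beta>"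
    "(triples k I J \<beta>)[p := (I p, a, \<beta> p)] = triples k I (J(p := a)) \<beta>"
  using assms by (auto simp: triples_def nth_list_update intro!: nth_equalityI)

section \<open>Invariants as polynomials in traces\<close>

context omega_basis
begin

abbreviation dE :: "nat \<Rightarrow> nat \<Rightarrow> nat \<Rightarrow> 'a gpoly \<Rightarrow> 'a gpoly" where
  "dE N a b \<equiv> dX N (E_mat N a b 1)"

lemma dE_var:
  assumes "a < N" "b < N" "(i, j, c) \<in> ZN N"
  shows "dE N a b (var (i, j, c)) = (if i = b then var (a, j, c) else 0) - (if j = a then var (i, b, c) else 0)"
proof -
  have ij: "i < N" "j < N" using assms(3) by (auto simp: ZN_def)
  have 1: "(\<Sum>m<N. sc (E_mat N a b 1 $$ (m, i)) (var (m, j, c))) =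
      (\<Sum>m<N. if m = a then (if i = b then var (a, j, c) else 0) else 0)"
    using ij assms by (intro sum.cong) auto
  have 2: "(\<Sum>m<N. sc (E_mat N a b 1 $$ (j, m)) (var (i, m, c))) =
      (\<Sum>m<N. if m = b then (if j = a then var (i, b, c) else 0) else 0)"
    using ij assms by (intro sum.cong) auto
  show ?thesis unfolding dX_var[OF assms(3)] 1 2 using assms by simp
qed

text \<open>The commutator of two derivations is a derivation, so it can be computed on
  variables.\<close>

lemma partial_dE:
  assumes "a < N" "b < N" "(i, j, c) \<in> ZN N" "g \<in> polys (ZN N)"
  shows "partial (i, j, c) (dE N a b g) = dE N a b (partial (i, j, c) g) +
    sc (of_bool (i = a)) (partial (b, j, c) g) - sc (of_bool (j = b)) (partial (i, a, c) g)"
proof -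
  have "partial (i, j, c) (dE N a b g) - dE N a b (partial (i, j, c) g) =
    sc (of_bool (i = a)) (partial (b, j, c) g) - sc (of_bool (j = b)) (partial (i, a, c) g)"
  proof (rule derivation_eq[OF _ _ assms(4)])
    show "lin (\<lambda>g. partial (i, j, c) (dE N a b g) - dE N a b (partial (i, j, c) g))"
      by (intro lin_minus lin_comp[OF lin_partial lin_dX] lin_comp[OF lin_dX lin_partial])
    show "lin (\<lambda>g. sc (of_bool (i = a)) (partial (b, j, c) g) - sc (of_bool (j = b)) (partial (i, a, c) g))"
      by (intro lin_minus lin_scale lin_partial)
    fix z assume z: "z \<in> ZN N"
    obtain k l d where kl: "z = (k, l, d)" by (metis prod_cases3)
    have pv: "partial x (if Q then var y else 0) = (if Q \<and> y = x then 1 else 0)" for Q and x y :: "nat \<times> nat \<times> 'a"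
      by (simp add: partial_def lin_0[OF lin_dv])
    have so: "sc (of_bool Q) (if R then 1 else 0) = (if Q \<and> R then 1 else (0 :: 'a gpoly))" for Q R
      by simp
    have 1: "partial (i, j, c) (dE N a b (var z)) =
      (if k = b \<and> (a, l, d) = (i, j, c) then 1 else 0) - (if l = a \<and> (k, b, d) = (i, j, c) then 1 else 0)"
      unfolding kl dE_var[OF assms(1,2) z[unfolded kl]] lin_diffD[OF lin_partial] pv by (rule refl)
    have 2: "dE N a b (partial (i, j, c) (var z)) = 0"
      by (simp add: partial_def dX_one lin_0[OF lin_dX])
    have 3: "sc (of_bool (i = a)) (partial (b, j, c) (var z)) - sc (of_bool (j = b)) (partial (i, a, c) (var z)) =
      (if i = a \<and> (k, l, d) = (b, j, c) then 1 else 0) - (if j = b \<and> (k, l, d) = (i, a, c) then 1 else 0)"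
      unfolding kl partial_def dv_var so by (rule refl)
    have 4: "(k = b \<and> (a, l, d) = (i, j, c)) = (i = a \<and> (k, l, d) = (b, j, c))"
      "(l = a \<and> (k, b, d) = (i, j, c)) = (j = b \<and> (k, l, d) = (i, a, c))" by auto
    show "partial (i, j, c) (dE N a b (var z)) - dE N a b (partial (i, j, c) (var z)) =
      sc (of_bool (i = a)) (partial (b, j, c) (var z)) - sc (of_bool (j = b)) (partial (i, a, c) (var z))"
      unfolding 1 2 3 4 by (rule diff_0_right)
  qed (auto simp: dX_mult partial_mult lin_addD[OF lin_partial] lin_addD[OF lin_dX] sc_add sc_mult_left sc_mult_right algebra_simps)
  then show ?thesis by (simp add: algebra_simps)
qed

lemma partials_dE:
  assumes "a < N" "b < N" "set xs \<subseteq> ZN N" "g \<in> polys (ZN N)"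
  shows "partials xs (dE N a b g) = dE N a b (partials xs g) + (\<Sum>p<length xs. case xs ! p of (i, j, c) \<Rightarrow>
    sc (of_bool (i = a)) (partials (xs[p := (b, j, c)]) g) - sc (of_bool (j = b)) (partials (xs[p := (i, a, c)]) g))"
  using assms(3,4)
proof (induction xs arbitrary: g)
  case (Cons x xs)
  obtain i j c where x: "x = (i, j, c)" by (metis prod_cases3)
  have z: "(i, j, c) \<in> ZN N" using Cons(2) x by simp
  have "partials (x # xs) (dE N a b g) = partials xs (dE N a b (partial x g)) +
      (sc (of_bool (i = a)) (partials xs (partial (b, j, c) g)) - sc (of_bool (j = b)) (partials xs (partial (i, a, c) g)))"
    by (simp add: x partial_dE[OF assms(1,2) z Cons(3)] lin_addD[OF lin_partials] lin_diffD[OF lin_partials] lin_scD[OF lin_partials])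
  also have "partials xs (dE N a b (partial x g)) = dE N a b (partials (x # xs) g) + (\<Sum>p<length xs. case xs ! p of (i, j, c) \<Rightarrow>
    sc (of_bool (i = a)) (partials (xs[p := (b, j, c)]) (partial x g)) - sc (of_bool (j = b)) (partials (xs[p := (i, a, c)]) (partial x g)))"
    using Cons by (simp add: partial_polys)
  finally show ?case
    by (simp add: sum.lessThan_Suc_shift x del: sum.lessThan_Suc)
qed simp

text \<open>Every term of the derivation contains the linear form that has replaced a
  variable.\<close>

lemma dX_no_const:
  assumes "g \<in> polys (ZN N)" shows "lkp (dX N X g) {#} = 0"
proof -
  have "dX N X g \<in> pm {m. m \<noteq> {#}}"
    unfolding dX_def
  proof (rule dv_in[OF assms])
    fix z m assume "z \<in> ZN N"
    have "gl.li N (ad_act scale N X (eN N z)) \<in> pm {m. m \<noteq> {#}}"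
      by (rule pm_mono[OF gl.li_in[OF gl.co_pm]]) auto
    then show "gl.li N (ad_act scale N X (eN N z)) * mon m \<in> pm {m. m \<noteq> {#}}"
      by (rule pm_mult[of _ _ _ UNIV]) auto
  qed
  then show ?thesis by (simp add: pm_iff)
qed

lemma partials_polys: "g \<in> polys Z \<Longrightarrow> partials xs g \<in> polys Z"
  by (induction xs arbitrary: g) (auto intro: partial_polys)

text \<open>The iterated partial derivatives are moved past the derivation \<open>dE\<close>, whose
  values have no constant term; the commutators that remain change one row or column index at a
  time.\<close>

lemma partials_const_invariant:
  assumes "a < N" "b < N" "\<And>p. p < k \<Longrightarrow> I p < N \<and> J p < N \<and> \<beta> p \<in> B" "g \<in> polys (ZN N)" "dE N a b g = 0"
  shows "(\<Sum>p<k. if I p = a then partials_const (triples k (I(p := b)) J \<beta>) g else 0) =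
    (\<Sum>p<k. if J p = b then partials_const (triples k I (J(p := a)) \<beta>) g else 0)"
proof -
  let ?xs = "triples k I J \<beta>"
  have xs: "set ?xs \<subseteq> ZN N" using assms(3) by (auto simp: triples_def ZN_def)
  have l: "length ?xs = k" by (simp add: triples_def)
  have "0 = lkp (partials ?xs (dE N a b g)) {#}" by (simp add: assms(5) lin_0[OF lin_partials])
  also have "\<dots> = (\<Sum>p<k. case ?xs ! p of (i, j, c) \<Rightarrow>
    of_bool (i = a) * partials_const (?xs[p := (b, j, c)]) g - of_bool (j = b) * partials_const (?xs[p := (i, a, c)]) g)"
    unfolding partials_dE[OF assms(1,2) xs assms(4)] lookup_add lookup_sum l
    by (simp add: dX_no_const[OF partials_polys[OF assms(4)]] partials_const_def lookup_minus case_prod_unfold)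
  also have "\<dots> = (\<Sum>p<k. (if I p = a then partials_const (triples k (I(p := b)) J \<beta>) g else 0) -
      (if J p = b then partials_const (triples k I (J(p := a)) \<beta>) g else 0))"
  proof (rule sum.cong[OF refl])
    fix p assume p: "p \<in> {..<k}"
    then have "?xs ! p = (I p, J p, \<beta> p)" by (simp add: triples_def)
    then show "(case ?xs ! p of (i, j, c) \<Rightarrow>
        of_bool (i = a) * partials_const (?xs[p := (b, j, c)]) g - of_bool (j = b) * partials_const (?xs[p := (i, a, c)]) g) =
      (if I p = a then partials_const (triples k (I(p := b)) J \<beta>) g else 0) - (if J p = b then partials_const (triples k I (J(p := a)) \<beta>) g else 0)"
      using p by (simp add: triples_upd)
  qed
  finally show ?thesis by (simp add: sum_subtractf)
qed

text \<open>A stable form of the first fundamental theorem for matrices under simultaneous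
  conjugation. The \<open>k\<close> additional levels provide one fresh index for each of the
  \<open>k\<close> factors of a monomial.\<close>

lemma invariants_traces:
  assumes g: "g \<in> pm {m. set_mset m \<subseteq> ZN (M + k) \<and> size m = k}"
    and inv: "\<And>a b. a < M + k \<Longrightarrow> b < M + k \<Longrightarrow> dE (M + k) a b g = 0"
  shows "\<exists>s\<in>NP B k. cutoff M g = TN M s"
proof -
  let ?N = "M + k"
  \<comment> \<open>Only finitely many basis elements occur in \<open>g\<close>, so with labels in
    \<open>B0\<close> the sums over sequences of variables are finite.\<close>
  define B0 where "B0 = (\<lambda>(i, j, c). c) ` (\<Union>m\<in>keys g. set_mset m)"
  have gp: "g \<in> polys (ZN ?N)" using g by (rule pm_mono) auto
  have B0: "finite B0" "B0 \<subseteq> B"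
    using gp by (auto simp: B0_def pm_def ZN_def)
  let ?E = "\<lambda>N :: nat. {..<N} \<times> {..<N} \<times> B0"
  have gE: "g \<in> pm {m. set_mset m \<subseteq> ?E ?N \<and> size m = k}"
  proof -
    have "set_mset m \<subseteq> ?E ?N \<and> size m = k" if m: "m \<in> keys g" for m
    proof -
      have "set_mset m \<subseteq> ZN ?N" "size m = k" using g m by (auto simp: pm_def)
      moreover have "c \<in> B0" if "(i, j, c) \<in># m" for i j c
        unfolding B0_def using that m by force
      ultimately show ?thesis by (auto simp: ZN_def)
    qed
    then show ?thesis by (auto simp: pm_def)
  qed
  have fE: "finite (?E N)" for N using B0 by simp
  define P where "P = {\<tau>. \<tau> permutes {..<k}}"
  have fP: "finite P" unfolding P_def by (rule finite_permutations) simp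
  \<comment> \<open>The values at sequences with pairwise distinct fresh row indices;
    \<open>invariant_sequences\<close> expresses all values below \<open>M\<close> by them.\<close>
  define G where "G \<tau> bs = partials_const (triples k (\<lambda>p. M + p) (\<lambda>p. M + \<tau> p) (\<lambda>p. bs ! p)) g" for \<tau> bs
  let ?col = "\<lambda>x :: nat \<times> nat \<times> 'a. fst (snd x)" and ?lab = "\<lambda>x :: nat \<times> nat \<times> 'a. snd (snd x)"
  have partials_const: "partials_const xs g = (\<Sum>\<tau>\<in>P. if \<forall>q<k. ?col (xs ! q) = fst (xs ! \<tau> q) then G \<tau> (map ?lab xs) else 0)"
    if xs: "xs \<in> Ln (?E M) k" for xs
  proof -
    have x: "xs ! p \<in> ?E M" if "p < k" for p using xs that nth_mem[of p xs] by auto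
    have eq: "xs = triples k (\<lambda>p. fst (xs ! p)) (\<lambda>p. ?col (xs ! p)) (\<lambda>p. map ?lab xs ! p)"
      using xs by (intro nth_equalityI) (auto simp: triples_def)
    have "partials_const (triples k (\<lambda>p. fst (xs ! p)) (\<lambda>p. ?col (xs ! p)) (\<lambda>p. map ?lab xs ! p)) g =
      (\<Sum>\<tau> | \<tau> permutes {..<k}. if \<forall>q<k. ?col (xs ! q) = fst (xs ! \<tau> q) then
        partials_const (triples k (\<lambda>p. M + p) (\<lambda>p. M + \<tau> p) (\<lambda>p. map ?lab xs ! p)) g else 0)"
    proof (rule invariant_sequences[where c = "\<lambda>I J. partials_const (triples k I J (\<lambda>p. map ?lab xs ! p)) g"])
      fix I J I' J' :: "nat \<Rightarrow> nat"
      assume "\<And>p. p < k \<Longrightarrow> I p = I' p" "\<And>p. p < k \<Longrightarrow> J p = J' p"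
      then have "triples k I J (\<lambda>p. map ?lab xs ! p) = triples k I' J' (\<lambda>p. map ?lab xs ! p)"
        unfolding triples_def by (intro map_cong) auto
      then show "partials_const (triples k I J (\<lambda>p. map ?lab xs ! p)) g = partials_const (triples k I' J' (\<lambda>p. map ?lab xs ! p)) g" by simp
    next
      fix I J :: "nat \<Rightarrow> nat" and a b
      assume IJ: "\<And>p. p < k \<Longrightarrow> I p < ?N \<and> J p < ?N" and ab: "a < ?N" "b < ?N"
      have "map ?lab xs ! p \<in> B" if "p < k" for p using x[OF that] xs that B0 by auto
      then show "(\<Sum>p<k. if I p = a then partials_const (triples k (I(p := b)) J (\<lambda>p. map ?lab xs ! p)) g else 0) =
          (\<Sum>p<k. if J p = b then partials_const (triples k I (J(p := a)) (\<lambda>p. map ?lab xs ! p)) g else 0)"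
        using IJ by (intro partials_const_invariant[OF ab _ gp inv[OF ab]]) auto
    qed (use x in force)+
    then show ?thesis unfolding P_def G_def using eq by simp
  qed
  \<comment> \<open>A sequence of variables whose columns are the permuted rows amounts to a list of
    labels and a choice of row indices. Summing over the latter gives the expression treated in
    \<open>permutation_trace\<close>.\<close>
  have bij: "(\<Sum>xs\<in>Ln (?E M) k. if \<forall>q<k. ?col (xs ! q) = fst (xs ! \<tau> q) then sc (G \<tau> (map ?lab xs)) (mon (mset xs)) else 0) =
      (\<Sum>bs\<in>Ln B0 k. sc (G \<tau> bs) (\<Sum>I\<in>PiE {..<k} (\<lambda>_. {..<M}). \<Prod>p<k. path M [bs ! p] (I p) (I (\<tau> p))))"
    if \<tau>: "\<tau> \<in> P" for \<tau>
  proof -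
    have \<tau>k: "\<tau> p < k" if "p < k" for p
      using permutes_in_image[of \<tau> "{..<k}" p] \<tau> that unfolding P_def by simp
    have prod: "(\<Prod>p<k. path M [bs ! p] (I p) (I (\<tau> p))) = mon (mset (triples k I (\<lambda>p. I (\<tau> p)) (\<lambda>p. bs ! p)))"
      if I: "I \<in> PiE {..<k} (\<lambda>_. {..<M})" for I bs
    proof -
      have "path M [bs ! p] (I p) (I (\<tau> p)) = var (I p, I (\<tau> p), bs ! p)" if "p < k" for p
      proof -
        have "path M [bs ! p] (I p) (I (\<tau> p)) = (\<Sum>x<M. if x = I (\<tau> p) then var (I p, I (\<tau> p), bs ! p) else 0)"
          unfolding path.simps by (intro sum.cong) auto
        moreover have "I (\<tau> p) < M" using I \<tau>k[OF that] by auto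
        ultimately show ?thesis by simp
      qed
      then have "(\<Prod>p<k. path M [bs ! p] (I p) (I (\<tau> p))) = (\<Prod>p<k. var (I p, I (\<tau> p), bs ! p))" by simp
      also have "\<dots> = mon (mset (map (\<lambda>p. (I p, I (\<tau> p), bs ! p)) [0..<k]))"
      proof (induction k)
        case (Suc k)
        then show ?case by (simp add: mult_single)
      qed (simp add: zero_multiset_def[symmetric] del: zero_multiset_def)
      finally show ?thesis by (simp add: triples_def)
    qed
    let ?S = "{xs \<in> Ln (?E M) k. \<forall>q<k. ?col (xs ! q) = fst (xs ! \<tau> q)}"
    have "(\<Sum>xs\<in>Ln (?E M) k. if \<forall>q<k. ?col (xs ! q) = fst (xs ! \<tau> q) then sc (G \<tau> (map ?lab xs)) (mon (mset xs)) else 0) =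
      (\<Sum>xs\<in>?S. sc (G \<tau> (map ?lab xs)) (mon (mset xs)))"
      by (rule sum.inter_filter[symmetric]) (rule finite_lists_length_eq[OF fE])
    also have "\<dots> = (\<Sum>(bs, I)\<in>Ln B0 k \<times> PiE {..<k} (\<lambda>_. {..<M}).
        sc (G \<tau> bs) (mon (mset (triples k I (\<lambda>p. I (\<tau> p)) (\<lambda>p. bs ! p)))))"
    proof (rule sum.reindex_bij_witness[where
          i = "\<lambda>(bs, I). triples k I (\<lambda>p. I (\<tau> p)) (\<lambda>p. bs ! p)" and
          j = "\<lambda>xs. (map ?lab xs, \<lambda>p\<in>{..<k}. fst (xs ! p))"])
      fix xs assume "xs \<in> ?S"
      then have xs: "set xs \<subseteq> ?E M" "length xs = k" "\<And>q. q < k \<Longrightarrow> ?col (xs ! q) = fst (xs ! \<tau> q)" by auto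
      have x: "xs ! p \<in> ?E M" if "p < k" for p using xs that nth_mem[of p xs] by auto
      have "triples k (\<lambda>p\<in>{..<k}. fst (xs ! p)) (\<lambda>p. (\<lambda>p\<in>{..<k}. fst (xs ! p)) (\<tau> p)) (\<lambda>p. map ?lab xs ! p) = xs"
      proof (rule nth_equalityI)
        fix p assume "p < length (triples k (\<lambda>p\<in>{..<k}. fst (xs ! p)) (\<lambda>p. (\<lambda>p\<in>{..<k}. fst (xs ! p)) (\<tau> p)) (\<lambda>p. map ?lab xs ! p))"
        then have p: "p < k" by (simp add: triples_def)
        then show "triples k (\<lambda>p\<in>{..<k}. fst (xs ! p)) (\<lambda>p. (\<lambda>p\<in>{..<k}. fst (xs ! p)) (\<tau> p)) (\<lambda>p. map ?lab xs ! p) ! p = xs ! p"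
          using xs(2) \<tau>k[OF p] xs(3)[OF p] by (simp add: triples_def prod_eq_iff)
      qed (simp add: triples_def xs)
      then show e: "(case (map ?lab xs, \<lambda>p\<in>{..<k}. fst (xs ! p)) of (bs, I) \<Rightarrow> triples k I (\<lambda>p. I (\<tau> p)) (\<lambda>p. bs ! p)) = xs"
        by simp
      show "(map ?lab xs, \<lambda>p\<in>{..<k}. fst (xs ! p)) \<in> Ln B0 k \<times> PiE {..<k} (\<lambda>_. {..<M})"
      proof -
        have "?lab ` set xs \<subseteq> B0" using xs(1) by auto
        moreover have "fst (xs ! p) < M" if "p < k" for p using x[OF that] by auto
        ultimately show ?thesis using xs(2) by (auto simp del: set_image_mset)
      qed
      show "(case (map ?lab xs, \<lambda>p\<in>{..<k}. fst (xs ! p)) of (bs, I) \<Rightarrow>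
          sc (G \<tau> bs) (mon (mset (triples k I (\<lambda>p. I (\<tau> p)) (\<lambda>p. bs ! p))))) = sc (G \<tau> (map ?lab xs)) (mon (mset xs))"
        using e by simp
    next
      fix bI assume "bI \<in> Ln B0 k \<times> PiE {..<k} (\<lambda>_. {..<M})"
      then obtain bs I where bI: "bI = (bs, I)" "set bs \<subseteq> B0" "length bs = k" "I \<in> PiE {..<k} (\<lambda>_. {..<M})" by auto
      let ?xs = "triples k I (\<lambda>p. I (\<tau> p)) (\<lambda>p. bs ! p)"
      have n: "?xs ! p = (I p, I (\<tau> p), bs ! p)" if "p < k" for p using that by (simp add: triples_def)
      have "map ?lab ?xs = bs" using bI(3) by (intro nth_equalityI) (auto simp: triples_def)
      moreover have "(\<lambda>p\<in>{..<k}. fst (?xs ! p)) = I"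
        using bI(4) by (auto simp: fun_eq_iff n PiE_def extensional_def restrict_def)
      ultimately show "(map ?lab (case bI of (bs, I) \<Rightarrow> triples k I (\<lambda>p. I (\<tau> p)) (\<lambda>p. bs ! p)),
          \<lambda>p\<in>{..<k}. fst ((case bI of (bs, I) \<Rightarrow> triples k I (\<lambda>p. I (\<tau> p)) (\<lambda>p. bs ! p)) ! p)) = bI"
        by (simp add: bI)
      have "set ?xs \<subseteq> ?E M"
      proof
        fix y assume "y \<in> set ?xs"
        then obtain p where p: "p < k" "y = (I p, I (\<tau> p), bs ! p)" by (auto simp: triples_def)
        then show "y \<in> ?E M" using bI \<tau>k[OF p(1)] nth_mem[of p bs] by auto
      qed
      then show "(case bI of (bs, I) \<Rightarrow> triples k I (\<lambda>p. I (\<tau> p)) (\<lambda>p. bs ! p)) \<in> ?S"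
        using \<tau>k by (auto simp: bI n) (simp add: triples_def)
    qed
    also have "\<dots> = (\<Sum>bs\<in>Ln B0 k. \<Sum>I\<in>PiE {..<k} (\<lambda>_. {..<M}).
        sc (G \<tau> bs) (mon (mset (triples k I (\<lambda>p. I (\<tau> p)) (\<lambda>p. bs ! p)))))"
      by (rule sum.cartesian_product[symmetric])
    also have "\<dots> = (\<Sum>bs\<in>Ln B0 k. \<Sum>I\<in>PiE {..<k} (\<lambda>_. {..<M}).
        sc (G \<tau> bs) (\<Prod>p<k. path M [bs ! p] (I p) (I (\<tau> p))))"
      by (intro sum.cong refl) (simp only: prod)
    finally show ?thesis by (simp only: sc_sum)
  qed
  have ex: "\<exists>s\<in>NP B k. (\<Sum>I\<in>PiE {..<k} (\<lambda>_. {..<M}). \<Prod>p<k. path M [bs ! p] (I p) (I (\<tau> p))) = TN M s"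
    if "\<tau> \<in> P" "bs \<in> Ln B0 k" for \<tau> bs
  proof -
    have "\<exists>s\<in>NP B (\<Sum>p<k. length [bs ! p]). \<forall>N.
      (\<Sum>I\<in>PiE {..<k} (\<lambda>_. {..<N}). \<Prod>p<k. path N [bs ! p] (I p) (I (\<tau> p))) = TN N s"
    proof (rule permutation_trace)
      show "bij_betw \<tau> {..<k} {..<k}" using that(1) unfolding P_def by (auto intro: permutes_imp_bij)
      show "[bs ! p] \<noteq> [] \<and> set [bs ! p] \<subseteq> B" if p: "p \<in> {..<k}" for p
      proof -
        have "bs ! p \<in> set bs" "set bs \<subseteq> B0" using p \<open>bs \<in> Ln B0 k\<close> by auto
        then show ?thesis using B0(2) by auto
      qed
    qed simp
    then show ?thesis by auto
  qed
  define S where "S \<tau> bs = (SOME s. s \<in> NP B k \<and>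
      (\<Sum>I\<in>PiE {..<k} (\<lambda>_. {..<M}). \<Prod>p<k. path M [bs ! p] (I p) (I (\<tau> p))) = TN M s)" for \<tau> bs
  have S: "S \<tau> bs \<in> NP B k \<and>
      (\<Sum>I\<in>PiE {..<k} (\<lambda>_. {..<M}). \<Prod>p<k. path M [bs ! p] (I p) (I (\<tau> p))) = TN M (S \<tau> bs)"
    if "\<tau> \<in> P" "bs \<in> Ln B0 k" for \<tau> bs
    unfolding S_def using ex[OF that] by (intro someI_ex[of "\<lambda>s. s \<in> NP B k \<and> _ = TN M s"]) (simp only: Bex_def)
  \<comment> \<open>The factor compensates \<open>fact k\<close> from
    \<open>euler_lists\<close>.\<close>
  define s where "s = sc (1 / fact k) (\<Sum>\<tau>\<in>P. \<Sum>bs\<in>Ln B0 k. sc (G \<tau> bs) (S \<tau> bs))"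
  have sN: "s \<in> NP B k" unfolding s_def using S by (intro pm_sc pm_sum) blast
  have "sc (fact k) (cutoff M g) = cutoff M (\<Sum>xs\<in>Ln (?E ?N) k. sc (partials_const xs g) (mon (mset xs)))"
    unfolding euler_lists[OF fE gE, symmetric] by (rule lin_scD[OF lin_cutoff, symmetric])
  also have "\<dots> = (\<Sum>xs\<in>Ln (?E ?N) k. sc (partials_const xs g) (cutoff M (mon (mset xs))))"
    by (simp only: lin_sumD[OF lin_cutoff] lin_scD[OF lin_cutoff])
  \<comment> \<open>Truncation removes the sequences that contain an index
    \<open>\<ge> M\<close>.\<close>
  also have "\<dots> = (\<Sum>xs\<in>Ln (?E M) k. sc (partials_const xs g) (cutoff M (mon (mset xs))))"
  proof (rule sum.mono_neutral_right)
    show "finite (Ln (?E ?N) k)" by (rule finite_lists_length_eq[OF fE])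
    show "Ln (?E M) k \<subseteq> Ln (?E ?N) k" by auto
    show "\<forall>xs\<in>Ln (?E ?N) k - Ln (?E M) k. sc (partials_const xs g) (cutoff M (mon (mset xs))) = 0"
    proof
      fix xs assume xs: "xs \<in> Ln (?E ?N) k - Ln (?E M) k"
      have "\<not> (\<forall>(i, j, b)\<in>#mset xs. i < M \<and> j < M)"
      proof
        assume "\<forall>(i, j, b)\<in>#mset xs. i < M \<and> j < M"
        then have "set xs \<subseteq> ?E M" using xs by fastforce
        then show False using xs by auto
      qed
      then show "sc (partials_const xs g) (cutoff M (mon (mset xs))) = 0" unfolding cutoff_mon by (simp only: if_False sc_zero)
    qed
  qed
  also have "\<dots> = (\<Sum>xs\<in>Ln (?E M) k. sc (partials_const xs g) (mon (mset xs)))"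
    by (intro sum.cong refl) (auto simp: cutoff_mon)
  also have "\<dots> = (\<Sum>xs\<in>Ln (?E M) k. \<Sum>\<tau>\<in>P. if \<forall>q<k. ?col (xs ! q) = fst (xs ! \<tau> q) then
      sc (G \<tau> (map ?lab xs)) (mon (mset xs)) else 0)"
  proof (rule sum.cong[OF refl])
    have s0: "sc (sum f P) p = (\<Sum>\<tau>\<in>P. sc (f \<tau>) p)" for f and p :: "'a gpoly"
      using fP by (induction P) (simp_all add: sc_add_left)
    fix xs assume xs: "xs \<in> Ln (?E M) k"
    show "sc (partials_const xs g) (mon (mset xs)) = (\<Sum>\<tau>\<in>P. if \<forall>q<k. ?col (xs ! q) = fst (xs ! \<tau> q) then
        sc (G \<tau> (map ?lab xs)) (mon (mset xs)) else 0)"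
      unfolding partials_const[OF xs] s0 by (intro sum.cong refl) (auto simp del: Poly_Mapping.map_single)
  qed
  also have "\<dots> = (\<Sum>\<tau>\<in>P. \<Sum>xs\<in>Ln (?E M) k. if \<forall>q<k. ?col (xs ! q) = fst (xs ! \<tau> q) then
      sc (G \<tau> (map ?lab xs)) (mon (mset xs)) else 0)"
    by (rule sum.swap)
  also have "\<dots> = (\<Sum>\<tau>\<in>P. \<Sum>bs\<in>Ln B0 k. sc (G \<tau> bs) (TN M (S \<tau> bs)))"
    by (intro sum.cong refl) (simp only: bij, use S in \<open>intro sum.cong; simp\<close>)
  also have "\<dots> = TN M (\<Sum>\<tau>\<in>P. \<Sum>bs\<in>Ln B0 k. sc (G \<tau> bs) (S \<tau> bs))"
    by (simp only: lin_sumD[OF lin_TN] lin_scD[OF lin_TN])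
  finally have "sc (1 / fact k) (sc (fact k) (cutoff M g)) = TN M s"
    by (simp only: s_def lin_scD[OF lin_TN])
  then have "cutoff M g = TN M s" by simp
  with sN show ?thesis by blast
qed

lemma cutoff_cutoff: "M \<le> N \<Longrightarrow> cutoff M (cutoff N p) = cutoff M p"
  by (rule poly_mapping_eqI) (fastforce simp: cutoff_def lookup_filter_mon)

text \<open>\<open>f M\<close> is the truncation of \<open>f (M + k)\<close> and hence a polynomial
  in traces, but possibly with coefficients depending on \<open>M\<close>. From level
  \<open>k\<close> on, truncation to level \<open>k\<close> and \<open>TN_inj\<close> show that they
  do not; the lower levels are truncations of level \<open>k\<close>.\<close>

lemma stable_invariants:
  assumes f: "\<And>N. f N \<in> pm {m. set_mset m \<subseteq> ZN N \<and> size m = k}"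
    and inv: "\<And>N X. X \<in> carrier_mat N N \<Longrightarrow> dX N X (f N) = 0"
    and cutoff: "\<And>N. N > 0 \<Longrightarrow> cutoff (N - 1) (f N) = f (N - 1)"
  shows "\<exists>s\<in>NP B k. \<forall>N. f N = TN N s"
proof -
  have fp: "f N \<in> polys (ZN N)" for N using f by (rule pm_mono) auto
  have r: "cutoff M (f (M + d)) = f M" for M d
  proof (induction d)
    case (Suc d)
    have "cutoff M (f (M + Suc d)) = cutoff M (cutoff (M + d) (f (M + Suc d)))" by (simp add: cutoff_cutoff)
    also have "cutoff (M + d) (f (M + Suc d)) = f (M + d)" using cutoff[of "M + Suc d"] by simp
    finally show ?case using Suc by simp
  qed (simp add: cutoff_id fp)
  have "\<exists>s\<in>NP B k. f M = TN M s" for M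
  proof -
    have "\<exists>s\<in>NP B k. cutoff M (f (M + k)) = TN M s"
      by (rule invariants_traces[OF f], rule inv, simp)
    then show ?thesis unfolding r .
  qed
  then have "\<forall>M. \<exists>s. s \<in> NP B k \<and> f M = TN M s" by blast
  from choice[OF this] obtain S where S: "\<And>M. S M \<in> NP B k" "\<And>M. f M = TN M (S M)" by blast
  have st: "S (k + d) = S k" for d
  proof -
    have "TN k (S (k + d)) = cutoff k (f (k + d))"
      unfolding S(2)[of "k + d"] by (rule cutoff_TN[OF S(1), symmetric]) simp
    also have "\<dots> = TN k (S k)" unfolding r by (rule S(2))
    finally have "TN k (S (k + d) - S k) = 0" by (simp add: lin_diffD[OF lin_TN])
    then have "S (k + d) - S k = 0"
      using S(1) by (intro TN_inj[of _ B k k]) auto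
    then show ?thesis by simp
  qed
  have "f N = TN N (S k)" for N
  proof (cases "k \<le> N")
    case True
    then show ?thesis using S(2)[of N] st[of "N - k"] by simp
  next
    case False
    then have "f N = cutoff N (f k)" using r[of N "k - N"] by simp
    also have "\<dots> = TN N (S k)" using S(2)[of k] cutoff_TN[OF S(1)[of k], of N k] False by simp
    finally show ?thesis .
  qed
  then show ?thesis using S(1) by blast
qed

end

section \<open>Cyclic coinvariants and their symmetric algebra\<close>

lemma dsum_sel [simp]:
  "zero (dsum J M) = (\<lambda>m\<in>J. \<zero>\<^bsub>M m\<^esub>)" "add (dsum J M) = (\<lambda>u v. \<lambda>m\<in>J. u m \<oplus>\<^bsub>M m\<^esub> v m)"
  "module.smult (dsum J M) = (\<lambda>c u. \<lambda>m\<in>J. c \<odot>\<^bsub>M m\<^esub> u m)"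
  "carrier (dsum J M) = {u \<in> \<Pi>\<^sub>E m\<in>J. carrier (M m). finite {m \<in> J. u m \<noteq> \<zero>\<^bsub>M m\<^esub>}}"
  by (simp_all add: dsum_def)

lemma vec_space_dsum:
  assumes M: "\<And>m. m \<in> J \<Longrightarrow> vec_space (M m)"
  shows "vec_space (dsum J M)"
proof -
  have ag: "abelian_group (M m)" if "m \<in> J" for m by (rule vspD(1)[OF M[OF that]])
  note am = abelian_group.axioms(1)[OF ag]
  have clo: "(\<lambda>m\<in>J. u m \<oplus>\<^bsub>M m\<^esub> v m) \<in> carrier (dsum J M)"
    if u: "u \<in> carrier (dsum J M)" "v \<in> carrier (dsum J M)" for u v
  proof -
    have "{m \<in> J. (\<lambda>m\<in>J. u m \<oplus>\<^bsub>M m\<^esub> v m) m \<noteq> \<zero>\<^bsub>M m\<^esub>} \<subseteq>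
        {m \<in> J. u m \<noteq> \<zero>\<^bsub>M m\<^esub>} \<union> {m \<in> J. v m \<noteq> \<zero>\<^bsub>M m\<^esub>}"
      using abelian_monoid.l_zero[OF am] abelian_monoid.zero_closed[OF am] by auto
    then have "finite {m \<in> J. (\<lambda>m\<in>J. u m \<oplus>\<^bsub>M m\<^esub> v m) m \<noteq> \<zero>\<^bsub>M m\<^esub>}"
      by (rule finite_subset) (use u in simp)
    then show ?thesis using u abelian_monoid.a_closed[OF am] by (auto simp: PiE_iff)
  qed
  have "abelian_group (dsum J M)"
  proof (rule abelian_groupI)
    show "x \<oplus>\<^bsub>dsum J M\<^esub> y \<in> carrier (dsum J M)" if "x \<in> carrier (dsum J M)" "y \<in> carrier (dsum J M)" for x y
      using clo[OF that] by simp
    show "\<zero>\<^bsub>dsum J M\<^esub> \<in> carrier (dsum J M)"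
      using abelian_monoid.zero_closed[OF am] by auto
    fix u assume u: "u \<in> carrier (dsum J M)"
    show "\<zero>\<^bsub>dsum J M\<^esub> \<oplus>\<^bsub>dsum J M\<^esub> u = u"
      using u abelian_monoid.l_zero[OF am] by (auto simp: fun_eq_iff PiE_def extensional_def)
    let ?w = "\<lambda>m\<in>J. \<ominus>\<^bsub>M m\<^esub> u m"
    have "{m \<in> J. ?w m \<noteq> \<zero>\<^bsub>M m\<^esub>} \<subseteq> {m \<in> J. u m \<noteq> \<zero>\<^bsub>M m\<^esub>}"
    proof -
      have "\<ominus>\<^bsub>M m\<^esub> \<zero>\<^bsub>M m\<^esub> = \<zero>\<^bsub>M m\<^esub>" if "m \<in> J" for m
        by (rule abelian_group.minus_equality[OF ag[OF that]])
          (simp_all add: abelian_monoid.l_zero[OF am[OF that]] abelian_monoid.zero_closed[OF am[OF that]])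
      then show ?thesis by auto
    qed
    then have "finite {m \<in> J. ?w m \<noteq> \<zero>\<^bsub>M m\<^esub>}" by (rule finite_subset) (use u in simp)
    then have "?w \<in> carrier (dsum J M)" using u abelian_group.a_inv_closed[OF ag] by auto
    moreover have "?w \<oplus>\<^bsub>dsum J M\<^esub> u = \<zero>\<^bsub>dsum J M\<^esub>"
      using u abelian_group.l_neg[OF ag] by (auto simp: fun_eq_iff)
    ultimately show "\<exists>y\<in>carrier (dsum J M). y \<oplus>\<^bsub>dsum J M\<^esub> u = \<zero>\<^bsub>dsum J M\<^esub>" by blast
    fix v assume v: "v \<in> carrier (dsum J M)"
    show "u \<oplus>\<^bsub>dsum J M\<^esub> v = v \<oplus>\<^bsub>dsum J M\<^esub> u"
      using u v by (auto simp: fun_eq_iff PiE_iff intro!: abelian_monoid.a_comm[OF am])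
    fix w assume w: "w \<in> carrier (dsum J M)"
    show "u \<oplus>\<^bsub>dsum J M\<^esub> v \<oplus>\<^bsub>dsum J M\<^esub> w = u \<oplus>\<^bsub>dsum J M\<^esub> (v \<oplus>\<^bsub>dsum J M\<^esub> w)"
      using u v w by (auto simp: fun_eq_iff PiE_iff intro!: abelian_monoid.a_assoc[OF am])
  qed
  moreover have "c \<odot>\<^bsub>dsum J M\<^esub> u \<in> carrier (dsum J M)" if u: "u \<in> carrier (dsum J M)" for c u
  proof -
    have "{m \<in> J. (\<lambda>m\<in>J. c \<odot>\<^bsub>M m\<^esub> u m) m \<noteq> \<zero>\<^bsub>M m\<^esub>} \<subseteq> {m \<in> J. u m \<noteq> \<zero>\<^bsub>M m\<^esub>}"
      using vec_space_zero[OF M] by auto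
    then have "finite {m \<in> J. (\<lambda>m\<in>J. c \<odot>\<^bsub>M m\<^esub> u m) m \<noteq> \<zero>\<^bsub>M m\<^esub>}"
      by (rule finite_subset) (use u in simp)
    then show ?thesis using u vspD(2)[OF M] by auto
  qed
  moreover have "c \<odot>\<^bsub>dsum J M\<^esub> (u \<oplus>\<^bsub>dsum J M\<^esub> v) = c \<odot>\<^bsub>dsum J M\<^esub> u \<oplus>\<^bsub>dsum J M\<^esub> c \<odot>\<^bsub>dsum J M\<^esub> v"
    if "u \<in> carrier (dsum J M)" "v \<in> carrier (dsum J M)" for c u v
    using that by (auto simp: fun_eq_iff PiE_iff intro!: vspD(3)[OF M])
  ultimately show ?thesis unfolding vec_space_def by blast
qed

section \<open>The cyclic action on words\<close>

definition rot :: "nat \<Rightarrow> ('x list \<Rightarrow>\<^sub>0 complex) \<Rightarrow> ('x list \<Rightarrow>\<^sub>0 complex)" where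
  "rot k = lext (\<lambda>w. mon (rotate k w))"

lemma lin_rot: "lin (rot k)" unfolding rot_def by (rule lin_lext)
lemma rot_mon: "rot k (mon w) = mon (rotate k w)" by (simp add: rot_def)

lemma rot_mult:
  assumes "p \<in> pm {w. length w = k mod n}" "q \<in> pm {w. length w = n - k mod n}" "n > 0"
  shows "rot k (p * q) = q * p"
proof -
  have 1: "rot k (mon u * mon v) = mon v * mon u" if "length u = k mod n" "length v = n - k mod n" for u v :: "'a list"
  proof -
    have "length (u @ v) = n" using that assms(3) by simp
    then have "rotate k (u @ v) = v @ u" using that by (simp add: rotate_drop_take)
    then show ?thesis by (simp add: rot_mon flip: mon_append)
  qed
  have 2: "rot k (mon u * q) = q * mon u" if "length u = k mod n" for u
    by (rule lin_eq[OF _ _ assms(2)])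
      (auto intro!: lin_comp[OF lin_rot] lin_intros simp: 1[OF that])
  show ?thesis
    by (rule lin_eq[OF _ _ assms(1)])
      (auto intro!: lin_comp[OF lin_rot] lin_intros simp: 2)
qed

text \<open>A rotation cuts a word in two and exchanges the pieces. Expansion in the basis is
  multiplicative and keeps the lengths of the pieces, so it commutes with this.\<close>

lemma (in vbasis) ex_rot: assumes p: "p \<in> FV" shows "ex (rot k p) = rot k (ex p)"
proof (rule lin_eq[OF lin_comp[OF lin_ex lin_rot] lin_comp[OF lin_rot lin_ex] p])
  fix w assume w: "w \<in> lists (carrier V)"
  show "ex (rot k (mon w)) = rot k (ex (mon w))"
  proof (cases "w = []")
    case True
    have "rot k 1 = (1 :: 'y list \<Rightarrow>\<^sub>0 complex)" using rot_mon[of k "[] :: 'y list"] by (simp add: mon_Nil)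
    moreover have "ex (mon []) = 1" by (simp add: ex_mon)
    ultimately show ?thesis using True by (simp add: rot_mon)
  next
    case False
    let ?j = "k mod length w"
    have l: "take ?j w \<in> lists (carrier V)" "drop ?j w \<in> lists (carrier V)"
      using w set_take_subset[of ?j w] set_drop_subset[of ?j w] by (auto simp: in_lists_conv_set)
    have len: "length (take ?j w) = ?j" "length (drop ?j w) = length w - ?j"
      using False by (simp_all add: less_imp_le)
    have "mon w = mon (take ?j w) * mon (drop ?j w)" by (simp flip: mon_append)
    then have "ex (mon w) = ex (mon (take ?j w)) * ex (mon (drop ?j w))" by (simp add: ex_mult)
    moreover have "rot k \<dots> = ex (mon (drop ?j w)) * ex (mon (take ?j w))"
      by (rule rot_mult[where n = "length w"]; (rule pm_mono[OF ex_length[OF l(1)]] pm_mono[OF ex_length[OF l(2)]])?)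
        (use len False in auto)
    moreover have "ex (rot k (mon w)) = ex (mon (drop ?j w)) * ex (mon (take ?j w))"
      by (simp add: rot_mon rotate_drop_take mon_append ex_mult)
    ultimately show ?thesis by simp
  qed
qed

context omega_basis
begin

abbreviation "Om \<equiv> Omega scale"
abbreviation "FVm m \<equiv> pm {w :: 'a list. length w = m}"

definition to_necklace :: "('a list \<Rightarrow>\<^sub>0 complex) \<Rightarrow> ('a list set \<Rightarrow>\<^sub>0 complex)" where
  "to_necklace = lext (\<lambda>w. mon (necklace w))"

definition from_necklace :: "('a list set \<Rightarrow>\<^sub>0 complex) \<Rightarrow> ('a list \<Rightarrow>\<^sub>0 complex)" where
  "from_necklace = lext (\<lambda>z. mon (SOME w. w \<in> z))"

text \<open>On words of length \<open>m\<close>, \<open>cyc_class\<close> induces the isomorphism of the cyclic coinvariants of degree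
  \<open>m\<close> with the space spanned by the necklaces of length \<open>m\<close> over the basis.\<close>

definition cyc_class :: "('a list \<Rightarrow>\<^sub>0 complex) \<Rightarrow> ('a list set \<Rightarrow>\<^sub>0 complex)" where
  "cyc_class p = to_necklace (om.ex p)"

lemma lin_to_necklace: "lin to_necklace" unfolding to_necklace_def by (rule lin_lext)
lemma lin_from_necklace: "lin from_necklace" unfolding from_necklace_def by (rule lin_lext)
lemma lin_cyc_class: "lin cyc_class" unfolding cyc_class_def[abs_def] by (rule lin_comp[OF lin_to_necklace om.lin_ex])
lemma to_necklace_mon: "to_necklace (mon w) = mon (necklace w)" by (simp add: to_necklace_def)

lemma om_em: "om.em p = p"
  using lext_id[of p] by (simp add: om.em_def)

lemma to_necklace_rot: "to_necklace (rot k p) = to_necklace p"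
  by (rule lin_eq[OF lin_comp[OF lin_to_necklace lin_rot] lin_to_necklace, of p UNIV]) (simp_all add: rot_mon to_necklace_mon necklace_rotate)

lemma cyc_class_rot: "cyc_class (rot k p) = cyc_class p"
  by (simp add: cyc_class_def om.ex_rot to_necklace_rot)

lemma rot_FVm: "p \<in> FVm m \<Longrightarrow> rot k p \<in> FVm m"
  by (erule lin_pm[OF lin_rot]) (simp add: rot_mon)

lemma ex_FVm: "p \<in> FVm m \<Longrightarrow> om.ex p \<in> pm {w \<in> lists B. length w = m}"
  by (erule lin_pm[OF om.lin_ex], rule pm_mono[OF om.ex_length]) auto

lemma cyc_class_pm: "p \<in> FVm m \<Longrightarrow> m \<ge> 1 \<Longrightarrow> cyc_class p \<in> pm {z \<in> necklaces B. nlen z = m}"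
  unfolding cyc_class_def
  by (rule lin_pm[OF lin_to_necklace ex_FVm]) (auto simp: to_necklace_mon nlen_necklace necklaces_def in_lists_conv_set subset_iff)

lemma cyc_class_word: "set w \<subseteq> B \<Longrightarrow> cyc_class (mon w) = mon (necklace w)"
  using om.ex_em[of "mon w"] by (simp add: cyc_class_def om_em to_necklace_mon in_lists_conv_set subset_iff)

lemma some_in_necklaces: "z \<in> necklaces B \<Longrightarrow> \<exists>w. (SOME v. v \<in> z) = w \<and> w \<noteq> [] \<and> set w \<subseteq> B \<and> necklace w = z \<and> nlen z = length w"
proof -
  assume "z \<in> necklaces B"
  then obtain w where w: "z = necklace w" "w \<noteq> []" "set w \<subseteq> B" by (auto simp: necklaces_def)
  obtain k where "(SOME v. v \<in> necklace w) = rotate k w" using some_necklace by blast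
  then show ?thesis using w by (intro exI[of _ "rotate k w"]) (simp add: necklace_rotate nlen_necklace)
qed

lemma from_necklace_pm: "q \<in> pm {z \<in> necklaces B. nlen z = m} \<Longrightarrow> from_necklace q \<in> FVm m"
  by (erule lin_pm[OF lin_from_necklace]) (simp add: from_necklace_def nlen_def)

lemma cyc_class_from_necklace: "q \<in> pm {z \<in> necklaces B. nlen z = m} \<Longrightarrow> cyc_class (from_necklace q) = q"
proof (erule lin_eq[OF lin_comp[OF lin_cyc_class lin_from_necklace] lin_id])
  fix z assume "z \<in> {z \<in> necklaces B. nlen z = m}"
  then show "cyc_class (from_necklace (mon z)) = mon z" using some_in_necklaces[of z] by (auto simp: from_necklace_def cyc_class_word)
qed

lemma tensor_power_eq:
  "tensor_power Om m = (tensor_alg Om)\<lparr>carrier := om.qT ` FVm m\<rparr>"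
proof -
  have "{tens Om w | w. length w = m \<and> set w \<subseteq> carrier Om} = om.qT ` mon ` {w. length w = m}"
    by (auto simp: om.qT_def tens_def image_iff)
  moreover have "lin_span (tensor_alg Om) (om.qT ` mon ` {w. length w = m}) = om.qT ` FVm m"
    by (rule lin_span_presents[OF om.presents_tensor]) auto
  ultimately show ?thesis by (simp add: tensor_power_def)
qed

lemma tensor_power_lin_subspace: "lin_subspace (om.qT ` FVm m) (tensor_alg Om)"
  by (rule lin_subspace_image[OF om.presents_tensor]) auto

lemma vec_space_tensor_alg: "vec_space (tensor_alg Om)"
  by (rule calgD(1)[OF presentsD(1)[OF om.presents_tensor]])

lemma vec_space_tensor_power: "vec_space (tensor_power Om m)"
  unfolding tensor_power_eq by (rule sub_vec_space[OF vec_space_tensor_alg tensor_power_lin_subspace])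

lemma tensor_power_minus:
  assumes "p \<in> FVm m" "p' \<in> FVm m"
  shows "om.qT p \<ominus>\<^bsub>tensor_power Om m\<^esub> om.qT p' = om.qT (p - p')"
  unfolding tensor_power_eq using assms tensor_power_lin_subspace[of m] presents_minus[OF om.presents_tensor, of p p']
  by (subst sub_minus) (auto simp: lin_subspace_def vspD(1)[OF vec_space_tensor_alg])

lemma qT_eq_iff: "om.qT p = om.qT p' \<longleftrightarrow> om.ex p = om.ex p'"
  using presentsD(5)[OF om.presents_tensor, of p p'] om.tensor_ideal_iff[of "p - p'"]
  by (simp add: lin_diffD[OF om.lin_ex])

lemma cyc_act_qT: "cyc_act Om k (om.qT p) = om.qT (rot k p)"
proof -
  have "quot_map (free_alg (carrier Om)) (tensor_ideal Om) (rot k) (tensor_ideal Om +>\<^bsub>free_alg (carrier Om)\<^esub> p)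
      = tensor_ideal Om +>\<^bsub>free_alg (carrier Om)\<^esub> rot k p"
  proof (rule quot_map_presents[OF presents_free om.presents_tensor[unfolded tensor_alg_def om.qT_def[abs_def]]
        om.tensor_quot(5) _ om.presents_tensor[unfolded om.qT_def[abs_def]] lin_rot])
    fix p assume "p \<in> tensor_ideal Om"
    then have "om.ex (rot k p) = 0" by (simp add: om.ex_rot om.ex_tensor_ideal lin_0[OF lin_rot])
    then show "rot k p \<in> tensor_ideal Om" by (simp add: om.tensor_ideal_iff)
  qed auto
  then show ?thesis
    by (simp add: cyc_act_def lin_ext_eq_lext om.qT_def flip: rot_def)
qed

definition Dm :: "nat \<Rightarrow> ('a list \<Rightarrow>\<^sub>0 complex) set set" where
  "Dm m = om.qT ` {p \<in> FVm m. cyc_class p = 0}"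

text \<open>\<open>cyc_class\<close> does not change under rotation. Conversely, each word over the
  basis differs by one of the relations from the representative chosen for its necklace, so a tensor
  with \<open>cyc_class\<close> 0 is a linear combination of relations.\<close>

lemma coinvariant_relations:
  assumes m: "m \<ge> 1"
  shows "lin_span (tensor_power Om m)
       {t \<ominus>\<^bsub>tensor_alg Om\<^esub> cyc_act Om k t | t k. t \<in> carrier (tensor_power Om m) \<and> k < m} = Dm m"
    (is "lin_span _ ?S = _")
proof
  note D = presentsD[OF om.presents_tensor]
  have e: "om.qT p \<ominus>\<^bsub>tensor_alg Om\<^esub> cyc_act Om k (om.qT p) = om.qT (p - rot k p)" for p k
    using presents_minus[OF om.presents_tensor, of p "rot k p"] by (simp add: cyc_act_qT)
  have S: "?S = {om.qT (p - rot k p) | p k. p \<in> FVm m \<and> k < m}"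
  proof
    show "?S \<subseteq> {om.qT (p - rot k p) | p k. p \<in> FVm m \<and> k < m}"
    proof
      fix x assume "x \<in> ?S"
      then obtain p k where "p \<in> FVm m" "k < m" "x = om.qT (p - rot k p)"
        by (auto simp: tensor_power_eq e)
      then show "x \<in> {om.qT (p - rot k p) | p k. p \<in> FVm m \<and> k < m}" by blast
    qed
    show "{om.qT (p - rot k p) | p k. p \<in> FVm m \<and> k < m} \<subseteq> ?S"
    proof
      fix x assume "x \<in> {om.qT (p - rot k p) | p k. p \<in> FVm m \<and> k < m}"
      then obtain p k where p: "p \<in> FVm m" "k < m" "x = om.qT (p - rot k p)" by blast
      have "om.qT p \<in> carrier (tensor_power Om m)" using p(1) by (simp add: tensor_power_eq)
      then show "x \<in> ?S" unfolding p(3) e[symmetric] using p(2) by blast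
    qed
  qed
  show "lin_span (tensor_power Om m) ?S \<subseteq> Dm m"
  proof (rule lin_span_least)
    show "?S \<subseteq> Dm m"
      unfolding S Dm_def by (auto intro!: imageI pm_diff rot_FVm simp: lin_diffD[OF lin_cyc_class] cyc_class_rot)
    show "\<zero>\<^bsub>tensor_power Om m\<^esub> \<in> Dm m"
      by (auto simp: tensor_power_eq D(10) Dm_def lin_0[OF lin_cyc_class])
    show "x \<oplus>\<^bsub>tensor_power Om m\<^esub> y \<in> Dm m" if "x \<in> Dm m" "y \<in> Dm m" for x y
      using that by (auto simp: tensor_power_eq D(6) Dm_def lin_addD[OF lin_cyc_class] intro!: imageI)
    show "c \<odot>\<^bsub>tensor_power Om m\<^esub> x \<in> Dm m" if "x \<in> Dm m" for c x
      using that by (auto simp: tensor_power_eq D(8) Dm_def lin_scD[OF lin_cyc_class] intro!: imageI)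
  qed
  have *: "om.qT (y - from_necklace (to_necklace y)) \<in> lin_span (tensor_alg Om) ?S" if "y \<in> pm {w \<in> lists B. length w = m}" for y
    using that
  proof (induction rule: pm_induct)
    case zero
    show ?case using lin_span.zero[of "tensor_alg Om"] by (simp add: D(10) lin_0[OF lin_to_necklace] lin_0[OF lin_from_necklace])
  next
    case (add p q)
    have "om.qT (p + q - from_necklace (to_necklace (p + q))) = om.qT (p - from_necklace (to_necklace p)) \<oplus>\<^bsub>tensor_alg Om\<^esub> om.qT (q - from_necklace (to_necklace q))"
      by (simp add: D(6) lin_addD[OF lin_to_necklace] lin_addD[OF lin_from_necklace] algebra_simps)
    then show ?case using lin_span.add[OF add(3,4)] by simp
  next
    case (mon c w)
    obtain k where k: "(SOME v. v \<in> necklace w) = rotate k w" using some_necklace by blast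
    \<comment> \<open>The relations involve only rotations by less than \<open>m\<close>.\<close>
    have "rotate k w = rotate (k mod m) w" using mon by (simp add: rotate_conv_mod[of k])
    then have "from_necklace (to_necklace (mon w)) = rot (k mod m) (mon w)"
      by (simp add: to_necklace_mon from_necklace_def k rot_mon)
    moreover have "om.qT (mon w - rot (k mod m) (mon w)) \<in> ?S"
      unfolding S using mon m by (intro CollectI exI[of _ "mon w"] exI[of _ "k mod m"]) auto
    ultimately have "om.qT (mon w - from_necklace (to_necklace (mon w))) \<in> lin_span (tensor_alg Om) ?S"
      by (simp add: lin_span.base)
    from lin_span.smult[OF this, of c] show ?case
      by (simp add: D(8) sc_diff lin_scD[OF lin_to_necklace] lin_scD[OF lin_from_necklace] del: Poly_Mapping.map_single)
  qed
  show "Dm m \<subseteq> lin_span (tensor_power Om m) ?S"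
  proof
    fix x assume "x \<in> Dm m"
    then obtain p where p: "p \<in> FVm m" "cyc_class p = 0" "x = om.qT p" by (auto simp: Dm_def)
    \<comment> \<open>The basis is contained in \<open>\<Omega>\<close> itself, so the expansion of
      \<open>p\<close> is again a combination of words over \<open>\<Omega>\<close>, and it
      represents the same tensor.\<close>
    have "x = om.qT (om.ex p)"
      unfolding p(3) qT_eq_iff using om.ex_em[of "om.ex p"] om.ex_pm[of p] by (simp add: om_em)
    moreover have "om.qT (om.ex p - from_necklace (to_necklace (om.ex p))) \<in> lin_span (tensor_alg Om) ?S"
      by (rule *[OF ex_FVm[OF p(1)]])
    ultimately show "x \<in> lin_span (tensor_power Om m) ?S"
      using p(2) by (simp add: cyc_class_def lin_0[OF lin_from_necklace] tensor_power_eq)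
  qed
qed

section \<open>Necklaces as a basis of the cyclic coinvariants\<close>

definition cT :: "nat \<Rightarrow> ('a list \<Rightarrow>\<^sub>0 complex) \<Rightarrow> ('a list \<Rightarrow>\<^sub>0 complex) set set" where
  "cT m p = Dm m +>\<^bsub>tensor_power Om m\<^esub> om.qT p"

lemma T_cycl_quot: "m \<ge> 1 \<Longrightarrow> T_cycl Om m = quot (tensor_power Om m) (Dm m)"
  by (simp add: T_cycl_def coinvariant_relations)

lemma Dm_lin_subspace: "lin_subspace (Dm m) (tensor_power Om m)"
  unfolding tensor_power_eq
proof (rule sub_lin_subspace[OF vec_space_tensor_alg tensor_power_lin_subspace])
  show "lin_subspace (Dm m) (tensor_alg Om)"
    unfolding Dm_def
    by (rule lin_subspace_image[OF om.presents_tensor]) (auto simp: lin_0[OF lin_cyc_class] lin_addD[OF lin_cyc_class] lin_scD[OF lin_cyc_class])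
qed (auto simp: Dm_def)

lemma T_cycl_simps:
  assumes m: "m \<ge> 1"
  shows "vec_space (T_cycl Om m)" "carrier (T_cycl Om m) = cT m ` FVm m" "\<zero>\<^bsub>T_cycl Om m\<^esub> = cT m 0"
    "\<And>p p'. p \<in> FVm m \<Longrightarrow> p' \<in> FVm m \<Longrightarrow> cT m p \<oplus>\<^bsub>T_cycl Om m\<^esub> cT m p' = cT m (p + p')"
    "\<And>p c. p \<in> FVm m \<Longrightarrow> c \<odot>\<^bsub>T_cycl Om m\<^esub> cT m p = cT m (sc c p)"
    "\<And>p p'. p \<in> FVm m \<Longrightarrow> p' \<in> FVm m \<Longrightarrow> cT m p = cT m p' \<longleftrightarrow> cyc_class p = cyc_class p'"
proof -
  note D = presentsD[OF om.presents_tensor]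
  note q = quot_simps[OF vec_space_tensor_power[of m] Dm_lin_subspace]
  have c: "om.qT p \<in> carrier (tensor_power Om m)" if "p \<in> FVm m" for p
    using that by (simp add: tensor_power_eq)
  show "vec_space (T_cycl Om m)" unfolding T_cycl_quot[OF m] by (rule quot_vec_space[OF vec_space_tensor_power Dm_lin_subspace])
  show "carrier (T_cycl Om m) = cT m ` FVm m"
    unfolding T_cycl_quot[OF m] quot_carrier by (auto simp: cT_def tensor_power_eq)
  show "\<zero>\<^bsub>T_cycl Om m\<^esub> = cT m 0"
    unfolding T_cycl_quot[OF m] q(3) cT_def by (simp add: tensor_power_eq D(10))
  fix p assume p: "p \<in> FVm m"
  show "c \<odot>\<^bsub>T_cycl Om m\<^esub> cT m p = cT m (sc c p)" for c
    unfolding T_cycl_quot[OF m] cT_def q(2)[OF c[OF p]] by (simp add: tensor_power_eq D(8))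
  fix p' assume p': "p' \<in> FVm m"
  show "cT m p \<oplus>\<^bsub>T_cycl Om m\<^esub> cT m p' = cT m (p + p')"
    unfolding T_cycl_quot[OF m] cT_def q(1)[OF c[OF p] c[OF p']] by (simp add: tensor_power_eq D(6))
  have "cT m p = cT m p' \<longleftrightarrow> om.qT (p - p') \<in> Dm m"
    unfolding cT_def q(4)[OF c[OF p] c[OF p']] tensor_power_minus[OF p p'] ..
  also have "\<dots> \<longleftrightarrow> cyc_class (p - p') = 0"
  proof
    assume "om.qT (p - p') \<in> Dm m"
    then obtain r where "cyc_class r = 0" "om.qT (p - p') = om.qT r" by (auto simp: Dm_def)
    then show "cyc_class (p - p') = 0" by (simp add: qT_eq_iff cyc_class_def)
  next
    assume "cyc_class (p - p') = 0"
    then show "om.qT (p - p') \<in> Dm m" unfolding Dm_def using p p' by auto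
  qed
  finally show "cT m p = cT m p' \<longleftrightarrow> cyc_class p = cyc_class p'" by (simp add: lin_diffD[OF lin_cyc_class])
qed

definition cyc_coord :: "nat \<Rightarrow> ('a list \<Rightarrow>\<^sub>0 complex) set set \<Rightarrow> ('a list set \<Rightarrow>\<^sub>0 complex)" where
  "cyc_coord m X = cyc_class (SOME p. p \<in> FVm m \<and> cT m p = X)"

lemma cyc_coord_cT: assumes "m \<ge> 1" "p \<in> FVm m" shows "cyc_coord m (cT m p) = cyc_class p"
proof -
  let ?p = "SOME p'. p' \<in> FVm m \<and> cT m p' = cT m p"
  have "?p \<in> FVm m \<and> cT m ?p = cT m p" by (rule someI[of _ p]) (use assms in simp)
  then show ?thesis using T_cycl_simps(6)[OF assms(1), of ?p p] assms(2) by (simp add: cyc_coord_def)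
qed

text \<open>Components of different degree involve necklaces of different length, so adding their
  coordinates loses nothing.\<close>

definition coC :: "(nat \<Rightarrow> ('a list \<Rightarrow>\<^sub>0 complex) set set) \<Rightarrow> ('a list set \<Rightarrow>\<^sub>0 complex)" where
  "coC u = (\<Sum>m | m \<ge> 1 \<and> u m \<noteq> \<zero>\<^bsub>T_cycl Om m\<^esub>. cyc_coord m (u m))"

definition eC :: "'a list set \<Rightarrow> (nat \<Rightarrow> ('a list \<Rightarrow>\<^sub>0 complex) set set)" where
  "eC z = (\<lambda>m\<in>{1..}. if m = nlen z then cT m (mon (SOME w. w \<in> z)) else \<zero>\<^bsub>T_cycl Om m\<^esub>)"

lemma cyc_coord_zero: "m \<ge> 1 \<Longrightarrow> cyc_coord m \<zero>\<^bsub>T_cycl Om m\<^esub> = 0"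
  by (simp add: T_cycl_simps(3) cyc_coord_cT lin_0[OF lin_cyc_class])

lemma coC_superset:
  assumes "finite A" "\<And>m. m \<ge> 1 \<Longrightarrow> u m \<noteq> \<zero>\<^bsub>T_cycl Om m\<^esub> \<Longrightarrow> m \<in> A"
  shows "coC u = (\<Sum>m\<in>{m \<in> A. m \<ge> 1}. cyc_coord m (u m))"
  unfolding coC_def using assms by (intro sum.mono_neutral_left) (auto simp: cyc_coord_zero)

lemma T_cycl_plus_carrier:
  "u \<in> carrier (T_cycl_plus Om) \<longleftrightarrow> u \<in> (\<Pi>\<^sub>E m\<in>{1..}. cT m ` FVm m) \<and> finite {m. m \<ge> 1 \<and> u m \<noteq> \<zero>\<^bsub>T_cycl Om m\<^esub>}"
proof -
  have "(\<Pi>\<^sub>E m\<in>{1..}. carrier (T_cycl Om m)) = (\<Pi>\<^sub>E m\<in>{1..}. cT m ` FVm m)"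
    by (rule PiE_cong) (simp add: T_cycl_simps(2))
  then show ?thesis by (simp add: T_cycl_plus_def)
qed

lemma T_cycl_plus_mem: "u \<in> carrier (T_cycl_plus Om) \<Longrightarrow> m \<ge> 1 \<Longrightarrow> u m \<in> cT m ` FVm m"
  using PiE_mem[of u "{1..}" _ m] by (auto simp: T_cycl_plus_carrier)

lemma nlen_pos: "z \<in> necklaces B \<Longrightarrow> nlen z \<ge> 1"
  using some_in_necklaces[of z] by (auto simp: Suc_le_eq)

lemma some_FVm: "mon (SOME w. w \<in> z) \<in> FVm (nlen z)"
  by (simp add: nlen_def)

lemma zero_T_cycl: "m \<ge> 1 \<Longrightarrow> \<zero>\<^bsub>T_cycl Om m\<^esub> \<in> cT m ` FVm m"
  by (auto simp: T_cycl_simps(3))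

definition inC :: "nat \<Rightarrow> ('a list \<Rightarrow>\<^sub>0 complex) \<Rightarrow> (nat \<Rightarrow> ('a list \<Rightarrow>\<^sub>0 complex) set set)" where
  "inC n p = (\<lambda>m\<in>{1..}. if m = n then cT m p else \<zero>\<^bsub>T_cycl Om m\<^esub>)"

lemma T_cycl_plus_ops:
  "\<zero>\<^bsub>T_cycl_plus Om\<^esub> = (\<lambda>m\<in>{1..}. cT m 0)"
  "u \<oplus>\<^bsub>T_cycl_plus Om\<^esub> v = (\<lambda>m\<in>{1..}. u m \<oplus>\<^bsub>T_cycl Om m\<^esub> v m)"
  "c \<odot>\<^bsub>T_cycl_plus Om\<^esub> u = (\<lambda>m\<in>{1..}. c \<odot>\<^bsub>T_cycl Om m\<^esub> u m)"
  by (auto simp: T_cycl_plus_def fun_eq_iff T_cycl_simps(3))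

lemma inC_span:
  assumes "n \<ge> 1" "p \<in> FVm n"
  shows "inC n p \<in> lin_span (T_cycl_plus Om) (eC ` necklaces B)"
proof -
  have *: "inC n (from_necklace q) \<in> lin_span (T_cycl_plus Om) (eC ` necklaces B)" if "q \<in> pm {z \<in> necklaces B. nlen z = n}" for q
    using that
  proof (induction rule: pm_induct)
    case zero
    have "inC n (from_necklace 0) = \<zero>\<^bsub>T_cycl_plus Om\<^esub>"
      by (auto simp: inC_def T_cycl_plus_ops fun_eq_iff T_cycl_simps(3) lin_0[OF lin_from_necklace])
    then show ?case using lin_span.zero[of "T_cycl_plus Om"] by simp
  next
    case (add p q)
    have "inC n (from_necklace (p + q)) = inC n (from_necklace p) \<oplus>\<^bsub>T_cycl_plus Om\<^esub> inC n (from_necklace q)"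
      using from_necklace_pm[OF add(1)] from_necklace_pm[OF add(2)]
      by (auto simp: inC_def T_cycl_plus_ops fun_eq_iff T_cycl_simps(3,4) lin_addD[OF lin_from_necklace])
    then show ?case using lin_span.add[OF add(3,4)] by simp
  next
    case (mon c z)
    then have "from_necklace (mon z) \<in> FVm n" by (intro from_necklace_pm) simp
    then have "inC n (from_necklace (sc c (mon z))) = c \<odot>\<^bsub>T_cycl_plus Om\<^esub> inC n (from_necklace (mon z))"
      by (auto simp: inC_def T_cycl_plus_ops fun_eq_iff T_cycl_simps(3,5) lin_scD[OF lin_from_necklace]
          simp del: Poly_Mapping.map_single)
    moreover have "inC n (from_necklace (mon z)) = eC z"
      using mon by (auto simp: inC_def eC_def from_necklace_def)
    moreover have "eC z \<in> lin_span (T_cycl_plus Om) (eC ` necklaces B)" using mon by (intro lin_span.base) auto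
    ultimately show ?case using lin_span.smult by metis
  qed
  have l: "cyc_class p \<in> pm {z \<in> necklaces B. nlen z = n}" by (rule cyc_class_pm) fact+
  have "cT n p = cT n (from_necklace (cyc_class p))"
    using T_cycl_simps(6)[OF assms(1,2) from_necklace_pm[OF l]] cyc_class_from_necklace[OF l] by simp
  then have "inC n p = inC n (from_necklace (cyc_class p))" by (auto simp: inC_def fun_eq_iff)
  then show ?thesis using *[OF l] by simp
qed

sublocale cy: vbasis "T_cycl_plus Om" "necklaces B" eC coC
proof
  show "vec_space (T_cycl_plus Om)"
    unfolding T_cycl_plus_def by (rule vec_space_dsum) (simp add: T_cycl_simps(1))
  show "eC z \<in> carrier (T_cycl_plus Om)" if z: "z \<in> necklaces B" for z
  proof -
    have "finite {m. m \<ge> 1 \<and> eC z m \<noteq> \<zero>\<^bsub>T_cycl Om m\<^esub>}"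
      by (rule finite_subset[of _ "{nlen z}"]) (auto simp: eC_def)
    then show ?thesis
      unfolding T_cycl_plus_carrier using some_FVm[of z] zero_T_cycl
      by (auto simp: eC_def)
  qed
  show "coC (eC z) = mon z" if z: "z \<in> necklaces B" for z
  proof -
    have "coC (eC z) = (\<Sum>m\<in>{m \<in> {nlen z}. m \<ge> 1}. cyc_coord m (eC z m))"
      by (rule coC_superset) (auto simp: eC_def split: if_splits)
    also have "{m \<in> {nlen z}. m \<ge> 1} = {nlen z}" using nlen_pos[OF z] by auto
    finally have "coC (eC z) = cyc_coord (nlen z) (eC z (nlen z))" by simp
    also have "eC z (nlen z) = cT (nlen z) (mon (SOME w. w \<in> z))" using nlen_pos[OF z] by (simp add: eC_def)
    also have "cyc_coord (nlen z) \<dots> = mon z"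
      using cyc_coord_cT[OF nlen_pos[OF z] some_FVm] some_in_necklaces[OF z] by (auto simp: cyc_class_word)
    finally show ?thesis .
  qed
  fix u v assume u: "u \<in> carrier (T_cycl_plus Om)" and v: "v \<in> carrier (T_cycl_plus Om)"
  let ?S = "\<lambda>u. {m. m \<ge> 1 \<and> u m \<noteq> \<zero>\<^bsub>T_cycl Om m\<^esub>}"
  have fin: "finite (?S u)" "finite (?S v)" using u v by (simp_all add: T_cycl_plus_carrier)
  show "coC (u \<oplus>\<^bsub>T_cycl_plus Om\<^esub> v) = coC u + coC v"
  proof -
    let ?A = "?S u \<union> ?S v"
    have fA: "finite ?A" using fin by simp
    have "coC (u \<oplus>\<^bsub>T_cycl_plus Om\<^esub> v) = (\<Sum>m\<in>{m \<in> ?A. m \<ge> 1}. cyc_coord m ((u \<oplus>\<^bsub>T_cycl_plus Om\<^esub> v) m))"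
      by (rule coC_superset[OF fA]) (auto simp: T_cycl_plus_ops T_cycl_simps(3,4))
    also have "\<dots> = (\<Sum>m\<in>{m \<in> ?A. m \<ge> 1}. cyc_coord m (u m) + cyc_coord m (v m))"
    proof (rule sum.cong[OF refl])
      fix m assume "m \<in> {m \<in> ?A. m \<ge> 1}"
      then have m: "m \<ge> 1" by simp
      obtain p q where pq: "p \<in> FVm m" "u m = cT m p" "q \<in> FVm m" "v m = cT m q"
        using T_cycl_plus_mem[OF u m] T_cycl_plus_mem[OF v m] by blast
      then show "cyc_coord m ((u \<oplus>\<^bsub>T_cycl_plus Om\<^esub> v) m) = cyc_coord m (u m) + cyc_coord m (v m)"
        using m by (simp add: T_cycl_plus_ops T_cycl_simps(4) cyc_coord_cT pm_add lin_addD[OF lin_cyc_class])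
    qed
    also have "\<dots> = coC u + coC v"
      unfolding sum.distrib using coC_superset[OF fA, of u] coC_superset[OF fA, of v] by auto
    finally show ?thesis .
  qed
  show "coC (c \<odot>\<^bsub>T_cycl_plus Om\<^esub> u) = sc c (coC u)" for c
  proof -
    have "coC (c \<odot>\<^bsub>T_cycl_plus Om\<^esub> u) = (\<Sum>m\<in>{m \<in> ?S u. m \<ge> 1}. cyc_coord m ((c \<odot>\<^bsub>T_cycl_plus Om\<^esub> u) m))"
    proof (rule coC_superset[OF fin(1)])
      fix m assume m: "m \<ge> 1" "(c \<odot>\<^bsub>T_cycl_plus Om\<^esub> u) m \<noteq> \<zero>\<^bsub>T_cycl Om m\<^esub>"
      then have "c \<odot>\<^bsub>T_cycl Om m\<^esub> u m \<noteq> \<zero>\<^bsub>T_cycl Om m\<^esub>" by (simp add: T_cycl_plus_ops)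
      then have "u m \<noteq> \<zero>\<^bsub>T_cycl Om m\<^esub>" using vec_space_zero[OF T_cycl_simps(1)[OF m(1)], of c] by metis
      then show "m \<in> ?S u" using m(1) by blast
    qed
    also have "\<dots> = (\<Sum>m\<in>{m \<in> ?S u. m \<ge> 1}. sc c (cyc_coord m (u m)))"
    proof (rule sum.cong[OF refl])
      fix m assume "m \<in> {m \<in> ?S u. m \<ge> 1}"
      then have m: "m \<ge> 1" by simp
      obtain p where p: "p \<in> FVm m" "u m = cT m p" using T_cycl_plus_mem[OF u m] by blast
      then show "cyc_coord m ((c \<odot>\<^bsub>T_cycl_plus Om\<^esub> u) m) = sc c (cyc_coord m (u m))"
        using m by (simp add: T_cycl_plus_ops T_cycl_simps(5) cyc_coord_cT pm_sc lin_scD[OF lin_cyc_class])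
    qed
    also have "\<dots> = sc c (coC u)" using coC_superset[OF fin(1), of u] by (simp add: sc_sum)
    finally show ?thesis .
  qed
next
  show "carrier (T_cycl_plus Om) \<subseteq> lin_span (T_cycl_plus Om) (eC ` necklaces B)"
  proof
    fix u assume u: "u \<in> carrier (T_cycl_plus Om)"
    have "(\<lambda>m\<in>{1..}. if m \<in> A then u m else \<zero>\<^bsub>T_cycl Om m\<^esub>) \<in> lin_span (T_cycl_plus Om) (eC ` necklaces B)"
      if "finite A" "A \<subseteq> {1..}" for A
      using that
    proof (induction A)
      case empty
      have "(\<lambda>m\<in>{1..}. if m \<in> {} then u m else \<zero>\<^bsub>T_cycl Om m\<^esub>) = \<zero>\<^bsub>T_cycl_plus Om\<^esub>"
        by (auto simp: T_cycl_plus_ops fun_eq_iff T_cycl_simps(3))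
      then show ?case using lin_span.zero[of "T_cycl_plus Om"] by simp
    next
      case (insert n A)
      then have n: "n \<ge> 1" by simp
      obtain p where p: "p \<in> FVm n" "u n = cT n p" using T_cycl_plus_mem[OF u n] by blast
      have e: "(\<lambda>m\<in>{1..}. if m \<in> insert n A then u m else \<zero>\<^bsub>T_cycl Om m\<^esub>) =
        inC n p \<oplus>\<^bsub>T_cycl_plus Om\<^esub> (\<lambda>m\<in>{1..}. if m \<in> A then u m else \<zero>\<^bsub>T_cycl Om m\<^esub>)"
      proof
        fix m
        show "(\<lambda>m\<in>{1..}. if m \<in> insert n A then u m else \<zero>\<^bsub>T_cycl Om m\<^esub>) m =
          (inC n p \<oplus>\<^bsub>T_cycl_plus Om\<^esub> (\<lambda>m\<in>{1..}. if m \<in> A then u m else \<zero>\<^bsub>T_cycl Om m\<^esub>)) m"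
        proof (cases "m \<ge> 1")
          case m: True
          obtain q where q: "q \<in> FVm m" "u m = cT m q" using T_cycl_plus_mem[OF u m] by blast
          show ?thesis using m p q insert(2)
            by (auto simp: inC_def T_cycl_plus_ops T_cycl_simps(3,4))
        qed (simp add: T_cycl_plus_ops)
      qed
      have "A \<subseteq> {1..}" using insert(4) by simp
      then show ?case unfolding e by (intro lin_span.add inC_span n p(1) insert(3))
    qed
    from this[of "{m. m \<ge> 1 \<and> u m \<noteq> \<zero>\<^bsub>T_cycl Om m\<^esub>}"] u
    have "(\<lambda>m\<in>{1..}. if m \<in> {m. m \<ge> 1 \<and> u m \<noteq> \<zero>\<^bsub>T_cycl Om m\<^esub>} then u m else \<zero>\<^bsub>T_cycl Om m\<^esub>) \<in>
      lin_span (T_cycl_plus Om) (eC ` necklaces B)" by (auto simp: T_cycl_plus_carrier)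
    moreover have "(\<lambda>m\<in>{1..}. if m \<in> {m. m \<ge> 1 \<and> u m \<noteq> \<zero>\<^bsub>T_cycl Om m\<^esub>} then u m else \<zero>\<^bsub>T_cycl Om m\<^esub>) = u"
      using u by (auto simp: T_cycl_plus_carrier fun_eq_iff PiE_def extensional_def)
    ultimately show "u \<in> lin_span (T_cycl_plus Om) (eC ` necklaces B)" by simp
  qed
qed

section \<open>The symmetric algebra of the coinvariants in coordinates\<close>

abbreviation "Sym \<equiv> sym_alg (T_cycl_plus Om)"

definition psi :: "((nat \<Rightarrow> ('a list \<Rightarrow>\<^sub>0 complex) set set) list \<Rightarrow>\<^sub>0 complex) set set \<Rightarrow> ('a list set multiset \<Rightarrow>\<^sub>0 complex)" where
  "psi = ind cy.qS (carrier (T_cycl_plus Om)) cy.sy"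

lemma psi_qS: "p \<in> cy.FV \<Longrightarrow> psi (cy.qS p) = cy.sy p"
  unfolding psi_def by (rule ind_eq[OF cy.presents_sym cy.lin_sy]) auto

lemma psi_hom:
  "psi \<in> Ring.ring_hom Sym \<lparr>carrier = polys (necklaces B), monoid.mult = (*), one = 1, zero = 0, add = (+)\<rparr>"
  "u \<in> carrier Sym \<Longrightarrow> psi (c \<odot>\<^bsub>Sym\<^esub> u) = sc c (psi u)"
  "bij_betw psi (carrier Sym) (polys (necklaces B))"
proof -
  note D = presentsD[OF cy.presents_sym]
  show "psi \<in> Ring.ring_hom Sym \<lparr>carrier = polys (necklaces B), monoid.mult = (*), one = 1, zero = 0, add = (+)\<rparr>"
  proof (rule ring_hom_memI)
    have "(1 :: (nat \<Rightarrow> ('a list \<Rightarrow>\<^sub>0 complex) set set) list \<Rightarrow>\<^sub>0 complex) \<in> cy.FV" by (simp add: zero_list_def)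
    then show "psi \<one>\<^bsub>Sym\<^esub> = \<one>\<^bsub>\<lparr>carrier = polys (necklaces B), monoid.mult = (*), one = 1, zero = 0, add = (+)\<rparr>\<^esub>"
      using cy.ex_mon[of "[]"] ab_mon[of "[] :: 'a list set list"]
      by (simp add: D(9) psi_qS cy.sy_def mon_Nil)
  qed (auto simp: D(4,6,7) psi_qS cy.sy_pm cy.sy_mult lists_mult pm_add lin_addD[OF cy.lin_sy])
  show "psi (c \<odot>\<^bsub>Sym\<^esub> u) = sc c (psi u)" if "u \<in> carrier Sym"
    using that by (auto simp: D(4,8) psi_qS pm_sc lin_scD[OF cy.lin_sy])
  show "bij_betw psi (carrier Sym) (polys (necklaces B))"
    unfolding bij_betw_def
  proof
    show "inj_on psi (carrier Sym)"
    proof (rule inj_onI)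
      fix u v assume "u \<in> carrier Sym" "v \<in> carrier Sym" "psi u = psi v"
      then obtain p q where pq: "p \<in> cy.FV" "q \<in> cy.FV" "u = cy.qS p" "v = cy.qS q" "cy.sy p = cy.sy q"
        by (auto simp: D(4) psi_qS)
      then show "u = v" by (simp add: D(5) pm_diff lin_diffD[OF cy.lin_sy])
    qed
    show "psi ` carrier Sym = polys (necklaces B)"
    proof
      show "psi ` carrier Sym \<subseteq> polys (necklaces B)" by (auto simp: D(4) psi_qS cy.sy_pm)
      show "polys (necklaces B) \<subseteq> psi ` carrier Sym"
      proof
        fix p assume p: "p \<in> polys (necklaces B)"
        have "psi (cy.qS (cy.lift p)) = p" using p by (simp add: psi_qS cy.lift_pm cy.sy_lift)
        moreover have "cy.qS (cy.lift p) \<in> carrier Sym" using cy.lift_pm[OF p] by (simp add: D(4))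
        ultimately show "p \<in> psi ` carrier Sym" by (metis image_eqI)
      qed
    qed
  qed
qed

lemma coC_comp:
  assumes "u \<in> T_cycl_comp Om m" shows "coC u \<in> pm {z \<in> necklaces B. nlen z = m}" "u \<in> carrier (T_cycl_plus Om)"
proof -
  show u: "u \<in> carrier (T_cycl_plus Om)" using assms by (simp add: T_cycl_comp_def dsum_comp_def T_cycl_plus_def)
  have "coC u = (\<Sum>n\<in>{n \<in> {m}. n \<ge> 1}. cyc_coord n (u n))"
    by (rule coC_superset) (use assms in \<open>auto simp: T_cycl_comp_def dsum_comp_def\<close>)
  also have "\<dots> \<in> pm {z \<in> necklaces B. nlen z = m}"
  proof (rule pm_sum)
    fix n assume n: "n \<in> {n \<in> {m}. n \<ge> 1}"
    then obtain p where "p \<in> FVm m" "u m = cT m p"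
      using T_cycl_plus_mem[OF u, of m] by blast
    then show "cyc_coord n (u n) \<in> pm {z \<in> necklaces B. nlen z = m}" using n cyc_class_pm[of p m] by (auto simp: cyc_coord_cT)
  qed
  finally show "coC u \<in> pm {z \<in> necklaces B. nlen z = m}" .
qed

lemma eC_comp: "z \<in> necklaces B \<Longrightarrow> eC z \<in> T_cycl_comp Om (nlen z)"
  using cy.e_carrier[of z] by (auto simp: T_cycl_comp_def dsum_comp_def T_cycl_plus_def eC_def)

text \<open>A product of homogeneous elements has the sum of their degrees as weight. Conversely, a
  monomial of weight \<open>d\<close> is the image of the product of the basis vectors
  \<open>eC z\<close> for its necklaces, and \<open>eC z\<close> is homogeneous of degree
  \<open>nlen z\<close>.\<close>

lemma sym_comp_eq: "psi ` sym_comp (T_cycl_plus Om) (T_cycl_comp Om) d = NP B d"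
  "sym_comp (T_cycl_plus Om) (T_cycl_comp Om) d \<subseteq> carrier Sym"
proof -
  note D = presentsD[OF cy.presents_sym]
  let ?G = "{sym_ideal (T_cycl_plus Om) +>\<^bsub>tensor_alg (T_cycl_plus Om)\<^esub> tens (T_cycl_plus Om) (map fst ps) | ps.
        (\<forall>(v, m)\<in>set ps. v \<in> T_cycl_comp Om m) \<and> sum_list (map snd ps) = d}"
  let ?W = "{u \<in> carrier Sym. psi u \<in> NP B d}"
  have qS: "sym_ideal (T_cycl_plus Om) +>\<^bsub>tensor_alg (T_cycl_plus Om)\<^esub> tens (T_cycl_plus Om) w = cy.qS (mon w)" for w
    by (simp add: cy.qS_def cy.qT_def tens_def)
  have gen: "map fst ps \<in> lists (carrier (T_cycl_plus Om)) \<and> cy.sy (mon (map fst ps)) \<in> NP B (sum_list (map snd ps))"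
    if "\<forall>(v, m)\<in>set ps. v \<in> T_cycl_comp Om m" for ps
    using that
  proof (induction ps)
    case Nil
    show ?case using cy.ex_mon[of "[]"] ab_mon[of "[] :: 'a list set list"] NP_one[of B]
      by (simp add: cy.sy_def mon_Nil)
  next
    case (Cons vm ps)
    obtain v m where vm: "vm = (v, m)" "v \<in> T_cycl_comp Om m" using Cons(2) by (cases vm) auto
    have "cy.sy (mon [v]) = lext var (coC v)"
      unfolding cy.sy_def cy.ex_mon cy.lin_word_def by (simp add: lin_comp_lext[OF lin_ab] ab_mon)
    moreover have "lext var (coC v) \<in> NP B m"
      by (rule lin_pm[OF lin_lext coC_comp(1)[OF vm(2)]]) (auto simp: weight_def)
    ultimately have "cy.sy (mon [v]) * cy.sy (mon (map fst ps)) \<in> NP B (m + sum_list (map snd ps))"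
      using Cons by (intro NP_mult) auto
    moreover have "mon (map fst (vm # ps)) = mon [v] * mon (map fst ps)" using vm by (simp flip: mon_Cons)
    ultimately show ?case using Cons coC_comp(2)[OF vm(2)] vm by (simp add: cy.sy_mult)
  qed
  have vS: "vec_space Sym" by (rule calgD(1)[OF D(1)])
  have hom: "psi (u \<oplus>\<^bsub>Sym\<^esub> v) = psi u + psi v" if "u \<in> carrier Sym" "v \<in> carrier Sym" for u v
    using ring_hom_add[OF psi_hom(1) that] by simp
  interpret ring Sym by (rule D)
  have le: "sym_comp (T_cycl_plus Om) (T_cycl_comp Om) d \<subseteq> ?W"
    unfolding sym_comp_def
  proof (rule lin_span_least)
    show "?G \<subseteq> ?W"
    proof
      fix x assume "x \<in> ?G"
      then obtain ps where ps: "x = cy.qS (mon (map fst ps))" "\<forall>(v, m)\<in>set ps. v \<in> T_cycl_comp Om m"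
        "sum_list (map snd ps) = d" unfolding qS by blast
      then show "x \<in> ?W" using gen[OF ps(2)] by (simp add: D(4) psi_qS)
    qed
    have "psi \<zero>\<^bsub>Sym\<^esub> = 0" by (simp add: D(10) psi_qS lin_0[OF cy.lin_sy])
    then show "\<zero>\<^bsub>Sym\<^esub> \<in> ?W" by simp
    show "x \<oplus>\<^bsub>Sym\<^esub> y \<in> ?W" if "x \<in> ?W" "y \<in> ?W" for x y using that by (auto simp: hom)
    show "c \<odot>\<^bsub>Sym\<^esub> x \<in> ?W" if "x \<in> ?W" for c x using that by (auto simp: psi_hom(2) vspD(2)[OF vS])
  qed
  then show "sym_comp (T_cycl_plus Om) (T_cycl_comp Om) d \<subseteq> carrier Sym" by blast
  show "psi ` sym_comp (T_cycl_plus Om) (T_cycl_comp Om) d = NP B d"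
  proof
    show "psi ` sym_comp (T_cycl_plus Om) (T_cycl_comp Om) d \<subseteq> NP B d" using le by blast
    show "NP B d \<subseteq> psi ` sym_comp (T_cycl_plus Om) (T_cycl_comp Om) d"
    proof
      fix s assume "s \<in> NP B d"
      then have "\<exists>u\<in>lin_span Sym ?G. psi u = s"
      proof (induction rule: pm_induct)
        case zero
        have "psi \<zero>\<^bsub>Sym\<^esub> = 0" by (simp add: D(10) psi_qS lin_0[OF cy.lin_sy])
        then show ?case using lin_span.zero[of Sym] by blast
      next
        case (add p q)
        then obtain u v where uv: "u \<in> lin_span Sym ?G" "v \<in> lin_span Sym ?G" "psi u = p" "psi v = q" by blast
        then have "psi (u \<oplus>\<^bsub>Sym\<^esub> v) = p + q" using le hom unfolding sym_comp_def by blast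
        then show ?case using lin_span.add[OF uv(1,2)] by blast
      next
        case (mon c \<mu>)
        obtain zs where zs: "mset zs = \<mu>" using ex_mset by blast
        have zB: "set zs \<subseteq> necklaces B" using mon zs by auto
        let ?ps = "map (\<lambda>z. (eC z, nlen z)) zs"
        have ps: "\<forall>(v, m)\<in>set ?ps. v \<in> T_cycl_comp Om m" using zB eC_comp by auto
        have sd: "sum_list (map snd ?ps) = d"
        proof -
          have "sum_list (map snd ?ps) = (\<Sum>z\<in>#mset zs. nlen z)" by (simp add: comp_def flip: sum_mset_sum_list)
          then show ?thesis using mon zs by (simp add: weight_def)
        qed
        have me: "map fst ?ps = map eC zs" by (simp add: comp_def)
        have "cy.qS (mon (map fst ?ps)) \<in> lin_span Sym ?G"
          unfolding qS using ps sd by (intro lin_span.base) blast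
        moreover have "psi (cy.qS (mon (map fst ?ps))) = mon \<mu>"
        proof -
          have "cy.sy (mon (map eC zs)) = mon \<mu>"
            using cy.ex_em[of "mon zs"] zB zs by (simp add: cy.sy_def cy.em_mon ab_mon in_lists_conv_set subset_iff)
          moreover have "mon (map eC zs) \<in> cy.FV" using zB cy.e_carrier by (auto simp: subset_iff)
          ultimately show ?thesis unfolding me by (simp add: psi_qS)
        qed
        ultimately have u: "cy.qS (mon (map fst ?ps)) \<in> lin_span Sym ?G" "psi (cy.qS (mon (map fst ?ps))) = mon \<mu>" by auto
        then have "cy.qS (mon (map fst ?ps)) \<in> carrier Sym" using le unfolding sym_comp_def by blast
        then have "psi (c \<odot>\<^bsub>Sym\<^esub> cy.qS (mon (map fst ?ps))) = sc c (mon \<mu>)" by (simp only: psi_hom(2) u(2))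
        then show ?case using lin_span.smult[OF u(1), of c] by blast
      qed
      then show "s \<in> psi ` sym_comp (T_cycl_plus Om) (T_cycl_comp Om) d" unfolding sym_comp_def by blast
    qed
  qed
qed

end

section \<open>Associated graded algebras\<close>

text \<open>A filtered algebra is described by symbol maps: \<open>S k\<close> maps the elements of degree \<open>\<le> k\<close> onto
  the component of weight \<open>k\<close> of a graded polynomial algebra, and its kernel consists of the elements
  of smaller degree.\<close>

locale gr_symbol =
  fixes A :: "(complex, 'b) module" and F :: "nat \<Rightarrow> 'b set"
    and S :: "nat \<Rightarrow> 'b \<Rightarrow> ('n multiset \<Rightarrow>\<^sub>0 complex)" and P :: "'n multiset set" and w :: "'n multiset \<Rightarrow> nat"
  assumes vec_space: "vec_space A" and sub: "lin_subspace (F k) A" and mono: "F k \<subseteq> F (Suc k)"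
    and mult: "a \<in> F i \<Longrightarrow> b \<in> F j \<Longrightarrow> a \<otimes>\<^bsub>A\<^esub> b \<in> F (i + j)" and one: "\<one>\<^bsub>A\<^esub> \<in> F 0"
    and S_add: "a \<in> F k \<Longrightarrow> b \<in> F k \<Longrightarrow> S k (a \<oplus>\<^bsub>A\<^esub> b) = S k a + S k b"
    and S_smult: "a \<in> F k \<Longrightarrow> S k (c \<odot>\<^bsub>A\<^esub> a) = sc c (S k a)"
    and S_zero: "a \<in> F k \<Longrightarrow> S k a = 0 \<longleftrightarrow> a \<in> filt_below A F k"
    and S_mult: "a \<in> F i \<Longrightarrow> b \<in> F j \<Longrightarrow> S (i + j) (a \<otimes>\<^bsub>A\<^esub> b) = S i a * S j b"
    and S_one: "S 0 \<one>\<^bsub>A\<^esub> = 1"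
    and S_onto: "S k ` F k = pm {\<mu> \<in> P. w \<mu> = k}"
begin

abbreviation "fb \<equiv> filt_below A F"
abbreviation "gp \<equiv> gr_piece A F"

definition cs :: "nat \<Rightarrow> 'b \<Rightarrow> 'b set" where
  "cs k a = fb k +>\<^bsub>A\<^esub> a"

lemma ag: "abelian_group A" by (rule vspD[OF vec_space])

lemma F_sub: "additive_subgroup (F k) A" using sub by (simp add: lin_subspace_def)

lemma F_carrier: "F k \<subseteq> carrier A" by (rule additive_subgroup.a_subset[OF F_sub])

lemma F_closed: "\<zero>\<^bsub>A\<^esub> \<in> F k" "a \<in> F k \<Longrightarrow> b \<in> F k \<Longrightarrow> a \<oplus>\<^bsub>A\<^esub> b \<in> F k" "a \<in> F k \<Longrightarrow> c \<odot>\<^bsub>A\<^esub> a \<in> F k"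
  using sub[of k] by (auto simp: lin_subspace_def additive_subgroup.zero_closed additive_subgroup.a_closed)

lemma F_minus: "a \<in> F k \<Longrightarrow> b \<in> F k \<Longrightarrow> a \<ominus>\<^bsub>A\<^esub> b \<in> F k"
  unfolding a_minus_def
  using additive_subgroup.a_closed[OF F_sub] additive_subgroup.a_inv_closed[OF F_sub] by blast

lemma fb_F: "fb k \<subseteq> F k"
  using mono[of "k - 1"] F_closed(1) by (auto simp: filt_below_def)

lemma fb_lin_subspace: "lin_subspace (fb k) (A\<lparr>carrier := F k\<rparr>)"
proof (rule sub_lin_subspace[OF vec_space sub _ fb_F])
  interpret abelian_group A by (rule ag)
  have "subgroup {\<zero>\<^bsub>A\<^esub>} (add_monoid A)"
    by (rule add.triv_subgroup[simplified])
  then have "lin_subspace {\<zero>\<^bsub>A\<^esub>} A" by (simp add: lin_subspace_def additive_subgroupI vec_space_zero[OF vec_space])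
  then show "lin_subspace (fb k) A" using sub by (simp add: filt_below_def)
qed

lemma gp_eq: "gp k = quot (A\<lparr>carrier := F k\<rparr>) (fb k)"
  by (simp add: gr_piece_def)

lemmas gp_quot = quot_simps[OF sub_vec_space[OF vec_space sub] fb_lin_subspace]

lemma S_diff: assumes "a \<in> F k" "b \<in> F k" shows "S k (a \<ominus>\<^bsub>A\<^esub> b) = S k a - S k b"
proof -
  interpret abelian_group A by (rule ag)
  have "a \<in> carrier A" "b \<in> carrier A" using assms F_carrier by auto
  then have "(a \<ominus>\<^bsub>A\<^esub> b) \<oplus>\<^bsub>A\<^esub> b = a" by (simp add: a_minus_def a_assoc l_neg)
  then have "S k a = S k (a \<ominus>\<^bsub>A\<^esub> b) + S k b" using S_add[OF F_minus[OF assms] assms(2)] by simp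
  then show ?thesis by simp
qed

lemma gp_simps:
  "vec_space (gp k)" "carrier (gp k) = cs k ` F k" "\<zero>\<^bsub>gp k\<^esub> = cs k \<zero>\<^bsub>A\<^esub>"
  "\<And>a b. a \<in> F k \<Longrightarrow> b \<in> F k \<Longrightarrow> cs k a \<oplus>\<^bsub>gp k\<^esub> cs k b = cs k (a \<oplus>\<^bsub>A\<^esub> b)"
  "\<And>a c. a \<in> F k \<Longrightarrow> c \<odot>\<^bsub>gp k\<^esub> cs k a = cs k (c \<odot>\<^bsub>A\<^esub> a)"
  "\<And>a b. a \<in> F k \<Longrightarrow> b \<in> F k \<Longrightarrow> cs k a = cs k b \<longleftrightarrow> S k a = S k b"
proof -
  show "vec_space (gp k)" unfolding gp_eq by (rule quot_vec_space[OF sub_vec_space[OF vec_space sub] fb_lin_subspace])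
  show "carrier (gp k) = cs k ` F k" unfolding gp_eq quot_carrier cs_def by simp
  show "\<zero>\<^bsub>gp k\<^esub> = cs k \<zero>\<^bsub>A\<^esub>" using gp_quot(3) unfolding gp_eq cs_def by simp
  show "c \<odot>\<^bsub>gp k\<^esub> cs k a = cs k (c \<odot>\<^bsub>A\<^esub> a)" if "a \<in> F k" for a c
    using gp_quot(2)[of a k c] that unfolding gp_eq cs_def by simp
  fix a b assume ab: "a \<in> F k" "b \<in> F k"
  show "cs k a \<oplus>\<^bsub>gp k\<^esub> cs k b = cs k (a \<oplus>\<^bsub>A\<^esub> b)"
    using gp_quot(1)[of a k b] ab unfolding gp_eq cs_def by simp
  have "cs k a = cs k b \<longleftrightarrow> a \<ominus>\<^bsub>A\<lparr>carrier := F k\<rparr>\<^esub> b \<in> fb k"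
    using gp_quot(4)[of a k b] ab unfolding cs_def by simp
  also have "\<dots> \<longleftrightarrow> S k (a \<ominus>\<^bsub>A\<^esub> b) = 0"
    using S_zero[OF F_minus[OF ab]] by (simp add: sub_minus[OF ag F_sub ab])
  finally show "cs k a = cs k b \<longleftrightarrow> S k a = S k b" by (simp add: S_diff ab)
qed

lemma cs_mem: assumes "a \<in> F k" "x \<in> cs k a" shows "x \<in> F k" "S k x = S k a"
proof -
  obtain h where h: "h \<in> fb k" "x = h \<oplus>\<^bsub>A\<^esub> a" using assms(2) by (auto simp: cs_def a_r_coset_def')
  then have "h \<in> F k" using fb_F by auto
  then show "x \<in> F k" "S k x = S k a"
    using h assms(1) S_zero[of h k] by (auto simp: F_closed S_add)
qed

lemma cs_self: "a \<in> F k \<Longrightarrow> a \<in> cs k a"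
proof -
  interpret abelian_group A by (rule ag)
  assume "a \<in> F k"
  then have "a = \<zero>\<^bsub>A\<^esub> \<oplus>\<^bsub>A\<^esub> a" by (metis F_carrier l_zero subsetD)
  moreover have "\<zero>\<^bsub>A\<^esub> \<in> fb k" using F_closed(1) by (auto simp: filt_below_def)
  ultimately show "a \<in> cs k a" unfolding cs_def a_r_coset_def' by auto
qed

text \<open>The symbol of a coset; by \<open>gp_simps(6)\<close> the choice of the representative is
  immaterial.\<close>

definition th :: "nat \<Rightarrow> 'b set \<Rightarrow> ('n multiset \<Rightarrow>\<^sub>0 complex)" where
  "th k X = S k (SOME a. a \<in> F k \<and> cs k a = X)"

lemma th_cs: assumes "a \<in> F k" shows "th k (cs k a) = S k a"
proof -
  let ?a = "SOME b. b \<in> F k \<and> cs k b = cs k a"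
  have "?a \<in> F k \<and> cs k ?a = cs k a" by (rule someI[of _ a]) (use assms in simp)
  then show ?thesis using gp_simps(6)[of ?a k a] assms by (simp add: th_def)
qed

lemma S_0: "S k \<zero>\<^bsub>A\<^esub> = 0"
  using S_zero[OF F_closed(1)] F_closed(1) by (auto simp: filt_below_def)

lemma th_simps:
  "th k \<zero>\<^bsub>gp k\<^esub> = 0"
  "X \<in> carrier (gp k) \<Longrightarrow> Y \<in> carrier (gp k) \<Longrightarrow> th k (X \<oplus>\<^bsub>gp k\<^esub> Y) = th k X + th k Y"
  "X \<in> carrier (gp k) \<Longrightarrow> th k (c \<odot>\<^bsub>gp k\<^esub> X) = sc c (th k X)"
  "X \<in> carrier (gp k) \<Longrightarrow> Y \<in> carrier (gp k) \<Longrightarrow> th k X = th k Y \<Longrightarrow> X = Y"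
  "X \<in> carrier (gp k) \<Longrightarrow> th k X \<in> pm {\<mu> \<in> P. w \<mu> = k}"
proof -
  show "th k \<zero>\<^bsub>gp k\<^esub> = 0" by (simp add: gp_simps th_cs F_closed S_0)
  show "th k (c \<odot>\<^bsub>gp k\<^esub> X) = sc c (th k X)" if "X \<in> carrier (gp k)"
    using that by (auto simp: gp_simps th_cs F_closed S_smult)
  show "th k X \<in> pm {\<mu> \<in> P. w \<mu> = k}" if "X \<in> carrier (gp k)"
    using that by (auto simp: gp_simps th_cs simp flip: S_onto)
  assume X: "X \<in> carrier (gp k)" and Y: "Y \<in> carrier (gp k)"
  then obtain a b where ab: "a \<in> F k" "X = cs k a" "b \<in> F k" "Y = cs k b" by (auto simp: gp_simps(2))
  then show "th k (X \<oplus>\<^bsub>gp k\<^esub> Y) = th k X + th k Y" by (simp add: gp_simps(4) th_cs F_closed S_add)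
  show "X = Y" if "th k X = th k Y" using that gp_simps(6)[OF ab(1,3)] ab by (simp add: th_cs)
qed

section \<open>The associated graded algebra as a polynomial algebra\<close>

definition theta :: "(nat \<Rightarrow> 'b set) \<Rightarrow> ('n multiset \<Rightarrow>\<^sub>0 complex)" where
  "theta u = (\<Sum>k | u k \<noteq> \<zero>\<^bsub>gp k\<^esub>. th k (u k))"

lemma gr_sel:
  "carrier (gr_alg A F) = {u. (\<forall>k. u k \<in> carrier (gp k)) \<and> finite {k. u k \<noteq> \<zero>\<^bsub>gp k\<^esub>}}"
  "u \<oplus>\<^bsub>gr_alg A F\<^esub> v = (\<lambda>k. u k \<oplus>\<^bsub>gp k\<^esub> v k)"
  "c \<odot>\<^bsub>gr_alg A F\<^esub> u = (\<lambda>k. c \<odot>\<^bsub>gp k\<^esub> u k)"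
  "\<one>\<^bsub>gr_alg A F\<^esub> = (\<lambda>k. if k = 0 then cs 0 \<one>\<^bsub>A\<^esub> else \<zero>\<^bsub>gp k\<^esub>)"
  "(u \<otimes>\<^bsub>gr_alg A F\<^esub> v) k = finsum (gp k) (\<lambda>i. \<Union>a\<in>u i. \<Union>b\<in>v (k - i). cs k (a \<otimes>\<^bsub>A\<^esub> b)) {..k}"
proof -
  have "fb k = \<zero>\<^bsub>gp k\<^esub>" for k unfolding gp_eq by (simp add: quot_def)
  then show "\<one>\<^bsub>gr_alg A F\<^esub> = (\<lambda>k. if k = 0 then cs 0 \<one>\<^bsub>A\<^esub> else \<zero>\<^bsub>gp k\<^esub>)"
    by (auto simp: gr_alg_def cs_def fun_eq_iff)
qed (auto simp: gr_alg_def cs_def dsum_def PiE_iff)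

lemma bounded: "u \<in> carrier (gr_alg A F) \<Longrightarrow> \<exists>n. \<forall>k>n. u k = \<zero>\<^bsub>gp k\<^esub>"
proof -
  assume "u \<in> carrier (gr_alg A F)"
  then have "finite {k. u k \<noteq> \<zero>\<^bsub>gp k\<^esub>}" by (simp add: gr_sel)
  then obtain n where "\<forall>k\<in>{k. u k \<noteq> \<zero>\<^bsub>gp k\<^esub>}. k \<le> n" by (auto simp: finite_nat_set_iff_bounded_le)
  then show ?thesis by (intro exI[of _ n]) (auto simp: not_le[symmetric])
qed

lemma theta_bound: "\<forall>k>n. u k = \<zero>\<^bsub>gp k\<^esub> \<Longrightarrow> theta u = (\<Sum>k\<le>n. th k (u k))"
  unfolding theta_def by (rule sum.mono_neutral_left) (auto simp: th_simps(1) not_le[symmetric])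

lemma gr_bounded_carrier:
  "(\<And>k. u k \<in> carrier (gp k)) \<Longrightarrow> \<forall>k>n. u k = \<zero>\<^bsub>gp k\<^esub> \<Longrightarrow> u \<in> carrier (gr_alg A F)"
  unfolding gr_sel by (auto intro!: finite_subset[of _ "{..n}"] simp: not_le[symmetric])

lemma gp_am: "abelian_monoid (gp k)"
  by (rule abelian_group.axioms(1)[OF vspD(1)[OF gp_simps(1)]])

lemma th_finsum:
  assumes "finite I" "\<And>i. i \<in> I \<Longrightarrow> X i \<in> carrier (gp k)"
  shows "finsum (gp k) X I \<in> carrier (gp k) \<and> th k (finsum (gp k) X I) = (\<Sum>i\<in>I. th k (X i))"
  using assms
proof (induction I)
  case empty
  show ?case by (simp add: th_simps(1) abelian_monoid.finsum_empty[OF gp_am] abelian_monoid.zero_closed[OF gp_am])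
next
  case (insert i I)
  have "finsum (gp k) X (insert i I) = X i \<oplus>\<^bsub>gp k\<^esub> finsum (gp k) X I"
    using insert by (intro abelian_monoid.finsum_insert[OF gp_am]) auto
  then show ?case using insert abelian_monoid.a_closed[OF gp_am] by (simp add: th_simps(2))
qed

text \<open>The product of two cosets is defined as a union over all pairs of representatives. By
  \<open>S_mult\<close> all pairs give products with the same symbol, hence the same coset.\<close>

lemma gr_mult:
  assumes u: "u \<in> carrier (gr_alg A F)" and v: "v \<in> carrier (gr_alg A F)"
  shows "(u \<otimes>\<^bsub>gr_alg A F\<^esub> v) k \<in> carrier (gp k)"
    "th k ((u \<otimes>\<^bsub>gr_alg A F\<^esub> v) k) = (\<Sum>i\<le>k. th i (u i) * th (k - i) (v (k - i)))"
proof -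
  have X: "(\<Union>a\<in>u i. \<Union>b\<in>v (k - i). cs k (a \<otimes>\<^bsub>A\<^esub> b)) \<in> carrier (gp k) \<and>
    th k (\<Union>a\<in>u i. \<Union>b\<in>v (k - i). cs k (a \<otimes>\<^bsub>A\<^esub> b)) = th i (u i) * th (k - i) (v (k - i))" if i: "i \<le> k" for i
  proof -
    obtain a where a: "a \<in> F i" "u i = cs i a" using u by (auto simp: gr_sel gp_simps)
    obtain b where b: "b \<in> F (k - i)" "v (k - i) = cs (k - i) b" using v by (auto simp: gr_sel gp_simps)
    have ik: "i + (k - i) = k" using i by simp
    have ab: "a \<otimes>\<^bsub>A\<^esub> b \<in> F k" using mult[OF a(1) b(1)] ik by simp
    have "cs k (x \<otimes>\<^bsub>A\<^esub> y) = cs k (a \<otimes>\<^bsub>A\<^esub> b)" if x: "x \<in> u i" and y: "y \<in> v (k - i)" for x y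
    proof -
      have x': "x \<in> F i" "S i x = S i a" using cs_mem[OF a(1)] x a(2) by auto
      have y': "y \<in> F (k - i)" "S (k - i) y = S (k - i) b" using cs_mem[OF b(1)] y b(2) by auto
      have "S k (x \<otimes>\<^bsub>A\<^esub> y) = S k (a \<otimes>\<^bsub>A\<^esub> b)"
        using S_mult[OF x'(1) y'(1)] S_mult[OF a(1) b(1)] x'(2) y'(2) unfolding ik by simp
      moreover have "x \<otimes>\<^bsub>A\<^esub> y \<in> F k" using mult[OF x'(1) y'(1)] unfolding ik .
      ultimately show ?thesis using gp_simps(6) ab by simp
    qed
    then have "(\<Union>a\<in>u i. \<Union>b\<in>v (k - i). cs k (a \<otimes>\<^bsub>A\<^esub> b)) = (\<Union>x\<in>u i. \<Union>y\<in>v (k - i). cs k (a \<otimes>\<^bsub>A\<^esub> b))"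
      by (intro SUP_cong refl)
    also have "\<dots> = cs k (a \<otimes>\<^bsub>A\<^esub> b)" using cs_self[OF a(1)] cs_self[OF b(1)] a(2) b(2) by auto
    finally have e: "(\<Union>a\<in>u i. \<Union>b\<in>v (k - i). cs k (a \<otimes>\<^bsub>A\<^esub> b)) = cs k (a \<otimes>\<^bsub>A\<^esub> b)" .
    have "S k (a \<otimes>\<^bsub>A\<^esub> b) = S i a * S (k - i) b" using S_mult[OF a(1) b(1)] unfolding ik .
    then show ?thesis unfolding e using ab a b by (simp add: gp_simps(2) th_cs)
  qed
  have "finsum (gp k) (\<lambda>i. \<Union>a\<in>u i. \<Union>b\<in>v (k - i). cs k (a \<otimes>\<^bsub>A\<^esub> b)) {..k} \<in> carrier (gp k) \<and>
    th k (finsum (gp k) (\<lambda>i. \<Union>a\<in>u i. \<Union>b\<in>v (k - i). cs k (a \<otimes>\<^bsub>A\<^esub> b)) {..k}) =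
    (\<Sum>i\<le>k. th k (\<Union>a\<in>u i. \<Union>b\<in>v (k - i). cs k (a \<otimes>\<^bsub>A\<^esub> b)))"
    by (rule th_finsum) (use X in auto)
  then show "(u \<otimes>\<^bsub>gr_alg A F\<^esub> v) k \<in> carrier (gp k)"
    "th k ((u \<otimes>\<^bsub>gr_alg A F\<^esub> v) k) = (\<Sum>i\<le>k. th i (u i) * th (k - i) (v (k - i)))"
    unfolding gr_sel(5) using X by auto
qed

lemma th_eq_zero: "X \<in> carrier (gp k) \<Longrightarrow> th k X = 0 \<Longrightarrow> X = \<zero>\<^bsub>gp k\<^esub>"
  using th_simps(4)[of X k "\<zero>\<^bsub>gp k\<^esub>"] abelian_monoid.zero_closed[OF gp_am] by (simp add: th_simps(1))

lemma gr_mult_closed: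
  assumes u: "u \<in> carrier (gr_alg A F)" and v: "v \<in> carrier (gr_alg A F)"
  shows "u \<otimes>\<^bsub>gr_alg A F\<^esub> v \<in> carrier (gr_alg A F)" "theta (u \<otimes>\<^bsub>gr_alg A F\<^esub> v) = theta u * theta v"
proof -
  obtain m where m: "\<forall>k>m. u k = \<zero>\<^bsub>gp k\<^esub>" using bounded[OF u] by blast
  obtain m' where m': "\<forall>k>m'. v k = \<zero>\<^bsub>gp k\<^esub>" using bounded[OF v] by blast
  define n where "n = max m m'"
  let ?f = "\<lambda>i. th i (u i)" and ?g = "\<lambda>i. th i (v i)"
  have n: "\<forall>k>n. u k = \<zero>\<^bsub>gp k\<^esub>" "\<forall>k>n. v k = \<zero>\<^bsub>gp k\<^esub>" using m m' by (auto simp: n_def)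
  have f0: "?f i = 0" "?g i = 0" if "i > n" for i using n that by (simp_all add: th_simps(1))
  \<comment> \<open>If two indices add up to more than \<open>2 * n\<close>, one of them exceeds
    \<open>n\<close>, where the components vanish.\<close>
  have z: "\<forall>k>2 * n. (u \<otimes>\<^bsub>gr_alg A F\<^esub> v) k = \<zero>\<^bsub>gp k\<^esub>"
  proof (intro allI impI)
    fix k assume k: "k > 2 * n"
    have "th k ((u \<otimes>\<^bsub>gr_alg A F\<^esub> v) k) = 0"
      unfolding gr_mult(2)[OF u v]
    proof (rule sum.neutral, safe)
      fix i assume "i \<le> k"
      then have "i > n \<or> k - i > n" using k by linarith
      then show "?f i * ?g (k - i) = 0" using f0 by auto
    qed
    then show "(u \<otimes>\<^bsub>gr_alg A F\<^esub> v) k = \<zero>\<^bsub>gp k\<^esub>" by (rule th_eq_zero[OF gr_mult(1)[OF u v]])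
  qed
  show "u \<otimes>\<^bsub>gr_alg A F\<^esub> v \<in> carrier (gr_alg A F)" by (rule gr_bounded_carrier[OF gr_mult(1)[OF u v] z])
  have "theta (u \<otimes>\<^bsub>gr_alg A F\<^esub> v) = (\<Sum>k\<le>2 * n. \<Sum>i\<le>k. ?f i * ?g (k - i))"
    unfolding theta_bound[OF z] gr_mult(2)[OF u v] ..
  also have "\<dots> = (\<Sum>(i, j) | i + j \<le> 2 * n. ?f i * ?g j)"
    by (rule sum.triangle_reindex_eq[symmetric])
  \<comment> \<open>The triangle contains the square, and outside the square the terms
    vanish.\<close>
  also have "\<dots> = (\<Sum>(i, j)\<in>{..n} \<times> {..n}. ?f i * ?g j)"
  proof (rule sum.mono_neutral_right)
    show "finite {(i, j). i + j \<le> 2 * n}"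
      by (rule finite_subset[of _ "{..2 * n} \<times> {..2 * n}"]) auto
    show "\<forall>ij\<in>{(i, j). i + j \<le> 2 * n} - {..n} \<times> {..n}. (case ij of (i, j) \<Rightarrow> ?f i * ?g j) = 0"
    proof
      fix ij assume "ij \<in> {(i, j). i + j \<le> 2 * n} - {..n} \<times> {..n}"
      then have "fst ij > n \<or> snd ij > n" by (auto simp: not_le)
      then show "(case ij of (i, j) \<Rightarrow> ?f i * ?g j) = 0" using f0 by (auto simp: case_prod_beta)
    qed
    show "{..n} \<times> {..n} \<subseteq> {(i, j). i + j \<le> 2 * n}" by auto
  qed
  also have "\<dots> = theta u * theta v"
    unfolding theta_bound[OF n(1)] theta_bound[OF n(2)] by (simp add: sum_product sum.cartesian_product)
  finally show "theta (u \<otimes>\<^bsub>gr_alg A F\<^esub> v) = theta u * theta v" .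
qed

lemma gr_linear:
  assumes u: "u \<in> carrier (gr_alg A F)"
  shows "v \<in> carrier (gr_alg A F) \<Longrightarrow> u \<oplus>\<^bsub>gr_alg A F\<^esub> v \<in> carrier (gr_alg A F)"
    "v \<in> carrier (gr_alg A F) \<Longrightarrow> theta (u \<oplus>\<^bsub>gr_alg A F\<^esub> v) = theta u + theta v"
    "c \<odot>\<^bsub>gr_alg A F\<^esub> u \<in> carrier (gr_alg A F)" "theta (c \<odot>\<^bsub>gr_alg A F\<^esub> u) = sc c (theta u)"
proof -
  obtain m where m: "\<forall>k>m. u k = \<zero>\<^bsub>gp k\<^esub>" using bounded[OF u] by blast
  have uc: "u k \<in> carrier (gp k)" for k using u by (simp add: gr_sel)
  have sm: "\<forall>k>m. (c \<odot>\<^bsub>gr_alg A F\<^esub> u) k = \<zero>\<^bsub>gp k\<^esub>"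
    using m by (simp add: gr_sel vec_space_zero[OF gp_simps(1)])
  show "c \<odot>\<^bsub>gr_alg A F\<^esub> u \<in> carrier (gr_alg A F)"
    by (rule gr_bounded_carrier[OF _ sm]) (simp add: gr_sel vspD(2)[OF gp_simps(1)] uc)
  show "theta (c \<odot>\<^bsub>gr_alg A F\<^esub> u) = sc c (theta u)"
    unfolding theta_bound[OF sm] theta_bound[OF m] by (simp add: gr_sel th_simps(3) uc sc_sum)
  assume v: "v \<in> carrier (gr_alg A F)"
  obtain m' where m': "\<forall>k>m'. v k = \<zero>\<^bsub>gp k\<^esub>" using bounded[OF v] by blast
  define n where "n = max m m'"
  have n: "\<forall>k>n. u k = \<zero>\<^bsub>gp k\<^esub>" "\<forall>k>n. v k = \<zero>\<^bsub>gp k\<^esub>" using m m' by (auto simp: n_def)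
  have vc: "v k \<in> carrier (gp k)" for k using v by (simp add: gr_sel)
  have s: "\<forall>k>n. (u \<oplus>\<^bsub>gr_alg A F\<^esub> v) k = \<zero>\<^bsub>gp k\<^esub>"
    using n abelian_monoid.l_zero[OF gp_am] abelian_monoid.zero_closed[OF gp_am] by (simp add: gr_sel)
  show "u \<oplus>\<^bsub>gr_alg A F\<^esub> v \<in> carrier (gr_alg A F)"
    by (rule gr_bounded_carrier[OF _ s]) (simp add: gr_sel abelian_monoid.a_closed[OF gp_am] uc vc)
  show "theta (u \<oplus>\<^bsub>gr_alg A F\<^esub> v) = theta u + theta v"
    unfolding theta_bound[OF s] theta_bound[OF n(1)] theta_bound[OF n(2)]
    by (simp add: gr_sel th_simps(2) uc vc sum.distrib)
qed

lemma gr_one: "\<one>\<^bsub>gr_alg A F\<^esub> \<in> carrier (gr_alg A F)" "theta \<one>\<^bsub>gr_alg A F\<^esub> = 1"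
proof -
  have b: "\<forall>k>0. \<one>\<^bsub>gr_alg A F\<^esub> k = \<zero>\<^bsub>gp k\<^esub>" by (simp add: gr_sel)
  have c: "\<one>\<^bsub>gr_alg A F\<^esub> k \<in> carrier (gp k)" for k
    using one abelian_monoid.zero_closed[OF gp_am[of k]] by (cases "k = 0") (simp_all add: gr_sel gp_simps(2))
  show "\<one>\<^bsub>gr_alg A F\<^esub> \<in> carrier (gr_alg A F)" by (rule gr_bounded_carrier[OF c b])
  show "theta \<one>\<^bsub>gr_alg A F\<^esub> = 1"
    unfolding theta_bound[OF b] using th_cs[OF one] by (simp add: gr_sel S_one)
qed

text \<open>Components of different degree have symbols of different weight, so each can be
  recovered from the sum. This yields injectivity and the comparison of the gradings.\<close>

lemma filter_mon_theta:
  assumes u: "u \<in> carrier (gr_alg A F)"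
  shows "filter_mon (\<lambda>\<mu>. w \<mu> = k) (theta u) = th k (u k)"
proof -
  have uc: "u k \<in> carrier (gp k)" for k using u by (simp add: gr_sel)
  have 1: "filter_mon (\<lambda>\<mu>. w \<mu> = k) (th l (u l)) = (if l = k then th k (u k) else 0)" for l
    using th_simps(5)[OF uc[of l]]
    by (auto intro!: filter_mon_pm_id filter_mon_pm_zero)
  have "filter_mon (\<lambda>\<mu>. w \<mu> = k) (theta u) = (\<Sum>l | u l \<noteq> \<zero>\<^bsub>gp l\<^esub>. if l = k then th k (u k) else 0)"
    by (simp add: theta_def lin_sumD[OF lin_filter_mon] 1)
  also have "\<dots> = th k (u k)" using u by (simp add: gr_sel th_simps(1))
  finally show ?thesis .
qed

lemma theta_bij: "bij_betw theta (carrier (gr_alg A F)) (pm P)"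
  unfolding bij_betw_def
proof
  show "inj_on theta (carrier (gr_alg A F))"
  proof (rule inj_onI)
    fix u v assume uv: "u \<in> carrier (gr_alg A F)" "v \<in> carrier (gr_alg A F)" "theta u = theta v"
    show "u = v"
    proof
      fix k
      have "th k (u k) = th k (v k)" using filter_mon_theta[OF uv(1), of k] filter_mon_theta[OF uv(2), of k] uv(3) by simp
      then show "u k = v k" using uv by (intro th_simps(4)) (auto simp: gr_sel)
    qed
  qed
  show "theta ` carrier (gr_alg A F) = pm P"
  proof safe
    fix u assume u: "u \<in> carrier (gr_alg A F)"
    show "theta u \<in> pm P"
      unfolding theta_def
    proof (rule pm_sum)
      fix k
      show "th k (u k) \<in> pm P"
        by (rule pm_mono[OF th_simps(5)]) (use u in \<open>auto simp: gr_sel\<close>)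
    qed
  next
    fix p assume p: "p \<in> pm P"
    have "filter_mon (\<lambda>\<mu>. w \<mu> = k) p \<in> S k ` F k" for k
      unfolding S_onto using p by (auto simp: pm_iff lookup_filter_mon)
    then have "\<forall>k. \<exists>a. a \<in> F k \<and> S k a = filter_mon (\<lambda>\<mu>. w \<mu> = k) p" by (metis imageE)
    from choice[OF this] obtain a where a: "\<And>k. a k \<in> F k" "\<And>k. S k (a k) = filter_mon (\<lambda>\<mu>. w \<mu> = k) p" by blast
    obtain n where n: "\<forall>\<mu>\<in>keys p. w \<mu> \<le> n"
    proof -
      have "finite (w ` keys p)" by simp
      then show ?thesis using that unfolding finite_nat_set_iff_bounded_le by blast
    qed
    let ?u = "\<lambda>k. cs k (a k)"
    have b: "\<forall>k>n. ?u k = \<zero>\<^bsub>gp k\<^esub>"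
    proof (intro allI impI)
      fix k assume k: "k > n"
      have "filter_mon (\<lambda>\<mu>. w \<mu> = k) p = 0"
        by (rule filter_mon_pm_zero[of p "keys p"]) (use n k in \<open>auto simp: pm_def\<close>)
      then have "S k (a k) = S k \<zero>\<^bsub>A\<^esub>" by (simp add: a(2) S_0)
      then show "?u k = \<zero>\<^bsub>gp k\<^esub>" using a(1) F_closed(1) by (simp add: gp_simps(3,6))
    qed
    have "?u \<in> carrier (gr_alg A F)" by (rule gr_bounded_carrier[OF _ b]) (use a in \<open>auto simp: gp_simps\<close>)
    moreover have "theta ?u = p"
    proof -
      have "theta ?u = (\<Sum>k\<le>n. filter_mon (\<lambda>\<mu>. w \<mu> = k) p)"
        unfolding theta_bound[OF b] using a by (simp add: th_cs)
      also have "\<dots> = p"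
      proof (rule poly_mapping_eqI)
        fix \<mu>
        have "w \<mu> \<le> n \<or> lkp p \<mu> = 0" using n by (auto simp: in_keys_iff)
        then show "lkp (\<Sum>k\<le>n. filter_mon (\<lambda>\<mu>. w \<mu> = k) p) \<mu> = lkp p \<mu>"
          by (auto simp: lookup_sum lookup_filter_mon)
      qed
      finally show ?thesis .
    qed
    ultimately show "p \<in> theta ` carrier (gr_alg A F)" by blast
  qed
qed

lemma theta_comp:
  "gr_comp A F m \<subseteq> carrier (gr_alg A F)" "theta ` gr_comp A F m = pm {\<mu> \<in> P. w \<mu> = m}"
proof -
  have g: "gr_comp A F m = {u \<in> carrier (gr_alg A F). \<forall>k. k \<noteq> m \<longrightarrow> u k = \<zero>\<^bsub>gp k\<^esub>}"
    by (simp add: gr_comp_def dsum_comp_def gr_alg_def)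
  then show "gr_comp A F m \<subseteq> carrier (gr_alg A F)" by blast
  have t: "theta u = th m (u m)" if u: "u \<in> gr_comp A F m" for u
  proof -
    have "theta u = (\<Sum>k\<in>{m}. th k (u k))"
      unfolding theta_def using u by (intro sum.mono_neutral_left) (auto simp: g th_simps(1))
    then show ?thesis by simp
  qed
  show "theta ` gr_comp A F m = pm {\<mu> \<in> P. w \<mu> = m}"
  proof safe
    fix u assume u: "u \<in> gr_comp A F m"
    then show "theta u \<in> pm {\<mu> \<in> P. w \<mu> = m}"
      unfolding t[OF u] by (intro th_simps(5)) (auto simp: g gr_sel)
  next
    fix p assume p: "p \<in> pm {\<mu> \<in> P. w \<mu> = m}"
    then have "p \<in> pm P" by (rule pm_mono) auto
    then have "p \<in> theta ` carrier (gr_alg A F)" using theta_bij by (simp add: bij_betw_def)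
    then obtain u where u: "u \<in> carrier (gr_alg A F)" "theta u = p" by blast
    have "u k = \<zero>\<^bsub>gp k\<^esub>" if "k \<noteq> m" for k
    proof (rule th_eq_zero)
      show "u k \<in> carrier (gp k)" using u by (simp add: gr_sel)
      have "filter_mon (\<lambda>\<mu>. w \<mu> = k) p = 0" by (rule filter_mon_pm_zero[OF p]) (use that in auto)
      then show "th k (u k) = 0" using filter_mon_theta[OF u(1), of k] u(2) by simp
    qed
    then show "p \<in> theta ` gr_comp A F m" using u g by blast
  qed
qed

end

section \<open>The projective limit\<close>

context omega_basis
begin

abbreviation "Ug \<equiv> U_gl scale"

lemma Ug_ring: "ring (Ug N)" unfolding U_gl_eq by (rule gl.U_ring)

lemma Ug_eqI: "u \<in> carrier (Ug N) \<Longrightarrow> v \<in> carrier (Ug N) \<Longrightarrow> sgm N u = sgm N v \<Longrightarrow> u = v"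
  unfolding U_gl_eq by (rule gl.symbol_inj)

lemma Ug_vec_space: "vec_space (Ug N)"
  unfolding U_gl_eq by (rule calgD(1)[OF presentsD(1)[OF gl.presents_uea]])

lemma Ug_smult_mult:
  assumes "x \<in> carrier (Ug N)" "y \<in> carrier (Ug N)"
  shows "x \<otimes>\<^bsub>Ug N\<^esub> (c \<odot>\<^bsub>Ug N\<^esub> y) = c \<odot>\<^bsub>Ug N\<^esub> (x \<otimes>\<^bsub>Ug N\<^esub> y)"
    "(c \<odot>\<^bsub>Ug N\<^esub> x) \<otimes>\<^bsub>Ug N\<^esub> y = c \<odot>\<^bsub>Ug N\<^esub> (x \<otimes>\<^bsub>Ug N\<^esub> y)"
proof -
  note D = presentsD[OF gl.presents_uea[of N]]
  obtain p q where "p \<in> gl.FV N" "q \<in> gl.FV N" "x = gl.qU N p" "y = gl.qU N q"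
    using assms by (auto simp: U_gl_eq gl.U_carrier)
  then show "x \<otimes>\<^bsub>Ug N\<^esub> (c \<odot>\<^bsub>Ug N\<^esub> y) = c \<odot>\<^bsub>Ug N\<^esub> (x \<otimes>\<^bsub>Ug N\<^esub> y)"
    "(c \<odot>\<^bsub>Ug N\<^esub> x) \<otimes>\<^bsub>Ug N\<^esub> y = c \<odot>\<^bsub>Ug N\<^esub> (x \<otimes>\<^bsub>Ug N\<^esub> y)"
    unfolding U_gl_eq by (simp_all add: D(7,8) pm_sc lists_mult sc_mult_left sc_mult_right)
qed

lemma I_plus_left:
  assumes x: "x \<in> carrier (Ug N)" and l: "l \<in> I_plus scale N"
  shows "x \<otimes>\<^bsub>Ug N\<^esub> l \<in> I_plus scale N"
proof -
  interpret ring "Ug N" by (rule Ug_ring)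
  have m: "uea_mon (gl scale N) comm_br [E_mat N i (N - 1) y] \<in> carrier (Ug N)" for i y
    unfolding U_gl_eq gl.uea_mon_qU gl.U_carrier by (rule imageI) simp
  show ?thesis
    unfolding I_plus_def
  proof (rule lin_span_map[where f = "(\<otimes>\<^bsub>Ug N\<^esub>) x", OF Ug_vec_space _ _ _ _ _ l[unfolded I_plus_def]])
    fix g assume "g \<in> {u \<otimes>\<^bsub>Ug N\<^esub> uea_mon (gl scale N) comm_br [E_mat N i (N - 1) y] | u i y. u \<in> carrier (Ug N) \<and> i < N}"
    then obtain u i y where g: "u \<in> carrier (Ug N)" "i < N"
      "g = u \<otimes>\<^bsub>Ug N\<^esub> uea_mon (gl scale N) comm_br [E_mat N i (N - 1) y]" by blast
    show "x \<otimes>\<^bsub>Ug N\<^esub> g \<in> lin_span (Ug N)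
      {u \<otimes>\<^bsub>Ug N\<^esub> uea_mon (gl scale N) comm_br [E_mat N i (N - 1) y] | u i y. u \<in> carrier (Ug N) \<and> i < N}"
      unfolding g(3) m_assoc[OF x g(1) m, symmetric] by (rule lin_span.base) (use x g in blast)
  qed (use x m in \<open>auto simp: r_distr Ug_smult_mult\<close>)
qed

lemma I_minus_right:
  assumes x: "x \<in> carrier (Ug N)" and l: "l \<in> I_minus scale N"
  shows "l \<otimes>\<^bsub>Ug N\<^esub> x \<in> I_minus scale N"
proof -
  interpret ring "Ug N" by (rule Ug_ring)
  have m: "uea_mon (gl scale N) comm_br [E_mat N (N - 1) j y] \<in> carrier (Ug N)" for j y
    unfolding U_gl_eq gl.uea_mon_qU gl.U_carrier by (rule imageI) simp
  show ?thesis
    unfolding I_minus_def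
  proof (rule lin_span_map[where f = "\<lambda>l. l \<otimes>\<^bsub>Ug N\<^esub> x", OF Ug_vec_space _ _ _ _ _ l[unfolded I_minus_def]])
    fix g assume "g \<in> {uea_mon (gl scale N) comm_br [E_mat N (N - 1) j y] \<otimes>\<^bsub>Ug N\<^esub> u | u j y. u \<in> carrier (Ug N) \<and> j < N}"
    then obtain u j y where g: "u \<in> carrier (Ug N)" "j < N"
      "g = uea_mon (gl scale N) comm_br [E_mat N (N - 1) j y] \<otimes>\<^bsub>Ug N\<^esub> u" by blast
    show "g \<otimes>\<^bsub>Ug N\<^esub> x \<in> lin_span (Ug N)
      {uea_mon (gl scale N) comm_br [E_mat N (N - 1) j y] \<otimes>\<^bsub>Ug N\<^esub> u | u j y. u \<in> carrier (Ug N) \<and> j < N}"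
      unfolding g(3) m_assoc[OF m g(1) x] by (rule lin_span.base) (use x g in blast)
  qed (use x m in \<open>auto simp: l_distr Ug_smult_mult\<close>)
qed

text \<open>With \<open>u'\<close> and \<open>v'\<close> the projections, embedded again,
  \<open>u v - u' v' = (u - u') v + u' (v - v')\<close>. The first summand lies in the right ideal
  \<open>I_minus\<close>, the second in the left ideal \<open>I_plus\<close>, and truncation
  annihilates the symbols of both ideals.\<close>

lemma proj_mult_symbol:
  assumes N: "N > 0" and u: "u \<in> U_E scale N" and v: "v \<in> U_E scale N"
  shows "cutoff (N - 1) (sgm N (u \<otimes>\<^bsub>Ug N\<^esub> v)) = sgm (N - 1) (proj scale N u \<otimes>\<^bsub>Ug (N - 1)\<^esub> proj scale N v)"
proof -
  interpret ring "Ug N" by (rule Ug_ring)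
  interpret R: ring "Ug (N - 1)" by (rule Ug_ring)
  let ?u = "proj scale N u" and ?v = "proj scale N v" and ?i = "U_incl scale N"
  have uc: "u \<in> carrier (Ug N)" "v \<in> carrier (Ug N)" using u v by (simp_all add: U_E_def)
  have pc: "?u \<in> carrier (Ug (N - 1))" "?v \<in> carrier (Ug (N - 1))" using proj_symbol(1)[OF N] u v by auto
  have ic: "?i ?u \<in> carrier (Ug N)" "?i ?v \<in> carrier (Ug N)" using U_incl_symbol(1)[OF N] pc by auto
  have im: "?i (?u \<otimes>\<^bsub>Ug (N - 1)\<^esub> ?v) = ?i ?u \<otimes>\<^bsub>Ug N\<^esub> ?i ?v"
    using pbw_hom.uea_hom_symbol(3)[OF corner_hom[OF N]] pc by (simp add: U_gl_eq U_incl_def)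
  let ?x = "(u \<ominus>\<^bsub>Ug N\<^esub> ?i ?u) \<otimes>\<^bsub>Ug N\<^esub> v" and ?y = "?i ?u \<otimes>\<^bsub>Ug N\<^esub> (v \<ominus>\<^bsub>Ug N\<^esub> ?i ?v)"
  have x: "?x \<in> I_minus scale N"
    using proj_symbol(3)[OF N u] uc by (intro I_minus_right) (auto simp: L_ideal_def)
  have y: "?y \<in> I_plus scale N"
    using proj_symbol(3)[OF N v] ic by (intro I_plus_left) (auto simp: L_ideal_def)
  have xc: "?x \<in> carrier (Ug N)" "?y \<in> carrier (Ug N)" using uc ic by auto
  have "u \<otimes>\<^bsub>Ug N\<^esub> v = (?x \<oplus>\<^bsub>Ug N\<^esub> ?y) \<oplus>\<^bsub>Ug N\<^esub> ?i (?u \<otimes>\<^bsub>Ug (N - 1)\<^esub> ?v)"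
    unfolding im using uc ic by algebra
  then have "sgm N (u \<otimes>\<^bsub>Ug N\<^esub> v) = sgm N ?x + sgm N ?y + sgm N (?i (?u \<otimes>\<^bsub>Ug (N - 1)\<^esub> ?v))"
    using xc U_incl_symbol(1)[OF N R.m_closed[OF pc]] unfolding U_gl_eq by (simp add: gl.symbol_add ring.ring_simprules(1)[OF gl.U_ring])
  moreover have "cutoff (N - 1) (sgm N ?x) = 0"
    using x unfolding I_minus_iff[OF N] cutoff_def by (intro filter_mon_pm_zero) (blast, force)
  moreover have "cutoff (N - 1) (sgm N ?y) = 0"
    using y unfolding I_plus_iff[OF N] cutoff_def by (intro filter_mon_pm_zero) (blast, force)
  moreover have "sgm N (?i (?u \<otimes>\<^bsub>Ug (N - 1)\<^esub> ?v)) = sgm (N - 1) (?u \<otimes>\<^bsub>Ug (N - 1)\<^esub> ?v)"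
    using U_incl_symbol(2)[OF N R.m_closed[OF pc]] .
  moreover have "sgm (N - 1) (?u \<otimes>\<^bsub>Ug (N - 1)\<^esub> ?v) \<in> polys (ZN (N - 1))"
    using R.m_closed[OF pc] unfolding U_gl_eq by (rule gl.symbol_polys)
  ultimately show ?thesis by (simp add: lin_addD[OF lin_cutoff] cutoff_id)
qed

text \<open>Membership in terms of symbols. The equivalence for the projections presupposes
  invariance at all levels, since \<open>proj_symbol\<close> is available on \<open>U_E\<close>
  only.\<close>

lemma A0_filt_iff:
  "a \<in> A0_filt scale k \<longleftrightarrow> (\<forall>N. a N \<in> carrier (Ug N)) \<and> (\<forall>N. \<forall>X\<in>carrier_mat N N. dX N X (sgm N (a N)) = 0) \<and>
    (\<forall>N>0. cutoff (N - 1) (sgm N (a N)) = sgm (N - 1) (a (N - 1))) \<and> (\<forall>N. sgm N (a N) \<in> deg_le k)"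
proof -
  let ?L = "\<forall>N. a N \<in> A0_level scale N"
  have p: "proj scale N (a N) = a (N - 1) \<longleftrightarrow> cutoff (N - 1) (sgm N (a N)) = sgm (N - 1) (a (N - 1))"
    if L: ?L and N: "N > 0" for N
  proof -
    have "a N \<in> A0_level scale N" "a (N - 1) \<in> A0_level scale (N - 1)" using L by blast+
    then have E: "a N \<in> U_E scale N" and c: "a (N - 1) \<in> carrier (Ug (N - 1))"
      using A0_level_U_E[OF N] by (auto simp: A0_level_iff)
    note p = proj_symbol(1,2)[OF N E]
    show ?thesis
    proof
      show "cutoff (N - 1) (sgm N (a N)) = sgm (N - 1) (a (N - 1))" if "proj scale N (a N) = a (N - 1)"
        using p(2) unfolding that by (rule sym)
      show "proj scale N (a N) = a (N - 1)" if "cutoff (N - 1) (sgm N (a N)) = sgm (N - 1) (a (N - 1))"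
        by (rule Ug_eqI[OF p(1) c]) (simp only: p(2) that)
    qed
  qed
  have "a \<in> A0_filt scale k \<longleftrightarrow> ?L \<and>
    (\<forall>N>0. proj scale N (a N) = a (N - 1)) \<and> (\<forall>N. a N \<in> uea_filt (gl scale N) comm_br k)"
    by (simp only: A0_filt_def mem_Collect_eq)
  also have "\<dots> \<longleftrightarrow> ?L \<and> (\<forall>N>0. cutoff (N - 1) (sgm N (a N)) = sgm (N - 1) (a (N - 1))) \<and>
      (\<forall>N. a N \<in> uea_filt (gl scale N) comm_br k)"
    using p by (intro conj_cong refl iff_allI imp_cong) simp_all
  finally show ?thesis
    unfolding A0_level_iff gl.uea_filt_iff U_gl_eq by blast
qed

lemma A0_filtD:
  assumes "a \<in> A0_filt scale k"
  shows "\<And>N. a N \<in> carrier (Ug N)" "\<And>N X. X \<in> carrier_mat N N \<Longrightarrow> dX N X (sgm N (a N)) = 0"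
    "\<And>N. N > 0 \<Longrightarrow> cutoff (N - 1) (sgm N (a N)) = sgm (N - 1) (a (N - 1))" "\<And>N. sgm N (a N) \<in> deg_le k"
    "\<And>N. a N \<in> A0_level scale N" "\<And>N. N > 0 \<Longrightarrow> proj scale N (a N) = a (N - 1)"
    "\<And>N. a N \<in> uea_filt (gl scale N) comm_br k"
proof -
  note A = assms[unfolded A0_filt_iff] and B = assms[unfolded A0_filt_def mem_Collect_eq]
  show "a N \<in> carrier (Ug N)" for N using A by blast
  show "dX N X (sgm N (a N)) = 0" if "X \<in> carrier_mat N N" for N X using A that by blast
  show "cutoff (N - 1) (sgm N (a N)) = sgm (N - 1) (a (N - 1))" if "N > 0" for N using A that by blast
  show "sgm N (a N) \<in> deg_le k" for N using A by blast
  show "a N \<in> A0_level scale N" for N using B by blast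
  show "proj scale N (a N) = a (N - 1)" if "N > 0" for N using B that by blast
  show "a N \<in> uea_filt (gl scale N) comm_br k" for N using B by blast
qed

lemma A0_sel:
  "carrier (A0 scale) = (\<Union>k. A0_filt scale k)" "\<zero>\<^bsub>A0 scale\<^esub> = (\<lambda>N. \<zero>\<^bsub>Ug N\<^esub>)"
  "\<one>\<^bsub>A0 scale\<^esub> = (\<lambda>N. \<one>\<^bsub>Ug N\<^esub>)"
  "a \<oplus>\<^bsub>A0 scale\<^esub> b = (\<lambda>N. a N \<oplus>\<^bsub>Ug N\<^esub> b N)" "a \<otimes>\<^bsub>A0 scale\<^esub> b = (\<lambda>N. a N \<otimes>\<^bsub>Ug N\<^esub> b N)"
  "c \<odot>\<^bsub>A0 scale\<^esub> a = (\<lambda>N. c \<odot>\<^bsub>Ug N\<^esub> a N)"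
  by (simp_all add: A0_def)

lemma sgm_simps:
  "sgm N \<zero>\<^bsub>Ug N\<^esub> = 0" "sgm N \<one>\<^bsub>Ug N\<^esub> = 1"
  "u \<in> carrier (Ug N) \<Longrightarrow> v \<in> carrier (Ug N) \<Longrightarrow> sgm N (u \<oplus>\<^bsub>Ug N\<^esub> v) = sgm N u + sgm N v"
  "u \<in> carrier (Ug N) \<Longrightarrow> sgm N (c \<odot>\<^bsub>Ug N\<^esub> u) = sc c (sgm N u)"
  unfolding U_gl_eq by (simp_all add: gl.symbol_zero gl.symbol_one gl.symbol_add gl.symbol_smult)

lemma A0_filt_closed:
  "\<zero>\<^bsub>A0 scale\<^esub> \<in> A0_filt scale k" "\<one>\<^bsub>A0 scale\<^esub> \<in> A0_filt scale k"
  "a \<in> A0_filt scale k \<Longrightarrow> b \<in> A0_filt scale k \<Longrightarrow> a \<oplus>\<^bsub>A0 scale\<^esub> b \<in> A0_filt scale k"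
  "a \<in> A0_filt scale k \<Longrightarrow> c \<odot>\<^bsub>A0 scale\<^esub> a \<in> A0_filt scale k"
  using Ug_ring ring.ring_simprules(1,2,6)[OF Ug_ring] vspD(2)[OF Ug_vec_space]
  by (auto simp: A0_filt_iff A0_sel sgm_simps lin_0[OF lin_dX] lin_0[OF lin_cutoff] dX_one cutoff_one
    lin_addD[OF lin_dX] lin_addD[OF lin_cutoff] lin_scD[OF lin_dX] lin_scD[OF lin_cutoff])

lemma A0_filt_mono: "k \<le> l \<Longrightarrow> A0_filt scale k \<subseteq> A0_filt scale l"
proof (rule subsetI)
  fix a assume kl: "k \<le> l" and a: "a \<in> A0_filt scale k"
  have "sgm N (a N) \<in> deg_le l" for N
    by (rule pm_mono[OF A0_filtD(4)[OF a]]) (use kl in auto)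
  then show "a \<in> A0_filt scale l" using a unfolding A0_filt_iff by blast
qed

lemma A0_filt_mult:
  assumes a: "a \<in> A0_filt scale i" and b: "b \<in> A0_filt scale j"
  shows "a \<otimes>\<^bsub>A0 scale\<^esub> b \<in> A0_filt scale (i + j)"
proof -
  note A = A0_filtD[OF a] and B = A0_filtD[OF b]
  have c: "a N \<otimes>\<^bsub>Ug N\<^esub> b N \<in> carrier (Ug N)" for N
    using ring.ring_simprules(5)[OF Ug_ring A(1) B(1)] .
  \<comment> \<open>The symbol of a product is not the product of the symbols, so invariance is
    obtained from the Leibniz rule in the enveloping algebra and translated afterwards.\<close>
  have "dX N X (sgm N (a N \<otimes>\<^bsub>Ug N\<^esub> b N)) = 0" if X: "X \<in> carrier_mat N N" for N X
  proof -
    interpret ring "Ug N" by (rule Ug_ring)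
    have "U_ad scale N X (a N) = \<zero>\<^bsub>Ug N\<^esub>" "U_ad scale N X (b N) = \<zero>\<^bsub>Ug N\<^esub>"
      using A(5)[of N] B(5)[of N] X by (auto simp: A0_level_def)
    moreover have "U_ad scale N X (a N \<otimes>\<^bsub>Ug N\<^esub> b N) =
      (U_ad scale N X (a N) \<otimes>\<^bsub>Ug N\<^esub> b N) \<oplus>\<^bsub>Ug N\<^esub> (a N \<otimes>\<^bsub>Ug N\<^esub> U_ad scale N X (b N))"
      unfolding U_ad_def U_gl_eq
      by (rule gl.uea_deriv_symbol(3); use A(1)[of N] B(1)[of N] in \<open>simp add: ad_act_add ad_act_smult ad_act_mult U_gl_eq\<close>)
    ultimately have "U_ad scale N X (a N \<otimes>\<^bsub>Ug N\<^esub> b N) = \<zero>\<^bsub>Ug N\<^esub>" using A(1)[of N] B(1)[of N] by simp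
    then show ?thesis using U_ad_zero_iff[OF c] by blast
  qed
  moreover have "cutoff (N - 1) (sgm N (a N \<otimes>\<^bsub>Ug N\<^esub> b N)) = sgm (N - 1) (a (N - 1) \<otimes>\<^bsub>Ug (N - 1)\<^esub> b (N - 1))"
    if N: "N > 0" for N
    using proj_mult_symbol[OF N subsetD[OF A0_level_U_E[OF N] A(5)] subsetD[OF A0_level_U_E[OF N] B(5)]]
    unfolding A(6)[OF N] B(6)[OF N] .
  moreover have "sgm N (a N \<otimes>\<^bsub>Ug N\<^esub> b N) \<in> deg_le (i + j)" for N
    using gl.symbol_mult_top(1)[OF A(7) B(7), of N] unfolding gl.uea_filt_iff U_gl_eq by blast
  ultimately show ?thesis using c by (simp add: A0_filt_iff A0_sel)
qed

lemma A0_neg: "a \<in> A0_filt scale k \<Longrightarrow> (-1) \<odot>\<^bsub>A0 scale\<^esub> a \<oplus>\<^bsub>A0 scale\<^esub> a = \<zero>\<^bsub>A0 scale\<^esub>"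
proof
  fix N assume "a \<in> A0_filt scale k"
  then have a: "a N \<in> carrier (Ug N)" by (rule A0_filtD)
  interpret ring "Ug N" by (rule Ug_ring)
  have "(-1) \<odot>\<^bsub>Ug N\<^esub> a N \<in> carrier (Ug N)" by (rule vspD(2)[OF Ug_vec_space a])
  then show "((-1) \<odot>\<^bsub>A0 scale\<^esub> a \<oplus>\<^bsub>A0 scale\<^esub> a) N = \<zero>\<^bsub>A0 scale\<^esub> N"
    unfolding A0_sel using a by (intro Ug_eqI) (auto simp: sgm_simps sc_minus_one)
qed

lemma A0_carrier_common:
  assumes "a \<in> carrier (A0 scale)" "b \<in> carrier (A0 scale)"
  shows "\<exists>k. a \<in> A0_filt scale k \<and> b \<in> A0_filt scale k"
proof -
  obtain k l where "a \<in> A0_filt scale k" "b \<in> A0_filt scale l" using assms by (auto simp: A0_sel)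
  then have "a \<in> A0_filt scale (max k l)" "b \<in> A0_filt scale (max k l)"
    using A0_filt_mono[of k "max k l"] A0_filt_mono[of l "max k l"] by auto
  then show ?thesis by blast
qed

lemma vec_space_A0: "vec_space (A0 scale)"
proof -
  have U: "a N \<in> carrier (Ug N)" if "a \<in> carrier (A0 scale)" for a N
    using that A0_filtD(1) by (auto simp: A0_sel)
  have "abelian_group (A0 scale)"
  proof (rule abelian_groupI)
    show "\<zero>\<^bsub>A0 scale\<^esub> \<in> carrier (A0 scale)" unfolding A0_sel(1) using A0_filt_closed(1) by blast
    fix a assume a: "a \<in> carrier (A0 scale)"
    then obtain k where k: "a \<in> A0_filt scale k" by (auto simp: A0_sel)
    show "\<exists>y\<in>carrier (A0 scale). y \<oplus>\<^bsub>A0 scale\<^esub> a = \<zero>\<^bsub>A0 scale\<^esub>"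
      using A0_neg[OF k] A0_filt_closed(4)[OF k] unfolding A0_sel(1) by blast
    show "\<zero>\<^bsub>A0 scale\<^esub> \<oplus>\<^bsub>A0 scale\<^esub> a = a"
      using ring.ring_simprules(8)[OF Ug_ring U[OF a]] by (simp add: A0_sel)
    fix b assume b: "b \<in> carrier (A0 scale)"
    show "a \<oplus>\<^bsub>A0 scale\<^esub> b \<in> carrier (A0 scale)"
      using A0_carrier_common[OF a b] A0_filt_closed(3) unfolding A0_sel(1) by blast
    show "a \<oplus>\<^bsub>A0 scale\<^esub> b = b \<oplus>\<^bsub>A0 scale\<^esub> a"
      using ring.ring_simprules(10)[OF Ug_ring U[OF a] U[OF b]] by (simp add: A0_sel)
    fix c assume c: "c \<in> carrier (A0 scale)"
    show "a \<oplus>\<^bsub>A0 scale\<^esub> b \<oplus>\<^bsub>A0 scale\<^esub> c = a \<oplus>\<^bsub>A0 scale\<^esub> (b \<oplus>\<^bsub>A0 scale\<^esub> c)"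
      using ring.ring_simprules(7)[OF Ug_ring U[OF a] U[OF b] U[OF c]] by (simp add: A0_sel)
  qed
  moreover have "c \<odot>\<^bsub>A0 scale\<^esub> a \<in> carrier (A0 scale)" if "a \<in> carrier (A0 scale)" for c a
    using that A0_filt_closed(4) unfolding A0_sel(1) by blast
  moreover have "c \<odot>\<^bsub>A0 scale\<^esub> (a \<oplus>\<^bsub>A0 scale\<^esub> b) = c \<odot>\<^bsub>A0 scale\<^esub> a \<oplus>\<^bsub>A0 scale\<^esub> c \<odot>\<^bsub>A0 scale\<^esub> b"
    if "a \<in> carrier (A0 scale)" "b \<in> carrier (A0 scale)" for c a b
    using vspD(3)[OF Ug_vec_space U[OF that(1)] U[OF that(2)]] by (simp add: A0_sel)
  ultimately show ?thesis unfolding vec_space_def by blast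
qed

lemma A0_filt_lin_subspace: "lin_subspace (A0_filt scale k) (A0 scale)"
proof -
  interpret abelian_group "A0 scale" by (rule vspD(1)[OF vec_space_A0])
  have sub: "A0_filt scale k \<subseteq> carrier (A0 scale)" unfolding A0_sel(1) by blast
  have "subgroup (A0_filt scale k) (add_monoid (A0 scale))"
  proof
    show "inv\<^bsub>add_monoid (A0 scale)\<^esub> a \<in> A0_filt scale k" if a: "a \<in> A0_filt scale k" for a
    proof -
      have "\<ominus>\<^bsub>A0 scale\<^esub> a = (-1) \<odot>\<^bsub>A0 scale\<^esub> a"
        using A0_neg[OF a] a A0_filt_closed(4)[OF a] sub by (intro minus_equality) auto
      then show ?thesis using A0_filt_closed(4)[OF a, of "-1"] by (simp add: a_inv_def)
    qed
  qed (use sub A0_filt_closed in auto)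
  then show ?thesis by (auto simp: lin_subspace_def additive_subgroupI A0_filt_closed)
qed

text \<open>The derivation replaces a variable by a linear form and so preserves the degree.
  Consequently the leading terms of invariants are invariant.\<close>

lemma dX_hom_part:
  assumes "f \<in> polys (ZN N)" shows "dX N X (hom_part k f) = hom_part k (dX N X f)"
proof (rule lin_eq[OF lin_comp[OF lin_dX lin_hom_part] lin_comp[OF lin_hom_part lin_dX] assms])
  fix m assume m: "m \<in> {m. set_mset m \<subseteq> ZN N}"
  have "dX N X (mon m) \<in> pm {m'. size m' = size m}"
    unfolding dX_def dv_mon
  proof (rule pm_sum_mset)
    fix z assume z: "z \<in># m"
    have "size m > 0" using z by (metis gr_zeroI multi_member_split size_add_mset nat.distinct(1))
    then have "1 + size (m - {#z#}) = size m" using z by (simp add: size_Diff_singleton)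
    then show "gl.li N (ad_act scale N X (eN N z)) * mon (m - {#z#}) \<in> pm {m'. size m' = size m}"
      by (intro pm_mult[OF gl.li_in[OF gl.co_pm], of _ N _ "{m - {#z#}}"]) auto
  qed
  then have "hom_part l (dX N X (mon m)) = (if l = size m then dX N X (mon m) else 0)" for l
    unfolding hom_part_def by (auto intro!: filter_mon_pm_id filter_mon_pm_zero)
  then show "dX N X (hom_part k (mon m)) = hom_part k (dX N X (mon m))"
    by (auto simp: hom_part_mon lin_0[OF lin_dX])
qed

section \<open>Leading terms of compatible sequences\<close>

definition limit_symbol :: "nat \<Rightarrow> (nat \<Rightarrow> ('a mat list \<Rightarrow>\<^sub>0 complex) set set) \<Rightarrow> ('a list set multiset \<Rightarrow>\<^sub>0 complex)" where
  "limit_symbol k a = (THE s. s \<in> NP B k \<and> (\<forall>N. hom_part k (sgm N (a N)) = TN N s))"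

text \<open>Level \<open>N = k\<close> alone determines the polynomial, by
  \<open>TN_inj\<close>.\<close>

lemma limit_symbol_unique:
  assumes "s \<in> NP B k" "\<And>N. hom_part k (sgm N (a N)) = TN N s" "s' \<in> NP B k" "\<And>N. hom_part k (sgm N (a N)) = TN N s'"
  shows "s = s'"
proof -
  have "TN k (s - s') = 0" using assms(2)[of k] assms(4)[of k] by (simp add: lin_diffD[OF lin_TN])
  then have "s - s' = 0" using TN_inj[of "s - s'" B k k] assms by auto
  then show ?thesis by simp
qed

lemma limit_symbol_eqI:
  assumes "s \<in> NP B k" "\<And>N. hom_part k (sgm N (a N)) = TN N s" shows "limit_symbol k a = s"
  unfolding limit_symbol_def
  by (rule the_equality) (use assms in \<open>auto intro: limit_symbol_unique[of _ k a]\<close>)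

lemma limit_symbol_ex:
  assumes a: "a \<in> A0_filt scale k"
  shows "limit_symbol k a \<in> NP B k" "hom_part k (sgm N (a N)) = TN N (limit_symbol k a)"
proof -
  note A = A0_filtD[OF a]
  have p: "sgm N (a N) \<in> polys (ZN N)" for N using A(1)[of N] unfolding U_gl_eq by (rule gl.symbol_polys)
  have "\<exists>s\<in>NP B k. \<forall>N. hom_part k (sgm N (a N)) = TN N s"
  proof (rule stable_invariants)
    show "hom_part k (sgm N (a N)) \<in> pm {m. set_mset m \<subseteq> ZN N \<and> size m = k}" for N
      using p[of N] hom_part_homog[of k "sgm N (a N)"] by (auto simp: pm_iff hom_part_def lookup_filter_mon)
    show "dX N X (hom_part k (sgm N (a N))) = 0" if "X \<in> carrier_mat N N" for N X
      using A(2)[OF that] by (simp add: dX_hom_part[OF p] lin_0[OF lin_hom_part])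
    show "cutoff (N - 1) (hom_part k (sgm N (a N))) = hom_part k (sgm (N - 1) (a (N - 1)))" if "N > 0" for N
      using A(3)[OF that] by (simp flip: cutoff_hom_part)
  qed
  then obtain s where s: "s \<in> NP B k" "\<And>N. hom_part k (sgm N (a N)) = TN N s" by blast
  then have "limit_symbol k a = s" by (rule limit_symbol_eqI)
  then show "limit_symbol k a \<in> NP B k" "hom_part k (sgm N (a N)) = TN N (limit_symbol k a)" using s by auto
qed

sublocale A0: gr_symbol "A0 scale" "A0_filt scale" limit_symbol "{\<mu>. set_mset \<mu> \<subseteq> necklaces B}" weight
proof
  show "vec_space (A0 scale)" by (rule vec_space_A0)
  show "lin_subspace (A0_filt scale k) (A0 scale)" for k by (rule A0_filt_lin_subspace)
  show "A0_filt scale k \<subseteq> A0_filt scale (Suc k)" for k by (rule A0_filt_mono) simp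
  show "\<one>\<^bsub>A0 scale\<^esub> \<in> A0_filt scale 0" by (rule A0_filt_closed)
  show "limit_symbol 0 \<one>\<^bsub>A0 scale\<^esub> = 1"
    by (rule limit_symbol_eqI[OF NP_one]) (simp add: A0_sel sgm_simps TN_one)
  fix a k assume a: "a \<in> A0_filt scale k"
  note A = A0_filtD[OF a]
  show "limit_symbol k (c \<odot>\<^bsub>A0 scale\<^esub> a) = sc c (limit_symbol k a)" for c
    by (rule limit_symbol_eqI) (use A(1) limit_symbol_ex[OF a] in \<open>auto simp: A0_sel sgm_simps lin_scD[OF lin_hom_part] lin_scD[OF lin_TN]\<close>)
  show "limit_symbol k a = 0 \<longleftrightarrow> a \<in> filt_below (A0 scale) (A0_filt scale) k"
  proof -
    have "limit_symbol k a = 0 \<longleftrightarrow> (\<forall>N. hom_part k (sgm N (a N)) = 0)"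
    proof
      assume "limit_symbol k a = 0"
      then show "\<forall>N. hom_part k (sgm N (a N)) = 0" using limit_symbol_ex(2)[OF a] by (simp add: lin_0[OF lin_TN])
    next
      assume "\<forall>N. hom_part k (sgm N (a N)) = 0"
      then show "limit_symbol k a = 0" by (intro limit_symbol_eqI) (auto simp: lin_0[OF lin_TN])
    qed
    also have "\<dots> \<longleftrightarrow> (\<forall>N. sgm N (a N) \<in> deg_lt k)"
      using deg_lt_iff[OF A(4)] by blast
    also have "\<dots> \<longleftrightarrow> a \<in> filt_below (A0 scale) (A0_filt scale) k"
    proof (cases k)
      \<comment> \<open>In degree 0 the smaller part of the filtration is 0 by definition, so
        vanishing of the constant terms has to give the zero sequence.\<close>
      case 0
      have "sgm N (a N) \<in> deg_lt 0 \<longleftrightarrow> a N = \<zero>\<^bsub>Ug N\<^esub>" for N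
      proof -
        have "sgm N (a N) \<in> deg_lt 0 \<longleftrightarrow> sgm N (a N) = sgm N \<zero>\<^bsub>Ug N\<^esub>"
          by (simp add: sgm_simps pm_def)
        then show ?thesis using Ug_eqI[OF A(1) ring.ring_simprules(2)[OF Ug_ring], of N] by auto
      qed
      then show ?thesis by (auto simp: 0 filt_below_def A0_sel fun_eq_iff)
    next
      case (Suc l)
      have "a \<in> A0_filt scale l \<longleftrightarrow> (\<forall>N. sgm N (a N) \<in> deg_le l)"
        using A(1,2,3) by (auto simp: A0_filt_iff[of a l])
      then show ?thesis by (simp add: Suc filt_below_def less_Suc_eq_le)
    qed
    finally show ?thesis .
  qed
  fix b
  show "limit_symbol k (a \<oplus>\<^bsub>A0 scale\<^esub> b) = limit_symbol k a + limit_symbol k b" if b: "b \<in> A0_filt scale k"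
    by (rule limit_symbol_eqI)
      (use A(1) A0_filtD(1)[OF b] limit_symbol_ex[OF a] limit_symbol_ex[OF b] in
        \<open>auto simp: A0_sel sgm_simps lin_addD[OF lin_hom_part] lin_addD[OF lin_TN]\<close>)
  fix j assume b: "b \<in> A0_filt scale j"
  show "a \<otimes>\<^bsub>A0 scale\<^esub> b \<in> A0_filt scale (k + j)" by (rule A0_filt_mult[OF a b])
  show "limit_symbol (k + j) (a \<otimes>\<^bsub>A0 scale\<^esub> b) = limit_symbol k a * limit_symbol j b"
  proof (rule limit_symbol_eqI)
    show "limit_symbol k a * limit_symbol j b \<in> NP B (k + j)" by (rule NP_mult[OF limit_symbol_ex(1)[OF a] limit_symbol_ex(1)[OF b]])
    show "hom_part (k + j) (sgm N ((a \<otimes>\<^bsub>A0 scale\<^esub> b) N)) = TN N (limit_symbol k a * limit_symbol j b)" for N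
      using gl.symbol_mult_top(2)[OF A(7) A0_filtD(7)[OF b], of N] limit_symbol_ex(2)[OF a, of N] limit_symbol_ex(2)[OF b, of N]
      by (simp add: A0_sel U_gl_eq TN_mult)
  qed
next
  fix k
  have e: "pm {\<mu> \<in> {\<mu>. set_mset \<mu> \<subseteq> necklaces B}. weight \<mu> = k} = NP B k" by simp
  show "limit_symbol k ` A0_filt scale k = pm {\<mu> \<in> {\<mu>. set_mset \<mu> \<subseteq> necklaces B}. weight \<mu> = k}"
    unfolding e
  proof
    show "limit_symbol k ` A0_filt scale k \<subseteq> NP B k" using limit_symbol_ex(1) by blast
    show "NP B k \<subseteq> limit_symbol k ` A0_filt scale k"
    proof
      fix s assume s: "s \<in> NP B k"
      have h: "TN N s \<in> pm {m. set_mset m \<subseteq> ZN N \<and> size m = k}" for N by (rule TN_homog[OF s])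
      \<comment> \<open>At each level the element whose full symbol is \<open>TN N s\<close> is
        taken, not just one with this leading term. Compatibility with the projections then follows
        from that of the trace polynomials.\<close>
      have "\<forall>N. \<exists>u. u \<in> carrier (Ug N) \<and> sgm N u = TN N s"
      proof
        fix N
        have "TN N s \<in> polys (ZN N)" by (rule pm_mono[OF h]) auto
        from gl.symbol_onto[OF this] show "\<exists>u. u \<in> carrier (Ug N) \<and> sgm N u = TN N s"
          unfolding U_gl_eq by blast
      qed
      from choice[OF this] obtain a where a: "\<And>N. a N \<in> carrier (Ug N)" "\<And>N. sgm N (a N) = TN N s" by blast
      have "TN N s \<in> deg_le k" for N by (rule pm_mono[OF h]) auto
      then have "a \<in> A0_filt scale k"
        using a by (auto simp: A0_filt_iff dX_TN[OF s] cutoff_TN[OF s])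
      moreover have "hom_part k (TN N s) = TN N s" for N
        by (rule hom_part_id, rule pm_mono[OF h]) auto
      then have "limit_symbol k a = s" by (intro limit_symbol_eqI s) (simp add: a(2))
      ultimately show "s \<in> limit_symbol k ` A0_filt scale k" by blast
    qed
  qed
qed

text \<open>Both algebras have been identified with the polynomial ring in the necklaces over
  \<open>B\<close>, by \<open>A0.theta\<close> and by \<open>psi\<close>; the isomorphism is the
  composition of one with the inverse of the other. Its properties are checked after applying the
  injective map \<open>psi\<close>.\<close>

lemma gr_A0_iso:
  "\<exists>\<phi>. \<phi> \<in> graded_alg_iso (gr_alg (A0 scale) (A0_filt scale)) (gr_comp (A0 scale) (A0_filt scale))
      Sym (sym_comp (T_cycl_plus Om) (T_cycl_comp Om))"
proof -
  let ?G = "gr_alg (A0 scale) (A0_filt scale)"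
  let ?R = "\<lparr>carrier = polys (necklaces B), monoid.mult = (*), one = 1, zero = 0, add = (+)\<rparr> :: ('a list set multiset \<Rightarrow>\<^sub>0 complex) ring"
  define \<phi> where "\<phi> u = inv_into (carrier Sym) psi (A0.theta u)" for u
  have P: "bij_betw psi (carrier Sym) (polys (necklaces B))" by (rule psi_hom(3))
  have T: "bij_betw A0.theta (carrier ?G) (polys (necklaces B))" by (rule A0.theta_bij)
  have bij: "bij_betw \<phi> (carrier ?G) (carrier Sym)"
    using bij_betw_trans[OF T bij_betw_inv_into[OF P]] by (simp add: \<phi>_def[abs_def] comp_def)
  have Tc: "A0.theta u \<in> polys (necklaces B)" if "u \<in> carrier ?G" for u using T that by (auto simp: bij_betw_def)
  have \<phi>c: "\<phi> u \<in> carrier Sym" if "u \<in> carrier ?G" for u using bij that by (auto simp: bij_betw_def)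
  have psi: "psi (\<phi> u) = A0.theta u" if "u \<in> carrier ?G" for u
    unfolding \<phi>_def using bij_betw_inv_into_right[OF P Tc[OF that]] .
  have inj: "x = y" if "x \<in> carrier Sym" "y \<in> carrier Sym" "psi x = psi y" for x y
    using P that by (auto simp: bij_betw_def dest: inj_onD)
  have S: "ring Sym" by (rule presentsD(3)[OF cy.presents_sym])
  have S1: "\<one>\<^bsub>Sym\<^esub> \<in> carrier Sym" using ring.ring_simprules(6)[OF S] .
  note hm = ring_hom_mult[OF psi_hom(1)] ring_hom_add[OF psi_hom(1)] ring_hom_one[OF psi_hom(1)]
  have "\<phi> \<in> Ring.ring_hom ?G Sym"
  proof (rule ring_hom_memI)
    fix x y assume x: "x \<in> carrier ?G" and y: "y \<in> carrier ?G"
    show "\<phi> x \<in> carrier Sym" by (rule \<phi>c[OF x])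
    show "\<phi> (x \<otimes>\<^bsub>?G\<^esub> y) = \<phi> x \<otimes>\<^bsub>Sym\<^esub> \<phi> y"
      using hm(1)[OF \<phi>c[OF x] \<phi>c[OF y]] psi x y A0.gr_mult_closed[OF x y]
      by (intro inj \<phi>c ring.ring_simprules(5)[OF S]) auto
    show "\<phi> (x \<oplus>\<^bsub>?G\<^esub> y) = \<phi> x \<oplus>\<^bsub>Sym\<^esub> \<phi> y"
      using hm(2)[OF \<phi>c[OF x] \<phi>c[OF y]] psi x y A0.gr_linear(1,2)[OF x y]
      by (intro inj \<phi>c ring.ring_simprules(1)[OF S]) auto
  next
    show "\<phi> \<one>\<^bsub>?G\<^esub> = \<one>\<^bsub>Sym\<^esub>"
      using hm(3) psi A0.gr_one S1 by (intro inj \<phi>c) auto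
  qed
  moreover have "\<phi> (c \<odot>\<^bsub>?G\<^esub> x) = c \<odot>\<^bsub>Sym\<^esub> \<phi> x" if x: "x \<in> carrier ?G" for c x
  proof (rule inj)
    show "\<phi> (c \<odot>\<^bsub>?G\<^esub> x) \<in> carrier Sym" by (rule \<phi>c[OF A0.gr_linear(3)[OF x]])
    show "c \<odot>\<^bsub>Sym\<^esub> \<phi> x \<in> carrier Sym"
      by (rule vspD(2)[OF calgD(1)[OF presentsD(1)[OF cy.presents_sym]] \<phi>c[OF x]])
    show "psi (\<phi> (c \<odot>\<^bsub>?G\<^esub> x)) = psi (c \<odot>\<^bsub>Sym\<^esub> \<phi> x)"
      using A0.gr_linear(3,4)[OF x] by (simp add: psi psi_hom(2) \<phi>c x)
  qed
  moreover have "\<phi> ` gr_comp (A0 scale) (A0_filt scale) m = sym_comp (T_cycl_plus Om) (T_cycl_comp Om) m" for m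
  proof -
    let ?C = "gr_comp (A0 scale) (A0_filt scale) m" and ?S = "sym_comp (T_cycl_plus Om) (T_cycl_comp Om) m"
    have c: "?C \<subseteq> carrier ?G" by (rule A0.theta_comp(1))
    have "psi ` \<phi> ` ?C = A0.theta ` ?C" unfolding image_image using psi c by (intro image_cong) auto
    also have "\<dots> = NP B m" unfolding A0.theta_comp(2) by simp
    also have "\<dots> = psi ` ?S" by (rule sym_comp_eq(1)[symmetric])
    finally have "psi ` \<phi> ` ?C = psi ` ?S" .
    moreover have "\<phi> ` ?C \<subseteq> carrier Sym" using \<phi>c c by blast
    ultimately show ?thesis
      using inj_on_image_eq_iff[of psi "carrier Sym" "\<phi> ` ?C" ?S] sym_comp_eq(2)[of m] P
      by (simp add: bij_betw_def)
  qed
  ultimately show ?thesis using bij unfolding graded_alg_iso_def ring_iso_def by blast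
qed

end

theorem theorem4p6:
  fixes scale :: "complex \<Rightarrow> 'a::ring \<Rightarrow> 'a"
  assumes "complex_assoc_algebra scale"
    and "countable_dimension scale"
  shows "\<exists>\<phi>. \<phi> \<in> graded_alg_iso
      (gr_alg (A0 scale) (A0_filt scale))
      (gr_comp (A0 scale) (A0_filt scale))
      (sym_alg (T_cycl_plus (Omega scale)))
      (sym_comp (T_cycl_plus (Omega scale)) (T_cycl_comp (Omega scale)))"
proof -
  obtain B where "\<not> module.dependent scale B" "module.span scale B = UNIV"
    using assms(2) by (auto simp: countable_dimension_def)
  then interpret omega_basis scale B
    using assms(1) by (simp add: omega_basis_def omega_basis_axioms_def)
  show ?thesis by (rule gr_A0_iso)
qed

end
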